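(* Let $N,m,n\ge 1$ be positive integers and fix $\alpha\in(0,1)$. Then there exist $\varepsilon_n>0$, constants $\mu_n,\kappa_n,c_n>0$ and $\beta_n,\delta_n\in\mathbb{R}\setminus\{0\}$ depending only on $N$ and $n$, a radial function $t\mapsto\psi_1(|t|)$ on the unit ball $B_1\subset\mathbb{R}^N$, and a smooth curve $$(-\varepsilon_n,\varepsilon_n)\to(0,+\infty)\times\mathcal{P}^{2,\alpha}_{p,e}(\mathbb{R}^m),\qquad s\mapsto(\mu^n_s,h^n_s),$$ with $\mu^n_s|_{s=0}=\mu_n$ and $$h^n_s(x)=\kappa_n\sqrt{\mu^n_s}+s\,\beta_n\,\vartheta(x)+o(s)\qquad\text{as } s\to0\text{ uniformly on }\mathbb{R}^m,$$ where $\vartheta(x)=\cos(x_1)+\cdots+\cos(x_m)$, such that for every $s\in(-\varepsilon_n,\varepsilon_n)$ the overdetermined boundary value problem $$\begin{cases}\Delta w^n_s+\mu^n_s\,w^n_s=0&\text{in }\Omega_{h^n_s},\\ w^n_s=0&\text{on }\partial\Omega_{h^n_s},\\ |\nabla w^n_s|=c_n\sqrt{\mu^n_s}&\text{on }\partial\Omega_{h^n_s}\end{cases}$$ admits a classical solution $w^n_s$ which is radial in $t$, even in each of $x_1,\dots,x_m$, $2\pi$-periodic in each of $x_1,\dots,x_m$, and invariant with respect to permutations of the variables $x_1,\dots,x_m$. Moreover, $$w^n_s\Bigl(\frac{t}{h^n_s(x)},x\Bigr)=U_n(|t|)+s\bigl\{\psi_1(|t|)+\delta_n\,|t|\,U_n'(|t|)\bigr\}\vartheta(x)+o(s)\qquad\text{as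 }s\to0$$ uniformly on $B_1\times\mathbb{R}^m$, where $t\mapsto U_n(|t|)$ is the $n$-th radial Dirichlet eigenfunction of the Laplacian on $B_1$.
   Context: $C^{2,\alpha}_{p,e}(\mathbb{R}^m)$ is the Banach space (with the $C^{2,\alpha}$ norm) of $C^{2,\alpha}$ functions on $\mathbb{R}^m$ that are $2\pi\mathbb{Z}^m$-periodic and even in each variable. $\mathcal{P}^{2,\alpha}_{p,e}(\mathbb{R}^m)$ is the set of strictly positive functions in $C^{2,\alpha}_{p,e}(\mathbb{R}^m)$ that are invariant under permutations of the coordinates; it is regarded as an open subset of the closed subspace of permutation-invariant functions. For $h\in\mathcal{P}^{2,\alpha}_{p,e}(\mathbb{R}^m)$, $$\Omega_h=\Bigl\{(t,x)\in\mathbb{R}^N\times\mathbb{R}^m:\ |t|<\tfrac1{h(x)}\Bigr\}\subset\mathbb{R}^{N+m}.$$ For $\nu>-1$, $J_\nu$ is the Bessel function of the first kind of order $\nu$, $0<j_{\nu,1}<j_{\nu,2}<\cdots$ are its positive zeros, and $I_\nu(r):=r^{-\nu}J_\nu(r)$ (not the modified Bessel function). The eigenfunction $U_n$ is normalized as $U_n(r)=I_{N/2-1}(j_{N/2-1,n}\,r)$. *)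

theory Defs
  imports "HOL-Analysis.Analysis"
begin

text \<open>
  The constants of the theorem depend on $N$ and $n$ but not on $m$, so the dimension $m$ is
  quantified inside the statement and cannot be a type.  Hence $R^d$ is the library's
  \<^term>\<open>Euclidean_space d\<close>: the points are the \<open>x :: nat \<Rightarrow> real\<close> with \<open>x i = 0\<close> for \<open>i \<ge> d\<close>,
  and coordinates are numbered from \<open>0\<close>.  Only values of functions on this carrier matter.
\<close>

abbreviation Rn :: "nat \<Rightarrow> (nat \<Rightarrow> real) set"
  where "Rn d \<equiv> topspace (Euclidean_space d)"

abbreviation enorm :: "nat \<Rightarrow> (nat \<Rightarrow> real) \<Rightarrow> real"
  where "enorm d x \<equiv> L2_set x {..<d}"

definition pdiff :: "nat \<Rightarrow> ((nat \<Rightarrow> real) \<Rightarrow> real) \<Rightarrow> (nat \<Rightarrow> real) \<Rightarrow> real"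
  where "pdiff i f x = deriv (\<lambda>u. f (x(i := u))) (x i)"

definition laplacian :: "nat \<Rightarrow> ((nat \<Rightarrow> real) \<Rightarrow> real) \<Rightarrow> (nat \<Rightarrow> real) \<Rightarrow> real"
  where "laplacian d f x = (\<Sum>i<d. pdiff i (pdiff i f) x)"

definition cont_on :: "nat \<Rightarrow> (nat \<Rightarrow> real) set \<Rightarrow> ((nat \<Rightarrow> real) \<Rightarrow> real) \<Rightarrow> bool"
  where "cont_on d S f \<longleftrightarrow> continuous_map (subtopology (Euclidean_space d) S) euclideanreal f"

text \<open>Class $C^k$ on a subset \<open>S\<close> that is open in $R^d$.\<close>

primrec Ck_on :: "nat \<Rightarrow> (nat \<Rightarrow> real) set \<Rightarrow> nat \<Rightarrow> ((nat \<Rightarrow> real) \<Rightarrow> real) \<Rightarrow> bool"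
  where
    "Ck_on d S 0 f \<longleftrightarrow> cont_on d S f"
  | "Ck_on d S (Suc k) f \<longleftrightarrow> cont_on d S f \<and>
       (\<forall>i<d. (\<forall>x\<in>S. (\<lambda>u. f (x(i := u))) differentiable (at (x i))) \<and> Ck_on d S k (pdiff i f))"


definition sup_norm :: "nat \<Rightarrow> ((nat \<Rightarrow> real) \<Rightarrow> real) \<Rightarrow> real"
  where "sup_norm d f = (SUP x\<in>Rn d. \<bar>f x\<bar>)"

definition holder_quotients :: "nat \<Rightarrow> real \<Rightarrow> ((nat \<Rightarrow> real) \<Rightarrow> real) \<Rightarrow> real set"
  where "holder_quotients d \<alpha> f =
    {\<bar>f x - f y\<bar> / enorm d (\<lambda>i. x i - y i) powr \<alpha> | x y. x \<in> Rn d \<and> y \<in> Rn d \<and> x \<noteq> y}"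

text \<open>The Banach space $C^{2,\alpha}(R^d)$ and its norm; the real \<open>SUP\<close> and \<open>Sup\<close> in the norm
  are meaningful for members of the space only.\<close>

definition C2a :: "nat \<Rightarrow> real \<Rightarrow> ((nat \<Rightarrow> real) \<Rightarrow> real) set"
  where "C2a d \<alpha> = {f. Ck_on d (Rn d) 2 f \<and> bounded (f ` Rn d) \<and>
    (\<forall>i<d. bounded (pdiff i f ` Rn d)) \<and>
    (\<forall>i<d. \<forall>j<d. bounded (pdiff i (pdiff j f) ` Rn d) \<and>
                  bounded (holder_quotients d \<alpha> (pdiff i (pdiff j f))))}"

definition C2a_norm :: "nat \<Rightarrow> real \<Rightarrow> ((nat \<Rightarrow> real) \<Rightarrow> real) \<Rightarrow> real"
  where "C2a_norm d \<alpha> f = sup_norm d f + (\<Sum>i<d. sup_norm d (pdiff i f)) +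
    (\<Sum>i<d. \<Sum>j<d. sup_norm d (pdiff i (pdiff j f)) +
                   Sup (holder_quotients d \<alpha> (pdiff i (pdiff j f))))"


definition periodic_on :: "nat \<Rightarrow> (nat \<Rightarrow> real) set \<Rightarrow> ((nat \<Rightarrow> real) \<Rightarrow> real) \<Rightarrow> bool"
  where "periodic_on m A f \<longleftrightarrow> (\<forall>x\<in>A. \<forall>i<m. f (x(i := x i + 2 * pi)) = f x)"

definition even_on :: "nat \<Rightarrow> (nat \<Rightarrow> real) set \<Rightarrow> ((nat \<Rightarrow> real) \<Rightarrow> real) \<Rightarrow> bool"
  where "even_on m A f \<longleftrightarrow> (\<forall>x\<in>A. \<forall>i<m. f (x(i := - x i)) = f x)"

definition perm_invariant_on :: "nat \<Rightarrow> (nat \<Rightarrow> real) set \<Rightarrow> ((nat \<Rightarrow> real) \<Rightarrow> real) \<Rightarrow> bool"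
  where "perm_invariant_on m A f \<longleftrightarrow> (\<forall>x\<in>A. \<forall>p. p permutes {..<m} \<longrightarrow> f (x \<circ> p) = f x)"

definition C2a_pe :: "nat \<Rightarrow> real \<Rightarrow> ((nat \<Rightarrow> real) \<Rightarrow> real) set"
  where "C2a_pe m \<alpha> = {f \<in> C2a m \<alpha>. periodic_on m (Rn m) f \<and> even_on m (Rn m) f}"

definition P2a_pe :: "nat \<Rightarrow> real \<Rightarrow> ((nat \<Rightarrow> real) \<Rightarrow> real) set"
  where "P2a_pe m \<alpha> = {f \<in> C2a_pe m \<alpha>. perm_invariant_on m (Rn m) f \<and> (\<forall>x\<in>Rn m. f x > 0)}"

text \<open>Smooth means $C^\infty$.  For a curve in $C^{2,\alpha}_{p,e}(R^m)$ on an open set \<open>I\<close> of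
  parameters, \<open>D k\<close> is the \<open>k\<close>-th derivative, the difference quotients converging in the
  $C^{2,\alpha}$ norm.\<close>

definition smooth_curve_C2a ::
    "nat \<Rightarrow> real \<Rightarrow> real set \<Rightarrow> (real \<Rightarrow> (nat \<Rightarrow> real) \<Rightarrow> real) \<Rightarrow> bool"
  where "smooth_curve_C2a m \<alpha> I h \<longleftrightarrow>
    (\<exists>D :: nat \<Rightarrow> real \<Rightarrow> (nat \<Rightarrow> real) \<Rightarrow> real.
       (\<forall>s\<in>I. \<forall>x\<in>Rn m. D 0 s x = h s x) \<and>
       (\<forall>k. \<forall>s\<in>I. D k s \<in> C2a_pe m \<alpha> \<and>
          ((\<lambda>\<eta>. C2a_norm m \<alpha> (\<lambda>x. (D k (s + \<eta>) x - D k s x) / \<eta> - D (Suc k) s x))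
             \<longlongrightarrow> 0) (at 0)))"

definition smooth_real_curve :: "real set \<Rightarrow> (real \<Rightarrow> real) \<Rightarrow> bool"
  where "smooth_real_curve I f \<longleftrightarrow> (\<forall>k. \<forall>s\<in>I. (deriv ^^ k) f differentiable (at s))"


text \<open>\<open>F s p = o(s)\<close> as \<open>s\<close> tends to \<open>0\<close>, uniformly in \<open>p \<in> A\<close>.  As in the library's Landau
  symbols, the bound is required on a full neighbourhood of \<open>0\<close>, so \<open>F 0 p = 0\<close>.\<close>

definition uniform_little_o :: "'a set \<Rightarrow> (real \<Rightarrow> 'a \<Rightarrow> real) \<Rightarrow> bool"
  where "uniform_little_o A F \<longleftrightarrow>
    (\<forall>e>0. eventually (\<lambda>s. \<forall>p\<in>A. \<bar>F s p\<bar> \<le> e * \<bar>s\<bar>) (nhds 0))"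


text \<open>The point $(t,x)$ of $R^{N+m} = R^N \times R^m$.\<close>

definition join :: "nat \<Rightarrow> (nat \<Rightarrow> real) \<Rightarrow> (nat \<Rightarrow> real) \<Rightarrow> nat \<Rightarrow> real"
  where "join N t x = (\<lambda>i. if i < N then t i else x (i - N))"

definition Omega :: "nat \<Rightarrow> nat \<Rightarrow> ((nat \<Rightarrow> real) \<Rightarrow> real) \<Rightarrow> (nat \<Rightarrow> real) set"
  where "Omega N m h = {join N t x | t x. t \<in> Rn N \<and> x \<in> Rn m \<and> enorm N t < 1 / h x}"

definition Omega_closure :: "nat \<Rightarrow> nat \<Rightarrow> ((nat \<Rightarrow> real) \<Rightarrow> real) \<Rightarrow> (nat \<Rightarrow> real) set"
  where "Omega_closure N m h = Euclidean_space (N + m) closure_of Omega N m h"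

definition Omega_boundary :: "nat \<Rightarrow> nat \<Rightarrow> ((nat \<Rightarrow> real) \<Rightarrow> real) \<Rightarrow> (nat \<Rightarrow> real) set"
  where "Omega_boundary N m h = Euclidean_space (N + m) frontier_of Omega N m h"

text \<open>A classical solution is of class $C^2$ in the domain and $C^1$ up to the boundary: \<open>G\<close> is
  the continuous extension of the gradient of \<open>w\<close> to the closure, which is unique and gives
  meaning to $|\nabla w|$ on the boundary.\<close>

definition overdetermined_solution ::
    "nat \<Rightarrow> nat \<Rightarrow> ((nat \<Rightarrow> real) \<Rightarrow> real) \<Rightarrow> real \<Rightarrow> real \<Rightarrow> ((nat \<Rightarrow> real) \<Rightarrow> real) \<Rightarrow> bool"
  where "overdetermined_solution N m h \<mu> b w \<longleftrightarrow>
    Ck_on (N + m) (Omega N m h) 2 w \<and>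
    cont_on (N + m) (Omega_closure N m h) w \<and>
    (\<forall>z\<in>Omega N m h. laplacian (N + m) w z + \<mu> * w z = 0) \<and>
    (\<forall>z\<in>Omega_boundary N m h. w z = 0) \<and>
    (\<exists>G :: nat \<Rightarrow> (nat \<Rightarrow> real) \<Rightarrow> real.
       (\<forall>i<N + m. cont_on (N + m) (Omega_closure N m h) (G i) \<and>
                  (\<forall>z\<in>Omega N m h. G i z = pdiff i w z)) \<and>
       (\<forall>z\<in>Omega_boundary N m h. enorm (N + m) (\<lambda>i. G i z) = b))"

definition radial_in_t :: "nat \<Rightarrow> nat \<Rightarrow> (nat \<Rightarrow> real) set \<Rightarrow> ((nat \<Rightarrow> real) \<Rightarrow> real) \<Rightarrow> bool"
  where "radial_in_t N m S w \<longleftrightarrow>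
    (\<forall>x\<in>Rn m. \<forall>t\<in>Rn N. \<forall>t'\<in>Rn N. join N t x \<in> S \<longrightarrow> enorm N t = enorm N t' \<longrightarrow>
       w (join N t x) = w (join N t' x))"

definition symmetric_in_x :: "nat \<Rightarrow> nat \<Rightarrow> (nat \<Rightarrow> real) set \<Rightarrow> ((nat \<Rightarrow> real) \<Rightarrow> real) \<Rightarrow> bool"
  where "symmetric_in_x N m S w \<longleftrightarrow>
    (\<forall>t\<in>Rn N. let A = {x \<in> Rn m. join N t x \<in> S}; f = (\<lambda>x. w (join N t x))
      in even_on m A f \<and> periodic_on m A f \<and> perm_invariant_on m A f)"


text \<open>Bessel function of the first kind $J_\nu(r)$, for $\nu > -1$ and $r > 0$.\<close>

definition bessel_J :: "real \<Rightarrow> real \<Rightarrow> real"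
  where "bessel_J \<nu> r =
    (\<Sum>k. (-1) ^ k / (fact k * Gamma (\<nu> + real k + 1)) * (r / 2) powr (2 * real k + \<nu>))"

text \<open>$I_\nu(r) = r^{-\nu} J_\nu(r)$ for $r > 0$, extended continuously to $r = 0$ by the
  leading coefficient of the series.\<close>

definition bessel_I :: "real \<Rightarrow> real \<Rightarrow> real"
  where "bessel_I \<nu> r =
    (if r = 0 then 1 / (2 powr \<nu> * Gamma (\<nu> + 1)) else r powr (- \<nu>) * bessel_J \<nu> r)"

text \<open>The \<open>n\<close>-th positive zero $j_{\nu,n}$, for $n \ge 1$.\<close>

definition bessel_zero :: "real \<Rightarrow> nat \<Rightarrow> real"
  where "bessel_zero \<nu> n =
    (THE j. j > 0 \<and> bessel_J \<nu> j = 0 \<and> card {r. 0 < r \<and> r \<le> j \<and> bessel_J \<nu> r = 0} = n)"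

text \<open>Profile $U_n$ of the \<open>n\<close>-th radial Dirichlet eigenfunction of the unit ball of $R^N$.\<close>

definition U_fun :: "nat \<Rightarrow> nat \<Rightarrow> real \<Rightarrow> real"
  where "U_fun N n r = bessel_I (real N / 2 - 1) (bessel_zero (real N / 2 - 1) n * r)"

end

theory Submission
  imports Defs "HOL-Library.Function_Algebras" "HOL-Library.Poly_Mapping"
begin

text \<open>
  With \<open>j\<close> the \<open>n\<close>-th zero, \<open>\<mu> = j\<^sup>2 \<theta>\<^sup>2\<close>, \<open>h = \<theta> (1 + s z)\<close>, \<open>w(t,x) = V(y,x)\<close> and \<open>y = h(x)\<^sup>2 \<bar>t\<bar>\<^sup>2\<close>, the problem lives on the
  fixed interval \<open>0 \<le> y \<le> 1\<close>.  Write \<open>V = U + s (G - 2 z y U')\<close> with \<open>U\<close> the radial eigenfunction; the subtracted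
  term makes the two boundary conditions equivalent to \<open>z = G(1) / (2 U'(1))\<close> and one Robin condition for \<open>G\<close>.
  The unknowns \<open>G\<close> and \<open>\<theta>\<close> are sought as power series in \<open>s\<close> whose coefficients are trigonometric polynomials
  in \<open>x\<close> with entire coefficients in \<open>y\<close>.  At each order the \<open>k\<close>-th Fourier mode solves a linear Robin problem
  \<open>(D + j\<^sup>2 - L\<^sub>0 \<bar>k\<bar>\<^sup>2) G\<^sub>k = f\<close>, where \<open>D\<close> is the radial Laplacian in the variable \<open>y\<close>, \<open>L\<^sub>0 = j\<^sup>2 - q\<^sub>*\<close>,
  \<open>\<theta>(0) = 1 / sqrt L\<^sub>0\<close> and \<open>q\<^sub>* < j\<^sup>2\<close> is the least Robin eigenvalue.  Hence exactly the modes \<open>\<bar>k\<bar> = 1\<close> are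
  resonant; by symmetry they carry one solvability condition, which the next coefficient of \<open>\<theta>\<close> fulfils because
  the Wronskian is not zero.  The linear problem is solved with two derivatives gained, uniformly in \<open>k\<close> (maximum
  principle for large \<open>\<bar>k\<bar>\<close>, Gronwall for small \<open>\<bar>k\<bar>\<close>), so a majorant argument in an algebra of exponentially
  weighted sums shows that the series converges for small \<open>s\<close>.
\<close>

section \<open>Entire functions with the sup norm of the unit interval\<close>

text \<open>The period in x is fixed, so the scale of h is the bifurcation parameter and the
  straight cylinders form the trivial branch; the factor s in front of z and G divides this branch
  out, which is what allows an order-by-order construction. The obstacle is a loss of derivatives:
  the remainder contains second derivatives of G in the equation and first derivatives in the
  boundary condition. Hence the solution norm \<open>fullW\<close> carries two frequency weights and
  the radial Laplacian, Landau's inequality pays for the terms with one derivative in x and one in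
  y, and boundary data carry one weight. The variable y makes radial functions regular at the axis,
  and entire coefficients are stable under products and under solving the radial equation. Since
  everything is analytic in s and the frequency weights are exponential, smoothness of the curve in
  the Hoelder norm comes from differentiating power series termwise.\<close>

typedef ent = "{f :: real fps. fps_conv_radius f = \<infinity>}"
  by (rule exI[of _ 0]) simp

setup_lifting type_definition_ent

lemma conv_radius_min_infty:
  fixes f :: "real fps"
  assumes "fps_conv_radius f \<ge> min a b" "a = \<infinity>" "b = \<infinity>"
  shows "fps_conv_radius f = \<infinity>"
  using assms by simp

instantiation ent :: comm_ring_1
begin
lift_definition zero_ent :: ent is 0 by simp
lift_definition one_ent :: ent is 1 by simp
lift_definition plus_ent :: "ent \<Rightarrow> ent \<Rightarrow> ent" is "(+)"
  by (rule conv_radius_min_infty[OF fps_conv_radius_add])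
lift_definition minus_ent :: "ent \<Rightarrow> ent \<Rightarrow> ent" is "(-)"
  by (rule conv_radius_min_infty[OF fps_conv_radius_diff])
lift_definition uminus_ent :: "ent \<Rightarrow> ent" is uminus by simp
lift_definition times_ent :: "ent \<Rightarrow> ent \<Rightarrow> ent" is "(*)"
  by (rule conv_radius_min_infty[OF fps_conv_radius_mult])
instance
  by standard (transfer; simp add: algebra_simps)+
end

lift_definition ev :: "ent \<Rightarrow> real \<Rightarrow> real" is "\<lambda>f y. eval_fps f y" .
lift_definition ecoeff :: "ent \<Rightarrow> nat \<Rightarrow> real" is fps_nth .
lift_definition econst :: "real \<Rightarrow> ent" is fps_const by simp
lift_definition eX :: ent is fps_X by simp
lift_definition ediff :: "ent \<Rightarrow> ent" is fps_deriv
  by (metis fps_conv_radius_deriv ereal_infty_less_eq(1))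

lemma ev_simps [simp]:
  "ev 0 y = 0" "ev 1 y = 1" "ev (f + g) y = ev f y + ev g y" "ev (f - g) y = ev f y - ev g y"
  "ev (- f) y = - ev f y" "ev (f * g) y = ev f y * ev g y" "ev (econst c) y = c" "ev eX y = y"
  by (transfer; simp add: eval_fps_add eval_fps_diff eval_fps_minus eval_fps_mult)+

lemma ev_numeral [simp]: "ev (numeral n) y = numeral n"
proof -
  have "ev (of_nat m) y = of_nat m" for m by (induction m) auto
  from this[of "numeral n"] show ?thesis by simp
qed

lemma ev_has_derivative [derivative_intros]:
  "(g has_real_derivative g') (at x within S) \<Longrightarrow>
   ((\<lambda>x. ev f (g x)) has_real_derivative ev (ediff f) (g x) * g') (at x within S)"
proof -
  have "(ev f has_real_derivative ev (ediff f) y) (at y)" for y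
    by (transfer, rule has_field_derivative_eval_fps) auto
  then show "(g has_real_derivative g') (at x within S) \<Longrightarrow> ?thesis"
    using DERIV_chain2 by blast
qed

lemma continuous_on_ev [continuous_intros]:
  "continuous_on S g \<Longrightarrow> continuous_on S (\<lambda>x. ev f (g x))"
proof -
  have "continuous_on UNIV (ev f)"
    by (intro DERIV_continuous_on[of _ _ "ev (ediff f)"]) (auto intro!: derivative_eq_intros)
  then show "continuous_on S g \<Longrightarrow> ?thesis"
    by (rule continuous_on_compose2) auto
qed

lemma ent_sums: "(\<lambda>n. ecoeff f n * y ^ n) sums ev f y"
  by (transfer, rule sums_eval_fps) auto

lemma ent_eqI: "(\<And>n. ecoeff f n = ecoeff g n) \<Longrightarrow> f = g"
  by (transfer, rule fps_ext) auto

lemma ecoeff_simps [simp]: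
  "ecoeff 0 n = 0" "ecoeff (f + g) n = ecoeff f n + ecoeff g n" "ecoeff (f - g) n = ecoeff f n - ecoeff g n"
  "ecoeff (- f) n = - ecoeff f n" "ecoeff (econst c * f) n = c * ecoeff f n"
  "ecoeff (eX * f) n = (if n = 0 then 0 else ecoeff f (n - 1))"
  "ecoeff (ediff f) n = real (Suc n) * ecoeff f (Suc n)"
  by (transfer; simp)+

lemma ediff_simps [simp]:
  "ediff 0 = 0" "ediff (f + g) = ediff f + ediff g" "ediff (f - g) = ediff f - ediff g"
  "ediff (- f) = - ediff f" "ediff (econst c) = 0" "ediff eX = 1"
  "ediff (f * g) = ediff f * g + f * ediff g"
  by (transfer; simp)+

text \<open>Entry point for functions that are given by a coefficient recursion, such as the
  solutions of the radial equation.\<close>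

lemma ent_of_coeffs:
  assumes "\<And>r. r \<ge> 0 \<Longrightarrow> summable (\<lambda>n. \<bar>c n\<bar> * r ^ n)"
  obtains f where "\<And>n. ecoeff f n = c n"
proof -
  have "conv_radius c = \<infinity>"
  proof (rule conv_radius_inftyI')
    fix r :: real assume "0 < r"
    then show "\<exists>z. norm z = r \<and> summable (\<lambda>n. c n * z ^ n)"
      using assms[of r] by (intro exI[of _ r]) (auto intro: summable_rabs_cancel simp: abs_mult)
  qed
  then have "Abs_fps c \<in> {f. fps_conv_radius f = \<infinity>}" by (simp add: fps_conv_radius_def)
  then show ?thesis
    by (intro that[of "Abs_ent (Abs_fps c)"]) (simp add: ecoeff.rep_eq Abs_ent_inverse)
qed

text \<open>This norm does not make \<open>ent\<close> complete. Limits are only taken after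
  evaluation at a point, for which a submultiplicative norm that dominates the values on the
  interval is enough.\<close>

definition nrm :: "ent \<Rightarrow> real"
  where "nrm f = (SUP y\<in>{0..1}. \<bar>ev f y\<bar>)"

lemma nrm_bdd: "bdd_above ((\<lambda>y. \<bar>ev f y\<bar>) ` {0..1})"
  by (intro bounded_imp_bdd_above compact_imp_bounded compact_continuous_image continuous_intros) auto

lemma ev_le_nrm: "y \<in> {0..1} \<Longrightarrow> \<bar>ev f y\<bar> \<le> nrm f"
  unfolding nrm_def by (rule cSUP_upper[OF _ nrm_bdd])

lemma nrm_leI: "(\<And>y. 0 \<le> y \<Longrightarrow> y \<le> 1 \<Longrightarrow> \<bar>ev f y\<bar> \<le> c) \<Longrightarrow> nrm f \<le> c"
  unfolding nrm_def by (rule cSUP_least) auto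

lemma nrm_nonneg [simp]: "nrm f \<ge> 0"
  using ev_le_nrm[of 0 f] by auto

lemma nrm_0 [simp]: "nrm 0 = 0"
  by (intro antisym nrm_leI) auto

lemma nrm_const [simp]: "nrm (econst c) = \<bar>c\<bar>"
  using ev_le_nrm[of 0 "econst c"] by (intro antisym nrm_leI) auto

lemma nrm_add: "nrm (f + g) \<le> nrm f + nrm g"
proof (rule nrm_leI)
  fix y :: real assume "0 \<le> y" "y \<le> 1"
  then show "\<bar>ev (f + g) y\<bar> \<le> nrm f + nrm g"
    using ev_le_nrm[of y f] ev_le_nrm[of y g] by auto
qed

lemma nrm_minus [simp]: "nrm (- f) = nrm f"
  by (simp add: nrm_def)

lemma nrm_mult: "nrm (f * g) \<le> nrm f * nrm g"
proof (rule nrm_leI)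
  fix y :: real assume "0 \<le> y" "y \<le> 1"
  then show "\<bar>ev (f * g) y\<bar> \<le> nrm f * nrm g"
    using ev_le_nrm[of y f] ev_le_nrm[of y g] by (auto simp: abs_mult intro!: mult_mono)
qed

lemma nrm_scale: "nrm (econst c * f) \<le> \<bar>c\<bar> * nrm f"
  using nrm_mult[of "econst c" f] by simp

section \<open>The radial Laplacian in the variable \<open>y = r\<^sup>2\<close>\<close>

text \<open>For u(r) = f(r^2) the radial Laplacian u'' + (N - 1) u' / r equals 4 y f'' + 2 N f' at y
  = r^2, without a singular coefficient.\<close>

definition eD :: "nat \<Rightarrow> ent \<Rightarrow> ent"
  where "eD N f = econst 4 * (eX * ediff (ediff f)) + econst (2 * real N) * ediff f"

lemma ev_eD: "ev (eD N f) y = 4 * y * ev (ediff (ediff f)) y + 2 * real N * ev (ediff f) y"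
  by (simp add: eD_def)

lemma eD_simps [simp]:
  "eD N 0 = 0" "eD N (f + g) = eD N f + eD N g" "eD N (f - g) = eD N f - eD N g" "eD N (- f) = - eD N f"
  "eD N (econst c * f) = econst c * eD N f"
  by (simp_all add: eD_def algebra_simps)

text \<open>Divergence form: the derivative of r^N f'(r^2) is r^(N-1) / 2 times D f at r^2.
  Integrating from the axis bounds f' by the sup of D f, without loss near r = 0.\<close>

lemma nrm_ediff:
  assumes "N \<ge> 1"
  shows "nrm (ediff f) \<le> nrm (eD N f)"
proof (rule nrm_leI)
  fix y :: real assume y: "0 \<le> y" "y \<le> 1"
  define M where "M = nrm (eD N f)"
  \<comment> \<open>The sign \<open>x\<close> is 1 or -1, so that one monotonicity argument yields
    both halves of the absolute value.\<close>
  have weighted: "x * ev (ediff f) y * 2 * real N \<le> M" if x: "\<bar>x\<bar> = 1" for x :: real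
  proof (cases "y = 0")
    case True
    have "\<bar>ev (eD N f) 0\<bar> \<le> M" unfolding M_def by (rule ev_le_nrm) auto
    then have "\<bar>2 * real N * ev (ediff f) 0\<bar> \<le> M" by (simp add: ev_eD)
    moreover have "x = 1 \<or> x = - 1" using x by linarith
    ultimately show ?thesis using True by (auto simp: mult_ac abs_le_iff)
  next
    case False
    define r where "r = sqrt y"
    have r: "0 < r" "r \<le> 1" "r\<^sup>2 = y" using y False by (auto simp: r_def)
    \<comment> \<open>Comparison of r^N f' with the integral of the constant bound \<open>M\<close>;
      the derivative of \<open>H\<close> is r^(N-1) / 2 times M - x D f.\<close>
    define H where "H = (\<lambda>r. M * r ^ N / (2 * N) - x * r ^ N * ev (ediff f) (r\<^sup>2))"
    have "H 0 \<le> H r"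
    proof (rule DERIV_nonneg_imp_nondecreasing[OF less_imp_le[OF r(1)]])
      fix u assume u: "0 \<le> u" "u \<le> r"
      have A: "(H has_real_derivative M * (real N * u ^ (N - 1)) / (2 * N)
         - x * (real N * u ^ (N - 1) * ev (ediff f) (u\<^sup>2) + u ^ N * (ev (ediff (ediff f)) (u\<^sup>2) * (2 * u)))) (at u)"
        unfolding H_def by (auto intro!: derivative_eq_intros simp: algebra_simps)
      moreover have "u ^ N = u ^ (N - 1) * u" using assms by (cases N) auto
      then have B: "M * (real N * u ^ (N - 1)) / (2 * N)
         - x * (real N * u ^ (N - 1) * ev (ediff f) (u\<^sup>2) + u ^ N * (ev (ediff (ediff f)) (u\<^sup>2) * (2 * u)))
        = u ^ (N - 1) / 2 * (M - x * ev (eD N f) (u\<^sup>2))"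
        using assms by (simp add: ev_eD field_simps power2_eq_square)
      moreover have "\<bar>ev (eD N f) (u\<^sup>2)\<bar> \<le> M" unfolding M_def
        using u r by (intro ev_le_nrm) (auto intro: power_le_one)
      then have "x * ev (eD N f) (u\<^sup>2) \<le> M" using x
        by (metis abs_le_iff abs_mult mult_1 order_trans abs_ge_self)
      ultimately show "\<exists>d. (H has_real_derivative d) (at u) \<and> d \<ge> 0"
        using u DERIV_cong[OF A B] by (intro exI[of _ "u ^ (N - 1) / 2 * (M - x * ev (eD N f) (u\<^sup>2))"] conjI) auto
    qed
    moreover have "H 0 = 0" using assms by (simp add: H_def power_0_left)
    moreover have "H r = r ^ N * (M / (2 * N) - x * ev (ediff f) y)"
      by (simp add: H_def r algebra_simps)
    ultimately have "x * ev (ediff f) y \<le> M / (2 * N)"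
      using zero_less_power[OF r(1), of N] by (auto simp: zero_le_mult_iff)
    then show ?thesis using assms by (simp add: field_simps)
  qed
  have "\<bar>ev (ediff f) y\<bar> * (2 * N) \<le> M"
    using weighted[of 1] weighted[of "-1"] by (auto simp: abs_if algebra_simps)
  moreover have "\<bar>ev (ediff f) y\<bar> * 1 \<le> \<bar>ev (ediff f) y\<bar> * (2 * N)"
    using assms by (intro mult_left_mono) auto
  ultimately show "\<bar>ev (ediff f) y\<bar> \<le> nrm (eD N f)" by (simp add: M_def)
qed

text \<open>D f controls f'' only together with the factor y; a bound without it fails at the axis,
  where the operator degenerates. The factor returns later as the weight
  \<open>sqrt y ^ 2\<close>.\<close>

lemma nrm_X_ediff2:
  assumes "N \<ge> 1" "0 \<le> y" "y \<le> 1"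
  shows "y * \<bar>ev (ediff (ediff f)) y\<bar> \<le> (1 + real N) * nrm (eD N f)"
proof -
  have "4 * y * ev (ediff (ediff f)) y = ev (eD N f) y - 2 * real N * ev (ediff f) y"
    by (simp add: ev_eD)
  moreover have "\<bar>ev (eD N f) y\<bar> \<le> nrm (eD N f)" "\<bar>ev (ediff f) y\<bar> \<le> nrm (eD N f)"
    using ev_le_nrm[of y] nrm_ediff[OF assms(1), of f] assms order_trans by fastforce+
  then have "\<bar>2 * real N * ev (ediff f) y\<bar> \<le> 2 * real N * nrm (eD N f)"
    by (auto simp: abs_mult intro!: mult_left_mono)
  ultimately have "4 * \<bar>y * ev (ediff (ediff f)) y\<bar> \<le> nrm (eD N f) + 2 * real N * nrm (eD N f)"
    using \<open>\<bar>ev (eD N f) y\<bar> \<le> nrm (eD N f)\<close> by linarith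
  moreover have "nrm (eD N f) \<ge> 0" "real N * nrm (eD N f) \<ge> 0" by simp_all
  moreover have "\<bar>y * ev (ediff (ediff f)) y\<bar> = y * \<bar>ev (ediff (ediff f)) y\<bar>"
    using assms by (simp add: abs_mult)
  moreover have "(1 + real N) * nrm (eD N f) = nrm (eD N f) + real N * nrm (eD N f)"
    by (simp add: algebra_simps)
  ultimately show ?thesis by linarith
qed

text \<open>Landau's interpolation inequality for \<open>r \<mapsto> f (r\<^sup>2)\<close> with step \<open>1 / (2 \<kappa>)\<close>.\<close>

lemma landau:
  assumes "N \<ge> 1" "\<kappa> \<ge> 1" "0 \<le> y" "y \<le> 1"
  shows "\<kappa> * (sqrt y * \<bar>ev (ediff f) y\<bar>) \<le> (4 + 2 * real N) * (\<kappa>\<^sup>2 * nrm f + nrm (eD N f))"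
proof -
  define r where "r = sqrt y"
  have r: "0 \<le> r" "r \<le> 1" "r\<^sup>2 = y" using assms by (auto simp: r_def)
  define M where "M = nrm (eD N f)"
  have M: "M \<ge> 0" by (simp add: M_def)
  define g where "g = (\<lambda>r. ev f (r\<^sup>2))"
  define g' where "g' = (\<lambda>r. 2 * r * ev (ediff f) (r\<^sup>2))"
  define g'' where "g'' = (\<lambda>r. 2 * ev (ediff f) (r\<^sup>2) + 4 * r\<^sup>2 * ev (ediff (ediff f)) (r\<^sup>2))"
  have d1: "(g has_real_derivative g' x) (at x)" for x
    unfolding g_def g'_def by (auto intro!: derivative_eq_intros)
  have d2: "(g' has_real_derivative g'' x) (at x)" for x
    unfolding g'_def g''_def by (auto intro!: derivative_eq_intros simp: power2_eq_square algebra_simps)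
  have b2: "\<bar>g'' x\<bar> \<le> (6 + 4 * real N) * M" if "0 \<le> x" "x \<le> 1" for x
  proof -
    have x: "0 \<le> x\<^sup>2" "x\<^sup>2 \<le> 1" using that by (auto intro: power_le_one)
    have "\<bar>ev (ediff f) (x\<^sup>2)\<bar> \<le> M"
      using ev_le_nrm[of "x\<^sup>2" "ediff f"] nrm_ediff[OF assms(1), of f] x unfolding M_def by auto
    moreover have "x\<^sup>2 * \<bar>ev (ediff (ediff f)) (x\<^sup>2)\<bar> \<le> (1 + real N) * M"
      unfolding M_def by (rule nrm_X_ediff2[OF assms(1) x])
    moreover have "\<bar>g'' x\<bar> \<le> 2 * \<bar>ev (ediff f) (x\<^sup>2)\<bar> + 4 * (x\<^sup>2 * \<bar>ev (ediff (ediff f)) (x\<^sup>2)\<bar>)"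
      unfolding g''_def by (rule order_trans[OF abs_triangle_ineq]) (simp add: abs_mult)
    ultimately show ?thesis by (simp add: algebra_simps)
  qed
  define d where "d = 1 / (2 * \<kappa>)"
  have d: "0 < d" "d \<le> 1 / 2" using assms by (auto simp: d_def)
  \<comment> \<open>An interval of length \<open>d\<close> inside the unit interval that contains
    \<open>r\<close>; it extends to the right or to the left according to the half in which
    \<open>r\<close> lies.\<close>
  define a where "a = (if r \<le> 1/2 then r else r - d)"
  have a: "0 \<le> a" "a + d \<le> 1" "a \<le> r" "r \<le> a + d" using r d by (auto simp: a_def)
  \<comment> \<open>Somewhere in this interval the slope is at most 2 \<open>nrm f\<close> /
    \<open>d\<close>; the bound on the second derivative carries this to \<open>r\<close>.\<close>
  obtain z where z: "a < z" "z < a + d" "g (a + d) - g a = (a + d - a) * g' z"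
    using MVT2[of a "a + d" g g'] d1 d by auto
  have gb: "\<bar>g x\<bar> \<le> nrm f" if "0 \<le> x" "x \<le> 1" for x
    unfolding g_def using that by (intro ev_le_nrm) (auto intro: power_le_one)
  have "d * \<bar>g' z\<bar> = \<bar>g (a + d) - g a\<bar>" using z(3) d by (simp add: abs_mult)
  also have "\<dots> \<le> 2 * nrm f" using gb[of a] gb[of "a + d"] a d by (simp add: abs_le_iff)
  finally have z1: "\<bar>g' z\<bar> \<le> 4 * \<kappa> * nrm f" using assms by (simp add: d_def field_simps)
  have "\<bar>g' r - g' z\<bar> \<le> (6 + 4 * real N) * M * \<bar>r - z\<bar>"
    using field_differentiable_bound[of "{0..1}" g' g'' "(6 + 4 * real N) * M" r z] d2 b2 r z a
    by (auto intro: has_field_derivative_at_within)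
  also have "\<dots> \<le> (6 + 4 * real N) * M * d"
    using a z M by (intro mult_left_mono) auto
  finally have "\<bar>g' r\<bar> \<le> 4 * \<kappa> * nrm f + (6 + 4 * real N) * M * d" using z1 by linarith
  then have "\<kappa> * \<bar>g' r\<bar> \<le> \<kappa> * (4 * \<kappa> * nrm f + (6 + 4 * real N) * M * d)"
    using assms by (intro mult_left_mono) auto
  also have "\<dots> = 4 * (\<kappa>\<^sup>2 * nrm f) + (3 + 2 * real N) * M"
    using assms by (simp add: d_def field_simps power2_eq_square)
  also have "\<dots> \<le> 2 * ((4 + 2 * real N) * (\<kappa>\<^sup>2 * nrm f + M))"
    using M by (simp add: algebra_simps add_nonneg_nonneg add_mono)
  finally have "\<kappa> * \<bar>g' r\<bar> \<le> 2 * ((4 + 2 * real N) * (\<kappa>\<^sup>2 * nrm f + M))" .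
  moreover have "\<bar>g' r\<bar> = 2 * (sqrt y * \<bar>ev (ediff f) y\<bar>)"
    using r assms by (simp add: g'_def abs_mult r_def)
  ultimately show ?thesis by (simp add: M_def)
qed

text \<open>Comparison of coefficients in D g + q g = f with g(0) = a: the coefficient of y^p in D g
  is 2 (p + 1) (2 p + N) times that of y^(p+1) in g.\<close>

primrec ode_coeff :: "nat \<Rightarrow> real \<Rightarrow> real \<Rightarrow> (nat \<Rightarrow> real) \<Rightarrow> nat \<Rightarrow> real"
  where
    "ode_coeff N a q c 0 = a"
  | "ode_coeff N a q c (Suc p) = (c p - q * ode_coeff N a q c p) / (2 * real (Suc p) * (2 * real p + real N))"

text \<open>The partial sum plus twice the next term grows by at most twice \<open>y n\<close> per
  step, which bounds the partial sums: a ratio test with a summable inhomogeneity.\<close>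

lemma summable_contractive:
  fixes x y :: "nat \<Rightarrow> real"
  assumes "summable y" "\<And>n. x n \<ge> 0" "\<And>n. y n \<ge> 0" "\<And>n. n \<ge> n0 \<Longrightarrow> x (Suc n) \<le> x n / 2 + y n"
  shows "summable x"
proof -
  have main: "(\<Sum>i<k. x (i + n0)) + 2 * x (k + n0) \<le> 2 * x n0 + 2 * (\<Sum>i<k. y (i + n0))" for k
  proof (induction k)
    case (Suc k)
    then show ?case using assms(4)[of "k + n0"] by simp
  qed simp
  have "(\<Sum>i<k. x (i + n0)) \<le> 2 * x n0 + 2 * suminf (\<lambda>i. y (i + n0))" for k
  proof -
    have "(\<Sum>i<k. y (i + n0)) \<le> suminf (\<lambda>i. y (i + n0))"
      using assms(1,3) by (intro sum_le_suminf) (auto simp: summable_iff_shift)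
    then show ?thesis using main[of k] assms(2)[of "k + n0"] by linarith
  qed
  then have "summable (\<lambda>i. x (i + n0))"
    using assms(2) by (intro summableI_nonneg_bounded) auto
  then show ?thesis by (simp add: summable_iff_shift)
qed

lemma ent_abs_summable: "r \<ge> 0 \<Longrightarrow> summable (\<lambda>n. \<bar>ecoeff f n\<bar> * r ^ n)"
proof -
  assume r: "r \<ge> 0"
  have "summable (\<lambda>n. ecoeff f n * (r + 1) ^ n)" using ent_sums sums_summable by blast
  from powser_insidea[OF this, of r] r show ?thesis by (simp add: abs_mult power_abs)
qed

lemma ode_solution_exists:
  assumes "N \<ge> 1"
  shows "\<exists>g. \<forall>n. ecoeff g n = ode_coeff N a q (ecoeff f) n"
proof -
  define c where "c = ode_coeff N a q (ecoeff f)"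
  obtain g where "\<And>n. ecoeff g n = c n"
  proof (rule ent_of_coeffs)
    fix r :: real assume r: "r \<ge> 0"
    \<comment> \<open>From index \<open>n0\<close> on, the denominator of the recursion is at least
      2 |q| r, so the homogeneous part contracts by 1/2.\<close>
    obtain n0 :: nat where n0: "real n0 \<ge> \<bar>q\<bar> * r" using real_arch_simple by blast
    show "summable (\<lambda>n. \<bar>c n\<bar> * r ^ n)"
    proof (rule summable_contractive[where ?y = "\<lambda>n. r * (\<bar>ecoeff f n\<bar> * r ^ n)" and ?n0.0 = n0])
      fix n assume "n \<ge> n0"
      then have n: "real (Suc n) \<ge> \<bar>q\<bar> * r" using n0 by (simp add: order_trans)
      define e where "e = 2 * real (Suc n) * (2 * real n + real N)"
      have "2 * real (Suc n) * 1 \<le> e" unfolding e_def using assms by (intro mult_left_mono) auto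
      then have e: "e \<ge> 1" "e \<ge> 2 * (\<bar>q\<bar> * r)" using n by auto
      have "\<bar>c (Suc n)\<bar> = \<bar>ecoeff f n - q * c n\<bar> / e"
        using e by (simp add: c_def e_def abs_divide del: of_nat_Suc)
      also have "\<dots> \<le> \<bar>ecoeff f n\<bar> / e + \<bar>q\<bar> * \<bar>c n\<bar> / e"
        using e abs_triangle_ineq4[of "ecoeff f n" "q * c n"]
        by (simp add: abs_mult divide_right_mono flip: add_divide_distrib)
      finally have "\<bar>c (Suc n)\<bar> * r ^ Suc n \<le> (\<bar>ecoeff f n\<bar> / e + \<bar>q\<bar> * \<bar>c n\<bar> / e) * r ^ Suc n"
        using r by (intro mult_right_mono) auto
      also have "\<dots> = \<bar>ecoeff f n\<bar> / e * r ^ Suc n + (\<bar>q\<bar> * r) / e * (\<bar>c n\<bar> * r ^ n)"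
        by (simp add: algebra_simps)
      also have "\<dots> \<le> \<bar>ecoeff f n\<bar> * r ^ Suc n + 1 / 2 * (\<bar>c n\<bar> * r ^ n)"
        using e r by (intro add_mono mult_right_mono) (auto simp: field_simps mult_le_cancel_right1 mult_le_cancel_left1 abs_mult intro: mult_mono[of 1 e, simplified])
      finally show "\<bar>c (Suc n)\<bar> * r ^ Suc n \<le> \<bar>c n\<bar> * r ^ n / 2 + r * (\<bar>ecoeff f n\<bar> * r ^ n)"
        by (simp add: algebra_simps)
    qed (use r ent_abs_summable[OF r] in \<open>auto intro: summable_mult\<close>)
  qed blast
  then show ?thesis unfolding c_def by blast
qed

definition ode_sol :: "nat \<Rightarrow> real \<Rightarrow> real \<Rightarrow> ent \<Rightarrow> ent"
  where "ode_sol N a q f = (SOME g. \<forall>n. ecoeff g n = ode_coeff N a q (ecoeff f) n)"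

lemma ecoeff_ode_sol: "N \<ge> 1 \<Longrightarrow> ecoeff (ode_sol N a q f) n = ode_coeff N a q (ecoeff f) n"
  unfolding ode_sol_def using someI_ex[OF ode_solution_exists] by blast

lemma ode_sol_eq:
  assumes "N \<ge> 1"
  shows "eD N (ode_sol N a q f) + econst q * ode_sol N a q f = f"
proof (rule ent_eqI)
  fix p
  define c where "c = ode_coeff N a q (ecoeff f)"
  have c: "ecoeff (ode_sol N a q f) p = c p" for p using ecoeff_ode_sol[OF assms] by (simp add: c_def)
  define e where "e = 2 * real (Suc p) * (2 * real p + real N)"
  have "e \<noteq> 0" using assms unfolding e_def by auto
  moreover have "c (Suc p) = (ecoeff f p - q * c p) / e" by (simp add: c_def e_def)
  ultimately have "e * c (Suc p) + q * c p = ecoeff f p" by simp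
  moreover have "ecoeff (eD N (ode_sol N a q f)) p = e * c (Suc p)"
    unfolding eD_def by (cases p) (simp_all add: c e_def, simp_all add: algebra_simps)
  ultimately show "ecoeff (eD N (ode_sol N a q f) + econst q * ode_sol N a q f) p = ecoeff f p"
    by (simp add: c)
qed

lemma ev_0: "ev f 0 = ecoeff f 0"
  by transfer (simp add: eval_fps_at_0)

lemma ode_sol_0: "N \<ge> 1 \<Longrightarrow> ev (ode_sol N a q f) 0 = a"
  by (simp add: ev_0 ecoeff_ode_sol)

lemma ode_sol_0_0: "N \<ge> 1 \<Longrightarrow> ode_sol N 0 q 0 = 0"
proof (rule ent_eqI)
  fix n assume N: "N \<ge> 1"
  have "ode_coeff N 0 q (ecoeff 0) n = 0" by (induction n) auto
  then show "ecoeff (ode_sol N 0 q 0) n = ecoeff 0 n" using N by (simp add: ecoeff_ode_sol)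
qed

text \<open>Gronwall's inequality for the energy \<open>u'\<^sup>2 + u\<^sup>2\<close> of \<open>u r = g (r\<^sup>2)\<close>.\<close>

lemma ode_bound:
  assumes N: "N \<ge> 1" and eq: "eD N g + econst q * g = f" and g0: "ev g 0 = 0"
  shows "nrm g \<le> exp (2 + \<bar>q\<bar>) * nrm f"
proof (rule nrm_leI)
  fix y :: real assume y: "0 \<le> y" "y \<le> 1"
  define F where "F = nrm f"
  have F: "F \<ge> 0" by (simp add: F_def)
  define c where "c = 2 + \<bar>q\<bar>"
  define u where "u = (\<lambda>r. ev g (r\<^sup>2))"
  define u' where "u' = (\<lambda>r. 2 * r * ev (ediff g) (r\<^sup>2))"
  define u'' where "u'' = (\<lambda>r. 2 * ev (ediff g) (r\<^sup>2) + 4 * r\<^sup>2 * ev (ediff (ediff g)) (r\<^sup>2))"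
  define E where "E = (\<lambda>r. (u' r)\<^sup>2 + (u r)\<^sup>2)"
  have d1: "(u has_real_derivative u' x) (at x)" for x
    unfolding u_def u'_def by (auto intro!: derivative_eq_intros)
  have d2: "(u' has_real_derivative u'' x) (at x)" for x
    unfolding u'_def u''_def by (auto intro!: derivative_eq_intros simp: power2_eq_square algebra_simps)
  have dE: "(E has_real_derivative (2 * u' x * u'' x + 2 * u x * u' x)) (at x)" for x
    unfolding E_def by (auto intro!: derivative_eq_intros d1 d2 simp: algebra_simps)
  have E': "2 * u' x * u'' x + 2 * u x * u' x \<le> c * E x + F\<^sup>2" if x: "0 \<le> x" "x \<le> 1" for x
  proof -
    have "ev (eD N g + econst q * g) (x\<^sup>2) = ev f (x\<^sup>2)" using eq by simp
    then have u2: "u'' x = ev f (x\<^sup>2) - q * u x - 2 * (real N - 1) * ev (ediff g) (x\<^sup>2)"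
      by (simp add: ev_eD u''_def u_def algebra_simps)
    have "2 * u' x * u'' x + 2 * u x * u' x
        = 2 * u' x * ev f (x\<^sup>2) + 2 * (1 - q) * u x * u' x - 8 * (real N - 1) * x * (ev (ediff g) (x\<^sup>2))\<^sup>2"
      unfolding u2 by (simp add: u'_def algebra_simps power2_eq_square)
    \<comment> \<open>The singular first-order term (N - 1) u' / r enters the energy with a good
      sign and is dropped.\<close>
    also have "\<dots> \<le> 2 * u' x * ev f (x\<^sup>2) + 2 * (1 - q) * u x * u' x"
      using N x by simp
    also have "2 * u' x * ev f (x\<^sup>2) \<le> (u' x)\<^sup>2 + (ev f (x\<^sup>2))\<^sup>2"
      using sum_squares_bound[of "u' x" "ev f (x\<^sup>2)"] by simp
    also have "(ev f (x\<^sup>2))\<^sup>2 \<le> F\<^sup>2"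
      unfolding F_def using x ev_le_nrm[of "x\<^sup>2" f] by (intro abs_le_square_iff[THEN iffD1]) (auto simp: power_le_one)
    also have "2 * (1 - q) * u x * u' x = 2 * ((1 - q) * (u x * u' x))" by simp
    also have "(1 - q) * (u x * u' x) \<le> \<bar>1 - q\<bar> * (\<bar>u x\<bar> * \<bar>u' x\<bar>)"
      by (metis abs_ge_self abs_mult)
    also have "2 * (\<bar>1 - q\<bar> * (\<bar>u x\<bar> * \<bar>u' x\<bar>)) = \<bar>1 - q\<bar> * (2 * \<bar>u x\<bar> * \<bar>u' x\<bar>)" by simp
    also have "\<bar>1 - q\<bar> * (2 * \<bar>u x\<bar> * \<bar>u' x\<bar>) \<le> (1 + \<bar>q\<bar>) * E x"
      unfolding E_def using sum_squares_bound[of "\<bar>u x\<bar>" "\<bar>u' x\<bar>"] by (intro mult_mono) auto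
    also have "(u' x)\<^sup>2 \<le> E x" by (simp add: E_def)
    finally show ?thesis by (simp add: c_def algebra_simps)
  qed
  define r where "r = sqrt y"
  have r: "0 \<le> r" "r \<le> 1" "r\<^sup>2 = y" using y by (auto simp: r_def)
  \<comment> \<open>Gronwall with the integrating factor exp (- c r); the energy starts from 0,
    since u and u' vanish at the axis.\<close>
  define H where "H = (\<lambda>x. F\<^sup>2 * x - exp (- c * x) * E x)"
  have "H 0 \<le> H r"
  proof (rule DERIV_nonneg_imp_nondecreasing[OF r(1)])
    fix x assume x: "0 \<le> x" "x \<le> r"
    define e where "e = 2 * u' x * u'' x + 2 * u x * u' x"
    have "(H has_real_derivative F\<^sup>2 - (exp (- c * x) * (- c) * E x + exp (- c * x) * e)) (at x)"
      unfolding H_def e_def by (auto intro!: derivative_eq_intros dE)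
    moreover have "exp (- c * x) * (e - c * E x) \<le> 1 * F\<^sup>2"
    proof -
      have "exp (- c * x) * (e - c * E x) \<le> exp (- c * x) * F\<^sup>2"
        using E'[of x] x r by (intro mult_left_mono) (auto simp: e_def)
      also have "\<dots> \<le> 1 * F\<^sup>2" using x by (intro mult_right_mono) (auto simp: c_def mult_nonpos_nonneg)
      finally show ?thesis .
    qed
    ultimately show "\<exists>d. (H has_real_derivative d) (at x) \<and> d \<ge> 0"
      by (intro exI conjI) (auto simp: algebra_simps)
  qed
  moreover have "H 0 = 0" by (simp add: H_def E_def u_def u'_def g0)
  ultimately have "exp (- c * r) * E r \<le> F\<^sup>2 * r" by (simp add: H_def)
  also have "\<dots> \<le> F\<^sup>2" using r by (simp add: mult_left_le)
  finally have "E r \<le> exp (c * r) * F\<^sup>2" by (simp add: exp_minus field_simps)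
  \<comment> \<open>The exponent is enlarged to \<open>2 * c\<close> so that the bound is a
    square.\<close>
  also have "\<dots> \<le> exp (2 * c) * F\<^sup>2"
    using r mult_left_le[of r c] by (intro mult_right_mono) (auto simp: c_def)
  also have "\<dots> = (exp c * F)\<^sup>2" by (simp add: power_mult_distrib exp_double)
  finally have "(u r)\<^sup>2 \<le> (exp c * F)\<^sup>2" by (simp add: E_def add_increasing order_trans[rotated])
  then have "\<bar>u r\<bar> \<le> exp c * F" using F by (simp add: abs_le_square_iff[symmetric])
  then show "\<bar>ev g y\<bar> \<le> exp (2 + \<bar>q\<bar>) * nrm f" by (simp add: u_def r c_def F_def)
qed

section \<open>Maximum principle and coercivity of the Robin problem\<close>

lemma second_derivative_nonneg_at_min:
  fixes h h' :: "real \<Rightarrow> real"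
  assumes "\<And>y. a \<le> y \<Longrightarrow> y \<le> b \<Longrightarrow> (h has_real_derivative h' y) (at y)"
    and "(h' has_real_derivative l) (at x)" and x: "a < x" "x < b" "h' x = 0"
    and min: "\<And>y. a \<le> y \<Longrightarrow> y \<le> b \<Longrightarrow> h x \<le> h y"
  shows "l \<ge> 0"
proof (rule ccontr)
  assume "\<not> l \<ge> 0"
  \<comment> \<open>A negative second derivative makes h' negative just to the right of the critical
    point, and by the mean value theorem h falls below its minimum there.\<close>
  then obtain d where d: "d > 0" "\<And>t. t > 0 \<Longrightarrow> t < d \<Longrightarrow> h' (x + t) < h' x"
    using DERIV_neg_dec_right[OF assms(2)] by auto
  define t where "t = min (d / 2) (b - x)"
  have t: "0 < t" "t < d" "x + t \<le> b" using d x by (auto simp: t_def)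
  obtain z where z: "z > x" "z < x + t" "h (x + t) - h x = (x + t - x) * h' z"
    using MVT2[of x "x + t" h h'] assms(1) t x by (metis less_add_same_cancel1 less_eq_real_def order_less_le_trans order_trans)
  have "h' z < 0" using d(2)[of "z - x"] z t x by simp
  then have "h (x + t) < h x" using z t by (smt (verit) mult_pos_neg)
  then show False using min[of "x + t"] t x by simp
qed

text \<open>A negative minimum is excluded in three places: inside by the second derivative test, at
  y = 1 by the boundary condition, and at y = 0 because the operator degenerates there to 2 N h' - k
  h, with h' nonnegative at a minimum on the left end. The strict inequalities in the hypotheses
  take the place of a Hopf-type argument.\<close>

lemma robin_max_principle:
  fixes h h' h'' :: "real \<Rightarrow> real"
  assumes d1: "\<And>y. 0 \<le> y \<Longrightarrow> y \<le> 1 \<Longrightarrow> (h has_real_derivative h' y) (at y)"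
    and d2: "\<And>y. 0 \<le> y \<Longrightarrow> y \<le> 1 \<Longrightarrow> (h' has_real_derivative h'' y) (at y)"
    and sup: "\<And>y. 0 \<le> y \<Longrightarrow> y \<le> 1 \<Longrightarrow> 4 * y * h'' y + 2 * real N * h' y - k * h y < 0"
    and bd: "2 * h' 1 + (real N - 1) * h 1 > 0" and "k \<ge> 0" "N \<ge> 1" "0 \<le> y" "y \<le> 1"
  shows "h y \<ge> 0"
proof -
  have "continuous_on {0..1} h"
    using d1 by (intro DERIV_continuous_on[of _ _ h']) (auto intro: has_field_derivative_at_within)
  then obtain x where x: "0 \<le> x" "x \<le> 1" and xmin: "\<And>y. 0 \<le> y \<Longrightarrow> y \<le> 1 \<Longrightarrow> h x \<le> h y"
    using continuous_attains_inf[of "{0..1}" h] by auto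
  have "h x \<ge> 0"
  proof (rule ccontr)
    assume neg: "\<not> h x \<ge> 0"
    then have kh: "k * h x \<le> 0" using \<open>k \<ge> 0\<close> by (simp add: mult_nonneg_nonpos)
    consider "x = 0" | "x = 1" | "0 < x" "x < 1" using x by linarith
    then show False
    proof cases
      case 1
      have "h' 0 \<ge> 0"
      proof (rule ccontr)
        assume "\<not> h' 0 \<ge> 0"
        then obtain d where d: "d > 0" "\<And>t. t > 0 \<Longrightarrow> t < d \<Longrightarrow> h (0 + t) < h 0"
          using DERIV_neg_dec_right[OF d1[of 0]] by auto
        then have "h (min (d/2) 1) < h 0" using d(2)[of "min (d/2) 1"] by (simp add: min_less_iff_disj)
        then show False using xmin[of "min (d/2) 1"] 1 d by auto
      qed
      then have "real N * h' 0 \<ge> 0" by simp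
      then show False using sup[of 0] kh 1 by simp
    next
      case 2
      have "h' 1 \<le> 0"
      proof (rule ccontr)
        assume "\<not> h' 1 \<le> 0"
        then obtain d where d: "d > 0" "\<And>t. t > 0 \<Longrightarrow> t < d \<Longrightarrow> h (1 - t) < h 1"
          using DERIV_pos_inc_left[OF d1[of 1]] by auto
        then have "h (1 - min (d/2) 1) < h 1" using d(2)[of "min (d/2) 1"] by (simp add: min_less_iff_disj)
        moreover have "h 1 \<le> h (1 - min (d/2) 1)" using xmin[of "1 - min (d/2) 1"] 2 d by auto
        ultimately show False by linarith
      qed
      moreover have "(real N - 1) * h 1 \<le> 0" using neg 2 \<open>N \<ge> 1\<close> by (intro mult_nonneg_nonpos) auto
      ultimately show False using bd by simp
    next
      case 3
      have "h' x = 0"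
        using 3 xmin d1[of x] by (intro DERIV_local_min[of h "h' x" x "min x (1 - x)"]) auto
      moreover from this have "h'' x \<ge> 0"
        using 3 d1 d2 xmin by (intro second_derivative_nonneg_at_min[of 0 1 h h' "h'' x" x]) auto
      then have "4 * x * h'' x \<ge> 0" using 3 by simp
      ultimately have "4 * x * h'' x + 2 * real N * h' x - k * h x \<ge> 0" using kh 3 by simp
      then show False using sup[of x] x by simp
    qed
  qed
  then show ?thesis using xmin[of y] assms by simp
qed

text \<open>For u(r) = g(r^2) this is u'(1) + (N - 1) u(1), the form that the linearised condition
  on the gradient takes for G, see \<open>robin_yc\<close>.\<close>

definition robin :: "nat \<Rightarrow> ent \<Rightarrow> real"
  where "robin N g = 2 * ev (ediff g) 1 + (real N - 1) * ev g 1"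

lemma robin_simps [simp]:
  "robin N 0 = 0" "robin N (f + g) = robin N f + robin N g" "robin N (f - g) = robin N f - robin N g"
  "robin N (econst c * f) = c * robin N f"
  by (simp_all add: robin_def algebra_simps)

lemma robin_bound:
  assumes "N \<ge> 1"
  shows "\<bar>robin N g\<bar> \<le> (1 + real N) * (nrm g + nrm (eD N g))"
proof -
  have "\<bar>ev (ediff g) 1\<bar> \<le> nrm (eD N g)" "\<bar>ev g 1\<bar> \<le> nrm g"
    using ev_le_nrm[of 1] nrm_ediff[OF assms, of g] order_trans by fastforce+
  then have "\<bar>(real N - 1) * ev g 1\<bar> \<le> (real N - 1) * nrm g" "\<bar>2 * ev (ediff g) 1\<bar> \<le> 2 * nrm (eD N g)"
    using assms by (auto simp: abs_mult mult_left_mono)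
  then have "\<bar>robin N g\<bar> \<le> (real N - 1) * nrm g + 2 * nrm (eD N g)"
    unfolding robin_def by linarith
  also have "\<dots> \<le> (1 + real N) * nrm g + (1 + real N) * nrm (eD N g)"
    using assms by (intro add_mono mult_right_mono) auto
  finally show ?thesis by (simp add: algebra_simps)
qed

text \<open>The barrier is \<open>A + B * exp (K / 4 * (y - 1))\<close>.\<close>

lemma robin_coercive:
  assumes N: "N \<ge> 1" and K: "K \<ge> real N" and eq: "eD N g - econst (K\<^sup>2) * g = f" and b: "robin N g = b"
  shows "K\<^sup>2 * nrm g \<le> nrm f + 2 * K * \<bar>b\<bar>"
proof -
  have K0: "K \<ge> 1" using N K by simp
  \<comment> \<open>The slack \<open>e\<close> makes the differential and the boundary inequality
    strict, as the maximum principle demands; it tends to 0 at the end.\<close>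
  have "nrm g \<le> nrm f / K\<^sup>2 + 2 * \<bar>b\<bar> / K + 2 * e" if "e > 0" for e
  proof (rule nrm_leI)
    fix y :: real assume y: "0 \<le> y" "y \<le> 1"
    define A where "A = nrm f / K\<^sup>2 + e"
    define B where "B = 2 * \<bar>b\<bar> / K + e"
    have AB: "A \<ge> 0" "B > 0" "K\<^sup>2 * A > nrm f" "K * B > 2 * \<bar>b\<bar>"
      using that K0 by (auto simp: A_def B_def distrib_left intro!: add_nonneg_pos)
    have ind: "A + B * exp (K / 4 * (y - 1)) - x * ev g y \<ge> 0" if x: "\<bar>x\<bar> = 1" for x :: real
    proof (rule robin_max_principle[where y = y and k = "K\<^sup>2" and N = N])
      fix z :: real assume z: "0 \<le> z" "z \<le> 1"
      define X where "X = exp (K / 4 * (z - 1))"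
      show "((\<lambda>y. A + B * exp (K / 4 * (y - 1)) - x * ev g y) has_real_derivative
              B * (exp (K / 4 * (z - 1)) * (K / 4)) - x * ev (ediff g) z) (at z)"
        by (auto intro!: derivative_eq_intros)
      show "((\<lambda>y. B * (exp (K / 4 * (y - 1)) * (K / 4)) - x * ev (ediff g) y) has_real_derivative
              B * (exp (K / 4 * (z - 1)) * (K / 4) * (K / 4)) - x * ev (ediff (ediff g)) z) (at z)"
        by (auto intro!: derivative_eq_intros)
      have "ev (eD N g - econst (K\<^sup>2) * g) z = ev f z" using eq by simp
      then have f: "4 * z * ev (ediff (ediff g)) z + 2 * real N * ev (ediff g) z - K\<^sup>2 * ev g z = ev f z"
        by (simp add: ev_eD)
      have "x * ev f z \<ge> - nrm f"
        using ev_le_nrm[of z f] z x by (auto simp: abs_if split: if_splits)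
      \<comment> \<open>Here K >= N enters: the exponential part of the barrier is a supersolution
        because z K^2 / 4 + N K / 2 - K^2 <= 0.\<close>
      moreover have "B * X * (z * K\<^sup>2 / 4 + real N * K / 2 - K\<^sup>2) \<le> 0"
      proof -
        have "z * K\<^sup>2 \<le> K\<^sup>2" using z by (simp add: mult_left_le_one_le)
        moreover have "real N * K \<le> K * K" using K K0 by (intro mult_right_mono) auto
        ultimately have "z * K\<^sup>2 / 4 + real N * K / 2 - K\<^sup>2 \<le> 0"
          using zero_le_square[of K] unfolding power2_eq_square by argo
        then show ?thesis using AB unfolding X_def by (intro mult_nonneg_nonpos) auto
      qed
      moreover have "4 * z * (B * (X * (K / 4) * (K / 4)) - x * ev (ediff (ediff g)) z) +
            2 * real N * (B * (X * (K / 4)) - x * ev (ediff g) z) - K\<^sup>2 * (A + B * X - x * ev g z)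
          = B * X * (z * K\<^sup>2 / 4 + real N * K / 2 - K\<^sup>2) - K\<^sup>2 * A - x * ev f z"
        unfolding f[symmetric] by (simp add: algebra_simps power2_eq_square)
      ultimately show "4 * z * (B * (exp (K / 4 * (z - 1)) * (K / 4) * (K / 4)) - x * ev (ediff (ediff g)) z) +
            2 * real N * (B * (exp (K / 4 * (z - 1)) * (K / 4)) - x * ev (ediff g) z)
            - K\<^sup>2 * (A + B * exp (K / 4 * (z - 1)) - x * ev g z) < 0"
        using AB unfolding X_def by linarith
    next
      have "x * b \<le> \<bar>b\<bar>" using x by (auto simp: abs_if split: if_splits)
      moreover have "(real N - 1) * (A + B) \<ge> 0" using N AB by auto
      moreover have "2 * (B * (K / 4) - x * ev (ediff g) 1) + (real N - 1) * (A + B - x * ev g 1)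
          = K * B / 2 + (real N - 1) * (A + B) - x * b"
        unfolding b[symmetric] robin_def by (simp add: algebra_simps)
      ultimately have "2 * (B * (K / 4) - x * ev (ediff g) 1) + (real N - 1) * (A + B - x * ev g 1) > 0"
        using AB by linarith
      then show "2 * (B * (exp (K / 4 * (1 - 1)) * (K / 4)) - x * ev (ediff g) 1) +
            (real N - 1) * (A + B * exp (K / 4 * (1 - 1)) - x * ev g 1) > 0" by simp
    qed (use N y in auto)
    have "exp (K / 4 * (y - 1)) \<le> 1" using y K0 by (auto intro: mult_nonneg_nonpos)
    then have "B * exp (K / 4 * (y - 1)) \<le> B" using AB by (intro mult_left_le) auto
    then have "\<bar>ev g y\<bar> \<le> A + B" using ind[of 1] ind[of "-1"] by auto
    then show "\<bar>ev g y\<bar> \<le> nrm f / K\<^sup>2 + 2 * \<bar>b\<bar> / K + 2 * e" by (simp add: A_def B_def)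
  qed
  then have "nrm g \<le> nrm f / K\<^sup>2 + 2 * \<bar>b\<bar> / K + e" if "e > 0" for e
    using that by (metis field_sum_of_halves mult_2 half_gt_zero)
  then have "nrm g \<le> nrm f / K\<^sup>2 + 2 * \<bar>b\<bar> / K" by (rule field_le_epsilon)
  then have "K\<^sup>2 * nrm g \<le> K\<^sup>2 * (nrm f / K\<^sup>2 + 2 * \<bar>b\<bar> / K)" by (intro mult_left_mono) auto
  also have "\<dots> = nrm f + 2 * K * \<bar>b\<bar>" using K0 by (simp add: field_simps power2_eq_square)
  finally show ?thesis .
qed

section \<open>Bessel functions and the Robin problem\<close>

text \<open>The regular radial solution with value 1 at the axis. For q > 0 it is, at y = r^2, a
  multiple of I of order N / 2 - 1 at sqrt q * r, see \<open>bessel_I_Phi\<close> and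
  \<open>ev_phi\<close>.\<close>

definition phi :: "nat \<Rightarrow> real \<Rightarrow> ent"
  where "phi N q = ode_sol N 1 q 0"

abbreviation Phi :: "nat \<Rightarrow> ent"
  where "Phi N \<equiv> phi N 1"

lemma phi_eq: "N \<ge> 1 \<Longrightarrow> eD N (phi N q) = - (econst q * phi N q)"
  using ode_sol_eq[of N 1 q 0] by (simp add: phi_def eq_neg_iff_add_eq_0)

lemma phi_0: "N \<ge> 1 \<Longrightarrow> ev (phi N q) 0 = 1"
  by (simp add: phi_def ode_sol_0)

text \<open>Scaling y to q y reduces every q to \<open>Phi\<close>. In the variable y this includes
  q < 0, where sqrt q would not be real.\<close>

lemma ev_phi:
  assumes "N \<ge> 1"
  shows "ev (phi N q) y = ev (Phi N) (q * y)"
proof -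
  have "ecoeff (phi N q) n = q ^ n * ecoeff (Phi N) n" for n
  proof -
    have "ode_coeff N 1 q (ecoeff 0) n = q ^ n * ode_coeff N 1 1 (ecoeff 0) n"
      by (induction n) auto
    then show ?thesis using assms by (simp add: phi_def ecoeff_ode_sol)
  qed
  then have "(\<lambda>n. ecoeff (Phi N) n * (q * y) ^ n) sums ev (phi N q) y"
    using ent_sums[of "phi N q" y] by (simp add: power_mult_distrib mult_ac)
  then show ?thesis using ent_sums[of "Phi N" "q * y"] sums_unique2 by blast
qed

lemma ev_ediff_phi:
  assumes "N \<ge> 1"
  shows "ev (ediff (phi N q)) y = q * ev (ediff (Phi N)) (q * y)"
proof -
  have "((\<lambda>y. ev (Phi N) (q * y)) has_real_derivative ev (ediff (Phi N)) (q * y) * q) (at y)"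
    by (auto intro!: derivative_eq_intros)
  then have "(ev (phi N q) has_real_derivative ev (ediff (Phi N)) (q * y) * q) (at y)"
    by (simp only: ev_phi[OF assms, of q, symmetric])
  moreover have "(ev (phi N q) has_real_derivative ev (ediff (phi N q)) y) (at y)"
    by (auto intro!: derivative_eq_intros)
  ultimately show ?thesis using DERIV_unique by (simp add: mult.commute) 
qed

lemma Phi_ode:
  assumes "N \<ge> 1"
  shows "4 * x * ev (ediff (ediff (Phi N))) x + 2 * real N * ev (ediff (Phi N)) x + ev (Phi N) x = 0"
proof -
  have "ev (eD N (Phi N)) x = ev (- (econst 1 * Phi N)) x" using phi_eq[OF assms, of 1] by simp
  then show ?thesis by (simp add: ev_eD)
qed

text \<open>Simple zeros: \<open>x\<^sup>N\<^sup>-\<^sup>1 (4 x \<Phi>'\<^sup>2 + \<Phi>\<^sup>2)\<close> is nondecreasing and positive near \<open>0\<close>.\<close>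

lemma Phi_simple_zeros:
  assumes N: "N \<ge> 1" and x: "x > 0" and z: "ev (Phi N) x = 0"
  shows "ev (ediff (Phi N)) x \<noteq> 0"
proof
  assume z': "ev (ediff (Phi N)) x = 0"
  define P where "P = ev (Phi N)"
  define P' where "P' = ev (ediff (Phi N))"
  define P'' where "P'' = ev (ediff (ediff (Phi N)))"
  define E where "E = (\<lambda>x. x ^ (N - 1) * (4 * x * (P' x)\<^sup>2 + (P x)\<^sup>2))"
  have dP: "(P has_real_derivative P' u) (at u)" "(P' has_real_derivative P'' u) (at u)" for u
    unfolding P_def P'_def P''_def by (auto intro!: derivative_eq_intros)
  have mono: "E a \<le> E x" if a: "0 \<le> a" "a \<le> x" for a
  proof (rule DERIV_nonneg_imp_nondecreasing[OF a(2)])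
    fix u assume u: "a \<le> u" "u \<le> x"
    have ode: "4 * u * P'' u = - 2 * real N * P' u - P u"
      using Phi_ode[OF N, of u] by (simp add: P_def P'_def P''_def algebra_simps)
    have "(E has_real_derivative real (N - 1) * u ^ (N - 1 - 1) * (4 * u * (P' u)\<^sup>2 + (P u)\<^sup>2)
        + u ^ (N - 1) * (4 * (P' u)\<^sup>2 + 4 * u * (2 * P' u * P'' u) + 2 * P u * P' u)) (at u)"
      unfolding E_def by (auto intro!: derivative_eq_intros dP simp: algebra_simps)
    moreover have "real (N - 1) * u ^ (N - 1 - 1) * (4 * u * (P' u)\<^sup>2 + (P u)\<^sup>2)
        + u ^ (N - 1) * (4 * (P' u)\<^sup>2 + 4 * u * (2 * P' u * P'' u) + 2 * P u * P' u)
      = real (N - 1) * u ^ (N - 1 - 1) * (P u)\<^sup>2"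
    proof -
      have "4 * (P' u)\<^sup>2 + 4 * u * (2 * P' u * P'' u) + 2 * P u * P' u
          = 4 * (P' u)\<^sup>2 + 2 * P' u * (4 * u * P'' u) + 2 * P u * P' u" by simp
      also have "\<dots> = - 4 * real (N - 1) * (P' u)\<^sup>2"
        unfolding ode using N by (simp add: of_nat_diff algebra_simps power2_eq_square)
      finally have "4 * (P' u)\<^sup>2 + 4 * u * (2 * P' u * P'' u) + 2 * P u * P' u
        = - 4 * real (N - 1) * (P' u)\<^sup>2" .
      moreover have "real (N - 1) * u ^ (N - 1) = real (N - 1) * u ^ (N - 1 - 1) * u"
        by (cases "N - 1") auto
      ultimately show ?thesis by (auto simp: algebra_simps)
    qed
    ultimately show "\<exists>d. (E has_real_derivative d) (at u) \<and> d \<ge> 0"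
      using u a by (intro exI[of _ "real (N - 1) * u ^ (N - 1 - 1) * (P u)\<^sup>2"] conjI) (metis, auto)
  qed
  \<comment> \<open>For N > 1 the energy vanishes at 0, so its positivity is taken at a small point
    \<open>a\<close> > 0, where \<open>P\<close> is still positive.\<close>
  have "isCont P 0" using dP DERIV_isCont by blast
  moreover have "P 0 > 0" using phi_0[OF N] by (simp add: P_def)
  ultimately obtain d where d: "d > 0" "\<And>u. \<bar>u\<bar> < d \<Longrightarrow> P u > 0"
    unfolding isCont_def by (smt (verit, best) LIM_D real_norm_def dist_real_def)
  define a where "a = min (d / 2) x"
  have a: "0 < a" "a \<le> x" "P a > 0" using d x by (auto simp: a_def intro!: d(2))
  have "E a > 0" unfolding E_def using a by (intro mult_pos_pos add_nonneg_pos) auto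
  moreover have "E x = 0" using z z' by (simp add: E_def P_def P'_def)
  ultimately show False using mono[of a] a by simp
qed

text \<open>Each step of the recursion changes the sign. Thus at x <= 0 all terms of the series of
  \<open>Phi\<close> have the same sign, which is how negative Robin eigenvalues are
  excluded.\<close>

lemma ecoeff_Phi_sign:
  assumes "N \<ge> 1"
  shows "(- 1) ^ n * ecoeff (Phi N) n > 0"
proof (induction n)
  case 0
  then show ?case using assms by (simp add: phi_def ecoeff_ode_sol)
next
  case (Suc n)
  have "ecoeff (Phi N) (Suc n) = - ecoeff (Phi N) n / (2 * real (Suc n) * (2 * real n + real N))"
    using assms by (simp add: phi_def ecoeff_ode_sol)
  then have "(- 1) ^ Suc n * ecoeff (Phi N) (Suc n)
      = ((- 1) ^ n * ecoeff (Phi N) n) / (2 * real (Suc n) * (2 * real n + real N))"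
    by simp
  then show ?case using Suc assms by (auto intro!: divide_pos_pos mult_pos_pos)
qed

lemma Phi_nonpos:
  assumes N: "N \<ge> 1" and x: "x \<le> 0"
  shows "ev (Phi N) x > 0" and "ev (ediff (Phi N)) x \<le> 0"
proof -
  have sgn: "ecoeff (Phi N) n * x ^ n \<ge> 0" for n
  proof -
    have "ecoeff (Phi N) n * x ^ n = ((- 1) ^ n * ecoeff (Phi N) n) * (- x) ^ n"
      by (cases "even n") (auto simp del: of_nat_Suc)
    moreover have "(- x) ^ n \<ge> 0" using x by simp
    ultimately show ?thesis using less_imp_le[OF ecoeff_Phi_sign[OF N, of n]] by (metis mult_nonneg_nonneg)
  qed
  have "(\<Sum>n<1. ecoeff (Phi N) n * x ^ n) \<le> ev (Phi N) x"
    using sum_le_suminf[of "\<lambda>n. ecoeff (Phi N) n * x ^ n" "{..<1}"] ent_sums[of "Phi N" x] sgn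
    by (simp add: sums_iff)
  then show "ev (Phi N) x > 0" using phi_0[OF N, of 1] by (simp add: ev_0)
  have "ecoeff (ediff (Phi N)) n * x ^ n \<le> 0" for n
  proof -
    have "ecoeff (ediff (Phi N)) n * x ^ n = - real (Suc n) * (((- 1) ^ Suc n * ecoeff (Phi N) (Suc n)) * (- x) ^ n)"
      by (cases "even n") (auto simp del: of_nat_Suc)
    moreover have "(- x) ^ n \<ge> 0" using x by simp
    then have "real (Suc n) * (((- 1) ^ Suc n * ecoeff (Phi N) (Suc n)) * (- x) ^ n) \<ge> 0"
      using less_imp_le[OF ecoeff_Phi_sign[OF N, of "Suc n"]] by (intro mult_nonneg_nonneg[OF _ mult_nonneg_nonneg]) (simp_all del: power_Suc)
    ultimately show ?thesis by (simp only: mult_minus_left neg_le_0_iff_le)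
  qed
  then show "ev (ediff (Phi N)) x \<le> 0"
    by (rule sums_le[OF _ ent_sums sums_zero])
qed

text \<open>Sturm comparison of \<open>r\<^sup>p \<Phi>(r\<^sup>2)\<close>, \<open>p = (N - 1) / 2\<close>, with \<open>sin ((r - R) / 2)\<close>.\<close>

lemma Phi_oscillates:
  assumes N: "N \<ge> 1"
  shows "\<exists>r > R0. ev (Phi N) (r\<^sup>2) = 0"
proof (rule ccontr)
  assume no: "\<not> (\<exists>r > R0. ev (Phi N) (r\<^sup>2) = 0)"
  define p where "p = (real N - 1) / 2"
  \<comment> \<open>Beyond 2 p the potential term p (p - 1) / r^2 is at most 1/4.\<close>
  define R where "R = max (R0 + 1) (2 * p + 1)"
  define u where "u = (\<lambda>r. ev (Phi N) (r\<^sup>2))"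
  define u' where "u' = (\<lambda>r. 2 * r * ev (ediff (Phi N)) (r\<^sup>2))"
  define u'' where "u'' = (\<lambda>r. 2 * ev (ediff (Phi N)) (r\<^sup>2) + 4 * r\<^sup>2 * ev (ediff (ediff (Phi N))) (r\<^sup>2))"
  have p: "p \<ge> 0" using N by (simp add: p_def)
  have R: "R > 0" "R > R0" "R \<ge> 2 * p" using p by (auto simp: R_def)
  have du: "(u has_real_derivative u' x) (at x)" "(u' has_real_derivative u'' x) (at x)" for x
    unfolding u_def u'_def u''_def by (auto intro!: derivative_eq_intros simp: power2_eq_square algebra_simps)
  have nz: "u r \<noteq> 0" if "r \<ge> R" for r using no that R by (auto simp: u_def)
  define x where "x = sgn (u R)"
  have "x * u R > 0" using nz[of R] by (auto simp: x_def sgn_if)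
  have pos: "x * u r > 0" if r: "r \<ge> R" for r
  proof (rule ccontr)
    assume "\<not> x * u r > 0"
    moreover have "continuous_on {R..r} (\<lambda>r. x * u r)"
      unfolding u_def by (intro continuous_intros)
    ultimately obtain c where "R \<le> c" "c \<le> r" "x * u c = 0"
      using IVT2'[of "\<lambda>r. x * u r" r 0 R] \<open>x * u R > 0\<close> r by auto
    then show False using nz[of c] nz[of R] by (auto simp: x_def sgn_if split: if_splits)
  qed
  \<comment> \<open>The function v = r^p u satisfies v'' = - (1 - p (p - 1) / r^2) v with a factor
    of at least 3/4, while \<open>g\<close> solves g'' = - g / 4 and is positive between two zeros
    at distance 2 pi; so v oscillates faster than \<open>g\<close>.\<close>
  define g where "g = (\<lambda>r. sin ((r - R) / 2))"
  define g' where "g' = (\<lambda>r. cos ((r - R) / 2) / 2)"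
  \<comment> \<open>The Wronskian v' g - v g' for v = r^p u, written out in terms of u and
    u'.\<close>
  define W where "W = (\<lambda>r. r powr p * (((p / r) * u r + u' r) * g r - u r * g' r))"
  have "x * W R \<ge> x * W (R + 2 * pi)"
  proof (rule DERIV_nonpos_imp_nonincreasing[of R "R + 2 * pi" "\<lambda>r. x * W r"])
    fix r assume r: "R \<le> r" "r \<le> R + 2 * pi"
    have r0: "r > 0" using R r by simp
    have ode: "u'' r = - u r - 2 * (p / r) * u' r"
    proof -
      have "(p / r) * u' r = 2 * p * ev (ediff (Phi N)) (r\<^sup>2)" using r0 by (simp add: u'_def)
      then show ?thesis
        using Phi_ode[OF N, of "r\<^sup>2"] by (simp add: u_def u''_def p_def algebra_simps)
    qed
    have dg: "(g has_real_derivative g' r) (at r)" "(g' has_real_derivative - g r / 4) (at r)"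
      unfolding g_def g'_def by (auto intro!: derivative_eq_intros)
    have dq: "((\<lambda>r. p / r) has_real_derivative - p / r\<^sup>2) (at r)"
      using r0 by (auto intro!: derivative_eq_intros simp: power2_eq_square)
    have dp: "((\<lambda>r. r powr p) has_real_derivative (r powr p * (p / r))) (at r)"
      using r0 by (auto intro!: derivative_eq_intros simp: powr_diff)
    define Q where "Q = p / r"
    have "(W has_real_derivative
        (r powr p * Q) * ((Q * u r + u' r) * g r - u r * g' r) +
        r powr p * ((((- p / r\<^sup>2) * u r + Q * u' r + u'' r) * g r + (Q * u r + u' r) * g' r)
          - (u' r * g' r + u r * (- g r / 4)))) (at r)"
      unfolding W_def Q_def
      by (rule DERIV_cong, rule DERIV_mult[OF dp DERIV_diff[OF DERIV_mult[OF DERIV_add[OF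
            DERIV_mult[OF dq du(1)] du(2)] dg(1)] DERIV_mult[OF du(1) dg(2)]]])
        (simp add: algebra_simps)
    also have "(r powr p * Q) * ((Q * u r + u' r) * g r - u r * g' r) +
        r powr p * ((((- p / r\<^sup>2) * u r + Q * u' r + u'' r) * g r + (Q * u r + u' r) * g' r)
          - (u' r * g' r + u r * (- g r / 4)))
        = r powr p * (u r * g r * (p * (p - 1) / r\<^sup>2 - 3 / 4))"
    proof -
      have "Q * Q = p * p / r\<^sup>2" by (simp add: Q_def power2_eq_square)
      then have "p * (p - 1) / r\<^sup>2 = Q * Q - p / r\<^sup>2" by (simp add: right_diff_distrib diff_divide_distrib)
      then show ?thesis unfolding ode Q_def[symmetric] minus_divide_left[symmetric]
        by (simp only:) (simp add: algebra_simps)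
    qed
    finally have dW: "((\<lambda>r. x * W r) has_real_derivative x * (r powr p * (u r * g r * (p * (p - 1) / r\<^sup>2 - 3 / 4)))) (at r)"
      by (rule DERIV_cmult)
    have "p * (p - 1) \<le> p * p" using p by (simp add: mult_left_mono)
    also have "4 * (p * p) \<le> r\<^sup>2"
      using power_mono[of "2 * p" r 2] p R r by (simp add: power2_eq_square)
    finally have "p * (p - 1) / r\<^sup>2 \<le> 1 / 4" using r0 by (simp add: field_simps)
    moreover have "g r \<ge> 0" unfolding g_def using r by (intro sin_ge_zero) auto
    ultimately have "(r powr p * (x * u r) * g r) * (p * (p - 1) / r\<^sup>2 - 3 / 4) \<le> 0"
      using pos[of r] r by (intro mult_nonneg_nonpos) auto
    then show "\<exists>d. ((\<lambda>r. x * W r) has_real_derivative d) (at r) \<and> d \<le> 0"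
      using dW by (intro exI[of _ "x * (r powr p * (u r * g r * (p * (p - 1) / r\<^sup>2 - 3 / 4)))"] conjI)
        (simp_all only: mult_ac)
  qed auto
  moreover have "x * W R < 0"
    using pos[of R] R by (simp add: W_def g_def g'_def mult_less_0_iff zero_less_mult_iff)
  moreover have "x * W (R + 2 * pi) > 0"
  proof -
    have "x * W (R + 2 * pi) = (R + 2 * pi) powr p * (x * u (R + 2 * pi)) / 2"
      by (simp add: W_def g_def g'_def)
    moreover have "(R + 2 * pi) powr p * (x * u (R + 2 * pi)) / 2 > 0"
      using pos[of "R + 2 * pi"] R pi_gt_zero
      by (intro divide_pos_pos mult_pos_pos[of "(R + 2 * pi) powr p"]) (auto simp: add_nonneg_eq_0_iff)
    ultimately show ?thesis by argo
  qed
  ultimately show False by simp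
qed

text \<open>At an accumulation point of zeros both the function r -> Phi(r^2) and, by difference
  quotients along the sequence, its derivative would vanish, against the simplicity of zeros. The
  point 0 is excluded by Phi(0) = 1.\<close>

lemma Phi_zeros_finite:
  assumes N: "N \<ge> 1"
  shows "finite {r. 0 < r \<and> r \<le> R \<and> ev (Phi N) (r\<^sup>2) = 0}" (is "finite ?Z")
proof (rule ccontr)
  assume "infinite ?Z"
  moreover have "?Z \<subseteq> {0..R}" by auto
  ultimately obtain x where x: "x \<in> {0..R}" "x islimpt ?Z"
    using compact_eq_Bolzano_Weierstrass[of "{0..R}"] by auto
  define u where "u = (\<lambda>r. ev (Phi N) (r\<^sup>2))"
  have du: "(u has_real_derivative ev (ediff (Phi N)) (x\<^sup>2) * (2 * x)) (at x)"
    unfolding u_def by (auto intro!: derivative_eq_intros)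
  obtain f where f: "\<And>n::nat. f n \<in> ?Z - {x}" "f \<longlonglongrightarrow> x"
    using x(2) unfolding islimpt_sequential by blast
  have "(\<lambda>n. u (f n)) \<longlonglongrightarrow> u x"
    using DERIV_isCont[OF du] f(2) by (rule isCont_tendsto_compose)
  moreover have "(\<lambda>n. u (f n)) = (\<lambda>n. 0)" using f(1) by (auto simp: u_def)
  ultimately have ux: "u x = 0" using LIMSEQ_unique tendsto_const by metis
  then have "x \<noteq> 0" using phi_0[OF N] by (auto simp: u_def)
  then have "x > 0" using x by auto
  have "(\<lambda>n. (u (f n) - u x) / (f n - x)) \<longlonglongrightarrow> ev (ediff (Phi N)) (x\<^sup>2) * (2 * x)"
  proof (rule filterlim_compose[where f = f])
    show "((\<lambda>y. (u y - u x) / (y - x)) \<longlongrightarrow> ev (ediff (Phi N)) (x\<^sup>2) * (2 * x)) (at x)"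
      using du by (simp add: has_field_derivative_iff)
    show "filterlim f (at x) sequentially"
      using f by (auto simp: filterlim_at)
  qed
  moreover have "(\<lambda>n. (u (f n) - u x) / (f n - x)) = (\<lambda>n. 0)" using f(1) ux by (auto simp: u_def)
  ultimately have "ev (ediff (Phi N)) (x\<^sup>2) * (2 * x) = 0" using LIMSEQ_unique tendsto_const by metis
  then show False using Phi_simple_zeros[OF N, of "x\<^sup>2"] \<open>x > 0\<close> ux by (auto simp: u_def)
qed

text \<open>The recursion of \<open>ode_coeff\<close> is the functional equation of the Gamma
  function in disguise.\<close>

lemma ecoeff_Phi:
  assumes "N \<ge> 1"
  shows "ecoeff (Phi N) k = (- 1) ^ k * Gamma (real N / 2) / (4 ^ k * fact k * Gamma (real N / 2 + real k))"
proof (induction k)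
  case 0
  have "Gamma (real N / 2) > 0" by (rule Gamma_real_pos) (use assms in simp)
  then have "Gamma (real N / 2) \<noteq> 0" by linarith
  then show ?case using assms by (simp add: phi_def ecoeff_ode_sol)
next
  case (Suc k)
  define z where "z = real N / 2 + real k"
  have z: "z > 0" using assms by (simp add: z_def)
  then have G: "Gamma (z + 1) = z * Gamma z" "Gamma z > 0"
    by (auto intro!: Gamma_plus1 Gamma_real_pos elim!: nonpos_Ints_cases)
  have "ecoeff (Phi N) (Suc k) = - ecoeff (Phi N) k / (2 * real (Suc k) * (2 * z))"
    using assms by (simp add: phi_def ecoeff_ode_sol z_def)
  also have "ecoeff (Phi N) k = (- 1) ^ k * Gamma (real N / 2) / (4 ^ k * fact k * Gamma z)"
    using Suc by (simp add: z_def)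
  also have "- ((- 1) ^ k * Gamma (real N / 2) / (4 ^ k * fact k * Gamma z)) / (2 * real (Suc k) * (2 * z))
      = (- 1) ^ Suc k * Gamma (real N / 2) / (4 ^ Suc k * fact (Suc k) * Gamma (z + 1))"
    using z G by (simp add: mult_ac)
  finally show ?case by (simp add: z_def add_ac)
qed

lemma bessel_J_Phi:
  assumes N: "N \<ge> 1" and r: "r > 0"
  defines "\<nu> \<equiv> real N / 2 - 1"
  shows "bessel_J \<nu> r = (r / 2) powr \<nu> / Gamma (\<nu> + 1) * ev (Phi N) (r\<^sup>2)"
proof -
  have Gp: "Gamma (real N / 2) > 0" "Gamma (real N / 2 + real k) > 0" for k
    using N by (auto intro!: Gamma_real_pos add_pos_nonneg)
  have "(- 1) ^ k / (fact k * Gamma (\<nu> + real k + 1)) * (r / 2) powr (2 * real k + \<nu>)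
      = (r / 2) powr \<nu> / Gamma (\<nu> + 1) * (ecoeff (Phi N) k * (r\<^sup>2) ^ k)" for k
  proof -
    have "(r / 2) powr (2 * real k + \<nu>) = (r / 2) powr \<nu> * (r\<^sup>2) ^ k / 4 ^ k"
    proof -
      have "(r / 2) powr (2 * real k + \<nu>) = (r / 2) powr \<nu> * (r / 2) powr (real (2 * k))"
        by (simp add: powr_add)
      also have "(r / 2) powr (real (2 * k)) = (r / 2) ^ (2 * k)"
        using r by (intro powr_realpow) auto
      finally show ?thesis by (simp add: power_divide power_mult)
    qed
    moreover have "Gamma (\<nu> + real k + 1) = Gamma (real N / 2 + real k)" "Gamma (\<nu> + 1) = Gamma (real N / 2)"
      by (rule arg_cong, simp add: \<nu>_def)+
    moreover have "Gamma (real N / 2) \<noteq> 0" using Gp(1) by linarith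
    ultimately show ?thesis by (simp add: ecoeff_Phi[OF N] mult_ac)
  qed
  moreover have "(\<lambda>k. (r / 2) powr \<nu> / Gamma (\<nu> + 1) * (ecoeff (Phi N) k * (r\<^sup>2) ^ k)) sums
      ((r / 2) powr \<nu> / Gamma (\<nu> + 1) * ev (Phi N) (r\<^sup>2))"
    by (intro sums_mult ent_sums)
  ultimately show ?thesis unfolding bessel_J_def by (simp add: sums_iff)
qed

lemma bessel_I_Phi:
  assumes N: "N \<ge> 1" and r: "r \<ge> 0"
  defines "\<nu> \<equiv> real N / 2 - 1"
  shows "bessel_I \<nu> r = 1 / (2 powr \<nu> * Gamma (\<nu> + 1)) * ev (Phi N) (r\<^sup>2)"
proof (cases "r = 0")
  case True
  then show ?thesis using phi_0[OF N] by (simp add: bessel_I_def)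
next
  case False
  then have "r > 0" using r by simp
  then have *: "r powr (- \<nu>) * (r / 2) powr \<nu> = 1 / 2 powr \<nu>"
    by (simp add: powr_divide powr_minus)
  have "bessel_I \<nu> r = (r powr (- \<nu>) * (r / 2) powr \<nu>) / Gamma (\<nu> + 1) * ev (Phi N) (r\<^sup>2)"
    using bessel_J_Phi[OF N \<open>r > 0\<close>] False by (simp add: bessel_I_def \<nu>_def)
  then show ?thesis unfolding * by simp
qed

text \<open>The counting function of a locally finite set jumps by exactly one at each element, and
  unboundedness always supplies a next element.\<close>

lemma nth_element_ex1:
  fixes Z :: "real set"
  assumes fin: "\<And>R. finite {z \<in> Z. z \<le> R}" and unb: "\<And>R. \<exists>z\<in>Z. z > R" and n: "n \<ge> 1"
  shows "\<exists>!j. j \<in> Z \<and> card {z \<in> Z. z \<le> j} = n"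
proof -
  \<comment> \<open>A starting point below all elements, at which the count is 0.\<close>
  obtain b where b: "{z \<in> Z. z \<le> b} = {}"
  proof (cases "{z \<in> Z. z \<le> 0} = {}")
    case False
    have "{z \<in> Z. z \<le> Min {z \<in> Z. z \<le> 0} - 1} = {}"
    proof (rule ccontr)
      assume "{z \<in> Z. z \<le> Min {z \<in> Z. z \<le> 0} - 1} \<noteq> {}"
      then obtain w where w: "w \<in> Z" "w \<le> Min {z \<in> Z. z \<le> 0} - 1" by auto
      moreover have "Min {z \<in> Z. z \<le> 0} \<le> 0" using Min_in[OF fin False] by simp
      ultimately show False using Min_le[OF fin, of w 0] by auto
    qed
    then show ?thesis using that by blast
  qed (use that in blast)
  have next_ex: "\<exists>j. j \<in> Z \<and> R < j \<and> {z \<in> Z. z \<le> j} = insert j {z \<in> Z. z \<le> R}" for R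
  proof -
    obtain z where z: "z \<in> Z" "z > R" using unb by blast
    define S where "S = {w \<in> Z. R < w \<and> w \<le> z}"
    have S: "finite S" "S \<noteq> {}" unfolding S_def using z by (auto intro: finite_subset[OF _ fin[of z]])
    then have "Min S \<in> S" by simp
    then have "Min S \<in> Z" "R < Min S" "Min S \<le> z" by (auto simp: S_def)
    moreover have "w \<le> Min S \<longleftrightarrow> w = Min S \<or> w \<le> R" if "w \<in> Z" for w
      using Min_le[OF S(1), of w] calculation that by (auto simp: S_def)
    ultimately show ?thesis by (intro exI[of _ "Min S"]) auto
  qed
  have "\<exists>R. card {z \<in> Z. z \<le> R} = k \<and> (k \<ge> 1 \<longrightarrow> R \<in> Z)" for k
  proof (induction k)
    case 0
    then show ?case using b by (intro exI[of _ b]) (simp only: card.empty, simp)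
  next
    case (Suc k)
    then obtain R where R: "card {z \<in> Z. z \<le> R} = k" by blast
    obtain j where j: "j \<in> Z" "R < j" "{z \<in> Z. z \<le> j} = insert j {z \<in> Z. z \<le> R}"
      using next_ex by blast
    then have "card {z \<in> Z. z \<le> j} = Suc k" using R fin[of R] by (simp add: card_insert_if)
    then show ?case using j by blast
  qed
  then obtain j where j: "j \<in> Z" "card {z \<in> Z. z \<le> j} = n" using n by blast
  have less: "card {z \<in> Z. z \<le> a} < card {z \<in> Z. z \<le> c}" if "a < c" "c \<in> Z" for a c
    by (rule psubset_card_mono[OF fin]) (use that in force)
  show ?thesis
  proof (rule ex1I[of _ j])
    show "i = j" if "i \<in> Z \<and> card {z \<in> Z. z \<le> i} = n" for i
      using less[of i j] less[of j i] that j by (cases i j rule: linorder_cases) auto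
  qed (use j in auto)
qed

text \<open>For r > 0 the factor between \<open>bessel_J\<close> and \<open>Phi\<close> does not
  vanish, so both have the same positive zeros; their local finiteness and unboundedness give the
  definite description in \<open>bessel_zero\<close> a unique value.\<close>

lemma bessel_zero_Phi:
  assumes N: "N \<ge> 1" and n: "n \<ge> 1"
  defines "j \<equiv> bessel_zero (real N / 2 - 1) n"
  shows "j > 0" "ev (Phi N) (j\<^sup>2) = 0"
proof -
  define \<nu> where "\<nu> = real N / 2 - 1"
  define Z where "Z = {r. 0 < r \<and> ev (Phi N) (r\<^sup>2) = 0}"
  have "\<nu> + 1 > 0" using N by (simp add: \<nu>_def)
  then have "Gamma (\<nu> + 1) > 0" by (rule Gamma_real_pos)
  then have zero_iff: "bessel_J \<nu> r = 0 \<longleftrightarrow> ev (Phi N) (r\<^sup>2) = 0" if "r > 0" for r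
    using bessel_J_Phi[OF N that] that by (simp add: \<nu>_def)
  have "\<exists>!j. j \<in> Z \<and> card {z \<in> Z. z \<le> j} = n"
  proof (rule nth_element_ex1[OF _ _ n])
    show "finite {z \<in> Z. z \<le> R}" for R
      using Phi_zeros_finite[OF N, of R] by (rule finite_subset[rotated]) (auto simp: Z_def)
    show "\<exists>z\<in>Z. z > R" for R
      using Phi_oscillates[OF N, of "max R 0"] by (auto simp: Z_def)
  qed
  moreover have "(j \<in> Z \<and> card {z \<in> Z. z \<le> j} = n) \<longleftrightarrow>
     (j > 0 \<and> bessel_J \<nu> j = 0 \<and> card {r. 0 < r \<and> r \<le> j \<and> bessel_J \<nu> r = 0} = n)" for j
  proof -
    have "{z \<in> Z. z \<le> j} = {r. 0 < r \<and> r \<le> j \<and> bessel_J \<nu> r = 0}"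
      using zero_iff by (auto simp: Z_def)
    then show ?thesis using zero_iff by (auto simp: Z_def)
  qed
  ultimately have "\<exists>!j. j > 0 \<and> bessel_J \<nu> j = 0 \<and> card {r. 0 < r \<and> r \<le> j \<and> bessel_J \<nu> r = 0} = n"
    by simp
  from theI'[OF this] show "j > 0" "ev (Phi N) (j\<^sup>2) = 0"
    using zero_iff by (auto simp: j_def bessel_zero_def \<nu>_def)
qed

lemma U_fun_Phi:
  assumes N: "N \<ge> 1" and n: "n \<ge> 1" and r: "r \<ge> 0"
  defines "\<nu> \<equiv> real N / 2 - 1"
  shows "U_fun N n r = 1 / (2 powr \<nu> * Gamma (\<nu> + 1)) * ev (phi N ((bessel_zero \<nu> n)\<^sup>2)) (r\<^sup>2)"
  using bessel_I_Phi[OF N, of "bessel_zero \<nu> n * r"] bessel_zero_Phi[OF N n] r ev_phi[OF N]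
  by (simp add: U_fun_def \<nu>_def power_mult_distrib)

lemma robin_phi:
  assumes N: "N \<ge> 1"
  shows "robin N (phi N q) = 2 * q * ev (ediff (Phi N)) q + (real N - 1) * ev (Phi N) q"
  using ev_phi[OF N, of q 1] ev_ediff_phi[OF N, of q 1] by (simp add: robin_def)

text \<open>The least Robin eigenvalue. The restriction to q >= 0 makes the infimum meaningful; that
  there are no negative eigenvalues is shown in the next lemma. For N = 1 the value is 0.\<close>

definition q_star :: "nat \<Rightarrow> real"
  where "q_star N = Inf {q. q \<ge> 0 \<and> robin N (phi N q) = 0}"

text \<open>At q = 0 the Robin functional of \<open>phi N q\<close> is N - 1 >= 0. At the first zero
  of \<open>Phi\<close> only the derivative term survives and is negative, so the intermediate value
  theorem puts an eigenvalue before that zero.\<close>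

lemma q_star:
  assumes N: "N \<ge> 1"
  shows "q_star N \<ge> 0" "robin N (phi N (q_star N)) = 0"
    and "\<And>q. q < q_star N \<Longrightarrow> robin N (phi N q) \<noteq> 0"
    and "\<And>x. x > 0 \<Longrightarrow> ev (Phi N) x = 0 \<Longrightarrow> q_star N < x"
    and "ev (phi N (q_star N)) 1 \<noteq> 0"
proof -
  define \<sigma> where "\<sigma> = (\<lambda>q. robin N (phi N q))"
  have cont: "continuous_on A \<sigma>" for A
    unfolding \<sigma>_def robin_phi[OF N] by (intro continuous_intros)
  define S where "S = {q. q \<ge> 0 \<and> \<sigma> q = 0}"
  have "S = {0..} \<inter> \<sigma> -` {0}" by (auto simp: S_def)
  then have closed: "closed S"
    using continuous_closed_vimage[of "{0}" \<sigma>] cont[of UNIV] 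
    by (auto simp: continuous_on_eq_continuous_at intro!: closed_Int)
  have bdd: "bdd_below S" by (auto simp: S_def intro!: bdd_belowI[of _ 0])
  have ex: "\<exists>q\<in>S. q < x" if x: "x > 0" "ev (Phi N) x = 0" for x
  proof -
    \<comment> \<open>The least zero is taken so that \<open>Phi\<close> is positive before it; its
      derivative there is then nonpositive, hence negative by simplicity.\<close>
    define T where "T = {y. 0 \<le> y \<and> y \<le> x \<and> ev (Phi N) y = 0}"
    have "T = {0..x} \<inter> ev (Phi N) -` {0}" by (auto simp: T_def)
    moreover have "continuous_on UNIV (ev (Phi N))" by (intro continuous_intros)
    ultimately have "closed T"
      using continuous_closed_vimage[of "{0}" "ev (Phi N)"]
      by (auto simp: continuous_on_eq_continuous_at intro!: closed_Int)
    moreover have "x \<in> T" using x by (simp add: T_def)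
    moreover have bT: "bdd_below T" by (auto simp: T_def intro!: bdd_belowI[of _ 0])
    ultimately have iT: "Inf T \<in> T" using closed_contains_Inf by blast
    define y where "y = Inf T"
    have y: "0 \<le> y" "y \<le> x" "ev (Phi N) y = 0" using iT by (auto simp: T_def y_def)
    then have y0: "y > 0" using phi_0[OF N, of 1] by (cases "y = 0") auto
    have pos: "ev (Phi N) z > 0" if z: "0 \<le> z" "z < y" for z
    proof (rule ccontr)
      assume "\<not> ev (Phi N) z > 0"
      moreover have "continuous_on {0..z} (ev (Phi N))" by (intro continuous_intros)
      ultimately obtain c where c: "0 \<le> c" "c \<le> z" "ev (Phi N) c = 0"
        using IVT2'[of "ev (Phi N)" z 0 0] phi_0[OF N, of 1] z by auto
      then have "c \<in> T" using z y by (auto simp: T_def)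
      then have "y \<le> c" unfolding y_def using bT by (rule cInf_lower)
      then show False using c z by simp
    qed
    have d: "(ev (Phi N) has_real_derivative ev (ediff (Phi N)) y) (at y)"
      by (auto intro!: derivative_eq_intros)
    have "ev (ediff (Phi N)) y \<le> 0"
    proof (rule ccontr)
      assume "\<not> ev (ediff (Phi N)) y \<le> 0"
      then obtain e where e: "e > 0" "\<And>t. t > 0 \<Longrightarrow> t < e \<Longrightarrow> ev (Phi N) (y - t) < ev (Phi N) y"
        using DERIV_pos_inc_left[OF d] by auto
      define t where "t = min (e / 2) y"
      have "ev (Phi N) (y - t) < 0" using e(2)[of t] e(1) y y0 by (auto simp: t_def min_less_iff_disj)
      moreover have "ev (Phi N) (y - t) > 0" using e(1) y0 by (intro pos) (auto simp: t_def)
      ultimately show False by simp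
    qed
    then have "ev (ediff (Phi N)) y < 0" using Phi_simple_zeros[OF N y0 y(3)] by simp
    then have sy: "\<sigma> y < 0" using y y0 by (simp add: \<sigma>_def robin_phi[OF N] mult_less_0_iff zero_less_mult_iff)
    have s0: "\<sigma> 0 \<ge> 0" using N phi_0[OF N, of 1] by (simp add: \<sigma>_def robin_phi[OF N])
    obtain q where q: "0 \<le> q" "q \<le> y" "\<sigma> q = 0"
      using IVT2'[of \<sigma> y 0 0] sy s0 y cont by auto
    then have "q \<noteq> y" using sy by auto
    then show ?thesis using q y by (auto simp: S_def)
  qed
  obtain r where r: "r > 0" "ev (Phi N) (r\<^sup>2) = 0" using Phi_oscillates[OF N, of 0] by auto
  then have "S \<noteq> {}" using ex[of "r\<^sup>2"] by auto
  then have "Inf S \<in> S" using closed bdd closed_contains_Inf by blast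
  moreover have qs: "q_star N = Inf S" by (simp add: q_star_def S_def \<sigma>_def)
  ultimately show q0: "q_star N \<ge> 0" and s0: "robin N (phi N (q_star N)) = 0" by (auto simp: S_def \<sigma>_def)
  show "robin N (phi N q) \<noteq> 0" if "q < q_star N" for q
  proof (cases "q \<ge> 0")
    case True
    then show ?thesis using cInf_lower[OF _ bdd, of q] that qs by (auto simp: S_def \<sigma>_def)
  next
    case False
    show ?thesis
    \<comment> \<open>For N > 1 the term with N - 1 is strictly positive at negative q. For N = 1 it
      is absent, and the derivative of \<open>Phi\<close> itself must be shown nonzero, by its
      leading coefficient.\<close>
    proof (cases "N = 1")
      case True
      have "ev (ediff (Phi N)) q \<noteq> 0"
      proof
        assume z: "ev (ediff (Phi N)) q = 0"
        have sg: "ecoeff (ediff (Phi N)) n * q ^ n \<le> 0" for n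
        proof -
          have "ecoeff (ediff (Phi N)) n * q ^ n = - real (Suc n) * (((- 1) ^ Suc n * ecoeff (Phi N) (Suc n)) * (- q) ^ n)"
            by (cases "even n") (auto simp del: of_nat_Suc)
          moreover have "(- q) ^ n \<ge> 0" using False by simp
          then have "real (Suc n) * (((- 1) ^ Suc n * ecoeff (Phi N) (Suc n)) * (- q) ^ n) \<ge> 0"
            using less_imp_le[OF ecoeff_Phi_sign[OF N, of "Suc n"]] by (intro mult_nonneg_nonneg[OF _ mult_nonneg_nonneg]) (simp_all del: power_Suc)
          ultimately show ?thesis by (simp only: mult_minus_left neg_le_0_iff_le)
        qed
        have "(\<Sum>n<1. - (ecoeff (ediff (Phi N)) n * q ^ n)) \<le> - ev (ediff (Phi N)) q"
          using sum_le_suminf[of "\<lambda>n. - (ecoeff (ediff (Phi N)) n * q ^ n)" "{..<1}"]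
            sums_minus[OF ent_sums[of "ediff (Phi N)" q]] sg
          by (simp add: sums_iff)
        then show False using z ecoeff_Phi_sign[OF N, of 1] by simp
      qed
      then show ?thesis using True False robin_phi[OF N, of q] by simp
    next
      case F: False
      have "2 * q * ev (ediff (Phi N)) q \<ge> 0"
        using False Phi_nonpos(2)[OF N, of q] by (intro mult_nonpos_nonpos) auto
      moreover have "(real N - 1) * ev (Phi N) q > 0"
        using F N Phi_nonpos(1)[OF N, of q] False by (intro mult_pos_pos) auto
      ultimately show ?thesis by (simp add: robin_phi[OF N])
    qed
  qed
  show "q_star N < x" if "x > 0" "ev (Phi N) x = 0" for x
    using ex[OF that] cInf_lower[OF _ bdd] qs by force
  show "ev (phi N (q_star N)) 1 \<noteq> 0"
  proof
    \<comment> \<open>Boundary value and Robin functional both zero would produce a double zero of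
      \<open>Phi\<close>.\<close>
    assume z: "ev (phi N (q_star N)) 1 = 0"
    then have z1: "ev (Phi N) (q_star N) = 0" using ev_phi[OF N, of "q_star N" 1] by simp
    then have "q_star N \<noteq> 0" using phi_0[OF N, of 1] by auto
    then have "q_star N > 0" using q0 by simp
    then show False using Phi_simple_zeros[OF N _ z1] s0 z1 by (simp add: robin_phi[OF N])
  qed
qed

text \<open>The Wronskian identity \<open>(r\<^sup>N (g' \<phi> - g \<phi>'))' = r\<^sup>N\<^sup>-\<^sup>1 \<phi>\<^sup>2 / 2\<close> shows that the Robin problem at
  a Robin eigenvalue is not solvable with right-hand side \<open>\<phi>\<close>.\<close>

lemma robin_resonance:
  assumes N: "N \<ge> 1" and r0: "robin N (phi N q) = 0" and nz: "ev (phi N q) 1 \<noteq> 0"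
    and eq: "eD N g + econst q * g = phi N q"
  shows "robin N g \<noteq> 0"
proof
  assume rx: "robin N g = 0"
  define f where "f = phi N q"
  define M where "M = (\<lambda>r. r ^ N * (ev (ediff g) (r\<^sup>2) * ev f (r\<^sup>2) - ev g (r\<^sup>2) * ev (ediff f) (r\<^sup>2)))"
  have dM: "(M has_real_derivative r ^ (N - 1) * (ev f (r\<^sup>2))\<^sup>2 / 2) (at r)" if "r \<ge> 0" for r
  proof -
    define y where "y = r\<^sup>2"
    have f2: "4 * y * ev (ediff (ediff f)) y + 2 * real N * ev (ediff f) y = - q * ev f y"
      using arg_cong[OF phi_eq[OF N, of q], of "\<lambda>f. ev f y"] by (simp add: ev_eD f_def)
    have x2: "4 * y * ev (ediff (ediff g)) y + 2 * real N * ev (ediff g) y = ev f y - q * ev g y"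
      using arg_cong[OF eq, of "\<lambda>f. ev f y"] by (simp add: ev_eD f_def)
    define A where "A = ev (ediff g) y * ev f y - ev g y * ev (ediff f) y"
    define B where "B = ev (ediff (ediff g)) y * ev f y - ev g y * ev (ediff (ediff f)) y"
    have "(M has_real_derivative real N * r ^ (N - 1) * A + r ^ N * (2 * r * B)) (at r)"
      unfolding M_def A_def B_def y_def by (auto intro!: derivative_eq_intros simp: algebra_simps)
    moreover have "r ^ N = r ^ (N - 1) * r" using N by (cases N) auto
    then have "real N * r ^ (N - 1) * A + r ^ N * (2 * r * B) = r ^ (N - 1) / 2 * (2 * real N * A + 4 * y * B)"
      by (simp add: y_def power2_eq_square algebra_simps)
    moreover have "2 * real N * A + 4 * y * B = (4 * y * ev (ediff (ediff g)) y + 2 * real N * ev (ediff g) y) * ev f y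
       - ev g y * (4 * y * ev (ediff (ediff f)) y + 2 * real N * ev (ediff f) y)"
      by (simp add: A_def B_def algebra_simps)
    then have "2 * real N * A + 4 * y * B = (ev f y)\<^sup>2"
      unfolding f2 x2 by (simp add: algebra_simps power2_eq_square)
    ultimately show ?thesis by (simp only: y_def) (simp only: times_divide_eq_left)
  qed
  have M0: "M 0 = 0" using N by (simp add: M_def power_0_left)
  \<comment> \<open>Both functions satisfy the same Robin condition, so their Wronskian vanishes at
    the boundary.\<close>
  have d1: "ev (ediff f) 1 = - (real N - 1) / 2 * ev f 1" "ev (ediff g) 1 = - (real N - 1) / 2 * ev g 1"
    using r0 rx by (auto simp: robin_def f_def field_simps)
  have "M 1 = ev (ediff g) 1 * ev f 1 - ev g 1 * ev (ediff f) 1" by (simp add: M_def)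
  then have M1: "M 1 = 0" unfolding d1 by simp
  have mono: "M a \<le> M b" if "0 \<le> a" "a \<le> b" for a b
  proof (rule DERIV_nonneg_imp_nondecreasing[OF that(2)])
    fix r assume "a \<le> r" "r \<le> b"
    then show "\<exists>y. (M has_real_derivative y) (at r) \<and> y \<ge> 0"
      using dM[of r] that by (intro exI[of _ "r ^ (N - 1) * (ev f (r\<^sup>2))\<^sup>2 / 2"]) auto
  qed
  have "isCont (\<lambda>r. ev f (r\<^sup>2)) 1"
    by (rule DERIV_isCont) (auto intro!: derivative_eq_intros)
  moreover have "ev f (1\<^sup>2) \<noteq> 0" using nz by (simp add: f_def)
  ultimately obtain d where d0: "d > 0" and "\<forall>y. dist 1 y < d \<longrightarrow> ev f (y\<^sup>2) \<noteq> 0"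
    using continuous_at_avoid[of 1 "\<lambda>r. ev f (r\<^sup>2)" 0] by blast
  then have d: "d > 0" "\<And>r. \<bar>r - 1\<bar> < d \<Longrightarrow> ev f (r\<^sup>2) \<noteq> 0"
    by (auto simp: dist_real_def abs_minus_commute)
  \<comment> \<open>Near 1 the eigenfunction has no zero, so \<open>M\<close> increases strictly up
    to \<open>M 1\<close> = 0; but \<open>M\<close> starts from 0 at the axis and never
    decreases.\<close>
  define a where "a = max (1 / 2) (1 - d / 2)"
  have a: "0 < a" "a < 1" "1 - a < d" using d by (auto simp: a_def)
  have "M a < M 1"
  proof (rule DERIV_pos_imp_increasing[OF a(2)])
    fix r assume "a \<le> r" "r \<le> 1"
    then show "\<exists>y. (M has_real_derivative y) (at r) \<and> y > 0"
      using dM[of r] d(2)[of r] a by (intro exI[of _ "r ^ (N - 1) * (ev f (r\<^sup>2))\<^sup>2 / 2"]) auto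
  qed
  then show False using mono[of 0 a] a M0 M1 by simp
qed

section \<open>Trigonometric polynomials with entire coefficients\<close>

type_synonym idx = "nat \<Rightarrow> int"
text \<open>Real Fourier coefficients of a sum of c_k(y) e^(i k x). The product of finitely
  supported maps is convolution over the group of frequencies, that is, the product of the
  functions.\<close>

type_synonym pm = "idx \<Rightarrow>\<^sub>0 ent"

abbreviation lookup :: "pm \<Rightarrow> idx \<Rightarrow> ent"
  where "lookup \<equiv> Poly_Mapping.lookup"

abbreviation keys :: "pm \<Rightarrow> idx set"
  where "keys \<equiv> Poly_Mapping.keys"

abbreviation single :: "idx \<Rightarrow> ent \<Rightarrow> pm"
  where "single \<equiv> Poly_Mapping.single"

lemma pm_superset_sum:
  assumes "finite A" "keys p \<subseteq> A" "\<And>k. F k 0 = 0"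
  shows "(\<Sum>k\<in>keys p. F k (lookup p k)) = (\<Sum>k\<in>A. F k (lookup p k))"
  using assms by (intro sum.mono_neutral_left) (auto simp: in_keys_iff)

lemma pm_sum_add:
  fixes F :: "idx \<Rightarrow> ent \<Rightarrow> 'a::comm_monoid_add"
  assumes "\<And>k. F k 0 = 0" "\<And>k c d. F k (c + d) = F k c + F k d"
  shows "(\<Sum>k\<in>keys (p + q). F k (lookup (p + q) k))
    = (\<Sum>k\<in>keys p. F k (lookup p k)) + (\<Sum>k\<in>keys q. F k (lookup q k))"
proof -
  have "keys (p + q) \<subseteq> keys p \<union> keys q" by (rule keys_add)
  then show ?thesis
    using pm_superset_sum[of "keys p \<union> keys q" "p + q" F] pm_superset_sum[of "keys p \<union> keys q" p F]
      pm_superset_sum[of "keys p \<union> keys q" q F] assms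
    by (simp add: lookup_add sum.distrib)
qed

lemma pm_monomials: "(p :: pm) = (\<Sum>k\<in>keys p. single k (lookup p k))"
proof (rule poly_mapping_eqI)
  fix l
  have "lookup (\<Sum>k\<in>keys p. single k (lookup p k)) l = (\<Sum>k\<in>keys p. if k = l then lookup p k else 0)"
    by (auto simp: lookup_sum lookup_single when_def intro!: sum.cong)
  also have "\<dots> = lookup p l" by (simp add: in_keys_iff)
  finally show "lookup p l = lookup (\<Sum>k\<in>keys p. single k (lookup p k)) l" by simp
qed

lemma pm_mult_monomials:
  "(p :: pm) * q = (\<Sum>k\<in>keys p. \<Sum>l\<in>keys q. single (k + l) (lookup p k * lookup q l))"
  by (subst pm_monomials[of p], subst pm_monomials[of q])
    (simp add: sum_distrib_left sum_distrib_right mult_single, rule sum.swap)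

section \<open>Weighted Wiener algebra of Fourier coefficients\<close>

definition l1 :: "nat \<Rightarrow> idx \<Rightarrow> real"
  where "l1 m k = (\<Sum>i<m. \<bar>real_of_int (k i)\<bar>)"

definition sq :: "nat \<Rightarrow> idx \<Rightarrow> real"
  where "sq m k = (\<Sum>i<m. (real_of_int (k i))\<^sup>2)"

text \<open>The power counts derivatives in x within the recursion; the exponential absorbs the
  frequencies that appear when the sums are differentiated afterwards. Both factors are
  submultiplicative because \<open>l1\<close> is subadditive.\<close>

definition wt :: "nat \<Rightarrow> nat \<Rightarrow> idx \<Rightarrow> real"
  where "wt m a k = exp (l1 m k) * (1 + l1 m k) ^ a"

lemma l1_nonneg [simp]: "l1 m k \<ge> 0"
  by (simp add: l1_def sum_nonneg)

lemma wt_nonneg [simp]: "wt m a k \<ge> 0"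
  by (simp add: wt_def)

lemma l1_add: "l1 m (k + l) \<le> l1 m k + l1 m l"
  unfolding l1_def sum.distrib[symmetric] by (intro sum_mono) auto

lemma wt_add: "wt m a (k + l) \<le> wt m a k * wt m a l"
proof -
  have "1 + l1 m (k + l) \<le> (1 + l1 m k) * (1 + l1 m l)"
  proof -
    have "(1 + l1 m k) * (1 + l1 m l) = 1 + l1 m k + l1 m l + l1 m k * l1 m l"
      by (simp add: algebra_simps)
    moreover have "l1 m k * l1 m l \<ge> 0" by simp
    ultimately show ?thesis using l1_add[of m k l] by linarith
  qed
  then have "(1 + l1 m (k + l)) ^ a \<le> ((1 + l1 m k) * (1 + l1 m l)) ^ a"
    by (intro power_mono) auto
  moreover have "exp (l1 m (k + l)) \<le> exp (l1 m k) * exp (l1 m l)"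
    using l1_add[of m k l] by (simp flip: exp_add)
  ultimately have "wt m a (k + l) \<le> (exp (l1 m k) * exp (l1 m l)) * ((1 + l1 m k) * (1 + l1 m l)) ^ a"
    unfolding wt_def by (intro mult_mono) auto
  then show ?thesis by (simp add: wt_def power_mult_distrib mult_ac)
qed

lemma abs_le_l1: "i < m \<Longrightarrow> \<bar>real_of_int (k i)\<bar> \<le> l1 m k"
  unfolding l1_def by (rule member_le_sum) auto

lemma sq_nonneg [simp]: "sq m k \<ge> 0"
  by (simp add: sq_def sum_nonneg)

lemma sq_le_l1: "sq m k \<le> (l1 m k)\<^sup>2"
proof -
  have "sq m k \<le> (\<Sum>i<m. \<bar>real_of_int (k i)\<bar> * l1 m k)"
    unfolding sq_def
  proof (rule sum_mono)
    fix i assume "i \<in> {..<m}"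
    then have "\<bar>real_of_int (k i)\<bar> * \<bar>real_of_int (k i)\<bar> \<le> \<bar>real_of_int (k i)\<bar> * l1 m k"
      by (intro mult_left_mono abs_le_l1) auto
    then show "(real_of_int (k i))\<^sup>2 \<le> \<bar>real_of_int (k i)\<bar> * l1 m k"
      by (simp add: power2_eq_square)
  qed
  also have "\<dots> = (l1 m k)\<^sup>2" by (simp add: l1_def power2_eq_square sum_distrib_right)
  finally show ?thesis .
qed

text \<open>Integrality gives |k| <= k^2. The lemma bounds the weight of frequencies with a bounded
  eigenvalue \<open>sq\<close>.\<close>

lemma l1_le_sq: "l1 m k \<le> sq m k"
  unfolding l1_def sq_def
proof (rule sum_mono)
  fix i
  have "\<bar>k i\<bar> \<le> (k i)\<^sup>2"
  proof (cases "k i = 0")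
    case False
    then have "\<bar>k i\<bar> * 1 \<le> \<bar>k i\<bar> * \<bar>k i\<bar>" by (intro mult_left_mono) auto
    then show ?thesis by (simp add: power2_eq_square)
  qed simp
  then show "\<bar>real_of_int (k i)\<bar> \<le> (real_of_int (k i))\<^sup>2"
    by (metis of_int_abs of_int_le_iff of_int_power)
qed

lemma l1_squared_le: "(l1 m k)\<^sup>2 \<le> real m * sq m k"
  using Cauchy_Schwarz_ineq_sum[of "\<lambda>_. 1" "\<lambda>i. \<bar>real_of_int (k i)\<bar>" "{..<m}"]
  by (simp add: l1_def sq_def)

definition Wn :: "nat \<Rightarrow> nat \<Rightarrow> pm \<Rightarrow> real"
  where "Wn m a p = (\<Sum>k\<in>keys p. wt m a k * nrm (lookup p k))"

lemma Wn_superset: "finite A \<Longrightarrow> keys p \<subseteq> A \<Longrightarrow> Wn m a p = (\<Sum>k\<in>A. wt m a k * nrm (lookup p k))"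
  unfolding Wn_def by (rule pm_superset_sum) auto

lemma Wn_nonneg [simp]: "Wn m a p \<ge> 0"
  by (simp add: Wn_def sum_nonneg)

lemma Wn_0 [simp]: "Wn m a 0 = 0"
  by (simp add: Wn_def)

lemma Wn_single [simp]: "Wn m a (single k c) = wt m a k * nrm c"
  by (simp add: Wn_def)

lemma Wn_minus [simp]: "Wn m a (- p) = Wn m a p"
  by (simp add: Wn_def keys_def)

lemma Wn_add: "Wn m a (p + q) \<le> Wn m a p + Wn m a q"
proof -
  define A where "A = keys p \<union> keys q"
  have A: "finite A" "keys p \<subseteq> A" "keys q \<subseteq> A" "keys (p + q) \<subseteq> A"
    using keys_add[of p q] by (auto simp: A_def)
  have "Wn m a (p + q) \<le> (\<Sum>k\<in>A. wt m a k * nrm (lookup p k) + wt m a k * nrm (lookup q k))"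
    unfolding Wn_superset[OF A(1,4)]
    by (intro sum_mono) (simp add: lookup_add nrm_add mult_left_mono flip: distrib_left)
  then show ?thesis by (simp add: Wn_superset[OF A(1,2)] Wn_superset[OF A(1,3)] sum.distrib)
qed

lemma Wn_sum: "Wn m a (sum f A) \<le> (\<Sum>i\<in>A. Wn m a (f i))"
proof (induction A rule: infinite_finite_induct)
  case (insert x A)
  then show ?case using Wn_add[of m a "f x" "sum f A"] by simp
qed auto

lemma Wn_mono: "a \<le> b \<Longrightarrow> Wn m a p \<le> Wn m b p"
  unfolding Wn_def wt_def by (intro sum_mono mult_right_mono mult_left_mono power_increasing) auto

lemma Wn_mult: "Wn m a (p * q) \<le> Wn m a p * Wn m a q"
proof -
  have "Wn m a (p * q) \<le> (\<Sum>k\<in>keys p. \<Sum>l\<in>keys q. Wn m a (single (k + l) (lookup p k * lookup q l)))"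
    unfolding pm_mult_monomials by (rule order_trans[OF Wn_sum]) (intro sum_mono Wn_sum)
  also have "\<dots> \<le> (\<Sum>k\<in>keys p. \<Sum>l\<in>keys q. (wt m a k * nrm (lookup p k)) * (wt m a l * nrm (lookup q l)))"
  proof (intro sum_mono)
    fix k l
    have "wt m a (k + l) * nrm (lookup p k * lookup q l)
        \<le> (wt m a k * wt m a l) * (nrm (lookup p k) * nrm (lookup q l))"
      by (intro mult_mono wt_add nrm_mult) auto
    then show "Wn m a (single (k + l) (lookup p k * lookup q l))
        \<le> (wt m a k * nrm (lookup p k)) * (wt m a l * nrm (lookup q l))"
      by (simp add: mult_ac)
  qed
  also have "\<dots> = Wn m a p * Wn m a q" by (simp add: Wn_def sum_product)
  finally show ?thesis .
qed

text \<open>A Fourier multiplier. \<open>mapp\<close> acts on the support only, which is why the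
  rules about \<open>cw\<close> ask for F k 0 = 0.\<close>

definition cw :: "(idx \<Rightarrow> ent \<Rightarrow> ent) \<Rightarrow> pm \<Rightarrow> pm"
  where "cw F p = Poly_Mapping.mapp F p"

lemma lookup_cw: "F k 0 = 0 \<Longrightarrow> lookup (cw F p) k = F k (lookup p k)"
  by (simp add: cw_def lookup_mapp when_def in_keys_iff)

lemma keys_cw: "keys (cw F p) \<subseteq> keys p"
  by (simp add: cw_def keys_mapp_subset)

lemma cw_0 [simp]: "cw F 0 = 0"
  using keys_cw[of F 0] by simp

lemma Wn_cw:
  assumes "\<And>k. F k 0 = 0" and "\<And>k. k \<in> keys p \<Longrightarrow> (1 + l1 m k) ^ a * nrm (F k (lookup p k)) \<le> C * (1 + l1 m k) ^ b * nrm (lookup p k)"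
  shows "Wn m a (cw F p) \<le> C * Wn m b p"
proof -
  have "Wn m a (cw F p) = (\<Sum>k\<in>keys p. wt m a k * nrm (F k (lookup p k)))"
    using Wn_superset[OF _ keys_cw, of p m a F] by (simp add: lookup_cw assms(1))
  also have "\<dots> \<le> (\<Sum>k\<in>keys p. C * (wt m b k * nrm (lookup p k)))"
  proof (rule sum_mono)
    fix k assume "k \<in> keys p"
    from mult_left_mono[OF assms(2)[OF this], of "exp (l1 m k)"]
    show "wt m a k * nrm (F k (lookup p k)) \<le> C * (wt m b k * nrm (lookup p k))"
      by (simp add: wt_def mult_ac)
  qed
  finally show ?thesis by (simp add: Wn_def sum_distrib_left)
qed

definition Lap :: "nat \<Rightarrow> pm \<Rightarrow> pm"
  where "Lap m = cw (\<lambda>k c. econst (- sq m k) * c)"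

text \<open>The partial derivative in x with the factor i removed, so that coefficients stay
  real.\<close>

definition Kop :: "nat \<Rightarrow> pm \<Rightarrow> pm"
  where "Kop i = cw (\<lambda>k c. econst (real_of_int (k i)) * c)"

text \<open>The scalar product of the gradients in x; the minus sign is i^2, from the two factors i
  that \<open>Kop\<close> leaves out.\<close>

definition gp :: "nat \<Rightarrow> pm \<Rightarrow> pm \<Rightarrow> pm"
  where "gp m p q = - (\<Sum>i<m. Kop i p * Kop i q)"

lemma econst_simps: "econst (a + b) = econst a + econst b" "econst (a * b) = econst a * econst b"
  "econst (- a) = - econst a" "econst (a - b) = econst a - econst b" "econst 0 = 0" "econst 1 = 1"
  by (transfer; simp add: fps_const_add fps_const_mult)+

lemma econst_numeral: "econst (numeral n) = numeral n"
proof -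
  have "econst (of_nat k) = of_nat k" for k by (induction k) (auto simp: econst_simps)
  from this[of "numeral n"] show ?thesis by simp
qed

lemma econst_sum: "econst (sum f A) = (\<Sum>i\<in>A. econst (f i))"
  by (induction A rule: infinite_finite_induct) (auto simp: econst_simps)

lemma lookup_Lap: "lookup (Lap m p) k = econst (- sq m k) * lookup p k"
  by (simp add: Lap_def lookup_cw)

lemma lookup_Kop: "lookup (Kop i p) k = econst (real_of_int (k i)) * lookup p k"
  by (simp add: Kop_def lookup_cw)

lemma Lap_add: "Lap m (p + q) = Lap m p + Lap m q"
  by (rule poly_mapping_eqI) (simp add: lookup_Lap lookup_add algebra_simps)

lemma Kop_add: "Kop i (p + q) = Kop i p + Kop i q"
  by (rule poly_mapping_eqI) (simp add: lookup_Kop lookup_add algebra_simps)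

lemma Lap_0 [simp]: "Lap m 0 = 0" and Kop_0 [simp]: "Kop i 0 = 0"
  by (simp_all add: Lap_def Kop_def)

lemma Lap_sum: "Lap m (sum f A) = (\<Sum>i\<in>A. Lap m (f i))"
  by (induction A rule: infinite_finite_induct) (auto simp: Lap_add)

lemma Kop_sum: "Kop i (sum f A) = (\<Sum>j\<in>A. Kop i (f j))"
  by (induction A rule: infinite_finite_induct) (auto simp: Kop_add)

lemma Lap_single [simp]: "Lap m (single k c) = single k (econst (- sq m k) * c)"
  by (rule poly_mapping_eqI) (auto simp: lookup_Lap lookup_single when_def)

lemma Kop_single [simp]: "Kop i (single k c) = single k (econst (real_of_int (k i)) * c)"
  by (rule poly_mapping_eqI) (auto simp: lookup_Kop lookup_single when_def)

text \<open>The product rule for the Laplacian, checked on monomials and extended bilinearly. It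
  expresses the gradient product by operators that commute with all symmetries, which a single
  \<open>Kop\<close> does not.\<close>

lemma gp_Lap: "gp m p q + gp m p q = Lap m (p * q) - p * Lap m q - q * Lap m p"
proof -
  have singles: "gp m (single k c) (single l d) + gp m (single k c) (single l d) =
     Lap m (single k c * single l d) - single k c * Lap m (single l d) - single l d * Lap m (single k c)" for k l c d
  proof -
    have "sq m (k + l) - sq m k - sq m l = 2 * (\<Sum>i<m. real_of_int (k i) * real_of_int (l i))"
      by (simp add: sq_def sum_distrib_left power2_eq_square algebra_simps flip: sum_subtractf sum.distrib)
    then have e: "econst (sq m (k + l)) - econst (sq m k) - econst (sq m l) =
      2 * (\<Sum>i<m. econst (real_of_int (k i)) * econst (real_of_int (l i)))"
      by (simp add: econst_simps econst_sum econst_numeral flip: econst_simps(4))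
    have g: "gp m (single k c) (single l d) = single (k + l) (- (\<Sum>i<m. econst (real_of_int (k i)) * econst (real_of_int (l i))) * (c * d))"
      by (rule poly_mapping_eqI)
        (simp add: gp_def mult_single lookup_sum lookup_single when_def sum_distrib_right sum_distrib_left mult_ac)
    have "Lap m (single k c * single l d) - single k c * Lap m (single l d) - single l d * Lap m (single k c)
      = single (k + l) (- ((econst (sq m (k + l)) - econst (sq m k) - econst (sq m l)) * (c * d)))"
      by (simp add: mult_single econst_simps add.commute[of l k] algebra_simps flip: single_diff single_add)
    then show ?thesis unfolding e g by (simp add: algebra_simps flip: single_add)
  qed
  define s where "s = (\<lambda>k. single k (lookup p k))"
  define t where "t = (\<lambda>l. single l (lookup q l))"
  have pq: "p = sum s (keys p)" "q = sum t (keys q)" unfolding s_def t_def by (rule pm_monomials)+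
  have K: "Kop i p = (\<Sum>k\<in>keys p. Kop i (s k))" "Kop i q = (\<Sum>l\<in>keys q. Kop i (t l))" for i
    by (subst (1) pq, rule Kop_sum)+
  have L: "Lap m p = (\<Sum>k\<in>keys p. Lap m (s k))" "Lap m q = (\<Sum>l\<in>keys q. Lap m (t l))"
    by (subst (1) pq, rule Lap_sum)+
  have g: "gp m p q = (\<Sum>k\<in>keys p. \<Sum>l\<in>keys q. gp m (s k) (t l))"
  proof -
    have "gp m p q = - (\<Sum>i<m. \<Sum>k\<in>keys p. \<Sum>l\<in>keys q. Kop i (s k) * Kop i (t l))"
      unfolding gp_def K by (simp only: sum_product)
    also have "\<dots> = - (\<Sum>k\<in>keys p. \<Sum>l\<in>keys q. \<Sum>i<m. Kop i (s k) * Kop i (t l))"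
      by (subst sum.swap, subst (2) sum.swap) (rule refl)
    finally show ?thesis by (simp add: gp_def sum_negf)
  qed
  have 1: "Lap m (p * q) = (\<Sum>k\<in>keys p. \<Sum>l\<in>keys q. Lap m (s k * t l))"
    by (subst pq(1), subst pq(2)) (simp only: sum_product Lap_sum)
  have 2: "p * Lap m q = (\<Sum>k\<in>keys p. \<Sum>l\<in>keys q. s k * Lap m (t l))"
    unfolding L by (subst pq(1)) (simp only: sum_product)
  have 3: "q * Lap m p = (\<Sum>k\<in>keys p. \<Sum>l\<in>keys q. t l * Lap m (s k))"
  proof -
    have "q * Lap m p = (\<Sum>k\<in>keys p. Lap m (s k)) * sum t (keys q)"
      unfolding L pq(2)[symmetric] by (rule mult.commute)
    also have "\<dots> = (\<Sum>k\<in>keys p. \<Sum>l\<in>keys q. Lap m (s k) * t l)" by (rule sum_product)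
    finally show ?thesis by (simp only: mult.commute)
  qed
  show ?thesis
    unfolding g 1 2 3 by (simp only: s_def t_def singles flip: sum.distrib sum_subtractf)
qed

section \<open>Symmetries acting on frequencies\<close>

definition freqs :: "nat \<Rightarrow> idx set"
  where "freqs m = {k. \<forall>i\<ge>m. k i = 0}"

text \<open>A symmetry is described by what it must respect: addition for products,
  \<open>sq\<close> for the Laplacian and the solution operator, \<open>freqs\<close> for the
  support. Reflections and coordinate permutations are instances.\<close>

definition Sym :: "nat \<Rightarrow> (idx \<Rightarrow> idx) set"
  where "Sym m = {T. bij T \<and> (\<forall>k l. T (k + l) = T k + T l) \<and> (\<forall>k. sq m (T k) = sq m k) \<and>
    (\<forall>k. T k \<in> freqs m \<longleftrightarrow> k \<in> freqs m)}"

definition inv_pm :: "nat \<Rightarrow> pm \<Rightarrow> bool"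
  where "inv_pm m p \<longleftrightarrow> keys p \<subseteq> freqs m \<and> (\<forall>T\<in>Sym m. \<forall>k. lookup p (T k) = lookup p k)"

lemma inv_pm_0 [simp]: "inv_pm m 0"
  by (simp add: inv_pm_def)

lemma inv_pm_add: "inv_pm m p \<Longrightarrow> inv_pm m q \<Longrightarrow> inv_pm m (p + q)"
  using keys_add[of p q] by (auto simp: inv_pm_def lookup_add)

lemma inv_pm_minus: "inv_pm m p \<Longrightarrow> inv_pm m (- p)"
  by (simp add: inv_pm_def)

lemma inv_pm_diff: "inv_pm m p \<Longrightarrow> inv_pm m q \<Longrightarrow> inv_pm m (p - q)"
  using inv_pm_add[of m p "- q"] inv_pm_minus by simp

lemma inv_pm_sum: "(\<And>i. i \<in> A \<Longrightarrow> inv_pm m (f i)) \<Longrightarrow> inv_pm m (sum f A)"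
  by (induction A rule: infinite_finite_induct) (auto intro: inv_pm_add)

lemma inv_pm_cw:
  assumes "inv_pm m p" "\<And>k. F k 0 = 0" "\<And>T k. T \<in> Sym m \<Longrightarrow> k \<in> freqs m \<Longrightarrow> T k \<in> freqs m \<Longrightarrow> F (T k) = F k"
  shows "inv_pm m (cw F p)"
  unfolding inv_pm_def
proof (intro conjI ballI allI)
  show "keys (cw F p) \<subseteq> freqs m" using keys_cw[of F p] assms(1) by (auto simp: inv_pm_def)
  fix T k assume T: "T \<in> Sym m"
  then have e: "lookup p (T k) = lookup p k" using assms(1) by (auto simp: inv_pm_def)
  show "lookup (cw F p) (T k) = lookup (cw F p) k"
  proof (cases "lookup p k = 0")
    case True
    then show ?thesis using e assms(2) by (simp add: lookup_cw)
  next
    case False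
    then have "k \<in> keys p" "T k \<in> keys p" using e by (auto simp: in_keys_iff)
    then have "k \<in> freqs m" "T k \<in> freqs m" using assms(1) by (auto simp: inv_pm_def)
    then show ?thesis using e assms(2,3) T by (simp add: lookup_cw)
  qed
qed

lemma freqs_add: "k \<in> freqs m \<Longrightarrow> l \<in> freqs m \<Longrightarrow> k + l \<in> freqs m"
  by (simp add: freqs_def)

text \<open>Pulling back along an additive bijection is a ring homomorphism, as its effect on
  monomials shows, and invariant factors are fixed by it.\<close>

lemma inv_pm_mult:
  assumes "inv_pm m p" "inv_pm m q"
  shows "inv_pm m (p * q)"
  unfolding inv_pm_def
proof (intro conjI ballI allI)
  have "keys (p * q) \<subseteq> {k + l |k l. k \<in> keys p \<and> l \<in> keys q}" by (rule keys_mult)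
  then show "keys (p * q) \<subseteq> freqs m" using assms by (fastforce simp: inv_pm_def intro: freqs_add)
  fix T k assume T: "T \<in> Sym m"
  then have inj: "inj T" and surj: "surj T" and add: "\<And>k l. T (k + l) = T k + T l"
    by (auto simp: Sym_def bij_def)
  let ?M = "Poly_Mapping.map_key T :: pm \<Rightarrow> pm"
  have look: "lookup (?M r) k = lookup r (T k)" for r k
    by (simp add: map_key.rep_eq[OF inj])
  have M_sum: "?M (sum f A) = (\<Sum>i\<in>A. ?M (f i))" for f and A :: "'b set"
    by (induction A rule: infinite_finite_induct) (auto simp: map_key_plus[OF inj] inj)
  have single: "?M (single (T k) c) = single k c" for k c
    by (rule map_key_single[OF inj])
  have mult: "?M (single k c * single l d) = ?M (single k c) * ?M (single l d)" for k l c d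
    using surj by (metis mult_single single add surjD)
  have "?M (p * q) = ?M p * ?M q"
  proof -
    define s where "s = (\<lambda>k. single k (lookup p k))"
    define t where "t = (\<lambda>l. single l (lookup q l))"
    have pq: "p = sum s (keys p)" "q = sum t (keys q)" unfolding s_def t_def by (rule pm_monomials)+
    have "?M (p * q) = (\<Sum>k\<in>keys p. \<Sum>l\<in>keys q. ?M (s k) * ?M (t l))"
      by (subst pq(1), subst pq(2)) (simp only: sum_product M_sum mult s_def t_def)
    also have "\<dots> = ?M (sum s (keys p)) * ?M (sum t (keys q))" by (simp only: M_sum sum_product)
    finally show ?thesis using pq by simp
  qed
  moreover have "?M p = p" "?M q = q"
    using assms T by (auto intro!: poly_mapping_eqI simp: look inv_pm_def)
  ultimately have "?M (p * q) = p * q" by simp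
  then show "lookup (p * q) (T k) = lookup (p * q) k" using look[of "p * q" k] by simp
qed

lemma inv_pm_Lap: "inv_pm m p \<Longrightarrow> inv_pm m (Lap m p)"
  unfolding Lap_def by (rule inv_pm_cw) (auto simp: Sym_def)

text \<open>A reflection changes the sign of a single \<open>Kop\<close>, so invariance is read off
  from \<open>gp_Lap\<close> for twice the product, which is then halved.\<close>

lemma inv_pm_gp:
  assumes "inv_pm m p" "inv_pm m q"
  shows "inv_pm m (gp m p q)"
proof -
  have "inv_pm m (gp m p q + gp m p q)"
    unfolding gp_Lap by (intro inv_pm_diff inv_pm_mult inv_pm_Lap assms)
  then have h: "inv_pm m (cw (\<lambda>_ c. econst (1 / 2) * c) (gp m p q + gp m p q))"
    by (rule inv_pm_cw) auto
  have "cw (\<lambda>_ c. econst (1 / 2) * c) (gp m p q + gp m p q) = gp m p q"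
  proof (rule poly_mapping_eqI)
    fix k
    have "econst (1 / 2) * (c + c) = c" for c
    proof -
      have "econst (1 / 2) * (c + c) = (econst (1 / 2) + econst (1 / 2)) * c"
        by (simp only: distrib_left distrib_right)
      also have "econst (1 / 2) + econst (1 / 2) = econst (1 / 2 + 1 / 2)" by (simp only: econst_simps(1))
      finally show ?thesis by (simp add: econst_simps)
    qed
    then have half: "econst (1 / 2) * (c + c) = c" for c by blast
    have "lookup (cw (\<lambda>_ c. econst (1 / 2) * c) (gp m p q + gp m p q)) k
        = econst (1 / 2) * lookup (gp m p q + gp m p q) k"
      by (rule lookup_cw) simp
    then show "lookup (cw (\<lambda>_ c. econst (1 / 2) * c) (gp m p q + gp m p q)) k = lookup (gp m p q) k"
      unfolding lookup_add half .
  qed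
  then show ?thesis using h by simp
qed

lemma Sym_uminus: "uminus \<in> Sym m"
  by (auto simp: Sym_def sq_def freqs_def fun_eq_iff intro!: bijI' exI[of _ "- _"])

lemma Sym_permute: "\<pi> permutes {..<m} \<Longrightarrow> (\<lambda>k. k \<circ> \<pi>) \<in> Sym m"
proof -
  assume p: "\<pi> permutes {..<m}"
  have "bij (\<lambda>k::idx. k \<circ> \<pi>)"
    using p by (intro o_bij[of "\<lambda>k. k \<circ> inv \<pi>"]) (auto simp: fun_eq_iff permutes_inverses)
  moreover have "sq m (k \<circ> \<pi>) = sq m k" for k
    unfolding sq_def o_def by (rule sum.permute[OF p, of "\<lambda>i. (real_of_int (k i))\<^sup>2", unfolded o_def, symmetric])
  moreover have "k \<circ> \<pi> \<in> freqs m \<longleftrightarrow> k \<in> freqs m" for k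
    using p by (auto simp: freqs_def permutes_def)
  ultimately show ?thesis by (auto simp: Sym_def fun_eq_iff)
qed

lemma Sym_flip: "(\<lambda>k. k(i := - k i)) \<in> Sym m"
proof -
  have "bij (\<lambda>k::idx. k(i := - k i))"
    by (rule o_bij[of "\<lambda>k. k(i := - k i)"]) (auto simp: fun_eq_iff)
  moreover have "sq m (k(i := - k i)) = sq m k" for k
    unfolding sq_def by (rule sum.cong) auto
  moreover have "k(i := - k i) \<in> freqs m \<longleftrightarrow> k \<in> freqs m" for k
    by (auto simp: freqs_def)
  ultimately show ?thesis by (auto simp: Sym_def fun_eq_iff)
qed

definition unit_freq :: "nat \<Rightarrow> idx"
  where "unit_freq i = (\<lambda>j. if j = i then 1 else 0)"

lemma sq_unit_freq: "i < m \<Longrightarrow> sq m (unit_freq i) = 1"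
  by (simp add: sq_def unit_freq_def if_distrib[of "\<lambda>x. x\<^sup>2"] if_distrib[of real_of_int] cong: if_cong)

lemma sq_eq_1:
  assumes "k \<in> freqs m" "sq m k = 1"
  obtains i where "i < m" "k = unit_freq i \<or> k = - unit_freq i"
proof -
  have e: "(\<Sum>i<m. (k i)\<^sup>2) = 1"
    using assms(2) unfolding sq_def by (metis (mono_tags, lifting) of_int_1 of_int_eq_iff of_int_power of_int_sum sum.cong)
  then obtain i where i: "i < m" "k i \<noteq> 0" by (metis (no_types, lifting) lessThan_iff power_zero_numeral sum.neutral zero_neq_one)
  have "(\<Sum>j\<in>{..<m} - {i}. (k j)\<^sup>2) = 1 - (k i)\<^sup>2"
    using e i by (simp add: sum_diff1)
  moreover have "(k i)\<^sup>2 \<ge> 1" using i by (simp add: int_one_le_iff_zero_less)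
  moreover have nn: "(\<Sum>j\<in>{..<m} - {i}. (k j)\<^sup>2) \<ge> 0" by (simp add: sum_nonneg)
  ultimately have "(k i)\<^sup>2 = 1" "(\<Sum>j\<in>{..<m} - {i}. (k j)\<^sup>2) = 0" by linarith+
  then have ki: "k i = 1 \<or> k i = - 1" and less: "\<forall>j\<in>{..<m} - {i}. (k j)\<^sup>2 = 0"
    by (auto simp: power2_eq_1_iff sum_nonneg_eq_0_iff)
  have kj: "k j = (if j = i then k i else 0)" for j
    using less assms(1) by (cases "j < m") (auto simp: freqs_def)
  from ki
  consider "k i = 1" | "k i = - 1" by blast
  then have "k = unit_freq i \<or> k = - unit_freq i"
  proof cases
    case 1
    have "k j = (unit_freq i) j" for j using kj[of j] 1 by (cases "j = i") (auto simp: unit_freq_def)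
    then have "k = unit_freq i" by blast
    then show ?thesis ..
  next
    case 2
    have "k j = (- unit_freq i) j" for j using kj[of j] 2 by (cases "j = i") (auto simp: unit_freq_def)
    then have "k = - unit_freq i" by blast
    then show ?thesis ..
  qed
  then show ?thesis using that i by blast
qed

text \<open>The resonant frequencies form one orbit under reflections and permutations. An invariant
  series has the same coefficient on all of them, so one scalar per order can meet the solvability
  condition.\<close>

lemma inv_pm_unit:
  assumes p: "inv_pm m p" and k: "k \<in> freqs m" "sq m k = 1"
  shows "lookup p k = lookup p (unit_freq 0)"
proof -
  obtain i where i: "i < m" "k = unit_freq i \<or> k = - unit_freq i" using sq_eq_1[OF k] .
  have "lookup p (- unit_freq i) = lookup p (unit_freq i)"
    using p Sym_uminus by (auto simp: inv_pm_def)
  moreover have "lookup p (unit_freq 0 \<circ> Transposition.transpose 0 i) = lookup p (unit_freq 0)"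
    using p Sym_permute[of "Transposition.transpose 0 i" m] i
    by (force simp: inv_pm_def intro!: permutes_swap_id)
  moreover have "unit_freq 0 \<circ> Transposition.transpose 0 i = unit_freq i"
    by (auto simp: unit_freq_def fun_eq_iff Transposition.transpose_def)
  ultimately show ?thesis using i by auto
qed

section \<open>The linearised problem\<close>

text \<open>Any positive zero of \<open>Phi\<close> can serve as j^2 and any positive factor as
  \<open>C\<close>; the Bessel zero and the normalising constant of the eigenfunction are inserted
  at the end.\<close>

locale bif =
  fixes N m :: nat and j C :: real
  assumes N: "N \<ge> 1" and m: "m \<ge> 1" and j: "j > 0" and zero: "ev (Phi N) (j\<^sup>2) = 0" and C: "C > 0"
begin

definition U :: ent where "U = econst C * phi N (j\<^sup>2)"

text \<open>The derivative is taken in y = r^2, so the radial derivative of U at 1 is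
  \<open>2 * a\<close>.\<close>

definition a :: real where "a = ev (ediff U) 1"

definition qs :: real where "qs = q_star N"

definition L0 :: real where "L0 = j\<^sup>2 - qs"

definition th0 :: real where "th0 = 1 / sqrt L0"

lemma U_eq: "eD N U = - (econst (j\<^sup>2) * U)"
  by (simp add: U_def phi_eq[OF N] mult_ac)

lemma U_1: "ev U 1 = 0"
  using zero ev_phi[OF N, of "j\<^sup>2" 1] by (simp add: U_def)

lemma a_nz: "a \<noteq> 0"
proof -
  have "ev (ediff (Phi N)) (j\<^sup>2) \<noteq> 0" using Phi_simple_zeros[OF N _ zero] j by simp
  then show ?thesis using j C ev_ediff_phi[OF N, of "j\<^sup>2" 1] by (simp add: a_def U_def)
qed

lemma L0_pos: "L0 > 0"
  using q_star(4)[OF N _ zero] j by (simp add: L0_def qs_def)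

lemma th0_pos: "th0 > 0"
  using L0_pos by (simp add: th0_def)

lemma th0_L0: "th0\<^sup>2 * L0 = 1"
  using L0_pos by (simp add: th0_def power_divide)

text \<open>At the resonance \<open>x = 1\<close> the homogeneous solution satisfies the Robin condition; \<open>chi 1\<close> solves the
  equation with right-hand side \<open>phi N qs\<close> instead, so its multiple in \<open>msol\<close> measures the defect of
  solvability, which \<open>tsol\<close> returns.\<close>

definition chi :: "real \<Rightarrow> ent"
  where "chi x = (if x = 1 then ode_sol N 0 qs (phi N qs) else phi N (j\<^sup>2 - L0 * x))"

text \<open>Since x is an integer, three cases remain: at x = 0 the boundary value vanishes but the
  derivative does not, x = 1 is the resonance, and for x >= 2 the spectral parameter lies below the
  least Robin eigenvalue.\<close>

lemma robin_chi:
  assumes "x \<in> \<nat>"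
  shows "robin N (chi x) \<noteq> 0"
proof -
  obtain n :: nat where n: "x = real n" using assms by (auto simp: Nats_def)
  consider "n = 0" | "n = 1" | "n \<ge> 2" by linarith
  then show ?thesis
  proof cases
    case 1
    have "ev (phi N (j\<^sup>2)) 1 = 0" using zero ev_phi[OF N, of "j\<^sup>2" 1] by simp
    moreover have "ev (ediff (phi N (j\<^sup>2))) 1 \<noteq> 0"
      using a_nz by (auto simp: a_def U_def)
    ultimately show ?thesis using 1 n by (simp add: chi_def robin_def)
  next
    case 2
    have "robin N (ode_sol N 0 qs (phi N qs)) \<noteq> 0"
      using q_star[OF N] ode_sol_eq[OF N, of 0 qs "phi N qs"]
      by (intro robin_resonance[OF N, of qs]) (auto simp: qs_def)
    then show ?thesis using 2 n by (simp add: chi_def)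
  next
    case 3
    then have "L0 * 2 \<le> L0 * real n" using L0_pos by (intro mult_left_mono) auto
    then have "j\<^sup>2 - L0 * real n < qs" using L0_pos by (simp add: L0_def)
    then show ?thesis using 3 n q_star(3)[OF N] by (simp add: chi_def qs_def)
  qed
qed

lemma sq_Nats: "sq m k \<in> \<nat>"
proof -
  have "sq m k = of_int (\<Sum>i<m. (k i)\<^sup>2)" by (simp add: sq_def)
  also have "\<dots> = real (nat (\<Sum>i<m. (k i)\<^sup>2))" by (simp add: sum_nonneg)
  finally show ?thesis by simp
qed

text \<open>Shooting from the axis: the particular solution starts with value 0, and a multiple of
  \<open>chi\<close> corrects its Robin value.\<close>

definition msol_coeff :: "real \<Rightarrow> ent \<Rightarrow> real \<Rightarrow> real"
  where "msol_coeff x f b = (b - robin N (ode_sol N 0 (j\<^sup>2 - L0 * x) f)) / robin N (chi x)"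

definition msol :: "real \<Rightarrow> ent \<Rightarrow> real \<Rightarrow> ent"
  where "msol x f b = ode_sol N 0 (j\<^sup>2 - L0 * x) f + econst (msol_coeff x f b) * chi x"

lemma chi_eq: "eD N (chi x) + econst (j\<^sup>2 - L0 * x) * chi x = (if x = 1 then phi N qs else 0)"
proof (cases "x = 1")
  case True
  have "j\<^sup>2 - L0 * x = qs" using True by (simp add: L0_def)
  then show ?thesis using True ode_sol_eq[OF N, of 0 qs "phi N qs"] by (simp add: chi_def)
next
  case False
  then show ?thesis by (simp add: chi_def phi_eq[OF N])
qed

lemma msol_eq: "eD N (msol x f b) + econst (j\<^sup>2 - L0 * x) * msol x f b
    = f + (if x = 1 then econst (msol_coeff x f b) * phi N qs else 0)"
proof -
  define P where "P = ode_sol N 0 (j\<^sup>2 - L0 * x) f"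
  define c where "c = msol_coeff x f b"
  have "eD N (P + econst c * chi x) + econst (j\<^sup>2 - L0 * x) * (P + econst c * chi x)
     = (eD N P + econst (j\<^sup>2 - L0 * x) * P) + econst c * (eD N (chi x) + econst (j\<^sup>2 - L0 * x) * chi x)"
    by (simp add: algebra_simps)
  also have "eD N P + econst (j\<^sup>2 - L0 * x) * P = f" unfolding P_def by (rule ode_sol_eq[OF N])
  finally show ?thesis unfolding chi_eq by (simp add: msol_def P_def c_def)
qed

lemma robin_msol: "x \<in> \<nat> \<Longrightarrow> robin N (msol x f b) = b"
  by (simp add: msol_def msol_coeff_def robin_chi)

lemma msol_0 [simp]: "msol x 0 0 = 0" "msol_coeff x 0 0 = 0"
  using ode_sol_0_0[OF N] by (auto simp: msol_def msol_coeff_def econst_simps)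

text \<open>Gronwall's inequality bounds the particular solution and with it everything else. The
  constant depends on x, so this serves for finitely many x only.\<close>

lemma msol_bound_fixed:
  assumes x: "x \<in> \<nat>"
  shows "\<exists>K\<ge>0. \<forall>f b. nrm (msol x f b) + nrm (eD N (msol x f b)) + \<bar>msol_coeff x f b\<bar> \<le> K * (nrm f + \<bar>b\<bar>)"
proof -
  define q where "q = j\<^sup>2 - L0 * x"
  define A where "A = exp (2 + \<bar>q\<bar>)"
  define B where "B = A + (1 + \<bar>q\<bar> * A)"
  define D where "D = (1 + (1 + real N) * B) / \<bar>robin N (chi x)\<bar>"
  define E where "E = nrm (chi x) + nrm (eD N (chi x))"
  have nn: "A \<ge> 0" "B \<ge> 0" "D \<ge> 0" "E \<ge> 0" by (auto simp: A_def B_def D_def E_def)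
  have "nrm (msol x f b) + nrm (eD N (msol x f b)) + \<bar>msol_coeff x f b\<bar> \<le> (B + D * (E + 1)) * (nrm f + \<bar>b\<bar>)" for f b
  proof -
    define P where "P = ode_sol N 0 q f"
    define c where "c = msol_coeff x f b"
    have P1: "nrm P \<le> A * nrm f"
      unfolding P_def A_def by (rule ode_bound[OF N ode_sol_eq[OF N] ode_sol_0[OF N]])
    have "eD N P = f - econst q * P" using ode_sol_eq[OF N, of 0 q f] by (simp add: P_def eq_diff_eq)
    then have "nrm (eD N P) \<le> nrm f + nrm (econst q * P)"
      using nrm_add[of f "- (econst q * P)"] by simp
    also have "nrm (econst q * P) \<le> \<bar>q\<bar> * (A * nrm f)"
      using nrm_scale[of q P] P1 by (meson abs_ge_zero mult_left_mono order_trans)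
    finally have P2: "nrm P + nrm (eD N P) \<le> B * nrm f" using P1 by (simp add: B_def algebra_simps)
    have "\<bar>b - robin N P\<bar> \<le> \<bar>b\<bar> + (1 + real N) * (B * nrm f)"
      using robin_bound[OF N, of P] mult_left_mono[OF P2, of "1 + real N"]
        abs_triangle_ineq4[of b "robin N P"] by linarith
    also have "\<dots> \<le> (1 + (1 + real N) * B) * (nrm f + \<bar>b\<bar>)"
      using nn by (simp add: algebra_simps)
    finally have c1: "\<bar>c\<bar> \<le> D * (nrm f + \<bar>b\<bar>)"
      unfolding c_def msol_coeff_def D_def q_def[symmetric] P_def[symmetric]
      by (simp add: abs_divide divide_right_mono)
    have g: "msol x f b = P + econst c * chi x" by (simp add: msol_def P_def c_def q_def)
    have "nrm (msol x f b) \<le> nrm P + \<bar>c\<bar> * nrm (chi x)"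
      unfolding g using nrm_add[of P "econst c * chi x"] nrm_scale[of c "chi x"] by linarith
    moreover have "nrm (eD N (msol x f b)) \<le> nrm (eD N P) + \<bar>c\<bar> * nrm (eD N (chi x))"
      unfolding g using nrm_add[of "eD N P" "econst c * eD N (chi x)"] nrm_scale[of c "eD N (chi x)"] by simp
    ultimately have "nrm (msol x f b) + nrm (eD N (msol x f b)) + \<bar>c\<bar> \<le> B * nrm f + \<bar>c\<bar> * (E + 1)"
      using P2 by (simp add: E_def algebra_simps)
    also have "\<dots> \<le> B * (nrm f + \<bar>b\<bar>) + D * (nrm f + \<bar>b\<bar>) * (E + 1)"
      using nn c1 by (intro add_mono mult_left_mono mult_right_mono) auto
    finally show ?thesis by (simp add: c_def algebra_simps)
  qed
  then show ?thesis using nn by (intro exI[of _ "B + D * (E + 1)"]) auto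
qed

text \<open>For large x the operator is D - K^2 with K^2 = L0 x - j^2 comparable to |k|^2, so
  coercivity itself yields the two powers of the weight, uniformly in k.\<close>

lemma msol_bound_large:
  assumes k: "L0 * sq m k \<ge> 2 * (j\<^sup>2 + (real N)\<^sup>2)"
  shows "(1 + l1 m k)\<^sup>2 * nrm (msol (sq m k) f b) + nrm (eD N (msol (sq m k) f b))
    \<le> (4 * (real m + 1) / L0 + 2) * (2 + 2 * sqrt L0) * (nrm f + (1 + l1 m k) * \<bar>b\<bar>)"
proof -
  define x where "x = sq m k"
  define \<kappa> where "\<kappa> = 1 + l1 m k"
  define g where "g = msol x f b"
  define K where "K = sqrt (L0 * x - j\<^sup>2)"
  have \<kappa>: "\<kappa> \<ge> 1" by (simp add: \<kappa>_def)
  have Lx: "L0 * x - j\<^sup>2 \<ge> (real N)\<^sup>2" "L0 * x - j\<^sup>2 \<ge> L0 * x / 2"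
    using k zero_le_power2[of j] zero_le_power2[of "real N"] unfolding x_def by argo+
  have K2: "K\<^sup>2 = L0 * x - j\<^sup>2" unfolding K_def
    by (rule real_sqrt_pow2) (use Lx(1) zero_le_power2[of "real N"] in linarith)
  have K: "K \<ge> real N" unfolding K_def using Lx(1) real_le_rsqrt by blast
  have "j\<^sup>2 > 0" using j by simp
  moreover have "qs \<ge> 0" using q_star(1)[OF N] by (simp add: qs_def)
  ultimately have "L0 \<le> j\<^sup>2" by (simp add: L0_def)
  then have "L0 * 2 \<le> L0 * x" using k zero_le_power2[of "real N"] unfolding x_def by argo
  then have x2: "x \<ge> 2" using L0_pos by simp
  have eq: "eD N g - econst (K\<^sup>2) * g = f"
    using msol_eq[of x f b] x2 by (simp add: g_def K2 econst_simps algebra_simps)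
  have "robin N g = b" unfolding g_def x_def by (rule robin_msol[OF sq_Nats])
  from robin_coercive[OF N K eq this] have main: "K\<^sup>2 * nrm g \<le> nrm f + 2 * K * \<bar>b\<bar>" .
  have "K \<le> sqrt (L0 * x)" unfolding K_def using j by (intro real_sqrt_le_mono) auto
  also have "\<dots> \<le> sqrt (L0 * (l1 m k)\<^sup>2)"
    using L0_pos sq_le_l1[of m k] by (intro real_sqrt_le_mono mult_left_mono) (auto simp: x_def)
  also have "\<dots> \<le> sqrt L0 * \<kappa>" by (simp add: real_sqrt_mult \<kappa>_def L0_pos less_imp_le)
  finally have "2 * K * \<bar>b\<bar> \<le> 2 * (sqrt L0 * \<kappa>) * \<bar>b\<bar>" by (intro mult_right_mono) auto
  then have main2: "K\<^sup>2 * nrm g \<le> nrm f + 2 * sqrt L0 * (\<kappa> * \<bar>b\<bar>)" using main by (simp add: mult_ac)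
  also have "\<dots> \<le> (2 + 2 * sqrt L0) * (nrm f + \<kappa> * \<bar>b\<bar>)"
    using \<kappa> L0_pos by (simp add: algebra_simps)
  finally have m3: "K\<^sup>2 * nrm g \<le> (2 + 2 * sqrt L0) * (nrm f + \<kappa> * \<bar>b\<bar>)" .
  define R where "R = (2 + 2 * sqrt L0) * (nrm f + \<kappa> * \<bar>b\<bar>)"
  have "\<kappa>\<^sup>2 \<le> 2 + 2 * (l1 m k)\<^sup>2"
    using sum_squares_bound[of 1 "l1 m k"] by (simp add: \<kappa>_def power2_sum)
  also have "\<dots> \<le> x + 2 * (real m * x)" using l1_squared_le[of m k] x2 by (simp add: x_def)
  also have "\<dots> \<le> 2 * (real m + 1) * x" using x2 by (simp add: algebra_simps)
  also have "\<dots> = 4 * (real m + 1) / L0 * (L0 * x / 2)" using L0_pos by simp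
  also have "\<dots> \<le> 4 * (real m + 1) / L0 * K\<^sup>2"
    unfolding K2 using Lx L0_pos by (intro mult_left_mono) auto
  finally have "\<kappa>\<^sup>2 * nrm g \<le> 4 * (real m + 1) / L0 * K\<^sup>2 * nrm g" by (rule mult_right_mono) simp
  also have "\<dots> = 4 * (real m + 1) / L0 * (K\<^sup>2 * nrm g)" by simp
  also have "\<dots> \<le> 4 * (real m + 1) / L0 * R"
    using m3 L0_pos by (intro mult_left_mono) (auto simp: R_def)
  finally have p1: "\<kappa>\<^sup>2 * nrm g \<le> 4 * (real m + 1) / L0 * R" .
  have "eD N g = f + econst (K\<^sup>2) * g" using eq by (simp add: diff_eq_eq)
  then have "nrm (eD N g) \<le> nrm f + K\<^sup>2 * nrm g"
    using nrm_add[of f "econst (K\<^sup>2) * g"] nrm_scale[of "K\<^sup>2" g] by simp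
  moreover have "nrm f \<le> R"
  proof -
    have "1 * nrm f \<le> (2 + 2 * sqrt L0) * (nrm f + \<kappa> * \<bar>b\<bar>)"
      using \<kappa> L0_pos by (intro mult_mono) auto
    then show ?thesis by (simp add: R_def)
  qed
  ultimately have "nrm (eD N g) \<le> 2 * R" using m3 by (simp add: R_def)
  then have "\<kappa>\<^sup>2 * nrm g + nrm (eD N g) \<le> (4 * (real m + 1) / L0 + 2) * R"
    using p1 by (simp add: algebra_simps)
  then show ?thesis by (simp add: R_def \<kappa>_def g_def x_def mult_ac)
qed

lemma msol_bound:
  "\<exists>K\<ge>0. \<forall>k f b. (1 + l1 m k)\<^sup>2 * nrm (msol (sq m k) f b) + nrm (eD N (msol (sq m k) f b))
     + (if sq m k = 1 then \<bar>msol_coeff 1 f b\<bar> else 0) \<le> K * (nrm f + (1 + l1 m k) * \<bar>b\<bar>)"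
proof -
  \<comment> \<open>The additional 1 keeps the resonance x = 1 among the low modes, so the
    coefficient \<open>msol_coeff\<close> need not be estimated for the others.\<close>
  obtain M :: nat where M: "real M \<ge> 2 * (j\<^sup>2 + (real N)\<^sup>2) / L0 + 1" using real_arch_simple by blast
  obtain c where c: "\<And>n::nat. c n \<ge> 0"
    "\<And>n f b. nrm (msol (real n) f b) + nrm (eD N (msol (real n) f b)) + \<bar>msol_coeff (real n) f b\<bar> \<le> c n * (nrm f + \<bar>b\<bar>)"
    using msol_bound_fixed[OF of_nat_in_Nats] by metis
  define K1 where "K1 = (4 * (real m + 1) / L0 + 2) * (2 + 2 * sqrt L0)"
  define K2 where "K2 = (1 + real M)\<^sup>2 * (\<Sum>n\<le>M. c n)"
  have nn: "K1 \<ge> 0" "K2 \<ge> 0" using L0_pos c(1) by (auto simp: K1_def K2_def sum_nonneg)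
  have "(1 + l1 m k)\<^sup>2 * nrm (msol (sq m k) f b) + nrm (eD N (msol (sq m k) f b))
     + (if sq m k = 1 then \<bar>msol_coeff 1 f b\<bar> else 0) \<le> (K1 + K2) * (nrm f + (1 + l1 m k) * \<bar>b\<bar>)" for k f b
  proof -
    obtain n :: nat where n: "sq m k = real n" using sq_Nats by (auto simp: Nats_def)
    define R where "R = nrm f + (1 + l1 m k) * \<bar>b\<bar>"
    have R: "R \<ge> 0" by (simp add: R_def)
    show ?thesis
    proof (cases "n \<le> M")
      case True
      have "l1 m k \<le> real M" using l1_le_sq[of m k] n True by simp
      then have \<kappa>: "(1 + l1 m k)\<^sup>2 \<le> (1 + real M)\<^sup>2" by (intro power_mono) auto
      define g where "g = msol (sq m k) f b"
      have "c n \<le> (\<Sum>n\<le>M. c n)" using True c(1) by (intro member_le_sum) auto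
      moreover have "nrm f + \<bar>b\<bar> \<le> R" by (simp add: R_def mult_le_cancel_right1)
      ultimately have "c n * (nrm f + \<bar>b\<bar>) \<le> (\<Sum>n\<le>M. c n) * R" using c(1) by (intro mult_mono sum_nonneg) auto
      then have le: "nrm g + nrm (eD N g) + \<bar>msol_coeff (real n) f b\<bar> \<le> (\<Sum>n\<le>M. c n) * R"
        using c(2)[of n f b] n by (simp add: g_def)
      have "(1 + l1 m k)\<^sup>2 * nrm g \<le> (1 + real M)\<^sup>2 * nrm g" by (rule mult_right_mono[OF \<kappa>]) simp
      moreover have one: "1 \<le> (1 + real M)\<^sup>2" by simp
      have "1 * nrm (eD N g) \<le> (1 + real M)\<^sup>2 * nrm (eD N g)"
        "1 * \<bar>msol_coeff (real n) f b\<bar> \<le> (1 + real M)\<^sup>2 * \<bar>msol_coeff (real n) f b\<bar>"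
        by (intro mult_right_mono one; simp)+
      moreover have "(if sq m k = 1 then \<bar>msol_coeff 1 f b\<bar> else 0) \<le> \<bar>msol_coeff (real n) f b\<bar>"
        using n by auto
      ultimately have "(1 + l1 m k)\<^sup>2 * nrm g + nrm (eD N g) + (if sq m k = 1 then \<bar>msol_coeff 1 f b\<bar> else 0)
         \<le> (1 + real M)\<^sup>2 * (nrm g + nrm (eD N g) + \<bar>msol_coeff (real n) f b\<bar>)"
        by (simp only: distrib_left mult_1)
      also have "\<dots> \<le> (1 + real M)\<^sup>2 * ((\<Sum>n\<le>M. c n) * R)" using le by (intro mult_left_mono) auto
      also have "\<dots> \<le> (K1 + K2) * R" using nn R by (simp add: K2_def algebra_simps)
      finally show ?thesis by (simp add: g_def R_def)
    next
      case False
      have "j\<^sup>2 > 0" using j by simp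
      then have "2 * (j\<^sup>2 + (real N)\<^sup>2) / L0 > 0" using L0_pos by (intro divide_pos_pos) (auto intro: add_pos_nonneg)
      then have n1: "real n \<noteq> 1" "real n \<ge> 2 * (j\<^sup>2 + (real N)\<^sup>2) / L0" using M False by auto
      then have "L0 * sq m k \<ge> 2 * (j\<^sup>2 + (real N)\<^sup>2)" using L0_pos by (simp add: n divide_le_eq mult.commute)
      from msol_bound_large[OF this, of f b]
      have "(1 + l1 m k)\<^sup>2 * nrm (msol (sq m k) f b) + nrm (eD N (msol (sq m k) f b)) \<le> K1 * R"
        by (simp add: K1_def R_def)
      also have "\<dots> \<le> (K1 + K2) * R" using nn R by (intro mult_right_mono) auto
      finally show ?thesis using n1 n by (simp add: R_def)
    qed
  qed
  then show ?thesis using nn by (intro exI[of _ "K1 + K2"]) auto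
qed

text \<open>Boundary data are kept as a \<open>pm\<close> and evaluated at y = 1, so that interior
  and boundary terms live in one algebra.\<close>

definition solG :: "pm \<Rightarrow> pm \<Rightarrow> pm"
  where "solG f b = (\<Sum>k\<in>keys f \<union> keys b. single k (msol (sq m k) (lookup f k) (ev (lookup b k) 1)))"

lemma lookup_solG: "lookup (solG f b) k = msol (sq m k) (lookup f k) (ev (lookup b k) 1)"
proof -
  have "lookup (solG f b) k
     = (\<Sum>l\<in>keys f \<union> keys b. if l = k then msol (sq m l) (lookup f l) (ev (lookup b l) 1) else 0)"
    by (auto simp: solG_def lookup_sum lookup_single when_def intro!: sum.cong)
  also have "\<dots> = msol (sq m k) (lookup f k) (ev (lookup b k) 1)"
    by (auto simp: in_keys_iff)
  finally show ?thesis .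
qed

lemma keys_solG: "keys (solG f b) \<subseteq> keys f \<union> keys b"
  by (auto simp: in_keys_iff lookup_solG)

definition Dop :: "pm \<Rightarrow> pm" where "Dop = cw (\<lambda>_. eD N)"

lemma lookup_Dop: "lookup (Dop p) k = eD N (lookup p k)"
  by (simp add: Dop_def lookup_cw)

text \<open>Two derivatives in x, or the radial Laplacian; the separate y-derivatives are recovered
  from these by \<open>nrm_ediff\<close>, \<open>nrm_X_ediff2\<close> and
  \<open>landau\<close>.\<close>

definition fullW :: "pm \<Rightarrow> real"
  where "fullW p = Wn m 2 p + Wn m 0 (Dop p)"

lemma fullW_nonneg [simp]: "fullW p \<ge> 0"
  by (simp add: fullW_def)

lemma fullW_0 [simp]: "fullW 0 = 0"
  by (simp add: fullW_def Dop_def)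

lemma fullW_superset:
  assumes "finite A" "keys p \<subseteq> A"
  shows "fullW p = (\<Sum>k\<in>A. exp (l1 m k) * ((1 + l1 m k)\<^sup>2 * nrm (lookup p k) + nrm (eD N (lookup p k))))"
proof -
  have "keys (Dop p) \<subseteq> A" using assms keys_cw[of _ p] by (auto simp: Dop_def)
  then show ?thesis unfolding fullW_def
    by (simp add: Wn_superset[OF assms(1)] assms lookup_Dop wt_def sum.distrib[symmetric] algebra_simps)
qed

lemma Wn_cw_full:
  assumes "\<And>k. F k 0 = 0"
    and "\<And>k c. (1 + l1 m k) ^ r * nrm (F k c) \<le> K * ((1 + l1 m k)\<^sup>2 * nrm c + nrm (eD N c))"
  shows "Wn m r (cw F p) \<le> K * fullW p"
proof -
  have "Wn m r (cw F p) = (\<Sum>k\<in>keys p. wt m r k * nrm (F k (lookup p k)))"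
    using Wn_superset[OF _ keys_cw, of p m r F] by (simp add: lookup_cw assms(1))
  also have "\<dots> \<le> (\<Sum>k\<in>keys p. K * (exp (l1 m k) * ((1 + l1 m k)\<^sup>2 * nrm (lookup p k) + nrm (eD N (lookup p k)))))"
  proof (rule sum_mono)
    fix k
    from mult_left_mono[OF assms(2)[of k "lookup p k"], of "exp (l1 m k)"]
    show "wt m r k * nrm (F k (lookup p k))
       \<le> K * (exp (l1 m k) * ((1 + l1 m k)\<^sup>2 * nrm (lookup p k) + nrm (eD N (lookup p k))))"
      by (simp add: wt_def mult_ac)
  qed
  also have "\<dots> = K * fullW p" by (simp add: fullW_superset[of "keys p"] sum_distrib_left)
  finally show ?thesis .
qed

definition tsol :: "pm \<Rightarrow> pm \<Rightarrow> real"
  where "tsol f b = msol_coeff 1 (lookup f (unit_freq 0)) (ev (lookup b (unit_freq 0)) 1)"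

text \<open>Interior data without weight, boundary data with one, the solution with two: this is the
  gain of derivatives that lets the recursion close.\<close>

lemma sol_bound: "\<exists>K\<ge>0. \<forall>f b. fullW (solG f b) + \<bar>tsol f b\<bar> \<le> K * (Wn m 0 f + Wn m 1 b)"
proof -
  obtain K where K: "K \<ge> 0" "\<And>k f b. (1 + l1 m k)\<^sup>2 * nrm (msol (sq m k) f b) + nrm (eD N (msol (sq m k) f b))
     + (if sq m k = 1 then \<bar>msol_coeff 1 f b\<bar> else 0) \<le> K * (nrm f + (1 + l1 m k) * \<bar>b\<bar>)"
    using msol_bound by blast
  have "fullW (solG f b) + \<bar>tsol f b\<bar> \<le> K * (Wn m 0 f + Wn m 1 b)" for f b
  proof -
    define u where "u = unit_freq 0"
    define A where "A = insert u (keys f \<union> keys b)"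
    have A: "finite A" "keys f \<subseteq> A" "keys b \<subseteq> A" "keys (solG f b) \<subseteq> A" "u \<in> A"
      using keys_solG[of f b] by (auto simp: A_def)
    define t where "t k = (if k = u then \<bar>tsol f b\<bar> else 0)" for k
    have "\<bar>tsol f b\<bar> = (\<Sum>k\<in>A. t k)" using A by (simp add: t_def)
    then have "fullW (solG f b) + \<bar>tsol f b\<bar>
      = (\<Sum>k\<in>A. exp (l1 m k) * ((1 + l1 m k)\<^sup>2 * nrm (lookup (solG f b) k) + nrm (eD N (lookup (solG f b) k))) + t k)"
      by (simp add: fullW_superset[OF A(1,4)] sum.distrib)
    also have "\<dots> \<le> (\<Sum>k\<in>A. K * (wt m 0 k * nrm (lookup f k) + wt m 1 k * nrm (lookup b k)))"
    proof (rule sum_mono)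
      fix k
      define g where "g = msol (sq m k) (lookup f k) (ev (lookup b k) 1)"
      define c where "c = (if sq m k = 1 then \<bar>msol_coeff 1 (lookup f k) (ev (lookup b k) 1)\<bar> else 0)"
      have "t k \<le> c" using sq_unit_freq[of 0 m] m by (auto simp: t_def c_def tsol_def u_def)
      also have "c \<le> exp (l1 m k) * c" by (simp add: c_def mult_le_cancel_right1)
      finally have "exp (l1 m k) * ((1 + l1 m k)\<^sup>2 * nrm g + nrm (eD N g)) + t k
          \<le> exp (l1 m k) * ((1 + l1 m k)\<^sup>2 * nrm g + nrm (eD N g) + c)"
        by (simp add: algebra_simps)
      also have "\<dots> \<le> exp (l1 m k) * (K * (nrm (lookup f k) + (1 + l1 m k) * \<bar>ev (lookup b k) 1\<bar>))"
        using K(2)[of k "lookup f k" "ev (lookup b k) 1"] by (intro mult_left_mono) (auto simp: g_def c_def)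
      also have "\<dots> \<le> exp (l1 m k) * (K * (nrm (lookup f k) + (1 + l1 m k) * nrm (lookup b k)))"
        using K(1) ev_le_nrm[of 1 "lookup b k"] by (intro mult_left_mono add_mono) auto
      finally show "exp (l1 m k) * ((1 + l1 m k)\<^sup>2 * nrm (lookup (solG f b) k) + nrm (eD N (lookup (solG f b) k))) + t k
          \<le> K * (wt m 0 k * nrm (lookup f k) + wt m 1 k * nrm (lookup b k))"
        by (simp add: lookup_solG g_def wt_def algebra_simps)
    qed
    also have "\<dots> = K * (Wn m 0 f + Wn m 1 b)"
      by (simp add: Wn_superset[OF A(1,2)] Wn_superset[OF A(1,3)] sum.distrib sum_distrib_left[symmetric])
    finally show ?thesis .
  qed
  then show ?thesis using K(1) by blast
qed

lemma inv_solG: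
  assumes "inv_pm m f" "inv_pm m b"
  shows "inv_pm m (solG f b)"
  using assms keys_solG[of f b] by (auto simp: inv_pm_def lookup_solG Sym_def)

end

unbundle no vec_syntax and fps_syntax

section \<open>The nonlinear problem as a power series recursion\<close>

text \<open>Formal power series in the parameter s; \<open>fps_X\<close> stands for s.\<close>

type_synonym ser = "pm fps"

definition smap :: "(pm \<Rightarrow> pm) \<Rightarrow> ser \<Rightarrow> ser"
  where "smap F A = Abs_fps (\<lambda>n. F (A $ n))"

definition se :: "ent \<Rightarrow> ser"
  where "se u = fps_const (single 0 u)"

abbreviation sc :: "real \<Rightarrow> ser"
  where "sc r \<equiv> se (econst r)"

lemma smap_nth [simp]: "smap F A $ n = F (A $ n)"
  by (simp add: smap_def)

lemma se_mult: "se (u * v) = se u * se v"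
  by (simp add: se_def mult_single)

lemma se_1: "se 1 = 1"
  by (simp add: se_def)

lemma se_numeral: "numeral n = sc (numeral n)"
proof -
  have "of_nat k = sc (of_nat k)" for k
    by (induction k) (auto simp: se_def econst_simps single_add simp flip: fps_const_add)
  from this[of "numeral n"] show ?thesis by simp
qed

definition sgp :: "nat \<Rightarrow> ser \<Rightarrow> ser \<Rightarrow> ser"
  where "sgp m A B = - (\<Sum>i<m. smap (Kop i) A * smap (Kop i) B)"

text \<open>\<open>S * q1\<close> and \<open>S * q2\<close> are what is left of the interior equation and of the boundary condition
  after their linear parts, see \<open>q1_identity\<close> and \<open>q2_identity\<close> below.  Here \<open>S = s\<close>, \<open>T = \<theta>\<^sup>2\<close>, \<open>q = j\<^sup>2\<close>;
  \<open>D\<close> is the radial Laplacian, \<open>R = y \<partial>\<^sub>y\<close>, \<open>RR = y\<^sup>2 \<partial>\<^sub>y\<^sup>2\<close>, \<open>L\<close> the Laplacian in \<open>x\<close>, \<open>g = \<bar>\<nabla>z\<bar>\<^sup>2\<close> and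
  \<open>gY = \<nabla>z \<cdot> \<nabla>RY\<close>.\<close>

definition q1 :: "'a::comm_ring_1 \<Rightarrow> 'a \<Rightarrow> 'a \<Rightarrow> 'a \<Rightarrow> 'a \<Rightarrow> 'a \<Rightarrow> 'a \<Rightarrow> 'a \<Rightarrow> 'a \<Rightarrow> 'a \<Rightarrow> 'a \<Rightarrow> 'a \<Rightarrow> 'a \<Rightarrow> 'a \<Rightarrow> 'a \<Rightarrow> 'a \<Rightarrow> 'a"
  where "q1 S T q u Du Ru RRu z Lz g Y DY RY RRY LY gY =
    T * ((6 * z^2 + 4 * S * z^3 + S^2 * z^4) * Du + (4 * z + 6 * S * z^2 + 4 * S^2 * z^3 + S^3 * z^4) * DY
      + q * z^2 * u + q * (2 * z + S * z^2) * Y)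
    + (2 * z + S * z^2) * LY + 4 * (1 + S * z) * gY + 4 * g * (RRu + S * RRY)
    + 2 * (z * Lz + g) * Ru + 2 * (Lz * (1 + S * z) + S * g) * RY"

definition q2 :: "'a::comm_ring_1 \<Rightarrow> 'a \<Rightarrow> 'a \<Rightarrow> 'a \<Rightarrow> 'a \<Rightarrow> 'a \<Rightarrow> 'a"
  where "q2 S T a z e g =
    T * (2 * a * z * e + (a * z + e + S * e * z)^2
      + (2 * z + S * z^2) * (2 * a * (a * z + e + S * e * z) + S * (a * z + e + S * e * z)^2))
    + g * (a + S * e)^2"

section \<open>Causality, symmetry and majorants of formal series\<close>

definition agr :: "nat \<Rightarrow> ser \<Rightarrow> ser \<Rightarrow> bool"
  where "agr n A B \<longleftrightarrow> (\<forall>i<n. A $ i = B $ i)"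

lemma agr_refl [simp]: "agr n A A"
  by (simp add: agr_def)

lemma agr_add: "agr n A B \<Longrightarrow> agr n A' B' \<Longrightarrow> agr n (A + A') (B + B')"
  by (simp add: agr_def)

lemma agr_uminus: "agr n A B \<Longrightarrow> agr n (- A) (- B)"
  by (simp add: agr_def)

lemma agr_mult: "agr n A B \<Longrightarrow> agr n A' B' \<Longrightarrow> agr n (A * A') (B * B')"
  by (simp add: agr_def fps_mult_nth)

lemma agr_power: "agr n A B \<Longrightarrow> agr n (A ^ k) (B ^ k)"
  by (induction k) (auto intro: agr_mult)

lemma agr_smap: "agr n A B \<Longrightarrow> agr n (smap F A) (smap F B)"
  by (simp add: agr_def)

lemma agr_sum: "(\<And>i. i \<in> I \<Longrightarrow> agr n (f i) (g i)) \<Longrightarrow> agr n (sum f I) (sum g I)"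
  by (induction I rule: infinite_finite_induct) (auto intro: agr_add)

lemma agr_sgp: "agr n A B \<Longrightarrow> agr n A' B' \<Longrightarrow> agr n (sgp m A A') (sgp m B B')"
  unfolding sgp_def by (intro agr_uminus agr_sum agr_mult agr_smap)

lemma agr_X: "agr n A B \<Longrightarrow> agr (Suc n) (fps_X * A) (fps_X * B)"
  by (auto simp: agr_def)

text \<open>Both factors start at order 1, so order n of the product only involves orders 1 to n - 1
  of each; agreement below n thus gains one order.\<close>

lemma agr_mult_Suc:
  assumes "agr n A B" "agr n A' B'" "A $ 0 = 0" "B $ 0 = 0" "A' $ 0 = 0" "B' $ 0 = 0"
  shows "agr (Suc n) (A * A') (B * B')"
proof -
  have "A $ l * A' $ (i - l) = B $ l * B' $ (i - l)" if "i < Suc n" "l \<le> i" for i l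
    using assms that by (cases "l = 0"; cases "l = i") (auto simp: agr_def)
  then show ?thesis by (auto simp: agr_def fps_mult_nth intro!: sum.cong)
qed

definition sinv :: "nat \<Rightarrow> ser \<Rightarrow> bool"
  where "sinv m A \<longleftrightarrow> (\<forall>n. inv_pm m (A $ n))"

lemma sinv_add: "sinv m A \<Longrightarrow> sinv m B \<Longrightarrow> sinv m (A + B)"
  by (simp add: sinv_def inv_pm_add)

lemma sinv_uminus: "sinv m A \<Longrightarrow> sinv m (- A)"
  by (simp add: sinv_def inv_pm_minus)

lemma sinv_mult: "sinv m A \<Longrightarrow> sinv m B \<Longrightarrow> sinv m (A * B)"
  by (auto simp: sinv_def fps_mult_nth intro!: inv_pm_sum inv_pm_mult)

lemma inv_pm_single_0: "inv_pm m (single 0 c)"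
proof -
  have "T 0 = 0" if "T \<in> Sym m" for T
  proof -
    have "T (0 + 0) = T 0 + T 0" using that unfolding Sym_def by blast
    then show ?thesis unfolding add_0_left by (simp only: add_cancel_right_right)
  qed
  moreover have "T k = T 0 \<longleftrightarrow> k = 0" if "T \<in> Sym m" for T k
    using that by (auto simp: Sym_def bij_def inj_eq)
  ultimately show ?thesis
    unfolding inv_pm_def by (auto simp: freqs_def lookup_single when_def)
qed

lemma sinv_const: "inv_pm m p \<Longrightarrow> sinv m (fps_const p)"
  by (simp add: sinv_def)

lemma sinv_se: "sinv m (se u)"
  unfolding se_def by (intro sinv_const inv_pm_single_0)

lemma sinv_1: "sinv m 1"
  using sinv_se[of m 1] by (simp add: se_1)

lemma sinv_numeral: "sinv m (numeral n)"
  unfolding se_numeral by (rule sinv_se)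

lemma sinv_power: "sinv m A \<Longrightarrow> sinv m (A ^ n)"
  by (induction n) (auto intro: sinv_mult sinv_1)

lemma sinv_X: "sinv m fps_X"
  using inv_pm_single_0[of m 1] by (simp add: sinv_def fps_X_def)

lemma sinv_smap: "(\<And>p. inv_pm m p \<Longrightarrow> inv_pm m (F p)) \<Longrightarrow> sinv m A \<Longrightarrow> sinv m (smap F A)"
  by (simp add: sinv_def)

lemma inv_pm_cwc: "F 0 = 0 \<Longrightarrow> inv_pm m p \<Longrightarrow> inv_pm m (cw (\<lambda>_. F) p)"
  by (rule inv_pm_cw) auto

lemma sgp_nth: "sgp m A B $ n = (\<Sum>i\<le>n. gp m (A $ i) (B $ (n - i)))"
proof -
  have "sgp m A B $ n = - (\<Sum>l<m. \<Sum>i\<le>n. Kop l (A $ i) * Kop l (B $ (n - i)))"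
    by (simp add: sgp_def fps_sum_nth fps_mult_nth atLeast0AtMost)
  also have "\<dots> = (\<Sum>i\<le>n. gp m (A $ i) (B $ (n - i)))"
    by (subst sum.swap) (simp add: gp_def sum_negf)
  finally show ?thesis .
qed

lemma sinv_sgp: "sinv m A \<Longrightarrow> sinv m B \<Longrightarrow> sinv m (sgp m A B)"
  by (auto simp: sinv_def sgp_nth intro!: inv_pm_sum inv_pm_gp)

lemmas sinv_intros = sinv_add sinv_uminus sinv_mult sinv_se sinv_1 sinv_numeral sinv_power sinv_X sinv_sgp

text \<open>A bound for the weighted l^1 norm with radius \<open>e\<close>, stated through partial
  sums so that it applies to truncations and limits alike.\<close>

definition bd :: "nat \<Rightarrow> real \<Rightarrow> nat \<Rightarrow> ser \<Rightarrow> real \<Rightarrow> bool"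
  where "bd m e r A R \<longleftrightarrow> e \<ge> 0 \<and> (\<forall>n. (\<Sum>i\<le>n. e ^ i * Wn m r (A $ i)) \<le> R)"

lemma bd_nonneg: "bd m e r A R \<Longrightarrow> R \<ge> 0"
proof -
  assume "bd m e r A R"
  then have "e ^ 0 * Wn m r (A $ 0) \<le> R" by (auto simp: bd_def dest: spec[of _ 0])
  then have "Wn m r (A $ 0) \<le> R" by simp
  then show ?thesis by (rule order_trans[OF Wn_nonneg])
qed

lemma bd_add: "bd m e r A R \<Longrightarrow> bd m e r B R' \<Longrightarrow> bd m e r (A + B) (R + R')"
proof -
  assume *: "bd m e r A R" "bd m e r B R'"
  have "(\<Sum>i\<le>n. e ^ i * Wn m r ((A + B) $ i)) \<le> R + R'" for n
  proof -
    have "(\<Sum>i\<le>n. e ^ i * Wn m r ((A + B) $ i)) \<le> (\<Sum>i\<le>n. e ^ i * Wn m r (A $ i) + e ^ i * Wn m r (B $ i))"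
      using * by (intro sum_mono) (auto simp: bd_def Wn_add mult_left_mono simp flip: distrib_left)
    also have "\<dots> \<le> R + R'" using * by (auto simp: bd_def sum.distrib intro: add_mono)
    finally show ?thesis .
  qed
  then show ?thesis using * by (simp add: bd_def)
qed

lemma bd_uminus: "bd m e r A R \<Longrightarrow> bd m e r (- A) R"
  by (simp add: bd_def)

lemma bd_mult:
  assumes "bd m e r A R" "bd m e r B R'"
  shows "bd m e r (A * B) (R * R')"
proof -
  have e: "e \<ge> 0" using assms by (simp add: bd_def)
  have "(\<Sum>i\<le>n. e ^ i * Wn m r ((A * B) $ i)) \<le> R * R'" for n
  proof -
    define f where "f i = e ^ i * Wn m r (A $ i)" for i
    define g where "g i = e ^ i * Wn m r (B $ i)" for i
    have nn: "f i \<ge> 0" "g i \<ge> 0" for i using e by (auto simp: f_def g_def)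
    have "e ^ i * Wn m r ((A * B) $ i) \<le> (\<Sum>l\<le>i. f l * g (i - l))" for i
    proof -
      have "Wn m r ((A * B) $ i) \<le> (\<Sum>l\<le>i. Wn m r (A $ l) * Wn m r (B $ (i - l)))"
        unfolding fps_mult_nth atLeast0AtMost by (rule order_trans[OF Wn_sum]) (intro sum_mono Wn_mult)
      then have "e ^ i * Wn m r ((A * B) $ i) \<le> e ^ i * (\<Sum>l\<le>i. Wn m r (A $ l) * Wn m r (B $ (i - l)))"
        using e by (intro mult_left_mono) auto
      also have "\<dots> = (\<Sum>l\<le>i. f l * g (i - l))"
        unfolding sum_distrib_left
      proof (rule sum.cong)
        fix l assume "l \<in> {..i}"
        then have "e ^ i = e ^ l * e ^ (i - l)" by (simp flip: power_add)
        then show "e ^ i * (Wn m r (A $ l) * Wn m r (B $ (i - l))) = f l * g (i - l)"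
          by (simp add: f_def g_def mult_ac)
      qed simp
      finally show ?thesis .
    qed
    then have "(\<Sum>i\<le>n. e ^ i * Wn m r ((A * B) $ i)) \<le> (\<Sum>i\<le>n. \<Sum>l\<le>i. f l * g (i - l))"
      by (intro sum_mono)
    also have "\<dots> = (\<Sum>(l, k)\<in>{(l, k). l + k \<le> n}. f l * g k)"
      by (rule sum.triangle_reindex_eq[symmetric])
    \<comment> \<open>The triangle of index pairs is enlarged to a square; all terms are
      nonnegative.\<close>
    also have "\<dots> \<le> (\<Sum>(l, k)\<in>{..n} \<times> {..n}. f l * g k)"
      using nn by (intro sum_mono2) auto
    also have "\<dots> = (\<Sum>l\<le>n. f l) * (\<Sum>k\<le>n. g k)"
      by (simp add: sum_product sum.cartesian_product)
    also have "\<dots> \<le> R * R'"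
      using assms nn bd_nonneg[OF assms(1)] by (intro mult_mono) (auto simp: bd_def f_def g_def sum_nonneg)
    finally show ?thesis .
  qed
  then show ?thesis using e by (simp add: bd_def)
qed

lemma bd_const: "e \<ge> 0 \<Longrightarrow> Wn m r p \<le> R \<Longrightarrow> bd m e r (fps_const p) R"
proof -
  assume "e \<ge> 0" "Wn m r p \<le> R"
  moreover have "(\<Sum>i\<le>n. e ^ i * Wn m r (fps_const p $ i)) = Wn m r p" for n
  proof -
    have "(\<Sum>i\<le>n. e ^ i * Wn m r (fps_const p $ i)) = (\<Sum>i\<le>n. if i = 0 then Wn m r p else 0)"
      by (intro sum.cong) auto
    then show ?thesis by simp
  qed
  ultimately show ?thesis by (simp add: bd_def)
qed

lemma l1_0 [simp]: "l1 m 0 = 0"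
  by (simp add: l1_def)

lemma sq_0 [simp]: "sq m 0 = 0"
  by (simp add: sq_def)

lemma bd_se: "e \<ge> 0 \<Longrightarrow> bd m e r (se u) (nrm u)"
  unfolding se_def by (intro bd_const) (auto simp: wt_def)

lemma bd_sc: "e \<ge> 0 \<Longrightarrow> bd m e r (sc c) \<bar>c\<bar>"
  using bd_se[of e m r "econst c"] by simp

lemma bd_1: "e \<ge> 0 \<Longrightarrow> bd m e r 1 1"
  using bd_sc[of e m r 1] by (simp add: se_1 econst_simps)

lemma bd_numeral: "e \<ge> 0 \<Longrightarrow> bd m e r (numeral n) (numeral n)"
  using bd_sc[of e m r "numeral n"] by (simp add: se_numeral)

lemma bd_power: "e \<ge> 0 \<Longrightarrow> bd m e r A R \<Longrightarrow> bd m e r (A ^ n) (R ^ n)"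
  by (induction n) (auto intro: bd_mult bd_1)

lemma bd_X: "e \<ge> 0 \<Longrightarrow> bd m e r fps_X e"
proof -
  assume e: "e \<ge> 0"
  have "Wn m r (1 :: pm) \<le> 1" using Wn_single[of m r 0 1] nrm_leI[of 1 1] by (simp add: wt_def)
  then have "(\<Sum>i\<le>n. e ^ i * Wn m r (fps_X $ i)) \<le> (\<Sum>i\<le>n. if i = 1 then e else 0)" for n
    using e by (intro sum_mono) (auto intro: mult_left_le)
  moreover have "(\<Sum>i\<le>n. if i = 1 then e else 0) \<le> e" for n :: nat using e by (simp add: sum.delta)
  ultimately have "(\<Sum>i\<le>n. e ^ i * Wn m r (fps_X $ i)) \<le> e" for n by (meson order_trans)
  then show ?thesis using e by (simp add: bd_def)
qed

lemma bd_le: "bd m e r A R \<Longrightarrow> R \<le> R' \<Longrightarrow> bd m e r A R'"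
  by (auto simp: bd_def intro: order_trans)

lemma bd_mono: "bd m e r A R \<Longrightarrow> r' \<le> r \<Longrightarrow> bd m e r' A R"
proof -
  assume *: "bd m e r A R" "r' \<le> r"
  then have "(\<Sum>i\<le>n. e ^ i * Wn m r' (A $ i)) \<le> (\<Sum>i\<le>n. e ^ i * Wn m r (A $ i))" for n
    by (intro sum_mono mult_left_mono Wn_mono) (auto simp: bd_def)
  then show ?thesis using * unfolding bd_def by (meson order_trans)
qed

lemma bd_sum: "e \<ge> 0 \<Longrightarrow> (\<And>i. i \<in> I \<Longrightarrow> bd m e r (f i) R) \<Longrightarrow> bd m e r (sum f I) (real (card I) * R)"
proof (induction I rule: infinite_finite_induct)
  case (insert x F)
  then have "bd m e r (f x + sum f F) (R + real (card F) * R)" by (intro bd_add) auto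
  then show ?case using insert by (simp add: algebra_simps)
qed (auto simp: bd_def)

lemma bd_smap:
  assumes "\<And>p. Wn m r (F p) \<le> K * Wn m r' p" "K \<ge> 0" "bd m e r' A R"
  shows "bd m e r (smap F A) (K * R)"
proof -
  have e: "e \<ge> 0" using assms by (simp add: bd_def)
  have "(\<Sum>i\<le>n. e ^ i * Wn m r (F (A $ i))) \<le> K * R" for n
  proof -
    have "(\<Sum>i\<le>n. e ^ i * Wn m r (F (A $ i))) \<le> (\<Sum>i\<le>n. K * (e ^ i * Wn m r' (A $ i)))"
    proof (rule sum_mono)
      fix i
      show "e ^ i * Wn m r (F (A $ i)) \<le> K * (e ^ i * Wn m r' (A $ i))"
        using mult_left_mono[OF assms(1)[of "A $ i"], of "e ^ i"] e by (simp add: mult_ac)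
    qed
    also have "\<dots> \<le> K * R" using assms by (simp add: bd_def mult_left_mono flip: sum_distrib_left)
    finally show ?thesis .
  qed
  then show ?thesis using e by (simp add: bd_def)
qed

lemma Wn_Kop: "i < m \<Longrightarrow> Wn m r (Kop i p) \<le> 1 * Wn m (Suc r) p"
  unfolding Kop_def
proof (rule Wn_cw)
  fix k assume i: "i < m"
  have h: "nrm (econst (real_of_int (k i)) * lookup p k) \<le> (1 + l1 m k) * nrm (lookup p k)"
    using abs_le_l1[OF i, of k] by (intro order_trans[OF nrm_scale] mult_right_mono) auto
  show "(1 + l1 m k) ^ r * nrm (econst (real_of_int (k i)) * lookup p k)
      \<le> 1 * (1 + l1 m k) ^ Suc r * nrm (lookup p k)"
    using mult_left_mono[OF h, of "(1 + l1 m k) ^ r"] by (simp add: mult_ac)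
qed simp

lemma bd_sgp:
  assumes "bd m e (Suc r) A R" "bd m e (Suc r) B R'"
  shows "bd m e r (sgp m A B) (real m * (R * R'))"
proof -
  have e: "e \<ge> 0" using assms by (simp add: bd_def)
  have "bd m e r (\<Sum>i<m. smap (Kop i) A * smap (Kop i) B) (real (card {..<m}) * ((1 * R) * (1 * R')))"
    using assms by (intro bd_sum[OF e] bd_mult bd_smap[OF Wn_Kop]) auto
  then show ?thesis unfolding sgp_def by (intro bd_uminus) simp
qed

lemma Wn_Lap: "Wn m 0 (Lap m p) \<le> 1 * Wn m 2 p"
  unfolding Lap_def
proof (rule Wn_cw)
  fix k
  have "sq m k \<le> (1 + l1 m k)\<^sup>2" using sq_le_l1[of m k] by (simp add: power2_sum add_increasing2)
  then show "(1 + l1 m k) ^ 0 * nrm (econst (- sq m k) * lookup p k) \<le> 1 * (1 + l1 m k)\<^sup>2 * nrm (lookup p k)"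
    using nrm_scale[of "- sq m k" "lookup p k"] mult_right_mono[of "sq m k" _ "nrm (lookup p k)"]
    by (auto intro: order_trans)
qed simp

text \<open>All coefficients of \<open>q1\<close> are positive, so the bound is \<open>q1\<close>
  with every argument replaced by \<open>R\<close> and \<open>S\<close> by 1; it is uniform in e <=
  1.\<close>

lemma q1_bd:
  "\<exists>K. \<forall>e T q u Du Ru RRu z Lz g Y DY RY RRY LY gY. 0 \<le> e \<longrightarrow> e \<le> 1 \<longrightarrow>
     list_all (\<lambda>A. bd m e r A R) [T, q, u, Du, Ru, RRu, z, Lz, g, Y, DY, RY, RRY, LY, gY] \<longrightarrow>
     bd m e r (q1 fps_X T q u Du Ru RRu z Lz g Y DY RY RRY LY gY) K"
proof (intro exI allI impI)
  fix e :: real and T q u Du Ru RRu z Lz g Y DY RY RRY LY gY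
  assume e: "0 \<le> e" "e \<le> 1" and h: "list_all (\<lambda>A. bd m e r A R) [T, q, u, Du, Ru, RRu, z, Lz, g, Y, DY, RY, RRY, LY, gY]"
  then have 1: "bd m e r T R" "bd m e r q R" "bd m e r u R" "bd m e r Du R" "bd m e r Ru R"
    "bd m e r RRu R" "bd m e r z R" "bd m e r Lz R" "bd m e r g R" "bd m e r Y R" "bd m e r DY R"
    "bd m e r RY R" "bd m e r RRY R" "bd m e r LY R" "bd m e r gY R" by auto
  have X: "bd m e r fps_X 1" using bd_le[OF bd_X[OF e(1)] e(2)] .
  show "bd m e r (q1 fps_X T q u Du Ru RRu z Lz g Y DY RY RRY LY gY)
    (R * ((6 * R^2 + 4 * 1 * R^3 + 1^2 * R^4) * R + (4 * R + 6 * 1 * R^2 + 4 * 1^2 * R^3 + 1^3 * R^4) * R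
      + R * R^2 * R + R * (2 * R + 1 * R^2) * R)
    + (2 * R + 1 * R^2) * R + 4 * (1 + 1 * R) * R + 4 * R * (R + 1 * R)
    + 2 * (R * R + R) * R + 2 * (R * (1 + 1 * R) + 1 * R) * R)"
    unfolding q1_def by (intro bd_add bd_mult bd_power bd_numeral bd_1 X e 1)
qed

lemma q2_bd:
  "\<exists>K. \<forall>e T a z h g. 0 \<le> e \<longrightarrow> e \<le> 1 \<longrightarrow> list_all (\<lambda>A. bd m e r A R) [T, a, z, h, g] \<longrightarrow>
     bd m e r (q2 fps_X T a z h g) K"
proof (intro exI allI impI)
  fix e :: real and T a z h g
  assume e: "0 \<le> e" "e \<le> 1" and h: "list_all (\<lambda>A. bd m e r A R) [T, a, z, h, g]"
  then have 1: "bd m e r T R" "bd m e r a R" "bd m e r z R" "bd m e r h R" "bd m e r g R" by auto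
  have X: "bd m e r fps_X 1" using bd_le[OF bd_X[OF e(1)] e(2)] .
  show "bd m e r (q2 fps_X T a z h g)
    (R * (2 * R * R * R + (R * R + R + 1 * R * R)^2
      + (2 * R + 1 * R^2) * (2 * R * (R * R + R + 1 * R * R) + 1 * (R * R + R + 1 * R * R)^2))
    + R * (R + 1 * R)^2)"
    unfolding q2_def by (intro bd_add bd_mult bd_power bd_numeral bd_1 X e 1)
qed

text \<open>The argument handed to \<open>H J\<close> is masked by the default \<open>d\<close> from
  index J on, so \<open>H J\<close> can depend on earlier values only and well-founded recursion
  applies.\<close>

lemma course_of_values: "\<exists>X. \<forall>J::nat. X J = H J (\<lambda>i. if i < J then X i else d)"
proof -
  define X where "X = wfrec less_than (\<lambda>X J. H J (\<lambda>i. if i < J then X i else d))"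
  have "X J = H J (\<lambda>i. if i < J then cut X less_than J i else d)" for J
    unfolding X_def by (subst wfrec[OF wf_less_than]) simp
  moreover have "(\<lambda>i. if i < J then cut X less_than J i else d) = (\<lambda>i. if i < J then X i else d)" for J
    by (auto simp: cut_def)
  ultimately show ?thesis by metis
qed

section \<open>The recursion for G and theta and its convergence\<close>

context bif
begin

text \<open>The factor \<open>gam\<close> normalizes the first-order term to \<open>z = cos x\<^sub>1 + \<dots> + cos x\<^sub>m\<close> at \<open>s = 0\<close>.\<close>

definition gam :: real where "gam = 2 * a / ev (phi N qs) 1"

text \<open>Half of \<open>gam\<close>, because each cosine comes from the two frequencies k and -
  k; in this normalisation g0(1) = a.\<close>

definition g0 :: ent where "g0 = econst (gam / 2) * phi N qs"

definition K1 :: "idx set" where "K1 = {k \<in> freqs m. sq m k = 1}"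

definition G0 :: pm where "G0 = (\<Sum>k\<in>K1. single k g0)"

lemma K1_eq: "K1 = unit_freq ` {..<m} \<union> (\<lambda>i. - unit_freq i) ` {..<m}"
proof (intro equalityI subsetI)
  fix k assume "k \<in> K1"
  then have "k \<in> freqs m" "sq m k = 1" by (auto simp: K1_def)
  then obtain i where "i < m" "k = unit_freq i \<or> k = - unit_freq i" by (rule sq_eq_1)
  then show "k \<in> unit_freq ` {..<m} \<union> (\<lambda>i. - unit_freq i) ` {..<m}" by auto
next
  fix k assume "k \<in> unit_freq ` {..<m} \<union> (\<lambda>i. - unit_freq i) ` {..<m}"
  then obtain i where i: "i < m" "k = unit_freq i \<or> k = - unit_freq i" by auto
  moreover have "sq m (- unit_freq i) = sq m (unit_freq i)" by (simp add: sq_def)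
  ultimately show "k \<in> K1"
    using sq_unit_freq[OF i(1)] by (auto simp: K1_def freqs_def unit_freq_def)
qed

lemma finite_K1 [simp]: "finite K1"
  by (simp add: K1_eq)

lemma lookup_G0: "lookup G0 k = (if k \<in> K1 then g0 else 0)"
proof -
  have "lookup G0 k = (\<Sum>l\<in>K1. if l = k then g0 else 0)"
    by (auto simp: G0_def lookup_sum lookup_single when_def intro!: sum.cong)
  then show ?thesis by simp
qed

lemma inv_G0: "inv_pm m G0"
  unfolding inv_pm_def by (auto simp: lookup_G0 K1_def Sym_def in_keys_iff split: if_splits)

lemma phi1_nz: "ev (phi N qs) 1 \<noteq> 0"
  using q_star(5)[OF N] by (simp add: qs_def)

lemma gam_nz: "gam \<noteq> 0"
  using a_nz phi1_nz by (simp add: gam_def)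

lemma g0_eq: "eD N g0 = - (econst qs * g0)"
  by (simp add: g0_def phi_eq[OF N] mult.left_commute)

lemma robin_g0: "robin N g0 = 0"
  using q_star(2)[OF N] by (simp add: g0_def qs_def)

text \<open>The unknown is \<open>G = Y + 2 z y U'\<close>; since \<open>U' 1 = a\<close>, the Dirichlet condition \<open>Y 1 = 0\<close> becomes
  \<open>z = G 1 / (2 a)\<close>.\<close>

definition zc :: "ent \<Rightarrow> ent" where "zc c = econst (ev c 1 / (2 * a))"

definition uu :: ent where "uu = econst 2 * (eX * ediff U)"

definition yc :: "ent \<Rightarrow> ent" where "yc c = c - zc c * uu"

abbreviation "Zop \<equiv> cw (\<lambda>_. zc)"
abbreviation "Yop \<equiv> cw (\<lambda>_. yc)"
abbreviation "Rop \<equiv> cw (\<lambda>_ c. eX * ediff c)"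
abbreviation "RRop \<equiv> cw (\<lambda>_ c. eX * (eX * ediff (ediff c)))"
abbreviation "Nop \<equiv> cw (\<lambda>_ c. econst (ev (ediff c) 1))"
abbreviation "Bop \<equiv> cw (\<lambda>_ c. econst (robin N c))"
abbreviation "Mop \<equiv> cw (\<lambda>_ c. eD N c + econst (j\<^sup>2) * c)"

definition Zs :: "ser \<Rightarrow> ser" where "Zs G = smap Zop G"
definition Ys :: "ser \<Rightarrow> ser" where "Ys G = smap Yop G"
text \<open>With theta = th0 + t this is theta^2 - th0^2.\<close>

definition T2 :: "ser \<Rightarrow> ser" where "T2 t = sc (2 * th0) * t + t * t"
definition TH :: "ser \<Rightarrow> ser" where "TH t = sc (th0\<^sup>2) + T2 t"

definition Q1 :: "ser \<Rightarrow> ser \<Rightarrow> ser"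
  where "Q1 G t = q1 fps_X (TH t) (sc (j\<^sup>2)) (se U) (se (eD N U)) (se (eX * ediff U))
    (se (eX * (eX * ediff (ediff U)))) (Zs G) (smap (Lap m) (Zs G)) (sgp m (Zs G) (Zs G))
    (Ys G) (smap Dop (Ys G)) (smap Rop (Ys G)) (smap RRop (Ys G)) (smap (Lap m) (Ys G))
    (sgp m (Zs G) (smap Rop (Ys G)))"

definition Q2 :: "ser \<Rightarrow> ser \<Rightarrow> ser"
  where "Q2 G t = q2 fps_X (TH t) (sc a) (Zs G) (smap Nop (Ys G)) (sgp m (Zs G) (Zs G))"

definition plus_part :: "ser \<Rightarrow> ser" where "plus_part G = G - fps_const (G $ 0)"

text \<open>The right-hand sides for order \<open>J\<close>; they only depend on the orders below \<open>J\<close>, since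
  both factors of \<open>t * plus_part G\<close> start at order \<open>1\<close>.\<close>

definition fF :: "ser \<Rightarrow> ser \<Rightarrow> ser"
  where "fF G t = sc (- L0) * (sc (2 * th0) * (t * smap Mop (plus_part G)) + t * (t * smap Mop G)
    + fps_X * Q1 G t)"

definition bF :: "ser \<Rightarrow> ser \<Rightarrow> ser"
  where "bF G t = sc (- (1 / (th0\<^sup>2 * a))) * (sc a * (sc (2 * th0) * (t * smap Bop (plus_part G))
    + t * (t * smap Bop (plus_part G))) + fps_X * Q2 G t)"

definition tser :: "(nat \<Rightarrow> real) \<Rightarrow> ser" where "tser t = Abs_fps (\<lambda>i. single 0 (econst (t i)))"

lemma agr_plus_part:
  assumes "agr n G G'" "G $ 0 = G' $ 0"
  shows "agr n (plus_part G) (plus_part G')"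
  using assms by (simp add: agr_def plus_part_def)

lemma agr_F:
  assumes G: "agr n G G'" "G $ 0 = G' $ 0" and t: "agr n t t'" "t $ 0 = 0" "t' $ 0 = 0"
  shows "agr (Suc n) (fF G t) (fF G' t')" "agr (Suc n) (bF G t) (bF G' t')"
proof -
  have Z: "agr n (Zs G) (Zs G')" and Y: "agr n (Ys G) (Ys G')"
    unfolding Zs_def Ys_def by (intro agr_smap G)+
  have T: "agr n (TH t) (TH t')"
    unfolding TH_def T2_def by (intro agr_add agr_mult agr_refl t)
  have Q: "agr n (Q1 G t) (Q1 G' t')" "agr n (Q2 G t) (Q2 G' t')"
    unfolding Q1_def q1_def Q2_def q2_def
    by (intro agr_add agr_mult agr_power agr_refl agr_sgp agr_smap Z Y T)+
  have pp: "plus_part G $ 0 = 0" "plus_part G' $ 0 = 0" by (simp_all add: plus_part_def)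
  have t1: "agr (Suc n) (t * smap F (plus_part G)) (t' * smap F (plus_part G'))" if "F 0 = 0" for F
    using G t pp that by (intro agr_mult_Suc agr_smap agr_plus_part) auto
  have t2: "agr (Suc n) (t * (t * A)) (t' * (t' * A'))" if "agr n A A'" for A A'
    using that t by (intro agr_mult_Suc agr_mult) auto
  show "agr (Suc n) (fF G t) (fF G' t')" unfolding fF_def
    by (intro agr_mult[OF agr_refl] agr_add t1 t2 agr_X Q agr_smap G) simp
  show "agr (Suc n) (bF G t) (bF G' t')" unfolding bF_def
    by (intro agr_mult[OF agr_refl] agr_add t1 t2 agr_X Q agr_smap agr_plus_part G) simp
qed

lemma sinv_t: "sinv m (tser t)"
  by (simp add: sinv_def tser_def inv_pm_single_0)

lemma inv_cwc:
  "inv_pm m p \<Longrightarrow> inv_pm m (Zop p)" "inv_pm m p \<Longrightarrow> inv_pm m (Yop p)" "inv_pm m p \<Longrightarrow> inv_pm m (Rop p)"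
  "inv_pm m p \<Longrightarrow> inv_pm m (RRop p)" "inv_pm m p \<Longrightarrow> inv_pm m (Nop p)" "inv_pm m p \<Longrightarrow> inv_pm m (Bop p)"
  "inv_pm m p \<Longrightarrow> inv_pm m (Mop p)" "inv_pm m p \<Longrightarrow> inv_pm m (Dop p)"
  unfolding Dop_def by (rule inv_pm_cwc; simp add: zc_def yc_def econst_simps)+

lemma sinv_F:
  assumes G: "sinv m G" and t: "sinv m t"
  shows "sinv m (fF G t)" "sinv m (bF G t)"
proof -
  have Z: "sinv m (Zs G)" and Y: "sinv m (Ys G)"
    unfolding Zs_def Ys_def by (intro sinv_smap[OF _ G] inv_cwc; assumption)+
  have T: "sinv m (TH t)" unfolding TH_def T2_def by (intro sinv_intros t)
  have P: "sinv m (plus_part G)"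
    using G inv_pm_diff[of m] unfolding plus_part_def sinv_def by simp
  have Q: "sinv m (Q1 G t)" unfolding Q1_def q1_def
    by (intro sinv_intros Z Y T sinv_smap[OF inv_pm_Lap] sinv_smap[OF inv_cwc(3)]
        sinv_smap[OF inv_cwc(4)] sinv_smap[OF inv_cwc(8)])
  have Q': "sinv m (Q2 G t)" unfolding Q2_def q2_def
    by (intro sinv_intros Z Y T sinv_smap[OF inv_cwc(5)])
  have BM: "sinv m (smap Bop (plus_part G))" "sinv m (smap Mop (plus_part G))" "sinv m (smap Mop G)"
    by (intro sinv_smap[OF _ P] sinv_smap[OF _ G] inv_cwc; assumption)+
  show "sinv m (fF G t)" unfolding fF_def by (intro sinv_intros t BM Q)
  show "sinv m (bF G t)" unfolding bF_def by (intro sinv_intros t BM Q')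
qed

definition bdF :: "real \<Rightarrow> ser \<Rightarrow> real \<Rightarrow> bool"
  where "bdF e A R \<longleftrightarrow> e \<ge> 0 \<and> (\<forall>n. (\<Sum>i\<le>n. e ^ i * fullW (A $ i)) \<le> R)"

lemma bdF_smap:
  assumes "\<And>p. Wn m r (F p) \<le> K * fullW p" "K \<ge> 0" "bdF e A R"
  shows "bd m e r (smap F A) (K * R)"
proof -
  have e: "e \<ge> 0" using assms by (simp add: bdF_def)
  have "(\<Sum>i\<le>n. e ^ i * Wn m r (F (A $ i))) \<le> K * R" for n
  proof -
    have "(\<Sum>i\<le>n. e ^ i * Wn m r (F (A $ i))) \<le> (\<Sum>i\<le>n. K * (e ^ i * fullW (A $ i)))"
    proof (rule sum_mono)
      fix i
      show "e ^ i * Wn m r (F (A $ i)) \<le> K * (e ^ i * fullW (A $ i))"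
        using mult_left_mono[OF assms(1)[of "A $ i"], of "e ^ i"] e by (simp add: mult_ac)
    qed
    also have "\<dots> \<le> K * R" using assms by (simp add: bdF_def mult_left_mono flip: sum_distrib_left)
    finally show ?thesis .
  qed
  then show ?thesis using e by (simp add: bd_def)
qed

text \<open>Operators with one y-derivative keep one frequency weight by Landau's inequality, those
  with two y-derivatives keep none. The product of the x-gradients of Z and of \<open>Rop\<close>
  applied to Y needs exactly this one weight.\<close>

lemma op_bounds:
  obtains K where "K \<ge> 1"
    "\<And>p. Wn m 2 (Zop p) \<le> K * fullW p" "\<And>p. fullW (Yop p) \<le> K * fullW p"
    "\<And>p. Wn m 1 (Rop p) \<le> K * fullW p" "\<And>p. Wn m 0 (RRop p) \<le> K * fullW p"
    "\<And>p. Wn m 1 (Nop p) \<le> K * fullW p" "\<And>p. Wn m 1 (Bop p) \<le> K * fullW p"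
    "\<And>p. Wn m 0 (Mop p) \<le> K * fullW p" "\<And>p. Wn m 0 (Dop p) \<le> K * fullW p"
    "\<And>p. Wn m 2 p \<le> K * fullW p"
proof -
  define M where "M k c = (1 + l1 m k)\<^sup>2 * nrm c + nrm (eD N c)" for k c
  have \<kappa>: "1 + l1 m k \<ge> 1" for k by simp
  have \<kappa>2: "(1 + l1 m k)\<^sup>2 \<ge> 1" for k by (intro one_le_power) simp
  have M: "(1 + l1 m k)\<^sup>2 * nrm c \<le> M k c" "nrm (eD N c) \<le> M k c" "nrm c \<le> M k c" for k c
    using mult_right_mono[OF \<kappa>2[of k], of "nrm c"] by (auto simp: M_def intro: add_increasing2)
  have Mnn: "M k c \<ge> 0" for k c by (simp add: M_def)
  define A1 where "A1 = 1 / (2 * \<bar>a\<bar>)"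
  define A2 where "A2 = 4 + 2 * real N"
  have A: "A1 \<ge> 0" "A2 \<ge> 1" by (auto simp: A1_def A2_def)
  have z: "(1 + l1 m k)\<^sup>2 * nrm (zc c) \<le> A1 * M k c" for k c
  proof -
    have "(1 + l1 m k)\<^sup>2 * \<bar>ev c 1\<bar> \<le> (1 + l1 m k)\<^sup>2 * nrm c" using ev_le_nrm[of 1 c] by (intro mult_left_mono) auto
    then have "(1 + l1 m k)\<^sup>2 * \<bar>ev c 1\<bar> \<le> M k c" using M(1) order_trans by blast
    then have "A1 * ((1 + l1 m k)\<^sup>2 * \<bar>ev c 1\<bar>) \<le> A1 * M k c" using A by (intro mult_left_mono) auto
    then show ?thesis by (simp add: zc_def A1_def abs_divide abs_mult mult_ac)
  qed
  have landau1: "(1 + l1 m k) * \<bar>y * ev (ediff c) y\<bar> \<le> A2 * M k c"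
    "(1 + l1 m k) * \<bar>ev (ediff c) 1\<bar> \<le> A2 * M k c" if "0 \<le> y" "y \<le> 1" for k c y
  proof -
    \<comment> \<open>Landau's inequality carries the factor sqrt y, which dominates the factor y of
      \<open>Rop\<close>.\<close>
    have "y \<le> sqrt y" using that by (metis abs_of_nonneg real_le_rsqrt power2_eq_square mult_left_le real_sqrt_abs)
    then have "(1 + l1 m k) * (y * \<bar>ev (ediff c) y\<bar>) \<le> (1 + l1 m k) * (sqrt y * \<bar>ev (ediff c) y\<bar>)"
      by (intro mult_left_mono mult_right_mono) auto
    also have "\<dots> \<le> A2 * M k c" unfolding A2_def M_def by (rule landau[OF N \<kappa> that])
    finally show "(1 + l1 m k) * \<bar>y * ev (ediff c) y\<bar> \<le> A2 * M k c" using that by (simp add: abs_mult)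
    show "(1 + l1 m k) * \<bar>ev (ediff c) 1\<bar> \<le> A2 * M k c"
      using landau[OF N \<kappa>[of k], of 1 c] unfolding A2_def M_def by simp
  qed
  have r: "(1 + l1 m k) * nrm (eX * ediff c) \<le> A2 * M k c" for k c
  proof -
    have pos: "1 + l1 m k > 0" by (simp add: add_pos_nonneg)
    have "nrm (eX * ediff c) \<le> A2 * M k c / (1 + l1 m k)"
      using landau1(1)[of _ k c] by (intro nrm_leI) (simp add: pos_le_divide_eq[OF pos] mult.commute)
    then show ?thesis by (simp add: pos_le_divide_eq[OF pos] mult.commute)
  qed
  have rr: "nrm (eX * (eX * ediff (ediff c))) \<le> (1 + real N) * M k c" for k c
  proof (rule nrm_leI)
    fix y :: real assume y: "0 \<le> y" "y \<le> 1"
    have "y * (y * \<bar>ev (ediff (ediff c)) y\<bar>) \<le> 1 * ((1 + real N) * nrm (eD N c))"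
      by (rule mult_mono[OF y(2) nrm_X_ediff2[OF N y]]) (use y in auto)
    also have "\<dots> \<le> 1 * ((1 + real N) * M k c)" using M by (intro mult_left_mono) auto
    finally show "\<bar>ev (eX * (eX * ediff (ediff c))) y\<bar> \<le> (1 + real N) * M k c"
      using y by (simp add: abs_mult)
  qed
  have b: "(1 + l1 m k) * \<bar>robin N c\<bar> \<le> (2 * A2 + real N) * M k c" for k c
  proof -
    have "(1 + l1 m k) * \<bar>ev c 1\<bar> \<le> (1 + l1 m k) * nrm c"
      using ev_le_nrm[of 1 c] by (intro mult_left_mono) auto
    moreover have "(1 + l1 m k) * nrm c \<le> (1 + l1 m k)\<^sup>2 * nrm c"
      using self_le_power[OF \<kappa>, of 2 k] by (intro mult_right_mono) auto
    ultimately have e: "(1 + l1 m k) * \<bar>ev c 1\<bar> \<le> M k c"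
      using M(1)[of k c] by linarith
    have "\<bar>robin N c\<bar> \<le> 2 * \<bar>ev (ediff c) 1\<bar> + (real N - 1) * \<bar>ev c 1\<bar>"
      unfolding robin_def using N by (intro order_trans[OF abs_triangle_ineq]) (simp add: abs_mult)
    then have "(1 + l1 m k) * \<bar>robin N c\<bar> \<le> (1 + l1 m k) * (2 * \<bar>ev (ediff c) 1\<bar> + (real N - 1) * \<bar>ev c 1\<bar>)"
      by (intro mult_left_mono) auto
    also have "\<dots> = 2 * ((1 + l1 m k) * \<bar>ev (ediff c) 1\<bar>) + (real N - 1) * ((1 + l1 m k) * \<bar>ev c 1\<bar>)"
      by (simp add: algebra_simps)
    also have "\<dots> \<le> 2 * (A2 * M k c) + real N * M k c"
    proof (rule add_mono)
      show "2 * ((1 + l1 m k) * \<bar>ev (ediff c) 1\<bar>) \<le> 2 * (A2 * M k c)"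
        using landau1(2)[of 0 k c] by simp
      show "(real N - 1) * ((1 + l1 m k) * \<bar>ev c 1\<bar>) \<le> real N * M k c"
        by (rule mult_mono[OF _ e]) auto
    qed
    finally show ?thesis by (simp add: algebra_simps)
  qed
  have mo: "nrm (eD N c + econst (j\<^sup>2) * c) \<le> (1 + j\<^sup>2) * M k c" for k c
  proof -
    have "nrm (eD N c + econst (j\<^sup>2) * c) \<le> nrm (eD N c) + j\<^sup>2 * nrm c"
      using nrm_add[of "eD N c" "econst (j\<^sup>2) * c"] nrm_scale[of "j\<^sup>2" c] by simp
    also have "\<dots> \<le> M k c + j\<^sup>2 * M k c" using M by (intro add_mono mult_left_mono) auto
    finally show ?thesis by (simp add: algebra_simps)
  qed
  have y1: "(1 + l1 m k)\<^sup>2 * nrm (yc c) \<le> (1 + A1 * nrm uu) * M k c" for k c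
  proof -
    have "nrm (yc c) \<le> nrm c + nrm (zc c) * nrm uu"
      unfolding yc_def using nrm_add[of c "- (zc c * uu)"] nrm_mult[of "zc c" uu] by simp
    then have "(1 + l1 m k)\<^sup>2 * nrm (yc c) \<le> (1 + l1 m k)\<^sup>2 * (nrm c + nrm (zc c) * nrm uu)"
      by (intro mult_left_mono) auto
    also have "\<dots> = (1 + l1 m k)\<^sup>2 * nrm c + ((1 + l1 m k)\<^sup>2 * nrm (zc c)) * nrm uu" by (simp add: algebra_simps)
    also have "\<dots> \<le> M k c + (A1 * M k c) * nrm uu" by (intro add_mono mult_right_mono M z) auto
    finally show ?thesis by (simp add: algebra_simps)
  qed
  have y2: "nrm (eD N (yc c)) \<le> (1 + A1 * nrm (eD N uu)) * M k c" for k c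
  proof -
    have "eD N (yc c) = eD N c - zc c * eD N uu" by (simp add: yc_def zc_def)
    then have "nrm (eD N (yc c)) \<le> nrm (eD N c) + nrm (zc c) * nrm (eD N uu)"
      using nrm_add[of "eD N c" "- (zc c * eD N uu)"] nrm_mult[of "zc c" "eD N uu"] by simp
    moreover have "nrm (zc c) \<le> A1 * M k c"
      using z[of k c] mult_right_mono[OF \<kappa>2[of k], of "nrm (zc c)"] by simp
    ultimately have "nrm (eD N (yc c)) \<le> M k c + (A1 * M k c) * nrm (eD N uu)"
      using M(2)[of c k] mult_right_mono[of "nrm (zc c)" "A1 * M k c" "nrm (eD N uu)"] by simp
    then show ?thesis by (simp add: algebra_simps)
  qed
  define K where "K = 2 + A1 + A2 + (1 + real N) + (2 * A2 + real N) + (1 + j\<^sup>2)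
     + (1 + A1 * nrm uu) + (1 + A1 * nrm (eD N uu))"
  have ann: "A1 * nrm uu \<ge> 0" "A1 * nrm (eD N uu) \<ge> 0" using A by auto
  have KM: "x * M k c \<le> K * M k c" if "x \<le> K" for x k c using that Mnn by (rule mult_right_mono)
  have "fullW (Yop p) \<le> K * fullW p" for p
  proof -
    have "Wn m 2 (Yop p) \<le> (1 + A1 * nrm uu) * fullW p"
      by (rule Wn_cw_full) (auto simp: yc_def zc_def econst_simps y1[unfolded M_def yc_def zc_def])
    moreover have "Dop (Yop p) = cw (\<lambda>_ c. eD N (yc c)) p"
      by (rule poly_mapping_eqI) (simp add: lookup_Dop lookup_cw yc_def zc_def econst_simps)
    then have "Wn m 0 (Dop (Yop p)) \<le> (1 + A1 * nrm (eD N uu)) * fullW p"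
      using y2[unfolded M_def] by (auto intro!: Wn_cw_full simp: yc_def zc_def econst_simps)
    ultimately have "fullW (Yop p) \<le> ((1 + A1 * nrm uu) + (1 + A1 * nrm (eD N uu))) * fullW p"
      by (simp add: fullW_def algebra_simps)
    also have "\<dots> \<le> K * fullW p" using A by (intro mult_right_mono) (auto simp: K_def)
    finally show ?thesis .
  qed
  moreover have "Wn m 2 (Zop p) \<le> K * fullW p" for p
    by (rule Wn_cw_full)
      (use order_trans[OF z KM] A ann in \<open>auto simp: zc_def econst_simps K_def M_def[symmetric]\<close>)
  moreover have "Wn m 1 (Rop p) \<le> K * fullW p" for p
    by (rule Wn_cw_full) (use order_trans[OF r KM] A ann in \<open>auto simp: K_def M_def[symmetric]\<close>)
  moreover have "Wn m 0 (RRop p) \<le> K * fullW p" for p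
    by (rule Wn_cw_full) (use order_trans[OF rr KM] A ann in \<open>auto simp: K_def M_def[symmetric]\<close>)
  moreover have "Wn m 1 (Nop p) \<le> K * fullW p" for p
    by (rule Wn_cw_full)
      (use order_trans[OF landau1(2)[of 0] KM] A ann in \<open>auto simp: econst_simps K_def M_def[symmetric]\<close>)
  moreover have "Wn m 1 (Bop p) \<le> K * fullW p" for p
    by (rule Wn_cw_full) (use order_trans[OF b KM] A ann in \<open>auto simp: econst_simps K_def M_def[symmetric]\<close>)
  moreover have "Wn m 0 (Mop p) \<le> K * fullW p" for p
    by (rule Wn_cw_full) (use order_trans[OF mo KM] A ann in \<open>auto simp: K_def M_def[symmetric]\<close>)
  moreover have K1: "K \<ge> 1" using A ann unfolding K_def by auto
  moreover have "Wn m 0 (Dop p) \<le> K * fullW p" "Wn m 2 p \<le> K * fullW p" for p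
    using mult_right_mono[OF K1 fullW_nonneg[of p]] by (simp_all add: fullW_def add_increasing add_increasing2 order_trans[rotated])
  ultimately show ?thesis using that[of K] by blast
qed

end

context bif
begin

lemma bdF_le: "bdF e A R \<Longrightarrow> R \<le> R' \<Longrightarrow> bdF e A R'"
  unfolding bdF_def by (meson order_trans)

lemma bdF_smapF:
  assumes "\<And>p. fullW (F p) \<le> K * fullW p" "K \<ge> 0" "bdF e A R"
  shows "bdF e (smap F A) (K * R)"
proof -
  have e: "e \<ge> 0" using assms by (simp add: bdF_def)
  have "(\<Sum>i\<le>n. e ^ i * fullW (F (A $ i))) \<le> K * R" for n
  proof -
    have "(\<Sum>i\<le>n. e ^ i * fullW (F (A $ i))) \<le> (\<Sum>i\<le>n. K * (e ^ i * fullW (A $ i)))"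
    proof (rule sum_mono)
      fix i
      show "e ^ i * fullW (F (A $ i)) \<le> K * (e ^ i * fullW (A $ i))"
        using mult_left_mono[OF assms(1)[of "A $ i"], of "e ^ i"] e by (simp add: mult_ac)
    qed
    also have "\<dots> \<le> K * R" using assms by (simp add: bdF_def mult_left_mono flip: sum_distrib_left)
    finally show ?thesis .
  qed
  then show ?thesis using e by (simp add: bdF_def)
qed

text \<open>The bound depends on \<open>R0\<close> only, so the constants of the majorant argument
  are independent of the radius \<open>e\<close> and of the truncation order.\<close>

lemma component_bounds:
  obtains R where "\<And>e G t. 0 \<le> e \<Longrightarrow> e \<le> 1 \<Longrightarrow> bdF e G R0 \<Longrightarrow> bd m e 2 t 1 \<Longrightarrow>
    bd m e 2 (Zs G) R \<and> bd m e 0 (smap (Lap m) (Zs G)) R \<and> bd m e 1 (sgp m (Zs G) (Zs G)) R \<and>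
    bdF e (Ys G) R \<and> bd m e 0 (smap Dop (Ys G)) R \<and> bd m e 1 (smap Rop (Ys G)) R \<and>
    bd m e 0 (smap RRop (Ys G)) R \<and> bd m e 0 (smap (Lap m) (Ys G)) R \<and> bd m e 1 (smap Nop (Ys G)) R \<and>
    bd m e 0 (sgp m (Zs G) (smap Rop (Ys G))) R \<and> bd m e 2 (Ys G) R \<and> bd m e 2 (TH t) R \<and>
    bd m e 0 (smap Mop G) R"
proof -
  obtain K where K: "K \<ge> 1"
    "\<And>p. Wn m 2 (Zop p) \<le> K * fullW p" "\<And>p. fullW (Yop p) \<le> K * fullW p"
    "\<And>p. Wn m 1 (Rop p) \<le> K * fullW p" "\<And>p. Wn m 0 (RRop p) \<le> K * fullW p"
    "\<And>p. Wn m 1 (Nop p) \<le> K * fullW p" "\<And>p. Wn m 1 (Bop p) \<le> K * fullW p"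
    "\<And>p. Wn m 0 (Mop p) \<le> K * fullW p" "\<And>p. Wn m 0 (Dop p) \<le> K * fullW p"
    "\<And>p. Wn m 2 p \<le> K * fullW p"
    by (rule op_bounds) blast
  define RA where "RA = K * \<bar>R0\<bar>"
  \<comment> \<open>The operators on Y are bounded in two stages, \<open>Yop\<close> first, hence a
    second factor \<open>K\<close>.\<close>
  define RB where "RB = K * RA"
  define RT where "RT = \<bar>th0\<^sup>2\<bar> + (\<bar>2 * th0\<bar> * 1 + 1 * 1)"
  define R where "R = RA + RB + real m * (RA * RA) + real m * (RA * RB) + RT"
  have nn: "RA \<ge> 0" "RB \<ge> 0" "RT \<ge> 0" "real m * (RA * RA) \<ge> 0" "real m * (RA * RB) \<ge> 0"
    using K(1) by (auto simp: RA_def RB_def RT_def)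
  have K0: "K \<ge> 0" using K(1) by simp
  have "bd m e 2 (Zs G) R \<and> bd m e 0 (smap (Lap m) (Zs G)) R \<and> bd m e 1 (sgp m (Zs G) (Zs G)) R \<and>
    bdF e (Ys G) R \<and> bd m e 0 (smap Dop (Ys G)) R \<and> bd m e 1 (smap Rop (Ys G)) R \<and>
    bd m e 0 (smap RRop (Ys G)) R \<and> bd m e 0 (smap (Lap m) (Ys G)) R \<and> bd m e 1 (smap Nop (Ys G)) R \<and>
    bd m e 0 (sgp m (Zs G) (smap Rop (Ys G))) R \<and> bd m e 2 (Ys G) R \<and> bd m e 2 (TH t) R \<and>
    bd m e 0 (smap Mop G) R"
    if e: "0 \<le> e" "e \<le> 1" and G: "bdF e G R0" and t: "bd m e 2 t 1" for e G t
  proof -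
    have G': "bdF e G \<bar>R0\<bar>" using G by (rule bdF_le) simp
    have Z: "bd m e 2 (Zs G) RA" unfolding Zs_def RA_def by (rule bdF_smap[OF K(2) K0 G'])
    have Y: "bdF e (Ys G) RA" unfolding Ys_def RA_def by (rule bdF_smapF[OF K(3) K0 G'])
    have ops: "bd m e 0 (smap Dop (Ys G)) RB" "bd m e 1 (smap Rop (Ys G)) RB"
      "bd m e 0 (smap RRop (Ys G)) RB" "bd m e 1 (smap Nop (Ys G)) RB" "bd m e 0 (smap Mop G) RA"
      unfolding RB_def RA_def
      by (rule bdF_smap[OF _ K0 Y[unfolded RA_def]] bdF_smap[OF _ K0 G'], rule K)+
    have "bd m e 2 (smap (\<lambda>p. p) (Ys G)) RB" unfolding RB_def by (rule bdF_smap[OF K(10) K0 Y])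
    moreover have "smap (\<lambda>p. p) (Ys G) = Ys G" by (simp add: fps_eq_iff)
    ultimately have Y2: "bd m e 2 (Ys G) RB" by simp
    have L: "bd m e 0 (smap (Lap m) (Zs G)) (1 * RA)" "bd m e 0 (smap (Lap m) (Ys G)) (1 * RB)"
      by (rule bd_smap[OF Wn_Lap _ Z] bd_smap[OF Wn_Lap _ Y2], simp)+
    have Z2: "bd m e (Suc 1) (Zs G) RA" using Z by (simp add: numeral_2_eq_2)
    have g: "bd m e 1 (sgp m (Zs G) (Zs G)) (real m * (RA * RA))"
      by (rule bd_sgp[OF Z2 Z2])
    have g2: "bd m e 0 (sgp m (Zs G) (smap Rop (Ys G))) (real m * (RA * RB))"
      by (rule bd_sgp) (use bd_mono[OF Z, of 1] ops(2) in simp_all)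
    have T: "bd m e 2 (TH t) RT"
      unfolding TH_def T2_def RT_def by (intro bd_add bd_mult bd_sc e t)
    have "RA \<le> R" "RB \<le> R" "RT \<le> R" "real m * (RA * RA) \<le> R" "real m * (RA * RB) \<le> R"
      using nn by (auto simp: R_def)
    moreover from this have "bdF e (Ys G) R" using Y by (blast intro: bdF_le)
    ultimately show ?thesis using Z ops Y2 L g g2 T by (auto intro: bd_le)
  qed
  then show ?thesis using that by blast
qed

text \<open>Every term of the right-hand sides has at least two small factors t or G - G0, or the
  factor s; hence the bound by a multiple of delta^2 + e.\<close>

lemma F_bound:
  "\<exists>K\<ge>0. \<forall>e \<delta> G t. 0 \<le> e \<longrightarrow> e \<le> 1 \<longrightarrow> 0 \<le> \<delta> \<longrightarrow> \<delta> \<le> 1 \<longrightarrow> bdF e G R0 \<longrightarrow>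
     bdF e (plus_part G) \<delta> \<longrightarrow> bd m e 2 t \<delta> \<longrightarrow>
     bd m e 0 (fF G t) (K * (\<delta>\<^sup>2 + e)) \<and> bd m e 1 (bF G t) (K * (\<delta>\<^sup>2 + e))"
proof -
  obtain Ko where Ko: "Ko \<ge> 1" "\<And>p. Wn m 1 (Bop p) \<le> Ko * fullW p" "\<And>p. Wn m 0 (Mop p) \<le> Ko * fullW p"
    by (rule op_bounds) blast
  obtain R where R: "\<And>e G t. 0 \<le> e \<Longrightarrow> e \<le> 1 \<Longrightarrow> bdF e G R0 \<Longrightarrow> bd m e 2 t 1 \<Longrightarrow>
    bd m e 2 (Zs G) R \<and> bd m e 0 (smap (Lap m) (Zs G)) R \<and> bd m e 1 (sgp m (Zs G) (Zs G)) R \<and>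
    bdF e (Ys G) R \<and> bd m e 0 (smap Dop (Ys G)) R \<and> bd m e 1 (smap Rop (Ys G)) R \<and>
    bd m e 0 (smap RRop (Ys G)) R \<and> bd m e 0 (smap (Lap m) (Ys G)) R \<and> bd m e 1 (smap Nop (Ys G)) R \<and>
    bd m e 0 (sgp m (Zs G) (smap Rop (Ys G))) R \<and> bd m e 2 (Ys G) R \<and> bd m e 2 (TH t) R \<and>
    bd m e 0 (smap Mop G) R"
    by (rule component_bounds[of R0]) blast
  \<comment> \<open>One bound for the components above and for the fixed coefficients that come from
    U.\<close>
  define R' where "R' = \<bar>R\<bar> + j\<^sup>2 + nrm U + nrm (eD N U) + nrm (eX * ediff U) + nrm (eX * (eX * ediff (ediff U))) + \<bar>a\<bar>"
  obtain k1 where k1: "\<forall>e T q u Du Ru RRu z Lz g Y DY RY RRY LY gY. 0 \<le> e \<longrightarrow> e \<le> 1 \<longrightarrow>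
     list_all (\<lambda>A. bd m e 0 A R') [T, q, u, Du, Ru, RRu, z, Lz, g, Y, DY, RY, RRY, LY, gY] \<longrightarrow>
     bd m e 0 (q1 fps_X T q u Du Ru RRu z Lz g Y DY RY RRY LY gY) k1"
    by (rule exE[OF q1_bd[of m 0 R']])
  obtain k2 where k2: "\<forall>e T a z h g. 0 \<le> e \<longrightarrow> e \<le> 1 \<longrightarrow> list_all (\<lambda>A. bd m e 1 A R') [T, a, z, h, g] \<longrightarrow>
     bd m e 1 (q2 fps_X T a z h g) k2"
    by (rule exE[OF q2_bd[of m 1 R']])
  define A where "A = 1 / (th0\<^sup>2 * \<bar>a\<bar>)"
  define K where "K = L0 * (2 * th0 * Ko + \<bar>R\<bar> + \<bar>k1\<bar>) + A * (\<bar>a\<bar> * (2 * th0 * Ko + Ko) + \<bar>k2\<bar>)"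
  have A: "A \<ge> 0" by (simp add: A_def)
  have parts: "0 \<le> L0 * (2 * th0 * Ko + \<bar>R\<bar> + \<bar>k1\<bar>)" "0 \<le> A * (\<bar>a\<bar> * (2 * th0 * Ko + Ko) + \<bar>k2\<bar>)"
    using L0_pos th0_pos Ko(1) A by auto
  have "bd m e 0 (fF G t) (K * (\<delta>\<^sup>2 + e)) \<and> bd m e 1 (bF G t) (K * (\<delta>\<^sup>2 + e))"
    if e: "0 \<le> e" "e \<le> 1" and d: "0 \<le> \<delta>" "\<delta> \<le> 1" and G: "bdF e G R0" and P: "bdF e (plus_part G) \<delta>"
      and t: "bd m e 2 t \<delta>" for e \<delta> G t
  proof -
    from R[OF e G bd_le[OF t d(2)]] have c:
      "bd m e 2 (Zs G) R" "bd m e 0 (smap (Lap m) (Zs G)) R" "bd m e 1 (sgp m (Zs G) (Zs G)) R"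
      "bd m e 0 (smap Dop (Ys G)) R" "bd m e 1 (smap Rop (Ys G)) R"
      "bd m e 0 (smap RRop (Ys G)) R" "bd m e 0 (smap (Lap m) (Ys G)) R" "bd m e 1 (smap Nop (Ys G)) R"
      "bd m e 0 (sgp m (Zs G) (smap Rop (Ys G))) R" "bd m e 2 (Ys G) R" "bd m e 2 (TH t) R"
      "bd m e 0 (smap Mop G) R" by blast+
    have Rnn: "R \<le> R'" unfolding R'_def by (intro add_increasing2) auto
    have cU: "bd m e r (sc (j\<^sup>2)) R'" "bd m e r (se U) R'" "bd m e r (se (eD N U)) R'" "bd m e r (se (eX * ediff U)) R'"
      "bd m e r (se (eX * (eX * ediff (ediff U)))) R'" "bd m e r (sc a) R'" for r
      by (rule bd_le[OF bd_sc[OF e(1)]] bd_le[OF bd_se[OF e(1)]], simp add: R'_def)+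
    have le: "bd m e r A R \<Longrightarrow> r' \<le> r \<Longrightarrow> bd m e r' A R'" for r r' A
      using bd_le[OF bd_mono Rnn] by blast
    have Q1: "bd m e 0 (Q1 G t) k1" unfolding Q1_def
      by (rule k1[rule_format, OF e])
        (simp add: cU le[OF c(1)] le[OF c(2)] le[OF c(3)] le[OF c(4)] le[OF c(5)] le[OF c(6)] le[OF c(7)]
          le[OF c(9)] le[OF c(10)] le[OF c(11)])
    have Q2: "bd m e 1 (Q2 G t) k2" unfolding Q2_def
      by (rule k2[rule_format, OF e])
        (simp add: cU le[OF c(1)] le[OF c(3)] le[OF c(8)] le[OF c(11)])
    have tr: "bd m e r t \<delta>" if "r \<le> 2" for r using bd_mono[OF t that] .
    have K0: "Ko \<ge> 0" using Ko(1) by simp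
    have MP: "bd m e 0 (smap Mop (plus_part G)) (Ko * \<delta>)" by (rule bdF_smap[OF Ko(3) K0 P])
    have BP: "bd m e 1 (smap Bop (plus_part G)) (Ko * \<delta>)" by (rule bdF_smap[OF Ko(2) K0 P])
    have MG: "bd m e 0 (smap Mop G) R" using c by blast
    have X: "bd m e r fps_X e" for r by (rule bd_X[OF e(1)])
    have f: "bd m e 0 (fF G t) (\<bar>- L0\<bar> * (\<bar>2 * th0\<bar> * (\<delta> * (Ko * \<delta>)) + \<delta> * (\<delta> * R) + e * k1))"
      unfolding fF_def by (intro bd_mult bd_add bd_sc e tr MP MG X Q1) auto
    have b: "bd m e 1 (bF G t) (\<bar>- (1 / (th0\<^sup>2 * a))\<bar> * (\<bar>a\<bar> * (\<bar>2 * th0\<bar> * (\<delta> * (Ko * \<delta>)) + \<delta> * (\<delta> * (Ko * \<delta>))) + e * k2))"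
      unfolding bF_def by (intro bd_mult bd_add bd_sc e tr BP X Q2) auto
    have d2: "\<delta> * \<delta> * \<delta> \<le> \<delta>\<^sup>2" using d by (simp add: power2_eq_square mult_left_le)
    have sq: "\<delta>\<^sup>2 \<le> \<delta>\<^sup>2 + e" "e \<le> \<delta>\<^sup>2 + e" "0 \<le> \<delta>\<^sup>2 + e" using e by auto
    have "2 * th0 * (\<delta> * (Ko * \<delta>)) + \<delta> * (\<delta> * R) + e * k1 = (2 * th0 * Ko + R) * \<delta>\<^sup>2 + k1 * e"
      by (simp add: power2_eq_square algebra_simps)
    also have "\<dots> \<le> (2 * th0 * Ko + \<bar>R\<bar>) * (\<delta>\<^sup>2 + e) + \<bar>k1\<bar> * (\<delta>\<^sup>2 + e)"
      using sq th0_pos K0 e by (intro add_mono mult_mono) auto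
    also have "\<dots> = (2 * th0 * Ko + \<bar>R\<bar> + \<bar>k1\<bar>) * (\<delta>\<^sup>2 + e)" by (simp add: algebra_simps)
    finally have "L0 * (2 * th0 * (\<delta> * (Ko * \<delta>)) + \<delta> * (\<delta> * R) + e * k1)
        \<le> L0 * ((2 * th0 * Ko + \<bar>R\<bar> + \<bar>k1\<bar>) * (\<delta>\<^sup>2 + e))"
      using L0_pos by (intro mult_left_mono) auto
    also have "\<dots> \<le> K * (\<delta>\<^sup>2 + e)"
      unfolding mult.assoc[symmetric] using parts sq by (intro mult_right_mono) (auto simp: K_def)
    finally have 1: "bd m e 0 (fF G t) (K * (\<delta>\<^sup>2 + e))"
      using f L0_pos th0_pos by (intro bd_le[OF f]) simp
    have "2 * th0 * (\<delta> * (Ko * \<delta>)) + \<delta> * (\<delta> * (Ko * \<delta>)) = 2 * th0 * Ko * \<delta>\<^sup>2 + Ko * (\<delta> * \<delta> * \<delta>)"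
      by (simp add: power2_eq_square algebra_simps)
    also have "\<dots> \<le> 2 * th0 * Ko * \<delta>\<^sup>2 + Ko * \<delta>\<^sup>2" using d2 K0 by (intro add_left_mono mult_left_mono)
    also have "\<dots> = (2 * th0 * Ko + Ko) * \<delta>\<^sup>2" by (simp add: algebra_simps)
    finally have "\<bar>a\<bar> * (2 * th0 * (\<delta> * (Ko * \<delta>)) + \<delta> * (\<delta> * (Ko * \<delta>))) + e * k2
       \<le> \<bar>a\<bar> * ((2 * th0 * Ko + Ko) * \<delta>\<^sup>2) + \<bar>k2\<bar> * e"
      using e by (intro add_mono mult_left_mono) (auto simp: mult.commute[of e] intro!: mult_right_mono)
    also have "\<dots> \<le> (\<bar>a\<bar> * (2 * th0 * Ko + Ko)) * (\<delta>\<^sup>2 + e) + \<bar>k2\<bar> * (\<delta>\<^sup>2 + e)"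
      unfolding mult.assoc[symmetric, of "\<bar>a\<bar>"] using sq th0_pos K0 by (intro add_mono mult_left_mono) auto
    also have "\<dots> = (\<bar>a\<bar> * (2 * th0 * Ko + Ko) + \<bar>k2\<bar>) * (\<delta>\<^sup>2 + e)" by (simp add: algebra_simps)
    finally have "A * (\<bar>a\<bar> * (2 * th0 * (\<delta> * (Ko * \<delta>)) + \<delta> * (\<delta> * (Ko * \<delta>))) + e * k2)
       \<le> A * ((\<bar>a\<bar> * (2 * th0 * Ko + Ko) + \<bar>k2\<bar>) * (\<delta>\<^sup>2 + e))"
      using A by (intro mult_left_mono) auto
    also have "\<dots> \<le> K * (\<delta>\<^sup>2 + e)"
      unfolding mult.assoc[symmetric, of A] using parts sq by (intro mult_right_mono) (auto simp: K_def)
    finally have 2: "bd m e 1 (bF G t) (K * (\<delta>\<^sup>2 + e))"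
      using th0_pos by (intro bd_le[OF b]) (simp add: A_def abs_mult)
    show ?thesis using 1 2 by blast
  qed
  then show ?thesis using parts by (intro exI[of _ K]) (auto simp: K_def)
qed

lemma lookup_single_0_mult: "lookup (single 0 c * p) k = c * lookup p k"
proof -
  have "single 0 c * p = cw (\<lambda>_ d. c * d) p"
  proof -
    have "single 0 c * p = (\<Sum>l\<in>keys p. single l (c * lookup p l))"
      by (subst (1) pm_monomials[of p]) (simp add: sum_distrib_left mult_single)
    also have "\<dots> = cw (\<lambda>_ d. c * d) p"
      by (rule poly_mapping_eqI) (auto simp: lookup_sum lookup_single when_def lookup_cw in_keys_iff sum.delta)
    finally show ?thesis .
  qed
  then show ?thesis by (simp add: lookup_cw)
qed

lemma lookup_se_mult: "lookup ((se u * A) $ n) k = u * lookup (A $ n) k"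
  by (simp add: se_def lookup_single_0_mult)

text \<open>For a small radius the quadratic estimate keeps the partial sums of positive order below
  delta. The induction runs over truncations, whose right-hand sides agree with the true ones up to
  the order in question.\<close>

theorem solution_series:
  obtains e R :: real and G :: ser and t :: "nat \<Rightarrow> real" where
    "0 < e" "e \<le> 1" "G $ 0 = G0" "t 0 = 0" "sinv m G" "bdF e G R" "bd m e 2 (tser t) R"
    "sc (th0\<^sup>2) * smap Mop G + smap (Lap m) G + T2 (tser t) * smap Mop G + fps_X * Q1 G (tser t) = 0"
    "\<And>n k. ev (lookup ((sc a * (TH (tser t) * smap Bop G) + fps_X * Q2 G (tser t)) $ n) k) 1 = 0"
proof -
  \<comment> \<open>Since th0^2 L0 = 1, the solvability condition on the resonant modes at order n
    reads t n * B = - \<open>tsol\<close>.\<close>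
  define B where "B = th0 * L0\<^sup>2 * gam"
  have B: "B \<noteq> 0" using th0_pos L0_pos gam_nz by (simp add: B_def)
  \<comment> \<open>Truncations below order J, filled up with 0; by causality they determine the
    right-hand sides of order J.\<close>
  define trG where "trG J X = Abs_fps (\<lambda>i. if i < J then fst (X i) else (0::pm))" for J :: nat and X :: "nat \<Rightarrow> pm \<times> real"
  define trT where "trT J X = tser (\<lambda>i. if i < J then snd (X i) else 0)" for J :: nat and X :: "nat \<Rightarrow> pm \<times> real"
  define H where "H J X = (if J = 0 then (G0, 0) else
     (solG (fF (trG J X) (trT J X) $ J) (bF (trG J X) (trT J X) $ J),
      - tsol (fF (trG J X) (trT J X) $ J) (bF (trG J X) (trT J X) $ J) / B))" for J and X :: "nat \<Rightarrow> pm \<times> real"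
  obtain X where X: "\<And>J. X J = H J (\<lambda>i. if i < J then X i else (0, 0))"
    using course_of_values[of H "(0, 0)"] by blast
  have "trG J (\<lambda>i. if i < J then X i else (0, 0)) = trG J X" "trT J (\<lambda>i. if i < J then X i else (0, 0)) = trT J X" for J
    unfolding trG_def trT_def by (auto simp: fps_eq_iff tser_def)
  then have "H J (\<lambda>i. if i < J then X i else (0, 0)) = H J X" for J by (simp add: H_def)
  then have XH: "X J = H J X" for J using X by simp
  define Gs where "Gs n = fst (X n)" for n
  define t where "t n = snd (X n)" for n
  define G where "G = Abs_fps Gs"
  have X0: "Gs 0 = G0" "t 0 = 0" using XH[of 0] by (auto simp: Gs_def t_def H_def)
  define GJ where "GJ J = trG J X" for J
  define TJ where "TJ J = trT J X" for J
  have GJ: "GJ J $ i = (if i < J then Gs i else 0)" for J i by (simp add: GJ_def trG_def Gs_def)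
  have TJ: "TJ J $ i = (if i < J then single 0 (econst (t i)) else 0)" for J i
    by (simp add: TJ_def trT_def tser_def t_def econst_simps)
  have tse: "tser t $ i = single 0 (econst (t i))" for i by (simp add: tser_def)
  have recG: "Gs J = solG (fF (GJ J) (TJ J) $ J) (bF (GJ J) (TJ J) $ J)"
    and rect: "t J = - tsol (fF (GJ J) (TJ J) $ J) (bF (GJ J) (TJ J) $ J) / B" if "J \<ge> 1" for J
    using XH[of J] that by (auto simp: Gs_def t_def H_def GJ_def TJ_def)
  have FJ: "fF (GJ J) (TJ J) $ i = fF G (tser t) $ i" "bF (GJ J) (TJ J) $ i = bF G (tser t) $ i"
    if "J \<ge> 1" "i \<le> J" for i J
  proof -
    have "agr J (GJ J) G" "agr J (TJ J) (tser t)" by (auto simp: agr_def GJ TJ tse G_def)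
    moreover have "GJ J $ 0 = G $ 0" "TJ J $ 0 = 0" "tser t $ 0 = 0"
      using that by (auto simp: GJ TJ tse G_def X0 econst_simps)
    ultimately have "agr (Suc J) (fF (GJ J) (TJ J)) (fF G (tser t)) \<and> agr (Suc J) (bF (GJ J) (TJ J)) (bF G (tser t))"
      using agr_F by blast
    then show "fF (GJ J) (TJ J) $ i = fF G (tser t) $ i" "bF (GJ J) (TJ J) $ i = bF G (tser t) $ i"
      using that by (auto simp: agr_def)
  qed
  have inv: "inv_pm m (Gs J)" for J
  proof (induction J rule: less_induct)
    case (less J)
    show ?case
    proof (cases "J = 0")
      case True
      then show ?thesis using X0 inv_G0 by simp
    next
      case False
      have "sinv m (GJ J)" "sinv m (TJ J)"
        using less by (auto simp: sinv_def GJ TJ inv_pm_single_0)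
      from sinv_F[OF this] show ?thesis
        using recG[of J] False by (simp add: sinv_def inv_solG)
    qed
  qed
  then have sinvG: "sinv m G" by (simp add: sinv_def G_def)
  obtain K where K: "K \<ge> 0" "\<And>e \<delta> G t. 0 \<le> e \<Longrightarrow> e \<le> 1 \<Longrightarrow> 0 \<le> \<delta> \<Longrightarrow> \<delta> \<le> 1 \<Longrightarrow> bdF e G (fullW G0 + 1) \<Longrightarrow>
     bdF e (plus_part G) \<delta> \<Longrightarrow> bd m e 2 t \<delta> \<Longrightarrow>
     bd m e 0 (fF G t) (K * (\<delta>\<^sup>2 + e)) \<and> bd m e 1 (bF G t) (K * (\<delta>\<^sup>2 + e))"
    using F_bound[of "fullW G0 + 1"] by blast
  obtain K' where K': "K' \<ge> 0" "\<And>f b. fullW (solG f b) + \<bar>tsol f b\<bar> \<le> K' * (Wn m 0 f + Wn m 1 b)"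
    using sol_bound by blast
  define Ks where "Ks = (1 + 1 / \<bar>B\<bar>) * K'"
  have Ks: "Ks \<ge> 0" using K' by (simp add: Ks_def)
  \<comment> \<open>Chosen so that 4 Ks K delta <= 1 and 4 Ks K e <= delta, which together give the
    estimate \<open>small\<close>.\<close>
  define A where "A = 4 * (Ks * K) + 1"
  define \<delta> where "\<delta> = 1 / A"
  define e where "e = \<delta> / A"
  have A: "A \<ge> 1" using Ks K by (simp add: A_def)
  have d: "0 < \<delta>" "\<delta> \<le> 1" using A by (auto simp: \<delta>_def)
  have e: "0 < e" "e \<le> 1" using A d by (auto simp: e_def divide_le_eq)
  have small: "Ks * (2 * (K * (\<delta>\<^sup>2 + e))) \<le> \<delta>"
  proof -
    have "\<delta> * A = 1" "e * A = \<delta>" using A by (auto simp: \<delta>_def e_def)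
    then have "4 * (Ks * K) * \<delta> \<le> 1" "4 * (Ks * K) * e \<le> \<delta>"
      using d e by (auto simp: A_def algebra_simps)
    then have "4 * (Ks * K) * \<delta> * \<delta> \<le> 1 * \<delta>" using d by (intro mult_right_mono) auto
    then show ?thesis using \<open>4 * (Ks * K) * e \<le> \<delta>\<close> by (simp add: power2_eq_square algebra_simps)
  qed
  define an where "an i = fullW (Gs i) + \<bar>t i\<bar>" for i
  have an: "an i \<ge> 0" for i by (simp add: an_def)
  have anb: "an J \<le> Ks * (Wn m 0 (fF G (tser t) $ J) + Wn m 1 (bF G (tser t) $ J))" if J: "J \<ge> 1" for J
  proof -
    define f where "f = fF G (tser t) $ J"
    define b where "b = bF G (tser t) $ J"
    have "an J = fullW (solG f b) + \<bar>tsol f b\<bar> / \<bar>B\<bar>"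
      using recG[OF J] rect[OF J] FJ[OF J, of J] by (simp add: an_def f_def b_def abs_divide)
    also have "\<dots> \<le> (1 + 1 / \<bar>B\<bar>) * (fullW (solG f b) + \<bar>tsol f b\<bar>)"
      by (simp add: algebra_simps)
    also have "\<dots> \<le> (1 + 1 / \<bar>B\<bar>) * (K' * (Wn m 0 f + Wn m 1 b))"
      using K'(2) by (intro mult_left_mono) auto
    finally show ?thesis by (simp add: Ks_def f_def b_def)
  qed
  \<comment> \<open>The bound on orders below J also yields order J: the truncations satisfy the
    hypotheses of \<open>F_bound\<close>, and their right-hand sides are correct up to J.\<close>
  have Dn: "(\<Sum>i=1..<J. e ^ i * an i) \<le> \<delta>" for J
  proof (induction J)
    case 0
    then show ?case using d by simp
  next
    case (Suc J)
    show ?case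
    proof (cases "J = 0")
      case True
      then show ?thesis using d by simp
    next
      case False
      then have J: "J \<ge> 1" by simp
      have part: "(\<Sum>i\<le>n. if 1 \<le> i \<and> i < J then e ^ i * an i else 0) \<le> \<delta>" for n
      proof -
        have "(\<Sum>i\<le>n. if 1 \<le> i \<and> i < J then e ^ i * an i else 0) = (\<Sum>i\<in>{..n} \<inter> {1..<J}. e ^ i * an i)"
          by (simp add: sum.inter_restrict)
        also have "\<dots> \<le> (\<Sum>i=1..<J. e ^ i * an i)"
          using e an by (intro sum_mono2) auto
        finally show ?thesis using Suc by simp
      qed
      have pp: "bdF e (plus_part (GJ J)) \<delta>"
      proof -
        have "(\<Sum>i\<le>n. e ^ i * fullW (plus_part (GJ J) $ i)) \<le> (\<Sum>i\<le>n. if 1 \<le> i \<and> i < J then e ^ i * an i else 0)" for n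
          using e by (intro sum_mono) (auto simp: plus_part_def GJ an_def not_le)
        then show ?thesis using part e unfolding bdF_def by (meson order_trans less_imp_le)
      qed
      have "bdF e (GJ J) (fullW G0 + 1)"
      proof -
        have "(\<Sum>i\<le>n. e ^ i * fullW (GJ J $ i)) \<le> fullW G0 + 1" for n
        proof -
          have "(\<Sum>i\<le>n. e ^ i * fullW (GJ J $ i)) \<le> (\<Sum>i\<le>n. (if i = 0 then fullW G0 else 0) + (if 1 \<le> i \<and> i < J then e ^ i * an i else 0))"
            using e X0 J by (intro sum_mono) (auto simp: GJ an_def)
          also have "\<dots> \<le> fullW G0 + \<delta>" using part[of n] by (simp add: sum.distrib)
          finally show ?thesis using d by simp
        qed
        then show ?thesis using e by (simp add: bdF_def)
      qed
      moreover have "bd m e 2 (TJ J) \<delta>"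
      proof -
        have "(\<Sum>i\<le>n. e ^ i * Wn m 2 (TJ J $ i)) \<le> (\<Sum>i\<le>n. if 1 \<le> i \<and> i < J then e ^ i * an i else 0)" for n
          using e X0 by (intro sum_mono) (auto simp: TJ an_def not_le wt_def econst_simps)
        then show ?thesis using part e unfolding bd_def by (meson order_trans less_imp_le)
      qed
      ultimately have fb: "bd m e 0 (fF (GJ J) (TJ J)) (K * (\<delta>\<^sup>2 + e))" "bd m e 1 (bF (GJ J) (TJ J)) (K * (\<delta>\<^sup>2 + e))"
        using K(2)[of e \<delta> "GJ J" "TJ J"] e d pp by auto
      have "(\<Sum>i=1..<Suc J. e ^ i * an i)
         \<le> (\<Sum>i=1..<Suc J. Ks * (e ^ i * Wn m 0 (fF (GJ J) (TJ J) $ i) + e ^ i * Wn m 1 (bF (GJ J) (TJ J) $ i)))"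
      proof (rule sum_mono)
        fix i assume i: "i \<in> {1..<Suc J}"
        then have "an i \<le> Ks * (Wn m 0 (fF (GJ J) (TJ J) $ i) + Wn m 1 (bF (GJ J) (TJ J) $ i))"
          using anb[of i] FJ[OF J, of i] by simp
        from mult_left_mono[OF this, of "e ^ i"] e
        show "e ^ i * an i \<le> Ks * (e ^ i * Wn m 0 (fF (GJ J) (TJ J) $ i) + e ^ i * Wn m 1 (bF (GJ J) (TJ J) $ i))"
          by (simp add: algebra_simps)
      qed
      also have "\<dots> \<le> (\<Sum>i\<le>J. Ks * (e ^ i * Wn m 0 (fF (GJ J) (TJ J) $ i) + e ^ i * Wn m 1 (bF (GJ J) (TJ J) $ i)))"
        using e Ks by (intro sum_mono2) auto
      also have "\<dots> = Ks * ((\<Sum>i\<le>J. e ^ i * Wn m 0 (fF (GJ J) (TJ J) $ i)) + (\<Sum>i\<le>J. e ^ i * Wn m 1 (bF (GJ J) (TJ J) $ i)))"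
        unfolding sum.distrib[symmetric] sum_distrib_left ..
      also have "\<dots> \<le> Ks * (K * (\<delta>\<^sup>2 + e) + K * (\<delta>\<^sup>2 + e))"
        using fb Ks by (intro mult_left_mono add_mono) (auto simp: bd_def)
      also have "\<dots> \<le> \<delta>" using small by (simp add: algebra_simps)
      finally show ?thesis .
    qed
  qed
  define R where "R = fullW G0 + 1"
  have tot: "(\<Sum>i\<le>n. e ^ i * an i) \<le> R" for n
  proof -
    have "(\<Sum>i\<le>n. e ^ i * an i) = an 0 + (\<Sum>i=1..<Suc n. e ^ i * an i)"
      by (simp add: atLeast0AtMost[symmetric] atLeastLessThanSuc_atLeastAtMost sum.atLeast_Suc_atMost)
    also have "\<dots> \<le> an 0 + 1" using Dn[of "Suc n"] d by simp
    also have "an 0 = fullW G0" using X0 by (simp add: an_def)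
    finally show ?thesis by (simp add: R_def)
  qed
  have bG: "bdF e G R"
  proof -
    have "(\<Sum>i\<le>n. e ^ i * fullW (G $ i)) \<le> (\<Sum>i\<le>n. e ^ i * an i)" for n
      using e by (intro sum_mono mult_left_mono) (auto simp: an_def G_def)
    then show ?thesis using tot e unfolding bdF_def by (meson order_trans less_imp_le)
  qed
  have bT: "bd m e 2 (tser t) R"
  proof -
    have "(\<Sum>i\<le>n. e ^ i * Wn m 2 (tser t $ i)) \<le> (\<Sum>i\<le>n. e ^ i * an i)" for n
      using e by (intro sum_mono mult_left_mono) (auto simp: an_def tse wt_def)
    then show ?thesis using tot e unfolding bd_def by (meson order_trans less_imp_le)
  qed
  have G0': "G $ 0 = G0" by (simp add: G_def X0)
  have MG0: "lookup (Mop G0) k = (if k \<in> K1 then econst L0 * g0 else 0)" for k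
    by (simp add: lookup_cw lookup_G0 g0_eq L0_def econst_simps algebra_simps)
  have split: "smap Mop G = smap Mop (plus_part G) + fps_const (Mop G0)"
  proof (rule fps_ext)
    fix n show "smap Mop G $ n = (smap Mop (plus_part G) + fps_const (Mop G0)) $ n"
      by (cases "n = 0") (simp_all add: plus_part_def G0')
  qed
  \<comment> \<open>All terms beyond the linear part except \<open>2 * th0 * t\<close> times the
    order-zero term \<open>Mop G0\<close>: this one acts on the resonant modes and is reserved for
    the solvability condition.\<close>
  define f where "f = sc (2 * th0) * (tser t * smap Mop (plus_part G)) + tser t * (tser t * smap Mop G) + fps_X * Q1 G (tser t)"
  have fF: "fF G (tser t) = sc (- L0) * f" by (simp add: fF_def f_def)
  have "T2 (tser t) * smap Mop G + fps_X * Q1 G (tser t) = f + sc (2 * th0) * (tser t * fps_const (Mop G0))"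
  proof -
    have "sc (2 * th0) * (tser t * smap Mop G)
      = sc (2 * th0) * (tser t * smap Mop (plus_part G)) + sc (2 * th0) * (tser t * fps_const (Mop G0))"
      by (subst split) (simp only: distrib_left)
    then show ?thesis unfolding T2_def f_def by (simp only: distrib_right mult.assoc add_ac)
  qed
  then have lhs: "sc (th0\<^sup>2) * smap Mop G + smap (Lap m) G + T2 (tser t) * smap Mop G + fps_X * Q1 G (tser t)
     = sc (th0\<^sup>2) * smap Mop G + smap (Lap m) G + (f + sc (2 * th0) * (tser t * fps_const (Mop G0)))"
    by (simp add: add.assoc)
  have E1: "sc (th0\<^sup>2) * smap Mop G + smap (Lap m) G + T2 (tser t) * smap Mop G + fps_X * Q1 G (tser t) = 0"
    unfolding lhs
  proof (intro fps_ext poly_mapping_eqI ent_eqI)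
    fix n k i
    define g where "g = lookup (G $ n) k"
    define x where "x = sq m k"
    have L: "lookup ((sc (th0\<^sup>2) * smap Mop G + smap (Lap m) G + (f + sc (2 * th0) * (tser t * fps_const (Mop G0)))) $ n) k
       = econst (th0\<^sup>2) * (eD N g + econst (j\<^sup>2) * g) + econst (- x) * g
         + (lookup (f $ n) k + econst (2 * th0) * (econst (t n) * lookup (Mop G0) k))"
      by (simp add: lookup_add lookup_se_mult lookup_cw lookup_Lap tse lookup_single_0_mult g_def x_def)
    have "ecoeff (econst (th0\<^sup>2) * (eD N g + econst (j\<^sup>2) * g) + econst (- x) * g
         + (lookup (f $ n) k + econst (2 * th0) * (econst (t n) * lookup (Mop G0) k))) i = 0"
    proof (cases "n = 0")
      case True
      \<comment> \<open>At order 0 the equation is the eigenvalue relation th0^2 L0 = 1 for the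
        kernel element.\<close>
      have f0: "f $ 0 = 0" by (simp add: f_def tse X0 econst_simps)
      have g: "g = (if k \<in> K1 then g0 else 0)" by (simp add: g_def True G0' lookup_G0)
      show ?thesis
      proof (cases "k \<in> K1")
        case k: True
        then have "x = 1" by (simp add: x_def K1_def)
        have "th0\<^sup>2 * (- (qs * ecoeff g0 i) + j\<^sup>2 * ecoeff g0 i) - ecoeff g0 i = (th0\<^sup>2 * L0 - 1) * ecoeff g0 i"
          by (simp add: L0_def algebra_simps)
        then show ?thesis using True k f0 g \<open>x = 1\<close> X0 th0_L0
          by (simp add: econst_simps g0_eq)
      qed (use True f0 g X0 in \<open>simp add: econst_simps\<close>)
    next
      case False
      then have n: "n \<ge> 1" by simp
      define F where "F = lookup (fF G (tser t) $ n) k"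
      define b where "b = ev (lookup (bF G (tser t) $ n) k) 1"
      have g: "g = msol x F b"
        using recG[OF n] FJ[OF n, of n] by (simp add: g_def G_def lookup_solG F_def b_def x_def)
      have F: "F = econst (- L0) * lookup (f $ n) k" by (simp add: F_def fF lookup_se_mult)
      have eq: "ecoeff (eD N g) i = ecoeff F i + (if x = 1 then msol_coeff x F b * ecoeff (phi N qs) i else 0)
          - (j\<^sup>2 - L0 * x) * ecoeff g i"
        using arg_cong[OF msol_eq[of x F b], of "\<lambda>f. ecoeff f i"] by (simp add: g split: if_splits)
      have fi: "ecoeff (lookup (f $ n) k) i = - th0\<^sup>2 * ecoeff F i"
        using th0_L0 by (simp add: F mult.assoc[symmetric])
      \<comment> \<open>On resonant modes the defect of the linear problem cancels against the
        contribution of \<open>t n\<close>; on all others both terms vanish.\<close>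
      have main: "th0\<^sup>2 * (if x = 1 then msol_coeff x F b * ecoeff (phi N qs) i else 0)
         + 2 * th0 * (t n * ecoeff (lookup (Mop G0) k) i) = 0"
      proof (cases "k \<in> K1")
        case True
        then have x1: "x = 1" and kf: "k \<in> freqs m" by (auto simp: x_def K1_def)
        have sF: "sinv m (fF G (tser t))" "sinv m (bF G (tser t))" by (intro sinv_F sinvG sinv_t)+
        have "tsol (fF G (tser t) $ n) (bF G (tser t) $ n) = msol_coeff x F b"
          unfolding tsol_def F_def b_def x1
          using inv_pm_unit[of m "fF G (tser t) $ n" k] inv_pm_unit[of m "bF G (tser t) $ n" k] sF kf x1
          by (simp add: sinv_def x_def)
        then have "t n = - msol_coeff x F b / B" using rect[OF n] FJ[OF n, of n] by simp
        then have tn: "t n * B = - msol_coeff x F b" using B by simp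
        have "ecoeff (lookup (Mop G0) k) i = L0 * (gam / 2) * ecoeff (phi N qs) i"
          using True by (simp add: MG0 g0_def)
        then have "2 * th0 * (t n * ecoeff (lookup (Mop G0) k) i) = th0 * L0 * gam * t n * ecoeff (phi N qs) i"
          by simp
        also have "th0 * L0 * gam * t n = th0\<^sup>2 * (t n * B)"
        proof -
          have "th0\<^sup>2 * (t n * B) = (th0\<^sup>2 * L0) * (th0 * L0 * gam * t n)" by (simp add: B_def power2_eq_square)
          then show ?thesis unfolding th0_L0 by (simp only: mult_1)
        qed
        finally have fin: "2 * th0 * (t n * ecoeff (lookup (Mop G0) k) i) = th0\<^sup>2 * (t n * B) * ecoeff (phi N qs) i" .
        show ?thesis unfolding fin tn using x1 by simp
      next
        case k: False
        show ?thesis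
        proof (cases "x = 1")
          case True
          \<comment> \<open>A frequency with nonzero entries from index m on may also have
            \<open>sq\<close> = 1, but invariant series have no coefficient there.\<close>
          then have "k \<notin> freqs m" using k by (simp add: K1_def x_def)
          moreover have "sinv m (fF G (tser t))" "sinv m (bF G (tser t))" by (intro sinv_F sinvG sinv_t)+
          ultimately have "lookup (fF G (tser t) $ n) k = 0" "lookup (bF G (tser t) $ n) k = 0"
            unfolding sinv_def inv_pm_def by (meson in_keys_iff subsetD)+
          then show ?thesis using k True by (simp add: F_def b_def MG0)
        qed (simp add: MG0 k)
      qed
      have "ecoeff (econst (th0\<^sup>2) * (eD N g + econst (j\<^sup>2) * g) + econst (- x) * g
         + (lookup (f $ n) k + econst (2 * th0) * (econst (t n) * lookup (Mop G0) k))) i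
        = th0\<^sup>2 * (ecoeff (eD N g) i + j\<^sup>2 * ecoeff g i) - x * ecoeff g i + ecoeff (lookup (f $ n) k) i
          + 2 * th0 * (t n * ecoeff (lookup (Mop G0) k) i)"
        by simp
      also have "\<dots> = (th0\<^sup>2 * L0) * (x * ecoeff g i) - x * ecoeff g i
         + (th0\<^sup>2 * (if x = 1 then msol_coeff x F b * ecoeff (phi N qs) i else 0)
         + 2 * th0 * (t n * ecoeff (lookup (Mop G0) k) i))"
        unfolding eq fi by (simp add: algebra_simps)
      finally show ?thesis using main th0_L0 by simp
    qed
    then show "ecoeff (lookup ((sc (th0\<^sup>2) * smap Mop G + smap (Lap m) G + (f + sc (2 * th0) * (tser t * fps_const (Mop G0)))) $ n) k) i
      = ecoeff (lookup (0 $ n) k) i"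
      unfolding L by simp
  qed
  \<comment> \<open>The kernel element satisfies the Robin condition, so removing order 0 changes
    nothing on the boundary.\<close>
  have Bsplit: "smap Bop (plus_part G) = smap Bop G"
  proof (intro fps_ext poly_mapping_eqI)
    fix n k show "lookup (smap Bop (plus_part G) $ n) k = lookup (smap Bop G $ n) k"
      by (cases "n = 0") (simp_all add: plus_part_def G0' lookup_cw lookup_G0 robin_g0 econst_simps)
  qed
  define bb where "bb = sc a * (sc (2 * th0) * (tser t * smap Bop G) + tser t * (tser t * smap Bop G)) + fps_X * Q2 G (tser t)"
  have bF: "bF G (tser t) = sc (- (1 / (th0\<^sup>2 * a))) * bb" unfolding bF_def Bsplit bb_def ..
  have lhs2: "sc a * (TH (tser t) * smap Bop G) + fps_X * Q2 G (tser t) = sc a * (sc (th0\<^sup>2) * smap Bop G) + bb"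
    by (simp add: TH_def T2_def bb_def algebra_simps)
  have E2: "ev (lookup ((sc a * (TH (tser t) * smap Bop G) + fps_X * Q2 G (tser t)) $ n) k) 1 = 0" for n k
  proof -
    have L: "ev (lookup ((sc a * (TH (tser t) * smap Bop G) + fps_X * Q2 G (tser t)) $ n) k) 1
      = a * (th0\<^sup>2 * robin N (lookup (G $ n) k)) + ev (lookup (bb $ n) k) 1"
      unfolding lhs2 by (simp add: lookup_add lookup_se_mult lookup_cw econst_simps)
    show ?thesis
    proof (cases "n = 0")
      case True
      have "bb $ 0 = 0" by (simp add: bb_def tse X0 econst_simps)
      then show ?thesis unfolding L using True by (simp add: G0' lookup_G0 robin_g0)
    next
      case False
      then have n: "n \<ge> 1" by simp
      have "robin N (lookup (G $ n) k) = ev (lookup (bF G (tser t) $ n) k) 1"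
        using recG[OF n] FJ[OF n, of n] by (simp add: G_def lookup_solG robin_msol sq_Nats)
      then show ?thesis unfolding L bF using a_nz th0_pos by (simp add: lookup_se_mult)
    qed
  qed
  show ?thesis
    by (rule that[of e G t R]) (use e G0' X0 sinvG bG bT E1 E2 in auto)
qed

end

section \<open>Evaluation of the series\<close>

definition dot :: "nat \<Rightarrow> idx \<Rightarrow> (nat \<Rightarrow> real) \<Rightarrow> real"
  where "dot m k x = (\<Sum>i<m. real_of_int (k i) * x i)"

text \<open>The phase \<open>c\<close> takes care of derivatives: differentiating in x applies
  \<open>Kop\<close> and adds pi / 2 to \<open>c\<close>, so one kind of cosine sum represents all
  of them.\<close>

definition pr :: "nat \<Rightarrow> real \<Rightarrow> pm \<Rightarrow> real \<Rightarrow> (nat \<Rightarrow> real) \<Rightarrow> real"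
  where "pr m c p y x = (\<Sum>k\<in>keys p. ev (lookup p k) y * cos (dot m k x + c))"

text \<open>The complex sum is multiplicative for arbitrary factors, unlike the cosine sum
  \<open>pr\<close>; products are therefore computed here and carried over for invariant
  factors.\<close>

definition pc :: "nat \<Rightarrow> pm \<Rightarrow> real \<Rightarrow> (nat \<Rightarrow> real) \<Rightarrow> complex"
  where "pc m p y x = (\<Sum>k\<in>keys p. complex_of_real (ev (lookup p k) y) * cis (dot m k x))"

lemma dot_add: "dot m (k + l) x = dot m k x + dot m l x"
  by (simp add: dot_def distrib_right sum.distrib)

lemma dot_uminus: "dot m (- k) x = - dot m k x"
  by (simp add: dot_def sum_negf)

lemma pr_superset: "finite A \<Longrightarrow> keys p \<subseteq> A \<Longrightarrow> pr m c p y x = (\<Sum>k\<in>A. ev (lookup p k) y * cos (dot m k x + c))"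
  unfolding pr_def by (rule pm_superset_sum) auto

lemma pr_add: "pr m c (p + q) y x = pr m c p y x + pr m c q y x"
  unfolding pr_def by (rule pm_sum_add) (auto simp: algebra_simps)

lemma pr_0 [simp]: "pr m c 0 y x = 0"
  by (simp add: pr_def)

lemma pr_single [simp]: "pr m c (single k u) y x = ev u y * cos (dot m k x + c)"
  by (simp add: pr_def)

lemma pr_sum: "pr m c (sum f I) y x = (\<Sum>i\<in>I. pr m c (f i) y x)"
  by (induction I rule: infinite_finite_induct) (auto simp: pr_add)

lemma pc_add: "pc m (p + q) y x = pc m p y x + pc m q y x"
  unfolding pc_def by (rule pm_sum_add) (auto simp: algebra_simps)

lemma pc_0 [simp]: "pc m 0 y x = 0"
  by (simp add: pc_def)

lemma pc_single [simp]: "pc m (single k u) y x = complex_of_real (ev u y) * cis (dot m k x)"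
  by (simp add: pc_def)

lemma pc_uminus: "pc m (- p) y x = - pc m p y x"
  using pc_add[of m p "- p" y x] by (simp add: eq_neg_iff_add_eq_0 add.commute)

lemma pc_sum: "pc m (sum f I) y x = (\<Sum>i\<in>I. pc m (f i) y x)"
  by (induction I rule: infinite_finite_induct) (auto simp: pc_add)

lemma pc_mult: "pc m (p * q) y x = pc m p y x * pc m q y x"
proof -
  have "pc m (p * q) y x = (\<Sum>k\<in>keys p. \<Sum>l\<in>keys q.
      (complex_of_real (ev (lookup p k) y) * cis (dot m k x)) * (complex_of_real (ev (lookup q l) y) * cis (dot m l x)))"
    unfolding pm_mult_monomials[of p q] pc_sum by (simp add: dot_add mult_ac flip: cis_mult)
  then show ?thesis unfolding pc_def[of m p] pc_def[of m q] by (simp add: sum_product)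
qed

lemma pr_Re: "pr m c p y x = Re (cis c * pc m p y x)"
  by (simp add: pr_def pc_def sum_distrib_left cos_add algebra_simps sum_subtractf)

lemma sum_antisymmetric:
  fixes F :: "idx \<Rightarrow> real"
  assumes "\<And>k. k \<in> K \<Longrightarrow> - k \<in> K" "\<And>k. k \<in> K \<Longrightarrow> F (- k) = - F k"
  shows "sum F K = 0"
proof -
  have "sum F K = (\<Sum>k\<in>K. F (- k))"
    by (rule sum.reindex_bij_witness[of _ uminus uminus]) (use assms in auto)
  also have "\<dots> = - sum F K" using assms(2) by (simp add: sum_negf)
  finally show ?thesis by simp
qed

lemma inv_pm_uminus: "inv_pm m p \<Longrightarrow> lookup p (- k) = lookup p k"
  using Sym_uminus by (auto simp: inv_pm_def)

text \<open>Invariance under k -> - k cancels the sine terms.\<close>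

lemma pc_inv: "inv_pm m p \<Longrightarrow> pc m p y x = of_real (pr m 0 p y x)"
proof -
  assume p: "inv_pm m p"
  have "Im (pc m p y x) = (\<Sum>k\<in>keys p. ev (lookup p k) y * sin (dot m k x))"
    by (simp add: pc_def)
  also have "\<dots> = 0"
    by (rule sum_antisymmetric) (auto simp: in_keys_iff inv_pm_uminus[OF p] dot_uminus)
  finally show ?thesis by (simp add: complex_eq_iff pr_Re)
qed

text \<open>\<open>Kop\<close> makes the even coefficients odd, so here the cosine terms cancel and
  the phase pi / 2 picks up the sines.\<close>

lemma pc_Kop: "inv_pm m p \<Longrightarrow> pc m (Kop i p) y x = - \<i> * of_real (pr m (pi / 2) (Kop i p) y x)"
proof -
  assume p: "inv_pm m p"
  have "Re (pc m (Kop i p) y x) = pr m 0 (Kop i p) y x" by (simp add: pr_Re)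
  also have "\<dots> = (\<Sum>k\<in>keys p. ev (lookup (Kop i p) k) y * cos (dot m k x + 0))"
    by (rule pr_superset) (auto simp: Kop_def intro: subsetD[OF keys_cw])
  also have "\<dots> = 0"
    by (rule sum_antisymmetric) (auto simp: in_keys_iff lookup_Kop inv_pm_uminus[OF p] dot_uminus)
  finally show ?thesis by (simp add: complex_eq_iff pr_Re)
qed

lemma pr_mult:
  assumes "inv_pm m p" "inv_pm m q"
  shows "pr m 0 (p * q) y x = pr m 0 p y x * pr m 0 q y x"
  using assms by (simp add: pr_Re pc_mult) (simp add: pc_inv)

lemma pr_gp:
  assumes "inv_pm m p" "inv_pm m q"
  shows "pr m 0 (gp m p q) y x = (\<Sum>i<m. pr m (pi / 2) (Kop i p) y x * pr m (pi / 2) (Kop i q) y x)"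
proof -
  have "pc m (gp m p q) y x = - (\<Sum>i<m. (- \<i> * of_real (pr m (pi / 2) (Kop i p) y x)) * (- \<i> * of_real (pr m (pi / 2) (Kop i q) y x)))"
    using assms by (simp add: gp_def pc_uminus pc_sum pc_mult pc_Kop)
  also have "\<dots> = of_real (\<Sum>i<m. pr m (pi / 2) (Kop i p) y x * pr m (pi / 2) (Kop i q) y x)"
    by (simp add: sum_negf[symmetric] algebra_simps flip: mult.assoc[of \<i> \<i>])
  finally show ?thesis by (simp add: pr_Re[of m 0])
qed

lemma pr_bound:
  assumes "0 \<le> y" "y \<le> 1"
  shows "\<bar>pr m c p y x\<bar> \<le> Wn m 0 p"
  unfolding pr_def Wn_def
proof (rule order_trans[OF sum_abs sum_mono])
  fix k
  have "1 * (\<bar>ev (lookup p k) y\<bar> * \<bar>cos (dot m k x + c)\<bar>) \<le> wt m 0 k * (nrm (lookup p k) * 1)"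
    using assms ev_le_nrm[of y "lookup p k"] by (intro mult_mono) (auto simp: wt_def)
  then show "\<bar>ev (lookup p k) y * cos (dot m k x + c)\<bar> \<le> wt m 0 k * nrm (lookup p k)" by (simp add: abs_mult)
qed

lemma pr_cw_scale:
  assumes "F 0 = 0" "\<And>c. ev (F c) y = a * ev c y"
  shows "pr m c (cw (\<lambda>_. F) p) y x = a * pr m c p y x"
proof -
  have "pr m c (cw (\<lambda>_. F) p) y x = (\<Sum>k\<in>keys p. ev (lookup (cw (\<lambda>_. F) p) k) y * cos (dot m k x + c))"
    by (rule pr_superset) (auto intro: subsetD[OF keys_cw])
  then show ?thesis using assms by (simp add: lookup_cw pr_def sum_distrib_left mult_ac)
qed

definition EvR :: "nat \<Rightarrow> real \<Rightarrow> real \<Rightarrow> ser \<Rightarrow> real \<Rightarrow> (nat \<Rightarrow> real) \<Rightarrow> real"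
  where "EvR m s c A y x = suminf (\<lambda>J. s ^ J * pr m c (A $ J) y x)"

text \<open>The weight \<open>y\<^sup>r\<^sup>/\<^sup>2\<close> is needed for the second derivatives at the axis \<open>t = 0\<close>.\<close>

definition good :: "nat \<Rightarrow> real \<Rightarrow> nat \<Rightarrow> ser \<Rightarrow> bool"
  where "good m e r A \<longleftrightarrow> e \<ge> 0 \<and> (\<exists>\<beta>. (\<forall>J c y x. 0 \<le> y \<longrightarrow> y \<le> 1 \<longrightarrow> sqrt y ^ r * \<bar>pr m c (A $ J) y x\<bar> \<le> \<beta> J) \<and>
    summable (\<lambda>J. e ^ J * \<beta> J))"

lemma good_fullW:
  assumes "bd m e a A R" "K \<ge> 0"
    "\<And>J c y x. 0 \<le> y \<Longrightarrow> y \<le> 1 \<Longrightarrow> sqrt y ^ r * \<bar>pr m c (B $ J) y x\<bar> \<le> K * Wn m a (A $ J)"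
  shows "good m e r B"
proof -
  have "summable (\<lambda>J. e ^ J * Wn m a (A $ J))"
    using assms(1) by (intro bounded_imp_summable[of _ R]) (auto simp: bd_def)
  then have "summable (\<lambda>J. K * (e ^ J * Wn m a (A $ J)))" by (rule summable_mult)
  then show ?thesis unfolding good_def using assms
    by (intro conjI exI[of _ "\<lambda>J. K * Wn m a (A $ J)"]) (auto simp: mult_ac bd_def)
qed

lemma good_bd: "bd m e 0 A R \<Longrightarrow> good m e 0 A"
  by (rule good_fullW[of m e 0 A R 1]) (use pr_bound in auto)

text \<open>A prefactor \<open>b\<close> of size sqrt y ^ r supplies the weight under which the
  terms are bounded. The majorant is independent of x, y and the phase, as termwise differentiation
  and uniform limits require.\<close>

lemma good_majorant:
  assumes A: "good m e r A"
  obtains M where "summable M" "\<And>J. M J \<ge> 0" "\<And>s y b B J c x. \<bar>s\<bar> \<le> e \<Longrightarrow> 0 \<le> y \<Longrightarrow> y \<le> 1 \<Longrightarrow> \<bar>b\<bar> \<le> B * sqrt y ^ r \<Longrightarrow>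
    \<bar>b * (s ^ J * pr m c (A $ J) y x)\<bar> \<le> \<bar>B\<bar> * M J"
proof -
  obtain \<beta> where \<beta>: "\<And>J c y x. 0 \<le> y \<Longrightarrow> y \<le> 1 \<Longrightarrow> sqrt y ^ r * \<bar>pr m c (A $ J) y x\<bar> \<le> \<beta> J"
    "summable (\<lambda>J. e ^ J * \<beta> J)" using A unfolding good_def by blast
  have \<beta>0: "\<beta> J \<ge> 0" for J 
    using order_trans[OF _ \<beta>(1)[where y = 1 and J = J]] by fastforce
  have le: "\<bar>b * (s ^ J * pr m c (A $ J) y x)\<bar> \<le> \<bar>B\<bar> * \<bar>e ^ J * \<beta> J\<bar>"
    if s: "\<bar>s\<bar> \<le> e" and y: "0 \<le> y" "y \<le> 1" and b: "\<bar>b\<bar> \<le> B * sqrt y ^ r" for s y b B J c x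
  proof -
    have "\<bar>b\<bar> * \<bar>pr m c (A $ J) y x\<bar> \<le> \<bar>B\<bar> * sqrt y ^ r * \<bar>pr m c (A $ J) y x\<bar>"
      by (rule mult_right_mono[OF order_trans[OF b mult_right_mono]]) (use y in auto)
    also have "\<dots> \<le> \<bar>B\<bar> * \<beta> J" unfolding mult.assoc using \<beta>(1)[OF y] by (intro mult_left_mono) auto
    finally have c1: "\<bar>b\<bar> * \<bar>pr m c (A $ J) y x\<bar> \<le> \<bar>B\<bar> * \<beta> J" .
    have "\<bar>s\<bar> ^ J * (\<bar>b\<bar> * \<bar>pr m c (A $ J) y x\<bar>) \<le> e ^ J * (\<bar>B\<bar> * \<beta> J)"
      by (rule mult_mono[OF power_mono[OF s abs_ge_zero] c1]) (use s in auto)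
    also have "\<dots> = \<bar>B\<bar> * \<bar>e ^ J * \<beta> J\<bar>" using s \<beta>0[of J] by (simp add: abs_mult)
    finally show ?thesis by (simp add: abs_mult power_abs mult_ac)
  qed
  have "summable (\<lambda>J. \<bar>e ^ J * \<beta> J\<bar>)"
    using A \<beta>(2) \<beta>0 by (simp add: abs_mult good_def)
  then show ?thesis using le by (intro that[of "\<lambda>J. \<bar>e ^ J * \<beta> J\<bar>"]) auto
qed

lemma good_summable:
  assumes A: "good m e r A" and s: "\<bar>s\<bar> \<le> e" and y: "0 \<le> y" "y \<le> 1" and b: "\<bar>b\<bar> \<le> B * sqrt y ^ r"
  shows "summable (\<lambda>J. \<bar>b * (s ^ J * pr m c (A $ J) y x)\<bar>)" "summable (\<lambda>J. b * (s ^ J * pr m c (A $ J) y x))"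
    "suminf (\<lambda>J. b * (s ^ J * pr m c (A $ J) y x)) = b * EvR m s c A y x"
proof -
  obtain M where M: "summable M" "\<And>J. \<bar>b * (s ^ J * pr m c (A $ J) y x)\<bar> \<le> \<bar>B\<bar> * M J"
    using good_majorant[OF A] s y b by metis
  show "summable (\<lambda>J. \<bar>b * (s ^ J * pr m c (A $ J) y x)\<bar>)"
    by (rule summable_comparison_test'[OF summable_mult[OF M(1), of "\<bar>B\<bar>"], of 0]) (use M(2) in auto)
  then show 2: "summable (\<lambda>J. b * (s ^ J * pr m c (A $ J) y x))" by (rule summable_rabs_cancel)
  show "suminf (\<lambda>J. b * (s ^ J * pr m c (A $ J) y x)) = b * EvR m s c A y x"
  proof (cases "b = 0")
    case False
    have "summable (\<lambda>J. (1 / b) * (b * (s ^ J * pr m c (A $ J) y x)))" using 2 by (rule summable_mult)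
    then have "summable (\<lambda>J. s ^ J * pr m c (A $ J) y x)" using False by simp
    then show ?thesis unfolding EvR_def by (rule suminf_mult)
  qed simp
qed

lemma good_summable0:
  assumes "good m e 0 A" "\<bar>s\<bar> \<le> e" "0 \<le> y" "y \<le> 1"
  shows "summable (\<lambda>J. \<bar>s ^ J * pr m c (A $ J) y x\<bar>)" "summable (\<lambda>J. s ^ J * pr m c (A $ J) y x)"
  using good_summable(1,2)[OF assms, of 1 1] by auto

lemma EvR_add:
  assumes "good m e 0 A" "good m e 0 B" "\<bar>s\<bar> \<le> e" "0 \<le> y" "y \<le> 1"
  shows "EvR m s c (A + B) y x = EvR m s c A y x + EvR m s c B y x"
  unfolding EvR_def using suminf_add[OF good_summable0(2)[OF assms(1,3-)] good_summable0(2)[OF assms(2,3-)]]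
  by (simp add: pr_add distrib_left)

lemma EvR_mult:
  assumes "good m e 0 A" "good m e 0 B" "sinv m A" "sinv m B" "\<bar>s\<bar> \<le> e" "0 \<le> y" "y \<le> 1"
  shows "EvR m s 0 (A * B) y x = EvR m s 0 A y x * EvR m s 0 B y x"
proof -
  have "s ^ J * pr m 0 ((A * B) $ J) y x = (\<Sum>i\<le>J. (s ^ i * pr m 0 (A $ i) y x) * (s ^ (J - i) * pr m 0 (B $ (J - i)) y x))" for J
  proof -
    have "s ^ J * pr m 0 ((A * B) $ J) y x = (\<Sum>i\<le>J. s ^ J * (pr m 0 (A $ i) y x * pr m 0 (B $ (J - i)) y x))"
      using assms(3,4) by (simp add: fps_mult_nth atLeast0AtMost pr_sum pr_mult sinv_def sum_distrib_left)
    also have "\<dots> = (\<Sum>i\<le>J. (s ^ i * pr m 0 (A $ i) y x) * (s ^ (J - i) * pr m 0 (B $ (J - i)) y x))"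
    proof (rule sum.cong)
      fix i assume "i \<in> {..J}"
      then have "s ^ J = s ^ i * s ^ (J - i)" by (simp flip: power_add)
      then show "s ^ J * (pr m 0 (A $ i) y x * pr m 0 (B $ (J - i)) y x)
        = (s ^ i * pr m 0 (A $ i) y x) * (s ^ (J - i) * pr m 0 (B $ (J - i)) y x)" by simp
    qed simp
    finally show ?thesis .
  qed
  then show ?thesis unfolding EvR_def
    using Cauchy_product[of "\<lambda>J. s ^ J * pr m 0 (A $ J) y x" "\<lambda>J. s ^ J * pr m 0 (B $ J) y x"]
      good_summable0(1)[OF assms(1,5-)] good_summable0(1)[OF assms(2,5-)] by simp
qed

lemma EvR_const: "EvR m s c (fps_const p) y x = pr m c p y x"
proof -
  have "(\<lambda>J. s ^ J * pr m c (fps_const p $ J) y x) = (\<lambda>J. if J = 0 then pr m c p y x else 0)"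
    by (auto simp: fun_eq_iff)
  then show ?thesis unfolding EvR_def using sums_single[of 0 "\<lambda>_. pr m c p y x"] by (simp add: sums_iff)
qed

lemma EvR_se: "EvR m s 0 (se u) y x = ev u y"
  unfolding se_def EvR_const by (simp add: dot_def)

lemma EvR_sc: "EvR m s 0 (sc r) y x = r"
  by (simp add: EvR_se)

lemma EvR_X: "EvR m s 0 fps_X y x = s"
proof -
  have "pr m 0 (1 :: pm) y x = 1" using pr_single[of m 0 0 1 y x] by (simp add: dot_def)
  then have "(\<lambda>J. s ^ J * pr m 0 (fps_X $ J) y x) = (\<lambda>J. if J = 1 then s else 0)"
    by (auto simp: fun_eq_iff fps_X_def)
  then show ?thesis unfolding EvR_def using sums_single[of 1 "\<lambda>_. s"] by (simp add: sums_iff)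
qed

lemma EvR_sgp:
  assumes A: "\<And>i. i < m \<Longrightarrow> good m e 0 (smap (Kop i) A)" and B: "\<And>i. i < m \<Longrightarrow> good m e 0 (smap (Kop i) B)"
    and i: "sinv m A" "sinv m B" and s: "\<bar>s\<bar> \<le> e" "0 \<le> y" "y \<le> 1"
  shows "EvR m s 0 (sgp m A B) y x
    = (\<Sum>i<m. EvR m s (pi / 2) (smap (Kop i) A) y x * EvR m s (pi / 2) (smap (Kop i) B) y x)"
proof -
  define a where "a l J = s ^ J * pr m (pi / 2) (Kop l (A $ J)) y x" for l J
  define b where "b l J = s ^ J * pr m (pi / 2) (Kop l (B $ J)) y x" for l J
  have sa: "summable (\<lambda>J. norm (a l J))" "summable (\<lambda>J. norm (b l J))" if "l < m" for l
    using good_summable0(1)[OF A[OF that] s, of "pi / 2" x] good_summable0(1)[OF B[OF that] s, of "pi / 2" x]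
    by (simp_all add: a_def b_def)
  have "s ^ J * pr m 0 (sgp m A B $ J) y x = (\<Sum>l<m. \<Sum>i\<le>J. a l i * b l (J - i))" for J
  proof -
    have "s ^ J * pr m 0 (sgp m A B $ J) y x = (\<Sum>i\<le>J. \<Sum>l<m. s ^ J * (pr m (pi / 2) (Kop l (A $ i)) y x * pr m (pi / 2) (Kop l (B $ (J - i))) y x))"
      using i by (simp add: sgp_nth pr_sum pr_gp sinv_def sum_distrib_left)
    also have "\<dots> = (\<Sum>i\<le>J. \<Sum>l<m. a l i * b l (J - i))"
    proof (intro sum.cong)
      fix i l assume "i \<in> {..J}"
      then have "s ^ J = s ^ i * s ^ (J - i)" by (simp flip: power_add)
      then show "s ^ J * (pr m (pi / 2) (Kop l (A $ i)) y x * pr m (pi / 2) (Kop l (B $ (J - i))) y x) = a l i * b l (J - i)"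
        by (simp add: a_def b_def)
    qed simp_all
    also have "\<dots> = (\<Sum>l<m. \<Sum>i\<le>J. a l i * b l (J - i))" by (rule sum.swap)
    finally show ?thesis .
  qed
  then have "EvR m s 0 (sgp m A B) y x = suminf (\<lambda>J. \<Sum>l<m. \<Sum>i\<le>J. a l i * b l (J - i))"
    by (simp add: EvR_def)
  also have "\<dots> = (\<Sum>l<m. suminf (\<lambda>J. \<Sum>i\<le>J. a l i * b l (J - i)))"
    using summable_Cauchy_product[OF sa] by (intro suminf_sum) auto
  also have "\<dots> = (\<Sum>l<m. suminf (a l) * suminf (b l))"
    using Cauchy_product[OF sa] by (intro sum.cong) auto
  also have "\<dots> = (\<Sum>i<m. EvR m s (pi / 2) (smap (Kop i) A) y x * EvR m s (pi / 2) (smap (Kop i) B) y x)"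
    by (simp add: EvR_def a_def[abs_def] b_def[abs_def])
  finally show ?thesis .
qed

lemma pr_Lap: "pr m c (Lap m p) y x = (\<Sum>i<m. pr m (c + pi) (Kop i (Kop i p)) y x)"
proof -
  have L: "pr m c (Lap m p) y x = (\<Sum>k\<in>keys p. - sq m k * (ev (lookup p k) y * cos (dot m k x + c)))"
    using pr_superset[of "keys p" "Lap m p" m c y x] keys_cw[of _ p]
    by (simp add: Lap_def lookup_cw mult_ac)
  have K: "pr m (c + pi) (Kop i (Kop i p)) y x
     = (\<Sum>k\<in>keys p. - (real_of_int (k i))\<^sup>2 * (ev (lookup p k) y * cos (dot m k x + c)))" for i
  proof -
    have "keys (Kop i (Kop i p)) \<subseteq> keys p" using keys_cw unfolding Kop_def by blast
    then show ?thesis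
      by (subst pr_superset[of "keys p"]) (auto simp: lookup_Kop power2_eq_square add.assoc[symmetric] mult_ac intro!: sum.cong)
  qed
  show ?thesis unfolding L K by (subst sum.swap) (simp add: sq_def sum_distrib_right sum_negf)
qed

definition Dif :: "pm \<Rightarrow> pm" where "Dif = cw (\<lambda>_. ediff)"

lemma lookup_Dif: "lookup (Dif p) k = ediff (lookup p k)"
  by (simp add: Dif_def lookup_cw)

text \<open>Chain rule along a curve on which y moves and, if \<open>flag\<close> holds, x moves
  with unit speed in coordinate i. The coordinate lines of the domain are of this form, in t and in
  x.\<close>

lemma pr_has_derivative:
  assumes x: "\<And>k. ((\<lambda>u. dot m k (xs u)) has_real_derivative (if flag then real_of_int (k i) else 0)) (at u)"
    and y: "(y has_real_derivative y') (at u)"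
  shows "((\<lambda>u. pr m c p (y u) (xs u)) has_real_derivative
    y' * pr m c (Dif p) (y u) (xs u) + (if flag then pr m (c + pi / 2) (Kop i p) (y u) (xs u) else 0)) (at u)"
proof -
  have D: "pr m c (Dif p) (y u) (xs u) = (\<Sum>k\<in>keys p. ev (ediff (lookup p k)) (y u) * cos (dot m k (xs u) + c))"
    by (subst pr_superset[of "keys p"]) (auto simp: Dif_def lookup_cw intro: subsetD[OF keys_cw])
  have K: "pr m (c + pi / 2) (Kop i p) (y u) (xs u)
      = (\<Sum>k\<in>keys p. real_of_int (k i) * ev (lookup p k) (y u) * - sin (dot m k (xs u) + c))"
  proof -
    have "cos (v + (c + pi / 2)) = - sin (v + c)" for v
      by (simp add: cos_add sin_add)
    then show ?thesis
      by (subst pr_superset[of "keys p"]) (auto simp: Kop_def intro: subsetD[OF keys_cw] simp: lookup_cw)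
  qed
  have "((\<lambda>u. pr m c p (y u) (xs u)) has_real_derivative
     (\<Sum>k\<in>keys p. (ev (ediff (lookup p k)) (y u) * y') * cos (dot m k (xs u) + c)
       + (- sin (dot m k (xs u) + c) * (if flag then real_of_int (k i) else 0)) * ev (lookup p k) (y u))) (at u)"
    unfolding pr_def
    by (rule DERIV_sum, rule DERIV_mult[OF ev_has_derivative[OF y]])
      (use x in \<open>auto intro!: derivative_eq_intros\<close>)
  then show ?thesis
    by (rule DERIV_cong) (cases flag; simp add: D K sum.distrib sum_distrib_left mult_ac sum_negf sum_subtractf)
qed

text \<open>Termwise differentiation by the Weierstrass test. The prefactor p stays inside the
  series because the y-derivative may converge uniformly only after multiplication by p y', which is
  small at the axis.\<close>

lemma EvR_slice:
  assumes S: "open S" "convex S" "u0 \<in> S" and s: "\<bar>s\<bar> \<le> e"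
    and x: "\<And>k u. u \<in> S \<Longrightarrow> ((\<lambda>u. dot m k (xs u)) has_real_derivative (if flag then real_of_int (k i) else 0)) (at u)"
    and y: "\<And>u. u \<in> S \<Longrightarrow> (y has_real_derivative y' u) (at u)" "\<And>u. u \<in> S \<Longrightarrow> 0 \<le> y u \<and> y u \<le> 1"
    and p: "\<And>u. u \<in> S \<Longrightarrow> (p has_real_derivative p' u) (at u)"
    and B: "\<And>u. u \<in> S \<Longrightarrow> \<bar>p u\<bar> \<le> B" "\<And>u. u \<in> S \<Longrightarrow> \<bar>p' u\<bar> \<le> B"
      "\<And>u. u \<in> S \<Longrightarrow> \<bar>p u * y' u\<bar> \<le> B * sqrt (y u) ^ r1"
      "\<And>u. u \<in> S \<Longrightarrow> flag \<Longrightarrow> \<bar>p u\<bar> \<le> B * sqrt (y u) ^ r2"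
    and good: "good m e 0 A" "good m e r1 (smap Dif A)" "flag \<Longrightarrow> good m e r2 (smap (Kop i) A)"
  shows "((\<lambda>u. p u * EvR m s c A (y u) (xs u)) has_real_derivative
     p' u0 * EvR m s c A (y u0) (xs u0) + p u0 * y' u0 * EvR m s c (smap Dif A) (y u0) (xs u0)
     + (if flag then p u0 * EvR m s (c + pi / 2) (smap (Kop i) A) (y u0) (xs u0) else 0)) (at u0)"
proof -
  define f where "f J u = p u * (s ^ J * pr m c (A $ J) (y u) (xs u))" for J u
  define f1 where "f1 J u = p' u * (s ^ J * pr m c (A $ J) (y u) (xs u))" for J u
  define f2 where "f2 J u = p u * y' u * (s ^ J * pr m c (smap Dif A $ J) (y u) (xs u))" for J u
  define f3 where "f3 J u = (if flag then p u * (s ^ J * pr m (c + pi / 2) (smap (Kop i) A $ J) (y u) (xs u)) else 0)" for J u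
  have yu: "0 \<le> y u" "y u \<le> 1" if "u \<in> S" for u using y(2)[OF that] by auto
  have B0: "\<bar>p u\<bar> \<le> B * sqrt (y u) ^ 0" "\<bar>p' u\<bar> \<le> B * sqrt (y u) ^ 0" if "u \<in> S" for u
    using B(1,2)[OF that] by auto
  obtain M1 where M1: "summable M1" "\<And>J u. u \<in> S \<Longrightarrow> \<bar>f1 J u\<bar> \<le> \<bar>B\<bar> * M1 J"
    using good_majorant[OF good(1)] s yu B0(2) unfolding f1_def by metis
  obtain M2 where M2: "summable M2" "\<And>J u. u \<in> S \<Longrightarrow> \<bar>f2 J u\<bar> \<le> \<bar>B\<bar> * M2 J"
    using good_majorant[OF good(2)] s yu B(3) unfolding f2_def by metis
  obtain M3 where M3: "summable M3" "\<And>J u. u \<in> S \<Longrightarrow> \<bar>f3 J u\<bar> \<le> \<bar>B\<bar> * M3 J"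
  proof (cases flag)
    case True
    obtain M3 where "summable M3" "\<And>J u. u \<in> S \<Longrightarrow> \<bar>p u * (s ^ J * pr m (c + pi / 2) (smap (Kop i) A $ J) (y u) (xs u))\<bar> \<le> \<bar>B\<bar> * M3 J"
      using good_majorant[OF good(3)[OF True]] s yu B(4)[OF _ True] by metis
    then show ?thesis using that True by (simp add: f3_def)
  next
    case False
    then show ?thesis using that[of "\<lambda>_. 0"] by (simp add: f3_def)
  qed
  have df: "(f J has_real_derivative f1 J u + f2 J u + f3 J u) (at u within S)" if u: "u \<in> S" for J u
  proof -
    have "(f J has_real_derivative p' u * (s ^ J * pr m c (A $ J) (y u) (xs u)) + (s ^ J * (y' u * pr m c (Dif (A $ J)) (y u) (xs u)
       + (if flag then pr m (c + pi / 2) (Kop i (A $ J)) (y u) (xs u) else 0))) * p u) (at u)"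
      unfolding f_def by (rule DERIV_mult[OF p[OF u] DERIV_cmult[OF pr_has_derivative[OF x[OF u] y(1)[OF u]]]])
    then have "(f J has_real_derivative f1 J u + f2 J u + f3 J u) (at u)"
      by (rule DERIV_cong) (simp add: f1_def f2_def f3_def algebra_simps)
    then show ?thesis by (rule has_field_derivative_at_within)
  qed
  have unif: "uniformly_convergent_on S (\<lambda>n u. \<Sum>J<n. f1 J u + f2 J u + f3 J u)"
  proof (rule Weierstrass_m_test')
    show "summable (\<lambda>J. \<bar>B\<bar> * M1 J + \<bar>B\<bar> * M2 J + \<bar>B\<bar> * M3 J)"
      by (intro summable_add summable_mult M1 M2 M3)
    show "norm (f1 J u + f2 J u + f3 J u) \<le> \<bar>B\<bar> * M1 J + \<bar>B\<bar> * M2 J + \<bar>B\<bar> * M3 J" if "u \<in> S" for J u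
      using M1(2)[OF that, of J] M2(2)[OF that, of J] M3(2)[OF that, of J] unfolding real_norm_def by linarith
  qed
  have fs: "summable (\<lambda>J. f J u0)"
    using good_summable(2)[OF good(1) s yu B0(1)] S(3) unfolding f_def by blast
  have "interior S = S" using S(1) interior_open by blast
  then have der: "((\<lambda>u. suminf (\<lambda>J. f J u)) has_real_derivative suminf (\<lambda>J. f1 J u0 + f2 J u0 + f3 J u0)) (at u0)"
    using has_field_derivative_series'(2)[OF S(2) df unif S(3) fs, of u0] S(3) by simp
  have sf: "suminf (\<lambda>J. f J u) = p u * EvR m s c A (y u) (xs u)" if "u \<in> S" for u
    unfolding f_def using good_summable(3)[OF good(1) s yu[OF that] B0(1)[OF that]] .
  have s1: "summable (\<lambda>J. f1 J u0)" "suminf (\<lambda>J. f1 J u0) = p' u0 * EvR m s c A (y u0) (xs u0)"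
    unfolding f1_def using good_summable(2,3)[OF good(1) s yu B0(2)] S(3) by blast+
  have s2: "summable (\<lambda>J. f2 J u0)" "suminf (\<lambda>J. f2 J u0) = p u0 * y' u0 * EvR m s c (smap Dif A) (y u0) (xs u0)"
    unfolding f2_def using good_summable(2,3)[OF good(2) s yu B(3)] S(3) by blast+
  have s3: "summable (\<lambda>J. f3 J u0) \<and> suminf (\<lambda>J. f3 J u0) = (if flag then p u0 * EvR m s (c + pi / 2) (smap (Kop i) A) (y u0) (xs u0) else 0)"
  proof (cases flag)
    case True
    show ?thesis unfolding f3_def using True good_summable(2,3)[OF good(3)[OF True] s yu B(4)[OF _ True]] S(3) by auto
  qed (simp add: f3_def)
  have "suminf (\<lambda>J. f1 J u0 + f2 J u0 + f3 J u0) = p' u0 * EvR m s c A (y u0) (xs u0) + p u0 * y' u0 * EvR m s c (smap Dif A) (y u0) (xs u0)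
     + (if flag then p u0 * EvR m s (c + pi / 2) (smap (Kop i) A) (y u0) (xs u0) else 0)"
    using suminf_add[OF summable_add[OF s1(1) s2(1)] conjunct1[OF s3]] suminf_add[OF s1(1) s2(1)] s1(2) s2(2) s3 by simp
  then show ?thesis using der has_field_derivative_transform_within_open[OF _ S(1) S(3) sf] by simp
qed

lemma EvR_continuous:
  fixes y p :: "'a::t2_space \<Rightarrow> real"
  assumes s: "\<bar>s\<bar> \<le> e" and x: "\<And>i. i < m \<Longrightarrow> continuous_on S (\<lambda>z. xs z i)"
    and y: "continuous_on S y" "\<And>z. z \<in> S \<Longrightarrow> 0 \<le> y z \<and> y z \<le> 1"
    and p: "continuous_on S p" "\<And>z. z \<in> S \<Longrightarrow> \<bar>p z\<bar> \<le> B * sqrt (y z) ^ r" and good: "good m e r A"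
  shows "continuous_on S (\<lambda>z. p z * EvR m s c A (y z) (xs z))"
proof -
  define f where "f J z = p z * (s ^ J * pr m c (A $ J) (y z) (xs z))" for J z
  have yz: "0 \<le> y z" "y z \<le> 1" if "z \<in> S" for z using y(2)[OF that] by auto
  obtain M where M: "summable M" "\<And>J z. z \<in> S \<Longrightarrow> \<bar>f J z\<bar> \<le> \<bar>B\<bar> * M J"
    using good_majorant[OF good] s yz p(2) unfolding f_def by metis
  have "uniform_limit S (\<lambda>n z. \<Sum>J<n. f J z) (\<lambda>z. suminf (\<lambda>J. f J z)) sequentially"
    using M by (intro Weierstrass_m_test[of S f "\<lambda>J. \<bar>B\<bar> * M J"] summable_mult) auto
  moreover have "continuous_on S (\<lambda>z. \<Sum>J<n. f J z)" for n
    unfolding f_def pr_def dot_def by (intro continuous_intros p y x) auto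
  ultimately have "continuous_on S (\<lambda>z. suminf (\<lambda>J. f J z))"
    by (intro uniform_limit_theorem) auto
  moreover have "suminf (\<lambda>J. f J z) = p z * EvR m s c A (y z) (xs z)" if "z \<in> S" for z
    unfolding f_def using good_summable(3)[OF good s yz[OF that] p(2)[OF that]] .
  ultimately show ?thesis by (simp cong: continuous_on_cong)
qed

section \<open>The series of V, theta and h\<close>

locale bif_solution = bif +
  fixes e R :: real and G :: ser and t :: "nat \<Rightarrow> real"
  assumes e: "0 < e" "e \<le> 1" and G0: "G $ 0 = G0" and t0: "t 0 = 0" and invG: "sinv m G"
    and bdG: "bdF e G R" and bdt: "bd m e 2 (tser t) R"
    and E1: "sc (th0\<^sup>2) * smap Mop G + smap (Lap m) G + T2 (tser t) * smap Mop G + fps_X * Q1 G (tser t) = 0"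
    and E2: "\<And>n k. ev (lookup ((sc a * (TH (tser t) * smap Bop G) + fps_X * Q2 G (tser t)) $ n) k) 1 = 0"
begin

definition Z :: ser where "Z = Zs G"
definition Y :: ser where "Y = Ys G"
definition V :: ser where "V = se U + fps_X * Y"
definition TT :: ser where "TT = sc th0 + tser t"
definition H :: ser where "H = TT * (1 + fps_X * Z)"

lemma e0: "e \<ge> 0"
  using e by simp

lemma component_bound:
  obtains K where "bd m e 2 Z K" "bdF e Y K" "bd m e 0 (smap Dop Y) K" "bd m e 1 (smap Rop Y) K"
    "bd m e 0 (smap RRop Y) K" "bd m e 1 (smap Nop Y) K" "bd m e 2 Y K"
proof -
  obtain Ko where Ko: "Ko \<ge> 1"
    "\<And>p. Wn m 2 (Zop p) \<le> Ko * fullW p" "\<And>p. fullW (Yop p) \<le> Ko * fullW p"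
    "\<And>p. Wn m 1 (Rop p) \<le> Ko * fullW p" "\<And>p. Wn m 0 (RRop p) \<le> Ko * fullW p"
    "\<And>p. Wn m 1 (Nop p) \<le> Ko * fullW p" "\<And>p. Wn m 0 (Dop p) \<le> Ko * fullW p"
    "\<And>p. Wn m 2 p \<le> Ko * fullW p"
    by (rule op_bounds) blast
  have K0: "Ko \<ge> 0" using Ko(1) by simp
  have Rnn: "R \<ge> 0" using bd_nonneg[OF bdt] .
  have Z: "bd m e 2 Z (Ko * R)" unfolding Z_def Zs_def by (rule bdF_smap[OF Ko(2) K0 bdG])
  have Y: "bdF e Y (Ko * R)" unfolding Y_def Ys_def by (rule bdF_smapF[OF Ko(3) K0 bdG])
  have "smap (\<lambda>p. p) Y = Y" by (simp add: fps_eq_iff)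
  then have "bd m e 2 Y (Ko * (Ko * R))" using bdF_smap[of 2 "\<lambda>p. p", OF Ko(8) K0 Y] by simp
  moreover have "Ko * R \<le> Ko * (Ko * R)" using Ko(1) Rnn by (simp add: mult_le_cancel_right1 mult.assoc[symmetric])
  ultimately show ?thesis
    using Z Y bdF_smap[OF Ko(4) K0 Y] bdF_smap[OF Ko(5) K0 Y] bdF_smap[OF Ko(6) K0 Y] bdF_smap[OF Ko(7) K0 Y]
    by (intro that[of "Ko * (Ko * R)"]) (auto intro: bd_le bdF_le)
qed

lemma invZ: "sinv m Z" and invY: "sinv m Y" and invT: "sinv m TT"
  unfolding Z_def Y_def Zs_def Ys_def TT_def
  by (intro sinv_smap[OF _ invG] inv_cwc sinv_intros sinv_t; assumption)+

lemma TT_TH: "TH (tser t) = TT ^ 2"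
  by (simp add: TH_def T2_def TT_def power2_eq_square econst_simps(2) se_mult algebra_simps
      flip: se_numeral)

lemma lookup_mult_se: "lookup ((A * se u) $ n) k = lookup (A $ n) k * u"
  using lookup_se_mult[of u A n k] by (simp add: mult.commute)

lemma ediff_numeral [simp]: "ediff (numeral n) = 0"
  by (simp flip: econst_numeral)

text \<open>\<open>uu\<close> is r times the radial derivative of U, and the commutator of the
  Laplacian with this dilation is twice the Laplacian, here - 2 j^2 U.\<close>

lemma uu_eq: "eD N uu + econst (j\<^sup>2) * uu = econst (- 2 * j\<^sup>2) * U"
proof -
  have U2: "econst 4 * (eX * ediff (ediff U)) = - (econst (j\<^sup>2) * U) - econst (2 * real N) * ediff U"
    using U_eq by (simp add: eD_def eq_diff_eq)
  have "ediff (econst 4 * (eX * ediff (ediff U))) = ediff (- (econst (j\<^sup>2) * U) - econst (2 * real N) * ediff U)"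
    unfolding U2 ..
  then have U3: "econst 4 * (eX * ediff (ediff (ediff U)))
     = - (econst (j\<^sup>2) * ediff U) - econst (2 * real N) * ediff (ediff U) - econst 4 * ediff (ediff U)"
    by (simp add: algebra_simps)
  have "eD N uu + econst (j\<^sup>2) * uu = 2 * ((econst 4 * (eX * ediff (ediff U))) * 2 + eX * (econst 4 * (eX * ediff (ediff (ediff U)))))
     + econst (2 * real N) * (2 * (ediff U + eX * ediff (ediff U))) + econst (j\<^sup>2) * (2 * (eX * ediff U))"
    by (simp add: uu_def eD_def econst_numeral algebra_simps)
  also have "\<dots> = 4 * (- (econst (j\<^sup>2) * U) - econst (2 * real N) * ediff U) + 2 * econst (2 * real N) * ediff U
     - 2 * (econst 4 * (eX * ediff (ediff U)))"
    unfolding U3 U2[symmetric] by (simp add: econst_numeral algebra_simps)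
  also have "\<dots> = econst (- 2 * j\<^sup>2) * U"
    unfolding U2 by (simp add: econst_simps econst_numeral algebra_simps)
  finally show ?thesis .
qed

lemma ev_U2: "2 * ev (ediff (ediff U)) 1 = - real N * a"
  using arg_cong[OF U_eq, of "\<lambda>f. ev f 1"] U_1 by (simp add: ev_eD a_def)

text \<open>Substitution of G = Y + Z * \<open>uu\<close> in \<open>E1\<close>; by
  \<open>uu_eq\<close> the radial part contributes only a multiple of U.\<close>

lemma E1': "TT ^ 2 * (smap Dop Y + sc (j\<^sup>2) * Y + sc (- 2 * j\<^sup>2) * (Z * se U)) + smap (Lap m) Y
    + sc 2 * (smap (Lap m) Z * se (eX * ediff U)) + fps_X * Q1 G (tser t) = 0"
proof -
  have M: "smap Mop G = smap Dop Y + sc (j\<^sup>2) * Y + sc (- 2 * j\<^sup>2) * (Z * se U)"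
  proof (intro fps_ext poly_mapping_eqI)
    fix n k
    define g where "g = lookup (G $ n) k"
    have "eD N g + econst (j\<^sup>2) * g = (eD N g - zc g * eD N uu) + econst (j\<^sup>2) * (g - zc g * uu) + zc g * (eD N uu + econst (j\<^sup>2) * uu)"
      by (simp add: algebra_simps)
    also have "\<dots> = eD N (yc g) + econst (j\<^sup>2) * yc g + econst (- 2 * j\<^sup>2) * (zc g * U)"
      unfolding uu_eq by (simp add: yc_def zc_def)
    finally show "lookup (smap Mop G $ n) k = lookup ((smap Dop Y + sc (j\<^sup>2) * Y + sc (- 2 * j\<^sup>2) * (Z * se U)) $ n) k"
      by (simp add: lookup_add lookup_se_mult lookup_mult_se lookup_cw lookup_Dop Y_def Ys_def Z_def Zs_def g_def
          zc_def yc_def econst_simps)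
  qed
  have L: "smap (Lap m) G = smap (Lap m) Y + sc 2 * (smap (Lap m) Z * se (eX * ediff U))"
  proof (intro fps_ext poly_mapping_eqI)
    fix n k
    show "lookup (smap (Lap m) G $ n) k = lookup ((smap (Lap m) Y + sc 2 * (smap (Lap m) Z * se (eX * ediff U))) $ n) k"
      by (simp add: lookup_add lookup_se_mult lookup_mult_se lookup_cw lookup_Lap Y_def Ys_def Z_def Zs_def
          zc_def yc_def uu_def econst_simps algebra_simps)
  qed
  have "TT ^ 2 * smap Mop G = sc (th0\<^sup>2) * smap Mop G + T2 (tser t) * smap Mop G"
    unfolding TT_TH[symmetric] TH_def by (simp only: distrib_right)
  then have "TT ^ 2 * smap Mop G + (smap (Lap m) Y + sc 2 * (smap (Lap m) Z * se (eX * ediff U))) + fps_X * Q1 G (tser t) = 0"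
    using E1 unfolding L[symmetric] by (simp only: add_ac)
  then show ?thesis unfolding M by (simp only: add.assoc)
qed

lemma yc_1: "ev (yc c) 1 = 0"
  using a_nz by (simp add: yc_def zc_def uu_def a_def[symmetric])

text \<open>The right side is the linear part of the condition on the gradient, see
  \<open>q2_identity\<close>; this is where the Robin condition for G arises. The dimension enters
  through U''(1) = - N a / 2.\<close>

lemma robin_yc: "robin N c = 2 * ev (ediff (yc c)) 1 + 2 * a * ev (zc c) 1"
proof -
  have "ediff uu = 2 * (ediff U + eX * ediff (ediff U))" by (simp add: uu_def econst_numeral)
  then have "ev (ediff uu) 1 = (2 - real N) * a" using ev_U2 by (simp add: a_def algebra_simps)
  then have "ev (ediff (yc c)) 1 = ev (ediff c) 1 - ev c 1 / (2 * a) * ((2 - real N) * a)"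
    by (simp add: yc_def zc_def)
  also have "ev c 1 / (2 * a) * ((2 - real N) * a) = ev c 1 * (2 - real N) / 2" using a_nz by simp
  finally show ?thesis using a_nz by (simp add: robin_def zc_def field_simps)
qed

lemma E2': "ev (lookup ((sc a * (TT ^ 2 * (sc 2 * smap Nop Y + sc (2 * a) * Z)) + fps_X * Q2 G (tser t)) $ n) k) 1 = 0"
proof -
  have "smap Bop G = sc 2 * smap Nop Y + sc (2 * a) * Z"
  proof (intro fps_ext poly_mapping_eqI)
    fix n k
    have "econst (robin N g) = econst 2 * econst (ev (ediff (yc g)) 1) + econst (2 * a) * zc g" for g
    proof -
      have "econst (ev (zc g) 1) = zc g" by (simp add: zc_def)
      then show ?thesis unfolding robin_yc by (simp only: econst_simps)
    qed
    then show "lookup (smap Bop G $ n) k = lookup ((sc 2 * smap Nop Y + sc (2 * a) * Z) $ n) k"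
      by (simp add: lookup_add lookup_se_mult lookup_cw Y_def Ys_def Z_def Zs_def zc_def yc_def econst_simps)
  qed
  then show ?thesis using E2[of n k] by (simp add: TT_TH)
qed

end

text \<open>Convergence, invariance and value are bundled, so that the rules below evaluate a whole
  polynomial in series along its structure.\<close>

definition eval_to :: "nat \<Rightarrow> real \<Rightarrow> real \<Rightarrow> real \<Rightarrow> (nat \<Rightarrow> real) \<Rightarrow> ser \<Rightarrow> real \<Rightarrow> bool"
  where "eval_to m e s y x A v \<longleftrightarrow> (\<exists>R. bd m e 0 A R) \<and> sinv m A \<and> \<bar>s\<bar> \<le> e \<and> 0 \<le> y \<and> y \<le> 1 \<and> EvR m s 0 A y x = v"

lemma eval_to_add: "eval_to m e s y x A v \<Longrightarrow> eval_to m e s y x B w \<Longrightarrow> eval_to m e s y x (A + B) (v + w)"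
  unfolding eval_to_def using EvR_add[OF good_bd good_bd] by (metis bd_add sinv_add)

lemma eval_to_mult: "eval_to m e s y x A v \<Longrightarrow> eval_to m e s y x B w \<Longrightarrow> eval_to m e s y x (A * B) (v * w)"
  unfolding eval_to_def using EvR_mult[OF good_bd good_bd] by (metis bd_mult sinv_mult)

lemma eval_to_se:
  assumes "\<bar>s\<bar> \<le> e" "0 \<le> y" "y \<le> 1"
  shows "eval_to m e s y x (se u) (ev u y)"
proof -
  have "bd m e 0 (se u) (nrm u)" using assms by (intro bd_se) simp
  then show ?thesis using assms sinv_se EvR_se unfolding eval_to_def by blast
qed

lemma eval_to_sc:
  assumes "\<bar>s\<bar> \<le> e" "0 \<le> y" "y \<le> 1"
  shows "eval_to m e s y x (sc r) r"
  using eval_to_se[OF assms, of m x "econst r"] by simp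

lemma eval_to_numeral:
  assumes "\<bar>s\<bar> \<le> e" "0 \<le> y" "y \<le> 1"
  shows "eval_to m e s y x (numeral n) (numeral n)"
  using eval_to_sc[OF assms, of m x "numeral n"] by (simp add: se_numeral)

lemma eval_to_1:
  assumes "\<bar>s\<bar> \<le> e" "0 \<le> y" "y \<le> 1"
  shows "eval_to m e s y x 1 1"
  using eval_to_sc[OF assms, of m x 1] by (simp add: se_1 econst_simps)

lemma eval_to_power: "eval_to m e s y x A v \<Longrightarrow> eval_to m e s y x (A ^ n) (v ^ n)"
proof (induction n)
  case 0
  then have "\<bar>s\<bar> \<le> e" "0 \<le> y" "y \<le> 1" by (auto simp: eval_to_def)
  then show ?case using eval_to_1 by simp
next
  case (Suc n)
  then show ?case using eval_to_mult by simp
qed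

lemma eval_to_X:
  assumes "\<bar>s\<bar> \<le> e" "0 \<le> y" "y \<le> 1"
  shows "eval_to m e s y x fps_X s"
proof -
  have "bd m e 0 fps_X e" using assms by (intro bd_X) simp
  then show ?thesis using assms sinv_X EvR_X unfolding eval_to_def by blast
qed

lemma eval_to_base:
  assumes "bd m e r A K" "sinv m A" "\<bar>s\<bar> \<le> e" "0 \<le> y" "y \<le> 1"
  shows "eval_to m e s y x A (EvR m s 0 A y x)"
  unfolding eval_to_def using assms bd_mono[OF assms(1), of 0] by blast

lemma good_Kop: "bd m e 1 A K \<Longrightarrow> i < m \<Longrightarrow> good m e 0 (smap (Kop i) A)"
  by (rule good_bd, rule bd_smap[OF Wn_Kop]) auto

lemma eval_to_sgp:
  assumes A: "bd m e 1 A K" "sinv m A" and B: "bd m e 1 B K'" "sinv m B" and s: "\<bar>s\<bar> \<le> e" "0 \<le> y" "y \<le> 1"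
  shows "eval_to m e s y x (sgp m A B)
    (\<Sum>i<m. EvR m s (pi / 2) (smap (Kop i) A) y x * EvR m s (pi / 2) (smap (Kop i) B) y x)"
proof -
  have "bd m e 0 (sgp m A B) (real m * (K * K'))" using A B by (intro bd_sgp) auto
  then show ?thesis unfolding eval_to_def
    using EvR_sgp[OF good_Kop[OF A(1)] good_Kop[OF B(1)] A(2) B(2) s] sinv_sgp[OF A(2) B(2)] s by blast
qed

lemmas eval_to_intros = eval_to_add eval_to_mult eval_to_power

lemma eval_to_q1:
  assumes s: "\<bar>s\<bar> \<le> e" "0 \<le> y" "y \<le> 1"
    and "eval_to m e s y x T T'" "eval_to m e s y x q q'" "eval_to m e s y x u u'" "eval_to m e s y x Du Du'"
    "eval_to m e s y x Ru Ru'" "eval_to m e s y x RRu RRu'" "eval_to m e s y x z z'" "eval_to m e s y x Lz Lz'"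
    "eval_to m e s y x g g'" "eval_to m e s y x Y Y'" "eval_to m e s y x DY DY'" "eval_to m e s y x RY RY'"
    "eval_to m e s y x RRY RRY'" "eval_to m e s y x LY LY'" "eval_to m e s y x gY gY'"
  shows "eval_to m e s y x (q1 fps_X T q u Du Ru RRu z Lz g Y DY RY RRY LY gY)
    (q1 s T' q' u' Du' Ru' RRu' z' Lz' g' Y' DY' RY' RRY' LY' gY')"
  unfolding q1_def by (intro eval_to_intros assms eval_to_X[OF s] eval_to_numeral[OF s] eval_to_1[OF s])

lemma eval_to_q2:
  assumes s: "\<bar>s\<bar> \<le> e" "0 \<le> y" "y \<le> 1"
    and "eval_to m e s y x T T'" "eval_to m e s y x a a'" "eval_to m e s y x z z'" "eval_to m e s y x h h'"
    "eval_to m e s y x g g'"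
  shows "eval_to m e s y x (q2 fps_X T a z h g) (q2 s T' a' z' h' g')"
  unfolding q2_def by (intro eval_to_intros assms eval_to_X[OF s] eval_to_numeral[OF s] eval_to_1[OF s])

text \<open>The right side is the equation in the variables y and x, multiplied by (1 + s z)^2. Its
  order-zero part vanishes since D U = - q U, so a factor s splits off; the bracket is what the
  recursion solves.\<close>

lemma q1_identity:
  fixes s \<theta>2 z u y :: real
  defines "ze \<equiv> 1 + s * z"
  shows "s * (\<theta>2 * (DY + q * Y + (- 2 * q) * (z * u)) + LY + 2 * (Lz * Ru) + s * q1 s \<theta>2 q u (- (q * u)) Ru RRu z Lz g Y DY RY RRY LY gY)
    = \<theta>2 * (ze^4 * (- (q * u) + s * DY) + q * ze^2 * (u + s * Y)) + ze^2 * (s * LY) + 4 * ze * (s * s * gY)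
      + 4 * (s^2 * g) * (RRu + s * RRY) + 2 * (ze * (s * Lz) + s^2 * g) * (Ru + s * RY)"
  unfolding q1_def ze_def by algebra

text \<open>Up to the factor 4 / (1 + s z)^2 the right side is |grad w|^2 - 4 a^2 theta^2 on the
  boundary, see \<open>w_boundary\<close>. Here too the order-zero part cancels.\<close>

lemma q2_identity:
  fixes s \<theta>2 z a h g :: real
  shows "s * (a * (\<theta>2 * (2 * h + 2 * a * z)) + s * q2 s \<theta>2 a z h g)
    = (\<theta>2 * (1 + s * z)^4 + s^2 * g) * (a + s * h)^2 - \<theta>2 * a^2 * (1 + s * z)^2"
  unfolding q2_def by algebra

context bif_solution
begin

abbreviation "zn s x \<equiv> EvR m s 0 Z 0 x"
abbreviation "zi s i x \<equiv> EvR m s (pi / 2) (smap (Kop i) Z) 0 x"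
abbreviation "th s \<equiv> EvR m s 0 TT 0 (\<lambda>_. 0)"

lemma pr_const_coeffs:
  assumes "\<And>k. \<exists>r. lookup p k = econst r"
  shows "pr m c p y x = pr m c p 0 x"
proof -
  have "ev (lookup p k) y = ev (lookup p k) 0" for k using assms[of k] by auto
  then show ?thesis by (simp add: pr_def)
qed

lemma Z_const: "EvR m s c Z y x = EvR m s c Z 0 x"
  "EvR m s c (smap (Kop i) Z) y x = EvR m s c (smap (Kop i) Z) 0 x"
  "EvR m s c (smap (Lap m) Z) y x = EvR m s c (smap (Lap m) Z) 0 x"
proof -
  have Z: "lookup (Z $ n) k = econst (ev (lookup (G $ n) k) 1 / (2 * a))" for n k
    by (simp add: Z_def Zs_def lookup_cw zc_def econst_simps)
  show "EvR m s c Z y x = EvR m s c Z 0 x"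
    "EvR m s c (smap (Kop i) Z) y x = EvR m s c (smap (Kop i) Z) 0 x"
    "EvR m s c (smap (Lap m) Z) y x = EvR m s c (smap (Lap m) Z) 0 x"
    unfolding EvR_def using Z
    by (subst pr_const_coeffs[of _ c y]; simp add: lookup_Kop lookup_Lap flip: econst_simps(2); blast)+
qed

lemma pr_single_0_mult: "pr m c (single 0 u * p) y x = ev u y * pr m c p y x"
proof -
  have "single 0 u * p = cw (\<lambda>_ d. u * d) p"
    by (rule poly_mapping_eqI) (simp add: lookup_single_0_mult lookup_cw)
  then show ?thesis by (simp add: pr_cw_scale)
qed

lemma EvR_TT: "EvR m s 0 TT y x = th s"
proof -
  have "TT $ J = single 0 (econst (if J = 0 then th0 else t J))" for J
    by (simp add: TT_def tser_def se_def t0 econst_simps)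
  then show ?thesis unfolding EvR_def by (simp add: dot_def)
qed

lemma PDE_numbers:
  fixes s y :: real and x :: "nat \<Rightarrow> real"
  assumes s: "\<bar>s\<bar> \<le> e" and y: "0 \<le> y" "y \<le> 1"
  defines "ze \<equiv> 1 + s * zn s x"
  shows "(th s)\<^sup>2 * (ze^4 * (ev (eD N U) y + s * EvR m s 0 (smap Dop Y) y x) + j\<^sup>2 * ze^2 * (ev U y + s * EvR m s 0 Y y x))
      + ze^2 * (s * EvR m s 0 (smap (Lap m) Y) y x)
      + 4 * ze * (s * s * (\<Sum>i<m. zi s i x * EvR m s (pi / 2) (smap (Kop i) (smap Rop Y)) y x))
      + 4 * (s^2 * (\<Sum>i<m. zi s i x * zi s i x)) * (ev (eX * (eX * ediff (ediff U))) y + s * EvR m s 0 (smap RRop Y) y x)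
      + 2 * (ze * (s * EvR m s 0 (smap (Lap m) Z) 0 x) + s^2 * (\<Sum>i<m. zi s i x * zi s i x))
        * (ev (eX * ediff U) y + s * EvR m s 0 (smap Rop Y) y x) = 0"
proof -
  obtain K where K: "bd m e 2 Z K" "bdF e Y K" "bd m e 0 (smap Dop Y) K" "bd m e 1 (smap Rop Y) K"
    "bd m e 0 (smap RRop Y) K" "bd m e 1 (smap Nop Y) K" "bd m e 2 Y K" by (rule component_bound)
  note sy = s y
  have Z1: "bd m e 1 Z K" using bd_mono[OF K(1)] by simp
  have TTb: "bd m e 2 TT (\<bar>th0\<bar> + R)" unfolding TT_def by (intro bd_add bd_sc e0 bdt)
  have eT: "eval_to m e s y x TT (th s)"
    using eval_to_base[OF TTb invT sy, of x] by (simp only: EvR_TT[of s y x])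
  have eZ: "eval_to m e s y x Z (zn s x)" using eval_to_base[OF K(1) invZ sy, of x] by (simp only: Z_const[where y = y])
  have eLZ: "eval_to m e s y x (smap (Lap m) Z) (EvR m s 0 (smap (Lap m) Z) 0 x)"
    using eval_to_base[OF bd_smap[OF Wn_Lap _ K(1)] sinv_smap[OF inv_pm_Lap invZ] sy, of x] by (simp only: Z_const[where y = y])
  have eY: "eval_to m e s y x Y (EvR m s 0 Y y x)" by (rule eval_to_base[OF K(7) invY sy])
  have eLY: "eval_to m e s y x (smap (Lap m) Y) (EvR m s 0 (smap (Lap m) Y) y x)"
    by (rule eval_to_base[OF bd_smap[OF Wn_Lap _ K(7)] sinv_smap[OF inv_pm_Lap invY] sy]) simp
  have eDY: "eval_to m e s y x (smap Dop Y) (EvR m s 0 (smap Dop Y) y x)"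
    by (rule eval_to_base[OF K(3) sinv_smap[OF inv_cwc(8) invY] sy])
  have eRY: "eval_to m e s y x (smap Rop Y) (EvR m s 0 (smap Rop Y) y x)"
    by (rule eval_to_base[OF K(4) sinv_smap[OF inv_cwc(3) invY] sy])
  have eRRY: "eval_to m e s y x (smap RRop Y) (EvR m s 0 (smap RRop Y) y x)"
    by (rule eval_to_base[OF K(5) sinv_smap[OF inv_cwc(4) invY] sy])
  have eg: "eval_to m e s y x (sgp m Z Z) (\<Sum>i<m. zi s i x * zi s i x)"
    using eval_to_sgp[OF Z1 invZ Z1 invZ sy, of x] by (simp only: Z_const[where y = y])
  have egY: "eval_to m e s y x (sgp m Z (smap Rop Y)) (\<Sum>i<m. zi s i x * EvR m s (pi / 2) (smap (Kop i) (smap Rop Y)) y x)"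
    using eval_to_sgp[OF Z1 invZ K(4) sinv_smap[OF inv_cwc(3) invY] sy, of x] by (simp only: Z_const[where y = y])
  have Uy: "ev (eD N U) y = - (j\<^sup>2 * ev U y)" by (simp add: U_eq)
  have q: "eval_to m e s y x (Q1 G (tser t)) (q1 s ((th s)\<^sup>2) (j\<^sup>2) (ev U y) (ev (eD N U) y) (ev (eX * ediff U) y)
     (ev (eX * (eX * ediff (ediff U))) y) (zn s x) (EvR m s 0 (smap (Lap m) Z) 0 x) (\<Sum>i<m. zi s i x * zi s i x)
     (EvR m s 0 Y y x) (EvR m s 0 (smap Dop Y) y x) (EvR m s 0 (smap Rop Y) y x) (EvR m s 0 (smap RRop Y) y x)
     (EvR m s 0 (smap (Lap m) Y) y x) (\<Sum>i<m. zi s i x * EvR m s (pi / 2) (smap (Kop i) (smap Rop Y)) y x))"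
    unfolding Q1_def TT_TH Z_def[symmetric] Y_def[symmetric]
    by (intro eval_to_q1[OF sy] eval_to_power eT eval_to_se[OF sy] eval_to_sc[OF sy] eZ eLZ eg eY eDY eRY eRRY eLY egY)
  have "eval_to m e s y x (TT ^ 2 * (smap Dop Y + sc (j\<^sup>2) * Y + sc (- 2 * j\<^sup>2) * (Z * se U)) + smap (Lap m) Y
    + sc 2 * (smap (Lap m) Z * se (eX * ediff U)) + fps_X * Q1 G (tser t))
    ((th s)\<^sup>2 * (EvR m s 0 (smap Dop Y) y x + j\<^sup>2 * EvR m s 0 Y y x + (- 2 * j\<^sup>2) * (zn s x * ev U y)) + EvR m s 0 (smap (Lap m) Y) y x
    + 2 * (EvR m s 0 (smap (Lap m) Z) 0 x * ev (eX * ediff U) y) + s * q1 s ((th s)\<^sup>2) (j\<^sup>2) (ev U y) (ev (eD N U) y) (ev (eX * ediff U) y)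
     (ev (eX * (eX * ediff (ediff U))) y) (zn s x) (EvR m s 0 (smap (Lap m) Z) 0 x) (\<Sum>i<m. zi s i x * zi s i x)
     (EvR m s 0 Y y x) (EvR m s 0 (smap Dop Y) y x) (EvR m s 0 (smap Rop Y) y x) (EvR m s 0 (smap RRop Y) y x)
     (EvR m s 0 (smap (Lap m) Y) y x) (\<Sum>i<m. zi s i x * EvR m s (pi / 2) (smap (Kop i) (smap Rop Y)) y x))"
    by (intro eval_to_intros eT eDY eY eZ eLY eLZ q eval_to_X[OF sy] eval_to_se[OF sy] eval_to_sc[OF sy])
  moreover have "EvR m s 0 (0 :: ser) y x = 0" by (simp add: EvR_def)
  ultimately have "(th s)\<^sup>2 * (EvR m s 0 (smap Dop Y) y x + j\<^sup>2 * EvR m s 0 Y y x + (- 2 * j\<^sup>2) * (zn s x * ev U y)) + EvR m s 0 (smap (Lap m) Y) y x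
    + 2 * (EvR m s 0 (smap (Lap m) Z) 0 x * ev (eX * ediff U) y) + s * q1 s ((th s)\<^sup>2) (j\<^sup>2) (ev U y) (- (j\<^sup>2 * ev U y)) (ev (eX * ediff U) y)
     (ev (eX * (eX * ediff (ediff U))) y) (zn s x) (EvR m s 0 (smap (Lap m) Z) 0 x) (\<Sum>i<m. zi s i x * zi s i x)
     (EvR m s 0 Y y x) (EvR m s 0 (smap Dop Y) y x) (EvR m s 0 (smap Rop Y) y x) (EvR m s 0 (smap RRop Y) y x)
     (EvR m s 0 (smap (Lap m) Y) y x) (\<Sum>i<m. zi s i x * EvR m s (pi / 2) (smap (Kop i) (smap Rop Y)) y x) = 0"
    unfolding E1' eval_to_def Uy by simp
  \<comment> \<open>Multiplication by s undoes the division that led to the recursion.\<close>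
  from arg_cong[OF this, of "\<lambda>v. s * v", unfolded q1_identity] show ?thesis
    unfolding ze_def Uy by simp
qed

lemma boundary_numbers:
  fixes s :: real and x :: "nat \<Rightarrow> real"
  assumes s: "\<bar>s\<bar> \<le> e"
  defines "ze \<equiv> 1 + s * zn s x"
  shows "((th s)\<^sup>2 * ze^4 + s^2 * (\<Sum>i<m. zi s i x * zi s i x)) * (a + s * EvR m s 0 (smap Nop Y) 1 x)^2
    = (th s)\<^sup>2 * a^2 * ze^2" "EvR m s 0 Y 1 x = 0"
proof -
  obtain K where K: "bd m e 2 Z K" "bdF e Y K" "bd m e 0 (smap Dop Y) K" "bd m e 1 (smap Rop Y) K"
    "bd m e 0 (smap RRop Y) K" "bd m e 1 (smap Nop Y) K" "bd m e 2 Y K" by (rule component_bound)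
  have y: "0 \<le> (1::real)" "1 \<le> (1::real)" by auto
  note sy = s y
  have Z1: "bd m e 1 Z K" using bd_mono[OF K(1)] by simp
  have TTb: "bd m e 2 TT (\<bar>th0\<bar> + R)" unfolding TT_def by (intro bd_add bd_sc e0 bdt)
  have eT: "eval_to m e s 1 x TT (th s)"
    using eval_to_base[OF TTb invT sy, of x] by (simp only: EvR_TT[of s 1 x])
  have eZ: "eval_to m e s 1 x Z (zn s x)" using eval_to_base[OF K(1) invZ sy, of x] by (simp only: Z_const[where y = 1])
  have eN: "eval_to m e s 1 x (smap Nop Y) (EvR m s 0 (smap Nop Y) 1 x)"
    by (rule eval_to_base[OF K(6) sinv_smap[OF inv_cwc(5) invY] sy])
  have eg: "eval_to m e s 1 x (sgp m Z Z) (\<Sum>i<m. zi s i x * zi s i x)"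
    using eval_to_sgp[OF Z1 invZ Z1 invZ sy, of x] by (simp only: Z_const[where y = 1])
  have q: "eval_to m e s 1 x (Q2 G (tser t)) (q2 s ((th s)\<^sup>2) a (zn s x) (EvR m s 0 (smap Nop Y) 1 x) (\<Sum>i<m. zi s i x * zi s i x))"
    unfolding Q2_def TT_TH Z_def[symmetric] Y_def[symmetric]
    by (intro eval_to_q2[OF sy] eval_to_power eT eval_to_sc[OF sy] eZ eg eN)
  have "eval_to m e s 1 x (sc a * (TT ^ 2 * (sc 2 * smap Nop Y + sc (2 * a) * Z)) + fps_X * Q2 G (tser t))
    (a * ((th s)\<^sup>2 * (2 * EvR m s 0 (smap Nop Y) 1 x + 2 * a * zn s x)) + s * q2 s ((th s)\<^sup>2) a (zn s x) (EvR m s 0 (smap Nop Y) 1 x) (\<Sum>i<m. zi s i x * zi s i x))"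
    by (intro eval_to_intros eT eN eZ q eval_to_X[OF sy] eval_to_sc[OF sy])
  moreover have "EvR m s 0 (sc a * (TT ^ 2 * (sc 2 * smap Nop Y + sc (2 * a) * Z)) + fps_X * Q2 G (tser t)) 1 x = 0"
    unfolding EvR_def pr_def using E2' by simp
  ultimately have "a * ((th s)\<^sup>2 * (2 * EvR m s 0 (smap Nop Y) 1 x + 2 * a * zn s x)) + s * q2 s ((th s)\<^sup>2) a (zn s x) (EvR m s 0 (smap Nop Y) 1 x) (\<Sum>i<m. zi s i x * zi s i x) = 0"
    unfolding eval_to_def by simp
  from arg_cong[OF this, of "\<lambda>v. s * v", unfolded q2_identity]
  show "((th s)\<^sup>2 * ze^4 + s^2 * (\<Sum>i<m. zi s i x * zi s i x)) * (a + s * EvR m s 0 (smap Nop Y) 1 x)^2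
    = (th s)\<^sup>2 * a^2 * ze^2" unfolding ze_def by simp
  show "EvR m s 0 Y 1 x = 0"
    unfolding EvR_def pr_def by (simp add: Y_def Ys_def lookup_cw yc_1 yc_def[of 0] zc_def econst_simps)
qed

end

section \<open>Curves in the Hoelder space\<close>

lemma cont_on_iff: "S \<subseteq> Rn d \<Longrightarrow> cont_on d S f \<longleftrightarrow> continuous_on S f"
proof -
  assume "S \<subseteq> Rn d"
  then have "subtopology (Euclidean_space d) S = top_of_set S"
    unfolding Euclidean_space_def subtopology_subtopology euclidean_product_topology[symmetric]
    by (simp add: topspace_Euclidean_space Int_absorb1 Int_absorb2 Int_commute)
  then show ?thesis by (simp add: cont_on_def)
qed

text \<open>\<open>pdiff\<close> is a pointwise \<open>deriv\<close>, so its derivative can be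
  computed only if the formula for it holds nearby on each coordinate line; the
  \<open>eventually\<close> hypothesis provides this.\<close>

lemma Ck2I:
  assumes S: "S \<subseteq> Rn d" "\<And>z i. z \<in> S \<Longrightarrow> i < d \<Longrightarrow> eventually (\<lambda>u. z(i := u) \<in> S) (nhds (z i))"
    and d1: "\<And>z i. z \<in> S \<Longrightarrow> i < d \<Longrightarrow> ((\<lambda>u. f (z(i := u))) has_real_derivative f1 i z) (at (z i))"
    and d2: "\<And>z i j. z \<in> S \<Longrightarrow> i < d \<Longrightarrow> j < d \<Longrightarrow> ((\<lambda>u. f1 i (z(j := u))) has_real_derivative f2 i j z) (at (z j))"
    and c0: "continuous_on S f" and c1: "\<And>i. i < d \<Longrightarrow> continuous_on S (f1 i)"
    and c2: "\<And>i j. i < d \<Longrightarrow> j < d \<Longrightarrow> continuous_on S (f2 i j)"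
  shows "Ck_on d S 2 f" "\<And>z i. z \<in> S \<Longrightarrow> i < d \<Longrightarrow> pdiff i f z = f1 i z"
    "\<And>z i j. z \<in> S \<Longrightarrow> i < d \<Longrightarrow> j < d \<Longrightarrow> pdiff j (pdiff i f) z = f2 i j z"
proof -
  show p1: "pdiff i f z = f1 i z" if "z \<in> S" "i < d" for z i
    unfolding pdiff_def by (rule DERIV_imp_deriv[OF d1[OF that]])
  have D2: "((\<lambda>u. pdiff i f (z(j := u))) has_real_derivative f2 i j z) (at (z j))"
    if z: "z \<in> S" "i < d" "j < d" for z i j
  proof -
    have "eventually (\<lambda>u. pdiff i f (z(j := u)) = f1 i (z(j := u))) (nhds (z j))"
      using S(2)[OF z(1,3)] by (rule eventually_mono) (use p1 z in auto)
    then show ?thesis using d2[OF z] by (subst DERIV_cong_ev[OF refl _ refl]) 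
  qed
  then show p2: "pdiff j (pdiff i f) z = f2 i j z" if "z \<in> S" "i < d" "j < d" for z i j
    unfolding pdiff_def[of j] using that by (intro DERIV_imp_deriv)
  have "continuous_on S (pdiff i f)" if "i < d" for i
    using c1[OF that] p1 that by (simp cong: continuous_on_cong)
  moreover have "continuous_on S (pdiff j (pdiff i f))" if "i < d" "j < d" for i j
    using c2[OF that] p2 that by (simp cong: continuous_on_cong)
  ultimately show "Ck_on d S 2 f"
    unfolding numeral_2_eq_2 Ck_on.simps cont_on_iff[OF S(1)]
    using d1 D2 c0 real_differentiable_def by blast
qed

lemma abs_freq_le_exp:
  assumes "i < m"
  shows "\<bar>real_of_int (k i)\<bar> \<le> exp (l1 m k)"
  using abs_le_l1[OF assms, of k] exp_ge_add_one_self[of "l1 m k"] by linarith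

lemma abs_freq2_le_exp:
  assumes "i < m" "j < m"
  shows "\<bar>real_of_int (k i)\<bar> * \<bar>real_of_int (k j)\<bar> \<le> 2 * exp (l1 m k)"
proof -
  have "\<bar>real_of_int (k i)\<bar> * \<bar>real_of_int (k j)\<bar> \<le> l1 m k * l1 m k"
    using assms by (intro mult_mono abs_le_l1) auto
  also have "\<dots> \<le> 2 * exp (l1 m k)"
    using exp_lower_Taylor_quadratic[OF l1_nonneg, of m k] l1_nonneg[of m k] unfolding power2_eq_square by linarith
  finally show ?thesis .
qed

lemma pr_le_sum:
  assumes "keys q \<subseteq> keys p" "\<And>k. k \<in> keys p \<Longrightarrow> \<bar>ev (lookup q k) y\<bar> \<le> C * wt m 0 k * nrm (lookup p k)"
  shows "\<bar>pr m c q y x\<bar> \<le> C * Wn m 0 p"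
proof -
  have "\<bar>pr m c q y x\<bar> \<le> (\<Sum>k\<in>keys p. \<bar>ev (lookup q k) y * cos (dot m k x + c)\<bar>)"
    unfolding pr_superset[OF finite_keys assms(1)] by (rule sum_abs)
  also have "\<dots> \<le> (\<Sum>k\<in>keys p. C * (wt m 0 k * nrm (lookup p k)))"
  proof (rule sum_mono)
    fix k assume "k \<in> keys p"
    then have "\<bar>ev (lookup q k) y\<bar> * \<bar>cos (dot m k x + c)\<bar> \<le> (C * wt m 0 k * nrm (lookup p k)) * 1"
      by (intro mult_mono assms) (auto intro: order_trans[OF abs_ge_zero assms(2)])
    then show "\<bar>ev (lookup q k) y * cos (dot m k x + c)\<bar> \<le> C * (wt m 0 k * nrm (lookup p k))"
      by (simp add: abs_mult mult_ac)
  qed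
  finally show ?thesis by (simp add: Wn_def sum_distrib_left)
qed

lemma keys_Kop: "keys (Kop i p) \<subseteq> keys p"
  unfolding Kop_def by (rule keys_cw)

lemma pr_Kop_bound:
  assumes y: "0 \<le> y" "y \<le> 1" and i: "i < m"
  shows "\<bar>pr m c (Kop i p) y x\<bar> \<le> 1 * Wn m 0 p"
proof (rule pr_le_sum[OF keys_Kop])
  fix k
  have "\<bar>real_of_int (k i)\<bar> * \<bar>ev (lookup p k) y\<bar> \<le> wt m 0 k * nrm (lookup p k)"
    using y abs_freq_le_exp[OF i, of k] by (intro mult_mono ev_le_nrm) (auto simp: wt_def)
  then show "\<bar>ev (lookup (Kop i p) k) y\<bar> \<le> 1 * wt m 0 k * nrm (lookup p k)"
    by (simp add: lookup_Kop abs_mult)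
qed

lemma pr_Kop2_bound:
  assumes y: "0 \<le> y" "y \<le> 1" and i: "i < m" "j < m"
  shows "\<bar>pr m c (Kop i (Kop j p)) y x\<bar> \<le> 2 * Wn m 0 p"
proof (rule pr_le_sum)
  show "keys (Kop i (Kop j p)) \<subseteq> keys p" using keys_Kop by blast
  fix k
  have "(\<bar>real_of_int (k i)\<bar> * \<bar>real_of_int (k j)\<bar>) * \<bar>ev (lookup p k) y\<bar> \<le> (2 * wt m 0 k) * nrm (lookup p k)"
    using y abs_freq2_le_exp[OF i, of k] by (intro mult_mono[of _ _ "\<bar>ev (lookup p k) y\<bar>"] ev_le_nrm) (auto simp: wt_def)
  then show "\<bar>ev (lookup (Kop i (Kop j p)) k) y\<bar> \<le> 2 * wt m 0 k * nrm (lookup p k)"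
    by (simp add: lookup_Kop abs_mult mult.assoc)
qed

text \<open>Two derivatives cost |k|^2 and the Lipschitz constant of the cosine another |k|; the
  exponential weight absorbs the cube.\<close>

lemma pr_Kop2_lipschitz:
  assumes i: "i < m" "j < m"
  shows "\<bar>pr m c (Kop i (Kop j p)) 0 x - pr m c (Kop i (Kop j p)) 0 x'\<bar> \<le> 27 * enorm m (\<lambda>i. x i - x' i) * Wn m 0 p"
proof -
  define E where "E = enorm m (\<lambda>i. x i - x' i)"
  have E: "E \<ge> 0" by (simp add: E_def L2_set_nonneg)
  have coord: "\<bar>x l - x' l\<bar> \<le> E" if "l < m" for l
    unfolding E_def using member_le_L2_set[of "{..<m}" l "\<lambda>i. \<bar>x i - x' i\<bar>"] that
    by (simp add: L2_set_def)
  have sub: "keys (Kop i (Kop j p)) \<subseteq> keys p" using keys_Kop by blast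
  have "pr m c (Kop i (Kop j p)) 0 x - pr m c (Kop i (Kop j p)) 0 x'
    = (\<Sum>k\<in>keys p. ev (lookup (Kop i (Kop j p)) k) 0 * (cos (dot m k x + c) - cos (dot m k x' + c)))"
    unfolding pr_superset[OF finite_keys sub] by (simp add: sum_subtractf right_diff_distrib)
  also have "\<bar>\<dots>\<bar> \<le> (\<Sum>k\<in>keys p. 27 * E * (wt m 0 k * nrm (lookup p k)))"
  proof (rule order_trans[OF sum_abs sum_mono])
    fix k
    define L where "L = l1 m k"
    have L: "L \<ge> 0" by (simp add: L_def)
    have "\<bar>cos (dot m k x + c) - cos (dot m k x' + c)\<bar> \<le> \<bar>dot m k x - dot m k x'\<bar>"
    proof -
      have "\<bar>cos u - cos v\<bar> \<le> \<bar>u - v\<bar>" for u v :: real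
        using field_differentiable_bound[of UNIV cos "\<lambda>x. - sin x" 1 u v]
        by (auto intro!: derivative_eq_intros)
      from this[of "dot m k x + c" "dot m k x' + c"] show ?thesis by simp
    qed
    also have "\<dots> \<le> (\<Sum>l<m. \<bar>real_of_int (k l)\<bar> * E)"
    proof -
      have "\<bar>dot m k x - dot m k x'\<bar> = \<bar>\<Sum>l<m. real_of_int (k l) * (x l - x' l)\<bar>"
        by (simp add: dot_def sum_subtractf right_diff_distrib)
      also have "\<dots> \<le> (\<Sum>l<m. \<bar>real_of_int (k l)\<bar> * E)"
        by (rule order_trans[OF sum_abs sum_mono]) (auto simp: abs_mult intro!: mult_left_mono coord)
      finally show ?thesis .
    qed
    also have "\<dots> = L * E" by (simp add: L_def l1_def sum_distrib_right)
    finally have cosd: "\<bar>cos (dot m k x + c) - cos (dot m k x' + c)\<bar> \<le> L * E" .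
    have "\<bar>real_of_int (k i)\<bar> * (\<bar>real_of_int (k j)\<bar> * \<bar>ev (lookup p k) 0\<bar>) * \<bar>cos (dot m k x + c) - cos (dot m k x' + c)\<bar>
       \<le> L * (L * nrm (lookup p k)) * (L * E)"
      using i E L unfolding L_def by (intro mult_mono abs_le_l1 ev_le_nrm cosd[unfolded L_def]) auto
    also have "\<dots> = L ^ 3 * (E * nrm (lookup p k))" by (simp add: power3_eq_cube)
    also have "\<dots> \<le> (27 * exp L) * (E * nrm (lookup p k))"
    proof -
      \<comment> \<open>The constant 27 is 3^3, from L / 3 <= exp (L / 3).\<close>
      have "(L / 3) ^ 3 \<le> exp (L / 3) ^ 3"
        using L exp_ge_add_one_self[of "L / 3"] by (intro power_mono) (linarith, simp)
      also have "exp (L / 3) ^ 3 = exp L" by (simp flip: exp_of_nat_mult)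
      finally show ?thesis using E by (intro mult_right_mono) (auto simp: power_divide)
    qed
    finally show "\<bar>ev (lookup (Kop i (Kop j p)) k) 0 * (cos (dot m k x + c) - cos (dot m k x' + c))\<bar>
       \<le> 27 * E * (wt m 0 k * nrm (lookup p k))"
      by (simp add: lookup_Kop abs_mult wt_def L_def mult_ac)
  qed
  finally show ?thesis by (simp add: Wn_def sum_distrib_left E_def)
qed

lemma dot_update:
  assumes "i < m"
  shows "((\<lambda>u. dot m k (x(i := u))) has_real_derivative real_of_int (k i)) (at u)"
proof -
  have eq: "(\<lambda>u. dot m k (x(i := u))) = (\<lambda>u. dot m k (x(i := 0)) + real_of_int (k i) * u)"
  proof
    fix u
    have "dot m k (x(i := u)) = (\<Sum>l<m. real_of_int (k l) * (x(i := 0)) l + (if l = i then real_of_int (k i) * u else 0))"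
      unfolding dot_def by (intro sum.cong) auto
    then show "dot m k (x(i := u)) = dot m k (x(i := 0)) + real_of_int (k i) * u"
      using assms by (simp add: dot_def sum.distrib)
  qed
  show ?thesis unfolding eq by (auto intro!: derivative_eq_intros)
qed

text \<open>Coefficients independent of y, as in the series of z, theta and h.\<close>

definition const_ser :: "ser \<Rightarrow> bool"
  where "const_ser A \<longleftrightarrow> (\<forall>n k. \<exists>r. lookup (A $ n) k = econst r)"

lemma pr_good:
  assumes "bd m e 0 A K" "C \<ge> 0" "\<And>p c y x. 0 \<le> y \<Longrightarrow> y \<le> 1 \<Longrightarrow> \<bar>pr m c (F p) y x\<bar> \<le> C * Wn m 0 p"
  shows "good m e 0 (smap F A)"
  by (rule good_fullW[OF assms(1,2)]) (use assms(3) in auto)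

lemma good_0: "e \<ge> 0 \<Longrightarrow> good m e r 0"
  by (auto simp: good_def intro!: exI[of _ "\<lambda>_. 0"])

text \<open>Stated at s = 1 with radius 1: powers of s and difference quotients will be moved into
  the coefficients by \<open>wser\<close>.\<close>

lemma EvR_bound:
  assumes "bd m 1 0 B K" "C \<ge> 0" "\<And>p. \<bar>pr m c (F p) 0 x\<bar> \<le> C * Wn m 0 p"
  shows "\<bar>EvR m 1 c (smap F B) 0 x\<bar> \<le> C * K" "summable (\<lambda>J. pr m c (F (B $ J)) 0 x)"
proof -
  have S: "summable (\<lambda>J. Wn m 0 (B $ J))" "suminf (\<lambda>J. Wn m 0 (B $ J)) \<le> K"
  proof -
    have *: "(\<Sum>J\<le>n. Wn m 0 (B $ J)) \<le> K" for n using assms(1) by (simp add: bd_def)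
    show S: "summable (\<lambda>J. Wn m 0 (B $ J))" by (rule bounded_imp_summable[OF _ *]) simp
    show "suminf (\<lambda>J. Wn m 0 (B $ J)) \<le> K"
      by (rule LIMSEQ_le_const2[OF summable_LIMSEQ'[OF S]]) (use * in auto)
  qed
  have SC: "summable (\<lambda>J. C * Wn m 0 (B $ J))" using S(1) by (rule summable_mult)
  have sa: "summable (\<lambda>J. \<bar>pr m c (F (B $ J)) 0 x\<bar>)"
    by (rule summable_comparison_test'[OF SC, of 0]) (use assms(3) in auto)
  then show "summable (\<lambda>J. pr m c (F (B $ J)) 0 x)" by (rule summable_rabs_cancel)
  have "\<bar>suminf (\<lambda>J. pr m c (F (B $ J)) 0 x)\<bar> \<le> suminf (\<lambda>J. \<bar>pr m c (F (B $ J)) 0 x\<bar>)"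
    using sa by (rule summable_rabs)
  also have "\<dots> \<le> suminf (\<lambda>J. C * Wn m 0 (B $ J))"
    using assms(3) by (intro suminf_le sa SC)
  also have "\<dots> = C * suminf (\<lambda>J. Wn m 0 (B $ J))" using S(1) by (rule suminf_mult)
  also have "\<dots> \<le> C * K" using S(2) assms(2) by (rule mult_left_mono)
  finally show "\<bar>EvR m 1 c (smap F B) 0 x\<bar> \<le> C * K" by (simp add: EvR_def)
qed

lemma EvR_const_derivs:
  assumes B: "bd m e 0 B K" and cs: "const_ser B" and s: "\<bar>s\<bar> \<le> e"
  defines "f \<equiv> \<lambda>x. EvR m s 0 B 0 x"
  defines "f1 \<equiv> \<lambda>i x. EvR m s (pi / 2) (smap (Kop i) B) 0 x"
  defines "f2 \<equiv> \<lambda>i j x. EvR m s pi (smap (Kop j) (smap (Kop i) B)) 0 x"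
  shows "\<And>x i. i < m \<Longrightarrow> ((\<lambda>u. f (x(i := u))) has_real_derivative f1 i x) (at (x i))"
    "\<And>x i j. i < m \<Longrightarrow> j < m \<Longrightarrow> ((\<lambda>u. f1 i (x(j := u))) has_real_derivative f2 i j x) (at (x j))"
    "\<And>S. continuous_on S f" "\<And>S i. i < m \<Longrightarrow> continuous_on S (f1 i)"
    "\<And>S i j. i < m \<Longrightarrow> j < m \<Longrightarrow> continuous_on S (f2 i j)"
proof -
  have e: "e \<ge> 0" using B by (simp add: bd_def)
  have D0: "smap Dif B = 0" "smap Dif (smap (Kop i) B) = 0" for i
  proof -
    have c0: "ediff (lookup (B $ n) k) = 0" for n k
      using cs unfolding const_ser_def by (metis ediff_simps(5))
    have "Dif (B $ n) = 0" for n by (rule poly_mapping_eqI) (simp add: lookup_Dif c0)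
    moreover have "Dif (Kop i (B $ n)) = 0" for n
      by (rule poly_mapping_eqI) (simp add: lookup_Dif lookup_Kop ediff_simps c0)
    ultimately
    show "smap Dif B = 0" "smap Dif (smap (Kop i) B) = 0" by (simp_all add: fps_eq_iff)
  qed
  have g0: "good m e 0 B" using B by (rule good_bd)
  have g1: "good m e 0 (smap (Kop i) B)" if "i < m" for i
    using that pr_Kop_bound by (intro pr_good[OF B, of 1]) auto
  have g2: "good m e 0 (smap (Kop j) (smap (Kop i) B))" if "i < m" "j < m" for i j
  proof -
    have "good m e 0 (smap (\<lambda>p. Kop j (Kop i p)) B)"
      using that pr_Kop2_bound by (intro pr_good[OF B, of 2]) auto
    moreover have "smap (\<lambda>p. Kop j (Kop i p)) B = smap (Kop j) (smap (Kop i) B)" by (simp add: fps_eq_iff)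
    ultimately show ?thesis by simp
  qed
  show "((\<lambda>u. f (x(i := u))) has_real_derivative f1 i x) (at (x i))" if "i < m" for x i
    using EvR_slice[where S = UNIV and ?u0.0 = "x i" and xs = "\<lambda>u. x(i := u)" and flag = True and i = i and y = "\<lambda>_. 0"
        and y' = "\<lambda>_. 0" and p = "\<lambda>_. 1" and p' = "\<lambda>_. 0" and B = 1 and ?r1.0 = 0 and ?r2.0 = 0 and A = B and m = m
        and e = e and s = s and c = 0] s dot_update[OF that] g0 g1[OF that] good_0[OF e]
    by (simp add: D0 f_def f1_def)
  show "((\<lambda>u. f1 i (x(j := u))) has_real_derivative f2 i j x) (at (x j))" if "i < m" "j < m" for x i j
    using EvR_slice[where S = UNIV and ?u0.0 = "x j" and xs = "\<lambda>u. x(j := u)" and flag = True and i = j and y = "\<lambda>_. 0"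
        and y' = "\<lambda>_. 0" and p = "\<lambda>_. 1" and p' = "\<lambda>_. 0" and B = 1 and ?r1.0 = 0 and ?r2.0 = 0 and A = "smap (Kop i) B"
        and m = m and e = e and s = s and c = "pi / 2"] s dot_update[OF that(2)] g1[OF that(1)] g2[OF that] good_0[OF e]
    by (simp add: D0 f1_def f2_def)
  have cont: "continuous_on S (\<lambda>x. EvR m s c A 0 x)" if "good m e 0 A" for S c A
    using EvR_continuous[where y = "\<lambda>_. 0" and p = "\<lambda>_. 1" and B = 1 and r = 0 and xs = "\<lambda>x. x" and S = S and A = A
        and m = m and e = e and s = s and c = c] s that
    by (simp add: continuous_on_subset[OF continuous_on_product_coordinates subset_UNIV])
  show "continuous_on S f" for S unfolding f_def by (rule cont[OF g0])
  show "continuous_on S (f1 i)" if "i < m" for S i unfolding f1_def by (rule cont[OF g1[OF that]])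
  show "continuous_on S (f2 i j)" if "i < m" "j < m" for S i j unfolding f2_def by (rule cont[OF g2[OF that]])
qed

lemma Rn_slices: "z \<in> Rn d \<Longrightarrow> i < d \<Longrightarrow> z(i := u) \<in> Rn d"
  by (auto simp: topspace_Euclidean_space)

text \<open>In the constant, f contributes 1, each first derivative 1, and each second derivative 2
  for its sup norm and 31 for its Hoelder seminorm.\<close>

lemma C2a_series:
  assumes m: "m \<ge> 1" and \<alpha>: "0 < \<alpha>" "\<alpha> < 1" and B: "bd m 1 0 B K" and cs: "const_ser B"
  defines "f \<equiv> \<lambda>x. EvR m 1 0 B 0 x"
  shows "f \<in> C2a m \<alpha>" "0 \<le> C2a_norm m \<alpha> f" "C2a_norm m \<alpha> f \<le> (1 + real m + 33 * (real m)\<^sup>2) * K"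
proof -
  define f1 where "f1 i = EvR m 1 (pi / 2) (smap (Kop i) B) 0" for i
  define f2 where "f2 i j = EvR m 1 pi (smap (Kop j) (smap (Kop i) B)) 0" for i j
  note ders = EvR_const_derivs[OF B cs, of 1, simplified, folded f_def, folded f1_def f2_def]
  have K: "K \<ge> 0" using bd_nonneg[OF B] .
  have C: "Ck_on m (Rn m) 2 f" "\<And>z i. z \<in> Rn m \<Longrightarrow> i < m \<Longrightarrow> pdiff i f z = f1 i z"
    "\<And>z i j. z \<in> Rn m \<Longrightarrow> i < m \<Longrightarrow> j < m \<Longrightarrow> pdiff j (pdiff i f) z = f2 i j z"
    using Ck2I[of "Rn m" m f f1 f2, OF subset_refl _ ders(1) ders(2) ders(3) ders(4) ders(5)] Rn_slices
    by (simp_all add: always_eventually)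
  have f2': "f2 i j = (\<lambda>x. EvR m 1 pi (smap (\<lambda>p. Kop j (Kop i p)) B) 0 x)" for i j
  proof -
    have "smap (\<lambda>p. Kop j (Kop i p)) B = smap (Kop j) (smap (Kop i) B)" by (simp add: fps_eq_iff)
    then show ?thesis by (simp add: f2_def)
  qed
  have B_id: "smap (\<lambda>p. p) B = B" by (simp add: fps_eq_iff)
  have b0: "\<bar>f x\<bar> \<le> K" for x
    using EvR_bound(1)[OF B, of 1 0 "\<lambda>p. p" x] pr_bound[of 0 m 0 _ x] by (simp add: f_def B_id)
  have b1: "\<bar>f1 i x\<bar> \<le> K" if "i < m" for i x
    unfolding f1_def using EvR_bound(1)[OF B, of 1 "pi / 2" "Kop i" x] pr_Kop_bound[of 0 i m "pi / 2" _ x] that by simp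
  have b2: "\<bar>f2 i j x\<bar> \<le> 2 * K" if "i < m" "j < m" for i j x
    unfolding f2' using EvR_bound(1)[OF B, of 2 pi "\<lambda>p. Kop j (Kop i p)" x] pr_Kop2_bound[of 0 j m i pi _ x] that by simp
  have lip: "\<bar>f2 i j x - f2 i j x'\<bar> \<le> 27 * enorm m (\<lambda>i. x i - x' i) * K" if ij: "i < m" "j < m" for i j x x'
  proof -
    define E where "E = enorm m (\<lambda>i. x i - x' i)"
    define d where "d J = pr m pi (Kop j (Kop i (B $ J))) 0 x - pr m pi (Kop j (Kop i (B $ J))) 0 x'" for J
    have E: "E \<ge> 0" by (simp add: E_def L2_set_nonneg)
    have s: "summable (\<lambda>J. pr m pi (Kop j (Kop i (B $ J))) 0 x)" for x
      using EvR_bound(2)[OF B, of 2 pi "\<lambda>p. Kop j (Kop i p)" x] pr_Kop2_bound[of 0 j m i pi _ x] ij by simp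
    have f2d: "f2 i j x - f2 i j x' = suminf d"
      unfolding f2_def EvR_def d_def using suminf_diff[OF s s, of x x'] by simp
    have *: "(\<Sum>J\<le>n. Wn m 0 (B $ J)) \<le> K" for n using B by (simp add: bd_def)
    have S: "summable (\<lambda>J. Wn m 0 (B $ J))" by (rule bounded_imp_summable[OF _ *]) simp
    have SE: "summable (\<lambda>J. 27 * E * Wn m 0 (B $ J))" using S by (rule summable_mult)
    have dle: "\<bar>d J\<bar> \<le> 27 * E * Wn m 0 (B $ J)" for J
      unfolding d_def E_def by (rule pr_Kop2_lipschitz) (use ij in auto)
    have sd: "summable (\<lambda>J. \<bar>d J\<bar>)"
      by (rule summable_comparison_test'[OF SE, of 0]) (use dle in auto)
    have "\<bar>suminf d\<bar> \<le> suminf (\<lambda>J. \<bar>d J\<bar>)" using sd by (rule summable_rabs)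
    also have "\<dots> \<le> suminf (\<lambda>J. 27 * E * Wn m 0 (B $ J))" by (intro suminf_le dle sd SE)
    also have "\<dots> = 27 * E * suminf (\<lambda>J. Wn m 0 (B $ J))" using S by (rule suminf_mult)
    also have "\<dots> \<le> 27 * E * K"
      using E LIMSEQ_le_const2[OF summable_LIMSEQ'[OF S]] * by (intro mult_left_mono) auto
    finally show ?thesis by (simp add: f2d E_def)
  qed
  have hol: "q \<le> 31 * K \<and> 0 \<le> q" if q: "q \<in> holder_quotients m \<alpha> (pdiff i (pdiff j f))" and ij: "i < m" "j < m" for q i j
  proof -
    obtain x x' where x: "x \<in> Rn m" "x' \<in> Rn m" "x \<noteq> x'"
      and q: "q = \<bar>f2 j i x - f2 j i x'\<bar> / enorm m (\<lambda>i. x i - x' i) powr \<alpha>"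
      using q unfolding holder_quotients_def by (auto simp: C(3)[OF _ ij(2,1)])
    define E where "E = enorm m (\<lambda>i. x i - x' i)"
    obtain l where l: "l < m" "x l \<noteq> x' l"
      using x by (auto simp: topspace_Euclidean_space fun_eq_iff) (metis not_le)
    have "0 < \<bar>x l - x' l\<bar>" using l by simp
    also have "\<dots> \<le> E" unfolding E_def using member_le_L2_set[of "{..<m}" l "\<lambda>i. \<bar>x i - x' i\<bar>"] l by (simp add: L2_set_def)
    finally have E: "E > 0" .
    \<comment> \<open>At distances up to 1 the Lipschitz constant 27 K decides, beyond 1 twice the
      sup bound 2 K; 31 = 27 + 4 covers both.\<close>
    have "\<bar>f2 j i x - f2 j i x'\<bar> \<le> (31 * K) * E powr \<alpha>"
    proof (cases "E \<le> 1")
      case True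
      have "E = E powr 1" using E by simp
      also have "\<dots> \<le> E powr \<alpha>" using True E \<alpha> by (intro powr_mono') auto
      finally have "27 * E * K \<le> 27 * (E powr \<alpha>) * K" using K by (intro mult_right_mono mult_left_mono) auto
      also have "\<dots> \<le> 31 * (E powr \<alpha>) * K" using K by (intro mult_right_mono) auto
      finally show ?thesis using lip[OF ij(2,1), of x x'] by (simp add: E_def mult_ac)
    next
      case False
      then have "1 \<le> E powr \<alpha>" using \<alpha> by (intro ge_one_powr_ge_zero) auto
      then have "31 * K * 1 \<le> 31 * K * E powr \<alpha>" using K by (intro mult_left_mono) auto
      moreover have "\<bar>f2 j i x - f2 j i x'\<bar> \<le> 4 * K"
        using b2[OF ij(2,1), of x] b2[OF ij(2,1), of x'] by linarith
      ultimately show ?thesis using K by linarith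
    qed
    then show ?thesis using E by (simp add: q E_def[symmetric] divide_le_eq)
  qed
  have ne: "Rn m \<noteq> {}" by (auto simp: topspace_Euclidean_space)
  have hne: "holder_quotients m \<alpha> g \<noteq> {}" for g
  proof -
    have "(\<lambda>i. 0) \<in> Rn m" "(\<lambda>i. if i = 0 then 1 else 0) \<in> Rn m" using m by (auto simp: topspace_Euclidean_space)
    moreover have "(\<lambda>i::nat. 0::real) \<noteq> (\<lambda>i. if i = 0 then 1 else 0)" by (auto simp: fun_eq_iff)
    ultimately show ?thesis unfolding holder_quotients_def by blast
  qed
  show "f \<in> C2a m \<alpha>"
    unfolding C2a_def
  proof (intro CollectI conjI allI impI)
    show "bounded (f ` Rn m)" using b0 by (auto simp: bounded_iff)
    show "bounded (pdiff i f ` Rn m)" if "i < m" for i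
      using b1[OF that] C(2)[OF _ that] by (auto simp: bounded_iff)
    show "bounded (pdiff i (pdiff j f) ` Rn m)" if "i < m" "j < m" for i j
      using b2[OF that(2,1)] C(3)[OF _ that(2,1)] by (auto simp: bounded_iff)
    show "bounded (holder_quotients m \<alpha> (pdiff i (pdiff j f)))" if "i < m" "j < m" for i j
      using hol[OF _ that] by (auto simp: bounded_iff intro!: exI[of _ "31 * K"])
  qed (rule C(1))
  have sn: "0 \<le> sup_norm m g \<and> sup_norm m g \<le> c" if "\<And>x. x \<in> Rn m \<Longrightarrow> \<bar>g x\<bar> \<le> c" for g c
  proof
    show "sup_norm m g \<le> c" unfolding sup_norm_def by (rule cSUP_least[OF ne that])
    obtain x where x: "x \<in> Rn m" using ne by blast
    have "0 \<le> \<bar>g x\<bar>" by simp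
    also have "\<dots> \<le> sup_norm m g" unfolding sup_norm_def
      using that by (intro cSUP_upper[OF x] bdd_aboveI2) 
    finally show "0 \<le> sup_norm m g" .
  qed
  have s0: "0 \<le> sup_norm m f \<and> sup_norm m f \<le> K" by (rule sn) (rule b0)
  have s1: "0 \<le> sup_norm m (pdiff i f) \<and> sup_norm m (pdiff i f) \<le> K" if "i < m" for i
    by (rule sn) (use C(2)[OF _ that] b1[OF that] in auto)
  have s2: "0 \<le> sup_norm m (pdiff i (pdiff j f)) \<and> sup_norm m (pdiff i (pdiff j f)) \<le> 2 * K" if "i < m" "j < m" for i j
    by (rule sn) (use C(3)[OF _ that(2,1)] b2[OF that(2,1)] in auto)
  have s3: "0 \<le> Sup (holder_quotients m \<alpha> (pdiff i (pdiff j f))) \<and> Sup (holder_quotients m \<alpha> (pdiff i (pdiff j f))) \<le> 31 * K"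
    if "i < m" "j < m" for i j
  proof
    show "Sup (holder_quotients m \<alpha> (pdiff i (pdiff j f))) \<le> 31 * K"
      using hol[OF _ that] by (intro cSup_least[OF hne]) auto
    obtain q where q: "q \<in> holder_quotients m \<alpha> (pdiff i (pdiff j f))" using hne by blast
    have "q \<le> Sup (holder_quotients m \<alpha> (pdiff i (pdiff j f)))"
      using hol[OF _ that] by (intro cSup_upper[OF q] bdd_aboveI[of _ "31 * K"]) auto
    then show "0 \<le> Sup (holder_quotients m \<alpha> (pdiff i (pdiff j f)))" using hol[OF q that] by linarith
  qed
  show "0 \<le> C2a_norm m \<alpha> f"
    unfolding C2a_norm_def using s0 s1 s2 s3 by (intro add_nonneg_nonneg sum_nonneg) auto
  have "C2a_norm m \<alpha> f \<le> K + (\<Sum>i<m. K) + (\<Sum>i<m. \<Sum>j<m. 2 * K + 31 * K)"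
    unfolding C2a_norm_def using s0 s1 s2 s3 by (intro add_mono sum_mono) auto
  also have "\<dots> = (1 + real m + 33 * (real m)\<^sup>2) * K" by (simp add: power2_eq_square algebra_simps)
  finally show "C2a_norm m \<alpha> f \<le> (1 + real m + 33 * (real m)\<^sup>2) * K" .
qed

text \<open>A symmetry of x is transposed to the frequencies, where reindexing the sum along the
  bijection T of the support absorbs it.\<close>

lemma pr_sym:
  assumes "inv_pm m p" "T \<in> Sym m" "\<And>k. dot m k x' = dot m (T k) x"
  shows "pr m c p y x' = pr m c p y x"
proof -
  have T: "lookup p (T k) = lookup p k" for k using assms by (auto simp: inv_pm_def)
  have bT: "bij T" using assms by (simp add: Sym_def)
  have "bij_betw T (keys p) (keys p)"
    unfolding bij_betw_def
  proof (intro conjI equalityI subsetI)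
    show "inj_on T (keys p)" using bT by (metis bij_is_inj inj_on_subset subset_UNIV)
    fix k
    show "k \<in> T ` keys p \<Longrightarrow> k \<in> keys p" by (auto simp: in_keys_iff T)
    assume k: "k \<in> keys p"
    obtain l where "k = T l" using bT by (metis bij_pointE)
    then show "k \<in> T ` keys p" using k by (auto simp: in_keys_iff T)
  qed
  then have "(\<Sum>k\<in>keys p. ev (lookup p (T k)) y * cos (dot m (T k) x + c)) = (\<Sum>k\<in>keys p. ev (lookup p k) y * cos (dot m k x + c))"
    by (rule sum.reindex_bij_betw)
  then show ?thesis by (simp add: pr_def T assms(3))
qed

lemma EvR_cong_x: "(\<And>J. pr m c (A $ J) y x' = pr m c (A $ J) y x) \<Longrightarrow> EvR m s c A y x' = EvR m s c A y x"
  by (simp add: EvR_def)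

lemma EvR_flip:
  assumes "sinv m A" "i < m"
  shows "EvR m s c A y (x(i := - x i)) = EvR m s c A y x"
proof (rule EvR_cong_x, rule pr_sym[OF _ Sym_flip])
  show "inv_pm m (A $ J)" for J using assms(1) by (simp add: sinv_def)
  show "dot m k (x(i := - x i)) = dot m (k(i := - k i)) x" for k
    unfolding dot_def by (intro sum.cong) auto
qed

lemma EvR_permute:
  assumes "sinv m A" "p permutes {..<m}"
  shows "EvR m s c A y (x \<circ> p) = EvR m s c A y x"
\<comment> \<open>Permuting x by p permutes the frequencies by the inverse of p.\<close>
proof (rule EvR_cong_x, rule pr_sym[OF _ Sym_permute[OF permutes_inv[OF assms(2)]]])
  show "inv_pm m (A $ J)" for J using assms(1) by (simp add: sinv_def)
  show "dot m k (x \<circ> p) = dot m (k \<circ> inv p) x" for k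
    unfolding dot_def using sum.permute[OF assms(2), of "\<lambda>i. real_of_int (k (inv p i)) * x i"] assms(2)
    by (simp add: permutes_inverses o_def)
qed

lemma EvR_shift:
  assumes "i < m"
  shows "EvR m s c A y (x(i := x i + 2 * pi)) = EvR m s c A y x"
proof (rule EvR_cong_x)
  have "dot m k (x(i := x i + 2 * pi)) = dot m k x + real_of_int (k i) * (2 * pi)" for k
  proof -
    have "dot m k (x(i := x i + 2 * pi)) = (\<Sum>l<m. real_of_int (k l) * x l + (if l = i then real_of_int (k i) * (2 * pi) else 0))"
      unfolding dot_def by (intro sum.cong) (auto simp: distrib_left)
    then show ?thesis using assms by (simp add: dot_def sum.distrib)
  qed
  then have "cos (dot m k (x(i := x i + 2 * pi)) + c) = cos (dot m k x + c)" for k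
    using cos.plus_of_int[of "dot m k x + c" "k i"] by (simp add: add_ac)
  then show "pr m c (A $ J) y (x(i := x i + 2 * pi)) = pr m c (A $ J) y x" for J by (simp add: pr_def)
qed

section \<open>Dependence on the parameter s\<close>

definition scal :: "real \<Rightarrow> pm \<Rightarrow> pm"
  where "scal r = cw (\<lambda>_ c. econst r * c)"

text \<open>Multiplying order J by d J turns expressions in s, such as difference quotients, into a
  series at s = 1, to which \<open>C2a_series\<close> applies.\<close>

definition wser :: "(nat \<Rightarrow> real) \<Rightarrow> ser \<Rightarrow> ser"
  where "wser d A = Abs_fps (\<lambda>J. scal (d J) (A $ J))"

definition dser :: "ser \<Rightarrow> ser"
  where "dser A = Abs_fps (\<lambda>J. scal (real (Suc J)) (A $ Suc J))"

lemma lookup_wser: "lookup (wser d A $ J) k = econst (d J) * lookup (A $ J) k"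
  by (simp add: wser_def scal_def lookup_cw)

lemma lookup_dser: "lookup (dser A $ J) k = econst (real (Suc J)) * lookup (A $ Suc J) k"
  by (simp add: dser_def scal_def lookup_cw)

lemma pr_scaled: "pr m c (scal r p) y x = r * pr m c p y x"
  unfolding scal_def by (rule pr_cw_scale) auto

lemma Wn_scaled: "Wn m a (scal r p) \<le> \<bar>r\<bar> * Wn m a p"
  unfolding scal_def
proof (rule Wn_cw)
  fix k
  have "nrm (econst r * lookup p k) \<le> \<bar>r\<bar> * nrm (lookup p k)"
    by (rule nrm_leI) (simp add: abs_mult mult_left_mono ev_le_nrm)
  then have "(1 + l1 m k) ^ a * nrm (econst r * lookup p k) \<le> (1 + l1 m k) ^ a * (\<bar>r\<bar> * nrm (lookup p k))"
    by (rule mult_left_mono) simp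
  then show "(1 + l1 m k) ^ a * nrm (econst r * lookup p k) \<le> \<bar>r\<bar> * (1 + l1 m k) ^ a * nrm (lookup p k)"
    by (simp add: mult_ac)
qed simp

lemma sinv_dser: "sinv m A \<Longrightarrow> sinv m (dser A)"
  by (simp add: sinv_def dser_def scal_def inv_pm_cwc)

lemma const_wser: "const_ser A \<Longrightarrow> const_ser (wser d A)"
  unfolding const_ser_def lookup_wser by (metis econst_simps(2))

lemma const_dser: "const_ser A \<Longrightarrow> const_ser (dser A)"
  unfolding const_ser_def lookup_dser by (metis econst_simps(2))

text \<open>Convergence in the open disc is stable under termwise differentiation, whereas a bound
  at the radius itself is not.\<close>

definition conv_ser :: "nat \<Rightarrow> real \<Rightarrow> ser \<Rightarrow> bool"
  where "conv_ser m e A \<longleftrightarrow> (\<forall>x. \<bar>x\<bar> < e \<longrightarrow> summable (\<lambda>J. Wn m 0 (A $ J) * x ^ J))"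

lemma conv_ser_bd:
  assumes "bd m e 0 A K"
  shows "conv_ser m e A"
  unfolding conv_ser_def
proof (intro allI impI)
  fix x :: real assume x: "\<bar>x\<bar> < e"
  have "summable (\<lambda>J. e ^ J * Wn m 0 (A $ J))"
    using assms x by (intro bounded_imp_summable[of _ K]) (auto simp: bd_def)
  then show "summable (\<lambda>J. Wn m 0 (A $ J) * x ^ J)"
  proof (rule summable_comparison_test')
    fix J
    have "\<bar>x\<bar> ^ J \<le> e ^ J" using x by (intro power_mono) auto
    then show "norm (Wn m 0 (A $ J) * x ^ J) \<le> e ^ J * Wn m 0 (A $ J)"
      using mult_right_mono[of "\<bar>x\<bar> ^ J" "e ^ J" "Wn m 0 (A $ J)"] by (simp add: abs_mult power_abs mult.commute)
  qed
qed

lemma conv_ser_dser: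
  assumes "conv_ser m e A"
  shows "conv_ser m e (dser A)"
  unfolding conv_ser_def
proof (intro allI impI)
  fix x :: real assume x: "\<bar>x\<bar> < e"
  have "summable (\<lambda>J. diffs (\<lambda>J. Wn m 0 (A $ J)) J * \<bar>x\<bar> ^ J)"
    using assms x by (intro termdiff_converges[of _ e]) (auto simp: conv_ser_def)
  then show "summable (\<lambda>J. Wn m 0 (dser A $ J) * x ^ J)"
  proof (rule summable_comparison_test')
    fix J
    have "Wn m 0 (dser A $ J) \<le> diffs (\<lambda>J. Wn m 0 (A $ J)) J"
      using Wn_scaled[of m 0 "real (Suc J)" "A $ Suc J"] by (simp add: dser_def diffs_def)
    then show "norm (Wn m 0 (dser A $ J) * x ^ J) \<le> diffs (\<lambda>J. Wn m 0 (A $ J)) J * \<bar>x\<bar> ^ J"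
      by (simp add: abs_mult power_abs mult_right_mono)
  qed
qed

lemma conv_ser_summable:
  assumes "conv_ser m e A" "\<bar>s\<bar> < e"
  shows "summable (\<lambda>J. s ^ J * pr m c (A $ J) 0 x)"
proof (rule summable_comparison_test')
  show "summable (\<lambda>J. Wn m 0 (A $ J) * \<bar>s\<bar> ^ J)" using assms by (simp add: conv_ser_def)
  show "norm (s ^ J * pr m c (A $ J) 0 x) \<le> Wn m 0 (A $ J) * \<bar>s\<bar> ^ J" for J
    using pr_bound[of 0 m c "A $ J" x] by (simp add: abs_mult power_abs mult.commute mult_left_mono)
qed

lemma EvR_dser_sums:
  assumes "conv_ser m e A" "\<bar>s\<bar> < e"
  shows "(\<lambda>J. real J * s ^ (J - 1) * pr m c (A $ J) 0 x) sums EvR m s c (dser A) 0 x"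
proof -
  have "(\<lambda>J. s ^ J * pr m c (dser A $ J) 0 x) sums EvR m s c (dser A) 0 x"
    unfolding EvR_def using conv_ser_summable[OF conv_ser_dser[OF assms(1)] assms(2)] by (rule summable_sums)
  then have "(\<lambda>J. real (Suc J) * s ^ (Suc J - 1) * pr m c (A $ Suc J) 0 x) sums EvR m s c (dser A) 0 x"
    by (simp add: dser_def pr_scaled mult_ac)
  from sums_Suc[OF this] show ?thesis by simp
qed

lemma EvR_has_derivative_s:
  assumes "conv_ser m e A" "\<bar>s\<bar> < e"
  shows "((\<lambda>s. EvR m s c A 0 x) has_real_derivative EvR m s c (dser A) 0 x) (at s)"
proof -
  have s: "summable (\<lambda>J. pr m c (A $ J) 0 x * z ^ J)" if "norm z < e" for z
    using conv_ser_summable[OF assms(1), of z] that by (simp add: mult.commute)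
  have "((\<lambda>s. suminf (\<lambda>J. pr m c (A $ J) 0 x * s ^ J)) has_real_derivative
     suminf (\<lambda>J. diffs (\<lambda>J. pr m c (A $ J) 0 x) J * s ^ J)) (at s)"
    by (rule termdiffs_strong'[OF s]) (use assms(2) in auto)
  then show ?thesis
    by (simp add: EvR_def dser_def pr_scaled diffs_def mult_ac)
qed

lemma smooth_real_curve_series:
  assumes A: "conv_ser m e A"
  shows "smooth_real_curve {-e<..<e} (\<lambda>s. EvR m s c A 0 x)"
proof -
  have conv: "conv_ser m e ((dser ^^ k) A)" for k by (induction k) (auto intro: A conv_ser_dser)
  have "\<forall>s\<in>{-e<..<e}. (deriv ^^ k) (\<lambda>s. EvR m s c A 0 x) s = EvR m s c ((dser ^^ k) A) 0 x
     \<and> ((deriv ^^ k) (\<lambda>s. EvR m s c A 0 x) has_real_derivative EvR m s c ((dser ^^ Suc k) A) 0 x) (at s)" for k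
  proof (induction k)
    case 0
    then show ?case using EvR_has_derivative_s[OF A] by auto
  next
    case (Suc k)
    have eq: "(deriv ^^ Suc k) (\<lambda>s. EvR m s c A 0 x) s = EvR m s c ((dser ^^ Suc k) A) 0 x" if "s \<in> {-e<..<e}" for s
      using Suc that by (auto intro: DERIV_imp_deriv)
    have "((deriv ^^ Suc k) (\<lambda>s. EvR m s c A 0 x) has_real_derivative EvR m s c ((dser ^^ Suc (Suc k)) A) 0 x) (at s)"
      if s: "s \<in> {-e<..<e}" for s
    \<comment> \<open>The formula for the iterated \<open>deriv\<close> is known on the open
      interval, which suffices to differentiate it there.\<close>
    proof (rule has_field_derivative_transform_within_open[of "\<lambda>s. EvR m s c ((dser ^^ Suc k) A) 0 x" _ s "{-e<..<e}"])
      show "((\<lambda>s. EvR m s c ((dser ^^ Suc k) A) 0 x) has_real_derivative EvR m s c ((dser ^^ Suc (Suc k)) A) 0 x) (at s)"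
        using EvR_has_derivative_s[OF conv[of "Suc k"], of s c x] s by auto
    qed (use s eq in auto)
    then show ?case using eq by blast
  qed
  then show ?thesis unfolding smooth_real_curve_def real_differentiable_def by blast
qed

lemma EvR_C2a_pe:
  assumes m: "m \<ge> 1" and \<alpha>: "0 < \<alpha>" "\<alpha> < 1" and A: "conv_ser m e A" "const_ser A" "sinv m A" and s: "\<bar>s\<bar> < e"
  shows "(\<lambda>x. EvR m s 0 A 0 x) \<in> C2a_pe m \<alpha>"
proof -
  define B where "B = wser (\<lambda>J. s ^ J) A"
  have eq: "(\<lambda>x. EvR m s 0 A 0 x) = (\<lambda>x. EvR m 1 0 B 0 x)"
    by (simp add: EvR_def B_def wser_def pr_scaled)
  have S: "summable (\<lambda>J. Wn m 0 (A $ J) * \<bar>s\<bar> ^ J)" using A(1) s by (simp add: conv_ser_def)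
  have "(\<Sum>J\<le>n. Wn m 0 (B $ J)) \<le> suminf (\<lambda>J. Wn m 0 (A $ J) * \<bar>s\<bar> ^ J)" for n
  proof -
    have "(\<Sum>J\<le>n. Wn m 0 (B $ J)) \<le> (\<Sum>J\<le>n. Wn m 0 (A $ J) * \<bar>s\<bar> ^ J)"
    proof (rule sum_mono)
      fix J
      show "Wn m 0 (B $ J) \<le> Wn m 0 (A $ J) * \<bar>s\<bar> ^ J"
        using Wn_scaled[of m 0 "s ^ J" "A $ J"] by (simp add: B_def wser_def power_abs mult.commute)
    qed
    also have "\<dots> \<le> suminf (\<lambda>J. Wn m 0 (A $ J) * \<bar>s\<bar> ^ J)" by (rule sum_le_suminf[OF S]) auto
    finally show ?thesis .
  qed
  then have "bd m 1 0 B (suminf (\<lambda>J. Wn m 0 (A $ J) * \<bar>s\<bar> ^ J))" by (simp add: bd_def)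
  then have "(\<lambda>x. EvR m s 0 A 0 x) \<in> C2a m \<alpha>"
    unfolding eq using const_wser[OF A(2)] by (intro C2a_series[OF m \<alpha>]) (auto simp: B_def)
  then show ?thesis
    by (simp add: C2a_pe_def periodic_on_def even_on_def EvR_shift EvR_flip[OF A(3)])
qed

text \<open>By Taylor's formula order J of the difference is at most |eta| J (J - 1) rho^(J-2) times
  the coefficient. These terms sum to the twice differentiated majorant, so the Hoelder norm is
  O(eta).\<close>

lemma C2a_difference_quotient:
  assumes m: "m \<ge> 1" and \<alpha>: "0 < \<alpha>" "\<alpha> < 1" and A: "conv_ser m e A" "const_ser A" and s: "\<bar>s\<bar> < e"
  shows "((\<lambda>\<eta>. C2a_norm m \<alpha> (\<lambda>x. (EvR m (s + \<eta>) 0 A 0 x - EvR m s 0 A 0 x) / \<eta> - EvR m s 0 (dser A) 0 x)) \<longlongrightarrow> 0) (at 0)"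
proof -
  \<comment> \<open>A radius strictly between |s| and \<open>e\<close>, so that s + eta stays inside
    for small eta.\<close>
  define \<rho> where "\<rho> = (\<bar>s\<bar> + e) / 2"
  have \<rho>: "\<bar>s\<bar> < \<rho>" "\<rho> < e" "0 \<le> \<rho>" using s by (auto simp: \<rho>_def)
  define c where "c J = Wn m 0 (A $ J)" for J
  define b where "b J = real J * real (J - Suc 0) * \<rho> ^ (J - 2) * c J" for J
  have sb: "summable b"
  proof -
    have "summable (\<lambda>n. diffs (diffs c) n * \<rho> ^ n)"
    proof (rule termdiff_converges[of _ e])
      show "summable (\<lambda>n. diffs c n * x ^ n)" if "norm x < e" for x
        using A(1) that by (intro termdiff_converges[of _ e]) (auto simp: conv_ser_def c_def)
    qed (use \<rho> in auto)
    also have "(\<lambda>n. diffs (diffs c) n * \<rho> ^ n) = (\<lambda>n. b (Suc (Suc n)))"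
      by (simp add: diffs_def b_def fun_eq_iff algebra_simps)
    finally have "summable (\<lambda>n. b (Suc n))" by (subst summable_Suc_iff[symmetric])
    then show ?thesis by (subst summable_Suc_iff[symmetric])
  qed
  have b0: "b J \<ge> 0" for J using \<rho> by (simp add: b_def c_def)
  define M where "M = (1 + real m + 33 * (real m)\<^sup>2) * suminf b"
  have *: "0 \<le> C2a_norm m \<alpha> (\<lambda>x. (EvR m (s + \<eta>) 0 A 0 x - EvR m s 0 A 0 x) / \<eta> - EvR m s 0 (dser A) 0 x)
     \<and> C2a_norm m \<alpha> (\<lambda>x. (EvR m (s + \<eta>) 0 A 0 x - EvR m s 0 A 0 x) / \<eta> - EvR m s 0 (dser A) 0 x) \<le> M * \<bar>\<eta>\<bar>"
    if \<eta>: "\<eta> \<noteq> 0" "\<bar>\<eta>\<bar> < \<rho> - \<bar>s\<bar>" for \<eta>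
  proof -
    define q where "q J = ((s + \<eta>) ^ J - s ^ J) / \<eta> - real J * s ^ (J - 1)" for J
    have s\<eta>: "\<bar>s + \<eta>\<bar> < \<rho>" using \<eta> by linarith
    have q: "\<bar>q J\<bar> \<le> real J * real (J - Suc 0) * \<rho> ^ (J - 2) * \<bar>\<eta>\<bar>" for J
      using lemma_termdiff3[of \<eta> s \<rho> J] \<eta> \<rho> s\<eta> by (simp add: q_def)
    have eq: "(EvR m (s + \<eta>) 0 A 0 x - EvR m s 0 A 0 x) / \<eta> - EvR m s 0 (dser A) 0 x = EvR m 1 0 (wser q A) 0 x" for x
    proof -
      have 1: "(\<lambda>J. (s + \<eta>) ^ J * pr m 0 (A $ J) 0 x) sums EvR m (s + \<eta>) 0 A 0 x"
        unfolding EvR_def using conv_ser_summable[OF A(1), of "s + \<eta>"] s\<eta> \<rho> by (intro summable_sums) auto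
      have 2: "(\<lambda>J. s ^ J * pr m 0 (A $ J) 0 x) sums EvR m s 0 A 0 x"
        unfolding EvR_def using conv_ser_summable[OF A(1) s] by (rule summable_sums)
      have "(\<lambda>J. ((s + \<eta>) ^ J * pr m 0 (A $ J) 0 x - s ^ J * pr m 0 (A $ J) 0 x) / \<eta> - real J * s ^ (J - 1) * pr m 0 (A $ J) 0 x)
         sums ((EvR m (s + \<eta>) 0 A 0 x - EvR m s 0 A 0 x) / \<eta> - EvR m s 0 (dser A) 0 x)"
        by (intro sums_diff sums_divide 1 2 EvR_dser_sums[OF A(1) s])
      also have "(\<lambda>J. ((s + \<eta>) ^ J * pr m 0 (A $ J) 0 x - s ^ J * pr m 0 (A $ J) 0 x) / \<eta> - real J * s ^ (J - 1) * pr m 0 (A $ J) 0 x)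
         = (\<lambda>J. 1 ^ J * pr m 0 (wser q A $ J) 0 x)"
        by (simp add: wser_def pr_scaled q_def left_diff_distrib fun_eq_iff diff_divide_distrib)
      finally show ?thesis by (simp add: EvR_def sums_iff)
    qed
    have "(\<Sum>J\<le>n. Wn m 0 (wser q A $ J)) \<le> suminf b * \<bar>\<eta>\<bar>" for n
    proof -
      have "Wn m 0 (wser q A $ J) \<le> b J * \<bar>\<eta>\<bar>" for J
      proof -
        have "Wn m 0 (wser q A $ J) \<le> \<bar>q J\<bar> * c J" by (simp add: wser_def c_def Wn_scaled)
        also have "\<dots> \<le> (real J * real (J - Suc 0) * \<rho> ^ (J - 2) * \<bar>\<eta>\<bar>) * c J"
          using q by (intro mult_right_mono) (auto simp: c_def)
        finally show ?thesis by (simp add: b_def mult_ac)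
      qed
      then have "(\<Sum>J\<le>n. Wn m 0 (wser q A $ J)) \<le> (\<Sum>J\<le>n. b J * \<bar>\<eta>\<bar>)" by (intro sum_mono)
      also have "\<dots> = (\<Sum>J\<le>n. b J) * \<bar>\<eta>\<bar>" by (simp add: sum_distrib_right)
      also have "\<dots> \<le> suminf b * \<bar>\<eta>\<bar>" using b0 by (intro mult_right_mono sum_le_suminf[OF sb]) auto
      finally show ?thesis .
    qed
    then have bd: "bd m 1 0 (wser q A) (suminf b * \<bar>\<eta>\<bar>)" by (simp add: bd_def)
    show ?thesis unfolding eq M_def
      using C2a_series(2,3)[OF m \<alpha> bd const_wser[OF A(2)]] by (simp add: mult.assoc)
  qed
  have ev: "eventually (\<lambda>\<eta>. \<eta> \<noteq> 0 \<and> \<bar>\<eta>\<bar> < \<rho> - \<bar>s\<bar>) (at (0::real))"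
    using \<rho> by (auto simp: eventually_at intro!: exI[of _ "\<rho> - \<bar>s\<bar>"])
  show ?thesis
  proof (rule tendsto_sandwich[of "\<lambda>_. 0" _ _ "\<lambda>\<eta>. M * \<bar>\<eta>\<bar>"])
    show "((\<lambda>\<eta>. M * \<bar>\<eta>\<bar>) \<longlongrightarrow> 0) (at 0)" by (auto intro!: tendsto_eq_intros)
  qed (use ev * in \<open>auto elim!: eventually_mono\<close>)
qed

lemma smooth_curve_series:
  assumes m: "m \<ge> 1" and \<alpha>: "0 < \<alpha>" "\<alpha> < 1" and A: "conv_ser m e A" "const_ser A" "sinv m A"
  shows "smooth_curve_C2a m \<alpha> {-e<..<e} (\<lambda>s x. EvR m s 0 A 0 x)"
  unfolding smooth_curve_C2a_def
proof (intro exI conjI ballI allI)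
  have B: "conv_ser m e ((dser ^^ k) A) \<and> const_ser ((dser ^^ k) A) \<and> sinv m ((dser ^^ k) A)" for k
    by (induction k) (auto intro: A conv_ser_dser const_dser sinv_dser)
  fix k and s :: real assume "s \<in> {-e<..<e}"
  then have s: "\<bar>s\<bar> < e" by auto
  show "EvR m s 0 ((dser ^^ 0) A) 0 x = EvR m s 0 A 0 x" for x by simp
  show "(\<lambda>x. EvR m s 0 ((dser ^^ k) A) 0 x) \<in> C2a_pe m \<alpha>"
    using B by (intro EvR_C2a_pe[OF m \<alpha> _ _ _ s]) auto
  show "((\<lambda>\<eta>. C2a_norm m \<alpha> (\<lambda>x. (EvR m (s + \<eta>) 0 ((dser ^^ k) A) 0 x - EvR m s 0 ((dser ^^ k) A) 0 x) / \<eta>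
      - EvR m s 0 ((dser ^^ Suc k) A) 0 x)) \<longlongrightarrow> 0) (at 0)"
    using C2a_difference_quotient[OF m \<alpha> _ _ s, of "(dser ^^ k) A"] B by simp
qed

section \<open>The domain and the solution\<close>

lemma Dif_Kop: "Dif (Kop i p) = Kop i (Dif p)"
  by (rule poly_mapping_eqI) (simp add: lookup_Dif lookup_Kop)

lemma lookup_mult_const:
  assumes "\<And>k. \<exists>r. lookup p k = econst r" "\<And>k. \<exists>r. lookup q k = econst r"
  shows "\<exists>r. lookup (p * q) k = econst r"
proof -
  obtain a b where ab: "\<And>k. lookup p k = econst (a k)" "\<And>k. lookup q k = econst (b k)"
    using assms by metis
  have "lookup (p * q) l = econst (\<Sum>k\<in>keys p. \<Sum>k'\<in>keys q. if k + k' = l then a k * b k' else 0)" for l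
    unfolding pm_mult_monomials[of p q]
    by (auto simp: lookup_sum lookup_single ab econst_sum when_def econst_simps(2,5) intro!: sum.cong)
  then show ?thesis by blast
qed

lemma const_ser_mult: "const_ser A \<Longrightarrow> const_ser B \<Longrightarrow> const_ser (A * B)"
proof -
  assume AB: "const_ser A" "const_ser B"
  have "\<exists>r. lookup (A $ i * B $ l) k = econst r" for i l k
    by (rule lookup_mult_const) (use AB in \<open>auto simp: const_ser_def\<close>)
  then obtain f where "\<And>i l k. lookup (A $ i * B $ l) k = econst (f i l k)" by metis
  then have "lookup ((A * B) $ n) k = econst (\<Sum>i=0..n. f i (n - i) k)" for n k
    by (simp add: fps_mult_nth lookup_sum econst_sum)
  then show ?thesis unfolding const_ser_def by blast
qed

lemma const_ser_add: "const_ser A \<Longrightarrow> const_ser B \<Longrightarrow> const_ser (A + B)"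
  unfolding const_ser_def fps_add_nth lookup_add by (metis econst_simps(1))

lemma const_ser_singles: "(\<And>n. \<exists>r. A $ n = single 0 (econst r)) \<Longrightarrow> const_ser A"
  unfolding const_ser_def
proof (intro allI)
  fix n k
  assume "\<And>n. \<exists>r. A $ n = single 0 (econst r)"
  then obtain r where "A $ n = single 0 (econst r)" by blast
  then have "lookup (A $ n) k = econst (if k = 0 then r else 0)" by (auto simp: lookup_single when_def econst_simps)
  then show "\<exists>r. lookup (A $ n) k = econst r" by blast
qed

lemma EvR_le:
  assumes A: "bd m e 0 A K" and s: "\<bar>s\<bar> \<le> e" "0 \<le> y" "y \<le> 1"
  shows "\<bar>EvR m s c A y x\<bar> \<le> K"
proof -
  have le: "\<bar>s ^ J * pr m c (A $ J) y x\<bar> \<le> e ^ J * Wn m 0 (A $ J)" for J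
    using mult_mono[OF power_mono[OF s(1) abs_ge_zero, of J] pr_bound[OF s(2,3), of m c "A $ J" x]] s(1)
    by (simp add: abs_mult power_abs)
  have sum: "(\<Sum>J\<le>n. e ^ J * Wn m 0 (A $ J)) \<le> K" for n using A by (simp add: bd_def)
  have S: "summable (\<lambda>J. e ^ J * Wn m 0 (A $ J))"
    by (rule bounded_imp_summable[OF _ sum]) (use s in auto)
  have a: "summable (\<lambda>J. \<bar>s ^ J * pr m c (A $ J) y x\<bar>)"
    by (rule summable_comparison_test'[OF S, of 0]) (use le in auto)
  have "\<bar>EvR m s c A y x\<bar> \<le> suminf (\<lambda>J. \<bar>s ^ J * pr m c (A $ J) y x\<bar>)"
    unfolding EvR_def using a by (rule summable_rabs)
  also have "\<dots> \<le> suminf (\<lambda>J. e ^ J * Wn m 0 (A $ J))" by (intro suminf_le a S le)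
  also have "\<dots> \<le> K" by (rule LIMSEQ_le_const2[OF summable_LIMSEQ'[OF S]]) (use sum in auto)
  finally show ?thesis .
qed

lemma EvR_Lap:
  assumes "bd m e 0 A K" "\<bar>s\<bar> \<le> e" "0 \<le> y" "y \<le> 1"
  shows "EvR m s 0 (smap (Lap m) A) y x = (\<Sum>i<m. EvR m s pi (smap (Kop i) (smap (Kop i) A)) y x)"
proof -
  have g: "good m e 0 (smap (\<lambda>p. Kop i (Kop i p)) A)" if "i < m" for i
    using that pr_Kop2_bound by (intro pr_good[OF assms(1), of 2]) auto
  have "EvR m s 0 (smap (Lap m) A) y x = suminf (\<lambda>J. \<Sum>i<m. s ^ J * pr m pi (Kop i (Kop i (A $ J))) y x)"
    by (simp add: EvR_def pr_Lap sum_distrib_left)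
  also have "\<dots> = (\<Sum>i<m. suminf (\<lambda>J. s ^ J * pr m pi (Kop i (Kop i (A $ J))) y x))"
    using good_summable0(2)[OF g assms(2-)] by (intro suminf_sum) simp
  finally show ?thesis by (simp add: EvR_def)
qed

definition rad :: "nat \<Rightarrow> (nat \<Rightarrow> real) \<Rightarrow> real"
  where "rad N z = (\<Sum>i<N. (z i)\<^sup>2)"

definition xpart :: "nat \<Rightarrow> (nat \<Rightarrow> real) \<Rightarrow> nat \<Rightarrow> real"
  where "xpart N z = (\<lambda>i. z (i + N))"

lemma rad_nonneg [simp]: "rad N z \<ge> 0"
  by (simp add: rad_def sum_nonneg)

lemma rad_upd: "rad N (z(l := u)) = (if l < N then rad N z - (z l)\<^sup>2 + u\<^sup>2 else rad N z)"
proof (cases "l < N")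
  case True
  have "(\<Sum>i\<in>{..<N} - {l}. ((z(l := u)) i)\<^sup>2) = (\<Sum>i\<in>{..<N} - {l}. (z i)\<^sup>2)" by (intro sum.cong) auto
  then show ?thesis using True
    by (simp add: rad_def sum.remove[of "{..<N}" l])
next
  case False
  then have "(\<Sum>i<N. ((z(l := u)) i)\<^sup>2) = (\<Sum>i<N. (z i)\<^sup>2)" by (intro sum.cong) auto
  then show ?thesis using False by (simp add: rad_def)
qed

lemma xpart_upd: "xpart N (z(l := u)) = (if l < N then xpart N z else (xpart N z)(l - N := u))"
  by (auto simp: xpart_def fun_eq_iff)

lemma xpart_join [simp]: "xpart N (join N t x) = x"
  by (simp add: xpart_def join_def)

lemma rad_join [simp]: "rad N (join N t x) = rad N t"
  by (simp add: rad_def join_def)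

lemma enorm_rad: "enorm N t = sqrt (rad N t)"
  by (simp add: L2_set_def rad_def)

lemma abs_le_sqrt_rad: "l < N \<Longrightarrow> \<bar>z l\<bar> \<le> sqrt (rad N z)"
  by (rule real_le_rsqrt) (use member_le_sum[of l "{..<N}" "\<lambda>i. (z i)\<^sup>2"] in \<open>simp add: rad_def\<close>)

lemma continuous_on_rad: "continuous_on S (rad N)"
  unfolding rad_def
  by (intro continuous_intros continuous_on_subset[OF continuous_on_product_coordinates subset_UNIV])

lemma continuous_on_xpart: "continuous_on S (xpart N)"
  unfolding xpart_def
  by (intro continuous_on_coordinatewise_then_product continuous_on_subset[OF continuous_on_product_coordinates subset_UNIV])

lemma continuous_on_upd: "continuous_on S (\<lambda>u. (z :: nat \<Rightarrow> real)(l := u))"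
proof (rule continuous_on_coordinatewise_then_product)
  show "continuous_on S (\<lambda>u. (z(l := u)) i)" for i by (cases "i = l") auto
qed

lemma sum_split: "(\<Sum>l<N + m. f l) = (\<Sum>l<N. f l) + (\<Sum>i<m. f (i + N))" for f :: "nat \<Rightarrow> real"
  by (induction m) (auto simp: add_ac)

context bif_solution
begin

lemma const_Z: "const_ser Z"
proof -
  have "lookup (Z $ n) k = econst (ev (lookup (G $ n) k) 1 / (2 * a))" for n k
    by (simp add: Z_def Zs_def lookup_cw zc_def econst_simps)
  then show ?thesis unfolding const_ser_def by blast
qed

lemma const_TT: "const_ser TT"
proof (rule const_ser_singles)
  fix n
  have "TT $ n = single 0 (econst (if n = 0 then th0 else t n))"
    by (simp add: TT_def tser_def se_def t0 econst_simps)
  then show "\<exists>r. TT $ n = single 0 (econst r)" by blast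
qed

lemma const_H: "const_ser H"
proof -
  have "fps_X $ n = single 0 (econst (if n = 1 then 1 else 0))" for n :: nat
    by (auto simp: fps_X_def econst_simps)
  then have "const_ser fps_X" by (intro const_ser_singles) blast
  moreover have "(1 :: ser) $ n = single 0 (econst (if n = 0 then 1 else 0))" for n :: nat
    by (auto simp: econst_simps)
  then have "const_ser 1" by (intro const_ser_singles) blast
  ultimately show ?thesis unfolding H_def by (intro const_ser_mult const_ser_add const_Z const_TT)
qed

lemma sinv_H: "sinv m H"
  unfolding H_def by (intro sinv_intros invT invZ)

lemma H_bound: obtains K where "bd m e 2 H K" "bd m e 2 Z K" "bd m e 2 TT K"
proof -
  obtain K where K: "bd m e 2 Z K" by (rule component_bound)
  have T: "bd m e 2 TT (\<bar>th0\<bar> + R)" unfolding TT_def by (intro bd_add bd_sc e0 bdt)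
  have "bd m e 2 H ((\<bar>th0\<bar> + R) * (1 + e * K))" unfolding H_def
    by (intro bd_mult T bd_add bd_1 bd_X K e0)
  then show ?thesis using K T
    by (intro that[of "max ((\<bar>th0\<bar> + R) * (1 + e * K)) (max K (\<bar>th0\<bar> + R))"]) (auto elim: bd_le)
qed

lemma EvR_H: "\<bar>s\<bar> \<le> e \<Longrightarrow> EvR m s 0 H 0 x = th s * (1 + s * zn s x)"
proof -
  assume "\<bar>s\<bar> \<le> e"
  then have s: "\<bar>s\<bar> \<le> e" "0 \<le> (0::real)" "(0::real) \<le> 1" by auto
  obtain K where K: "bd m e 2 Z K" "bd m e 2 TT K" by (rule H_bound)
  have "eval_to m e s 0 x H (th s * (1 + s * zn s x))"
    unfolding H_def
    using eval_to_base[OF K(1) invZ s, of x] eval_to_base[OF K(2) invT s, of x]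
    unfolding EvR_TT[of s 0 x]
    by (intro eval_to_add eval_to_mult eval_to_1[OF s] eval_to_X[OF s]) auto
  then show ?thesis by (simp add: eval_to_def)
qed

lemma V_nth: "V $ 0 = single 0 U" "V $ Suc J = Y $ J"
  by (simp_all add: V_def se_def)

text \<open>The orders of V are U followed by those of Y, so an arbitrary F can be applied order by
  order.\<close>

lemma EvR_V:
  assumes "good m e 0 (smap F Y)" "\<bar>s\<bar> \<le> e" "0 \<le> y" "y \<le> 1"
  shows "EvR m s c (smap F V) y x = pr m c (F (single 0 U)) y x + s * EvR m s c (smap F Y) y x"
proof -
  have S: "summable (\<lambda>J. s ^ J * pr m c (F (Y $ J)) y x)"
    using good_summable0(2)[OF assms] by simp
  then have "summable (\<lambda>J. s * (s ^ J * pr m c (F (Y $ J)) y x))" by (rule summable_mult)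
  then have "summable (\<lambda>J. s ^ J * pr m c (F (V $ J)) y x)"
    by (subst summable_Suc_iff[symmetric]) (simp add: V_nth mult_ac)
  from suminf_split_head[OF this]
  have "EvR m s c (smap F V) y x = pr m c (F (single 0 U)) y x + suminf (\<lambda>J. s * (s ^ J * pr m c (F (Y $ J)) y x))"
    by (simp add: EvR_def V_nth mult_ac)
  then show ?thesis using suminf_mult[OF S, of s] by (simp add: EvR_def)
qed

lemma Dop_V: "smap Dop V = se (eD N U) + fps_X * smap Dop Y"
proof (rule fps_ext)
  fix n
  have "Dop (single 0 U) = single 0 (eD N U)"
    by (rule poly_mapping_eqI) (simp add: lookup_Dop lookup_single when_def)
  then show "smap Dop V $ n = (se (eD N U) + fps_X * smap Dop Y) $ n"
    by (cases n) (simp_all add: V_nth se_def)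
qed

lemma V_bound: obtains K where "bd m e 0 V K" "bd m e 0 (smap Dop V) K"
proof -
  obtain K where K: "bd m e 0 (smap Dop Y) K" "bd m e 2 Y K" by (rule component_bound)
  have "bd m e 0 V (nrm U + e * K)" unfolding V_def
    using bd_mono[OF K(2)] by (intro bd_add bd_mult bd_se bd_X e0) auto
  moreover have "bd m e 0 (smap Dop V) (nrm (eD N U) + e * K)" unfolding Dop_V
    by (intro bd_add bd_mult bd_se bd_X e0 K)
  ultimately show ?thesis
    by (intro that[of "max (nrm U + e * K) (nrm (eD N U) + e * K)"]) (auto elim: bd_le)
qed

lemma Wn_Dif: "Wn m 0 (Dif p) \<le> Wn m 0 (Dop p)"
proof -
  have "Wn m 0 (Dif p) = (\<Sum>k\<in>keys p. wt m 0 k * nrm (ediff (lookup p k)))"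
    by (subst Wn_superset[of "keys p"]) (auto simp: Dif_def lookup_cw intro: subsetD[OF keys_cw])
  moreover have "Wn m 0 (Dop p) = (\<Sum>k\<in>keys p. wt m 0 k * nrm (eD N (lookup p k)))"
    by (subst Wn_superset[of "keys p"]) (auto simp: Dop_def lookup_cw intro: subsetD[OF keys_cw])
  ultimately show ?thesis using nrm_ediff[OF N] by (auto intro!: sum_mono mult_left_mono)
qed

text \<open>The factor y = \<open>sqrt y ^ 2\<close> is the price of a second y-derivative, paid for
  by \<open>nrm_X_ediff2\<close>.\<close>

lemma pr_Dif2_bound:
  assumes y: "0 \<le> y" "y \<le> 1"
  shows "sqrt y ^ 2 * \<bar>pr m c (Dif (Dif p)) y x\<bar> \<le> (1 + real N) * Wn m 0 (Dop p)"
proof -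
  have "\<bar>y * pr m c (Dif (Dif p)) y x\<bar> = \<bar>\<Sum>k\<in>keys p. y * ev (ediff (ediff (lookup p k))) y * cos (dot m k x + c)\<bar>"
    by (subst pr_superset[of "keys p"])
      (auto simp: Dif_def lookup_cw sum_distrib_left mult.assoc intro: subsetD[OF keys_cw])
  also have "\<dots> \<le> (\<Sum>k\<in>keys p. (1 + real N) * (wt m 0 k * nrm (eD N (lookup p k))))"
  proof (rule order_trans[OF sum_abs sum_mono])
    fix k
    have "(y * \<bar>ev (ediff (ediff (lookup p k))) y\<bar>) * \<bar>cos (dot m k x + c)\<bar> \<le> ((1 + real N) * nrm (eD N (lookup p k))) * 1"
      by (intro mult_mono nrm_X_ediff2[OF N y]) auto
    also have "((1 + real N) * nrm (eD N (lookup p k))) * 1 \<le> (1 + real N) * (wt m 0 k * nrm (eD N (lookup p k)))"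
    proof -
      have "1 * nrm (eD N (lookup p k)) \<le> wt m 0 k * nrm (eD N (lookup p k))"
      by (intro mult_right_mono) (auto simp: wt_def)
      then show ?thesis unfolding mult_1 mult_1_right by (rule mult_left_mono) simp
    qed
    finally show "\<bar>y * ev (ediff (ediff (lookup p k))) y * cos (dot m k x + c)\<bar> \<le> (1 + real N) * (wt m 0 k * nrm (eD N (lookup p k)))"
      unfolding abs_mult abs_of_nonneg[OF y(1)] .
  qed
  also have "\<dots> = (1 + real N) * Wn m 0 (Dop p)"
    unfolding sum_distrib_left[symmetric]
    by (subst Wn_superset[of "keys p"]) (auto simp: Dop_def lookup_cw intro: subsetD[OF keys_cw])
  finally show ?thesis using y by (simp add: abs_mult)
qed

lemma good_V:
  shows "good m e 0 V" "good m e 0 (smap Dif V)" "good m e 2 (smap Dif (smap Dif V))"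
    "i < m \<Longrightarrow> good m e 0 (smap (Kop i) V)" "i < m \<Longrightarrow> good m e 0 (smap (Kop i) (smap Dif V))"
    "i < m \<Longrightarrow> good m e 0 (smap Dif (smap (Kop i) V))"
    "i < m \<Longrightarrow> l < m \<Longrightarrow> good m e 0 (smap (Kop l) (smap (Kop i) V))"
proof -
  obtain K where K: "bd m e 0 V K" "bd m e 0 (smap Dop V) K" by (rule V_bound)
  show "good m e 0 V" by (rule good_bd[OF K(1)])
  have D: "bd m e 0 (smap Dif V) K"
    unfolding bd_def
  proof (intro conjI allI)
    fix n
    have "(\<Sum>i\<le>n. e ^ i * Wn m 0 (smap Dif V $ i)) \<le> (\<Sum>i\<le>n. e ^ i * Wn m 0 (smap Dop V $ i))"
      using e0 Wn_Dif by (intro sum_mono mult_left_mono) auto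
    also have "\<dots> \<le> K" using K(2) by (simp add: bd_def)
    finally show "(\<Sum>i\<le>n. e ^ i * Wn m 0 (smap Dif V $ i)) \<le> K" .
  qed (rule e0)
  show "good m e 0 (smap Dif V)" by (rule good_bd[OF D])
  show "good m e 2 (smap Dif (smap Dif V))"
    by (rule good_fullW[OF K(2), of "1 + real N"]) (use pr_Dif2_bound in auto)
  show "good m e 0 (smap (Kop i) V)" if "i < m"
    using that pr_Kop_bound by (intro pr_good[OF K(1), of 1]) auto
  show *: "good m e 0 (smap (Kop i) (smap Dif V))" if "i < m"
    using that pr_Kop_bound by (intro pr_good[OF D, of 1]) auto
  have "smap Dif (smap (Kop i) V) = smap (Kop i) (smap Dif V)" by (simp add: fps_eq_iff Dif_Kop)
  then show "good m e 0 (smap Dif (smap (Kop i) V))" if "i < m" using *[OF that] by simp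
  have "good m e 0 (smap (\<lambda>p. Kop l (Kop i p)) V)" if "i < m" "l < m"
    using that pr_Kop2_bound by (intro pr_good[OF K(1), of 2]) auto
  moreover have "smap (\<lambda>p. Kop l (Kop i p)) V = smap (Kop l) (smap (Kop i) V)" by (simp add: fps_eq_iff)
  ultimately show "good m e 0 (smap (Kop l) (smap (Kop i) V))" if "i < m" "l < m" using that by simp
qed

end

section \<open>A fixed small s: the solution on its domain\<close>

locale bif_at = bif_solution +
  fixes s :: real
  assumes s: "\<bar>s\<bar> \<le> e" and th_pos: "th s > 0" and ze_pos: "\<And>x. 1 + s * zn s x > 0"
begin

definition ht :: "(nat \<Rightarrow> real) \<Rightarrow> real"
  where "ht x = th s * (1 + s * zn s x)"

definition ht1 :: "nat \<Rightarrow> (nat \<Rightarrow> real) \<Rightarrow> real"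
  where "ht1 i x = th s * (s * zi s i x)"

definition ht2 :: "nat \<Rightarrow> nat \<Rightarrow> (nat \<Rightarrow> real) \<Rightarrow> real"
  where "ht2 i l x = th s * (s * EvR m s pi (smap (Kop l) (smap (Kop i) Z)) 0 x)"

lemma ht_pos: "ht x > 0"
  using th_pos ze_pos by (simp add: ht_def)

lemma ht_deriv: "i < m \<Longrightarrow> ((\<lambda>u. ht (x(i := u))) has_real_derivative ht1 i x) (at (x i))"
  "i < m \<Longrightarrow> l < m \<Longrightarrow> ((\<lambda>u. ht1 i (x(l := u))) has_real_derivative ht2 i l x) (at (x l))"
  and continuous_on_ht: "continuous_on S ht" "i < m \<Longrightarrow> continuous_on S (ht1 i)"
    "i < m \<Longrightarrow> l < m \<Longrightarrow> continuous_on S (ht2 i l)"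
proof -
  obtain K where "bd m e 2 Z K" by (rule H_bound)
  then have K: "bd m e 0 Z K" using bd_mono by blast
  note D = EvR_const_derivs[OF K const_Z s]
  show "((\<lambda>u. ht (x(i := u))) has_real_derivative ht1 i x) (at (x i))" if "i < m"
    unfolding ht_def ht1_def by (rule derivative_eq_intros D(1)[OF that] refl)+ simp
  show "((\<lambda>u. ht1 i (x(l := u))) has_real_derivative ht2 i l x) (at (x l))" if "i < m" "l < m"
    unfolding ht1_def ht2_def by (rule derivative_eq_intros D(2)[OF that] refl)+ simp
  show "continuous_on S ht" unfolding ht_def by (intro continuous_intros D(3))
  show "continuous_on S (ht1 i)" if "i < m" unfolding ht1_def by (intro continuous_intros D(4) that)
  show "continuous_on S (ht2 i l)" if "i < m" "l < m" unfolding ht2_def by (intro continuous_intros D(5) that)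
qed

lemma continuous_on_ht_xpart:
  "continuous_on S (\<lambda>z. ht (xpart N z))" "i < m \<Longrightarrow> continuous_on S (\<lambda>z. ht1 i (xpart N z))"
  "i < m \<Longrightarrow> l < m \<Longrightarrow> continuous_on S (\<lambda>z. ht2 i l (xpart N z))"
  by (rule continuous_on_compose2[OF _ continuous_on_xpart subset_UNIV], rule continuous_on_ht; assumption)+

definition yv :: "(nat \<Rightarrow> real) \<Rightarrow> real"
  where "yv z = (ht (xpart N z))\<^sup>2 * rad N z"

text \<open>\<open>y1\<close> and \<open>y2\<close> are gradient and Hessian of y = h^2 |t|^2;
  coordinates below N belong to t, the others to x.\<close>

definition y1 :: "nat \<Rightarrow> (nat \<Rightarrow> real) \<Rightarrow> real"
  where "y1 l z = (if l < N then 2 * (ht (xpart N z))\<^sup>2 * z l else 2 * ht (xpart N z) * ht1 (l - N) (xpart N z) * rad N z)"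

definition y2 :: "nat \<Rightarrow> nat \<Rightarrow> (nat \<Rightarrow> real) \<Rightarrow> real"
  where "y2 l k z =
    (if l < N then if k < N then (if k = l then 2 * (ht (xpart N z))\<^sup>2 else 0)
       else 4 * ht (xpart N z) * ht1 (k - N) (xpart N z) * z l
     else if k < N then 4 * ht (xpart N z) * ht1 (l - N) (xpart N z) * z k
       else 2 * (ht1 (k - N) (xpart N z) * ht1 (l - N) (xpart N z) + ht (xpart N z) * ht2 (l - N) (k - N) (xpart N z)) * rad N z)"

definition vv :: "ser \<Rightarrow> real \<Rightarrow> (nat \<Rightarrow> real) \<Rightarrow> real"
  where "vv A c z = EvR m s c A (yv z) (xpart N z)"

lemma yv_nonneg [simp]: "yv z \<ge> 0"
  by (simp add: yv_def)

lemma coord_deriv: "((\<lambda>u. (z(k := u)) l) has_real_derivative (if k = l then 1 else 0)) (at (v :: real))"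
  by auto

lemma ht_slices: "((\<lambda>u. ht (xpart N (z(k := u)))) has_real_derivative (if k < N then 0 else ht1 (k - N) (xpart N z))) (at (z k))"
  if "k < N + m"
proof (cases "k < N")
  case False
  then have k: "k - N < m" using that by simp
  from ht_deriv(1)[OF k, of "xpart N z"] show ?thesis using False by (simp add: xpart_upd) (simp add: xpart_def)
qed (simp add: xpart_upd)

lemma ht1_slices: "((\<lambda>u. ht1 i (xpart N (z(k := u)))) has_real_derivative (if k < N then 0 else ht2 i (k - N) (xpart N z))) (at (z k))"
  if "k < N + m" "i < m"
proof (cases "k < N")
  case False
  then have k: "k - N < m" using that by simp
  from ht_deriv(2)[OF that(2) k, of "xpart N z"] show ?thesis using False by (simp add: xpart_upd) (simp add: xpart_def)
qed (simp add: xpart_upd)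

lemma rad_slices: "((\<lambda>u. rad N (z(k := u))) has_real_derivative (if k < N then 2 * z k else 0)) (at (z k))"
  unfolding rad_upd by (auto intro!: derivative_eq_intros)

lemma yv_deriv:
  assumes "l < N + m"
  shows "((\<lambda>u. yv (z(l := u))) has_real_derivative y1 l z) (at (z l))"
  unfolding yv_def
  by (rule DERIV_cong, (rule derivative_intros ht_slices[OF assms] rad_slices)+)
    (auto simp: y1_def power2_eq_square algebra_simps)

lemma y1_deriv:
  assumes l: "l < N + m" and k: "k < N + m"
  shows "((\<lambda>u. y1 l (z(k := u))) has_real_derivative y2 l k z) (at (z k))"
proof (cases "l < N")
  case True
  have "((\<lambda>u. 2 * (ht (xpart N (z(k := u))))\<^sup>2 * (z(k := u)) l) has_real_derivative y2 l k z) (at (z k))"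
    by (rule DERIV_cong, (rule derivative_intros ht_slices[OF k] coord_deriv)+) (use True in \<open>auto simp: y2_def power2_eq_square algebra_simps\<close>)
  then show ?thesis using True by (simp add: y1_def)
next
  case False
  then have l': "l - N < m" using l by simp
  have "((\<lambda>u. 2 * ht (xpart N (z(k := u))) * ht1 (l - N) (xpart N (z(k := u))) * rad N (z(k := u))) has_real_derivative y2 l k z) (at (z k))"
    by (rule DERIV_cong, (rule derivative_intros ht_slices[OF k] ht1_slices[OF k l'] rad_slices)+) (use False in \<open>auto simp: y2_def algebra_simps\<close>)
  then show ?thesis using False by (simp add: y1_def)
qed

lemma continuous_on_coord: "continuous_on S (\<lambda>z. (z :: nat \<Rightarrow> real) i)"
  by (rule continuous_on_subset[OF continuous_on_product_coordinates subset_UNIV])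

lemma continuous_on_yv: "continuous_on S yv"
  unfolding yv_def by (intro continuous_intros continuous_on_ht_xpart continuous_on_rad)

lemma continuous_on_y1: "l < N + m \<Longrightarrow> continuous_on S (y1 l)"
  unfolding y1_def by (cases "l < N") (auto intro!: continuous_intros continuous_on_ht_xpart continuous_on_rad continuous_on_coord)

lemma continuous_on_y2:
  assumes "l < N + m" "k < N + m"
  shows "continuous_on S (y2 l k)"
proof -
  have "l - N < m \<or> l < N" "k - N < m \<or> k < N" using assms by auto
  then show ?thesis unfolding y2_def
    by (cases "l < N"; cases "k < N"; cases "k = l")
      (auto intro!: continuous_intros continuous_on_ht_xpart continuous_on_rad continuous_on_coord)
qed

text \<open>The gradient of y vanishes at the axis like sqrt y. Two such factors compensate the
  missing bound on the second y-derivative of V.\<close>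

definition yb :: "nat \<Rightarrow> (nat \<Rightarrow> real) \<Rightarrow> real"
  where "yb l z = (if l < N then 2 * ht (xpart N z) else 2 * \<bar>ht1 (l - N) (xpart N z)\<bar> * sqrt (rad N z))"

lemma sqrt_yv: "sqrt (yv z) = ht (xpart N z) * sqrt (rad N z)"
  using ht_pos[of "xpart N z"] by (simp add: yv_def real_sqrt_mult)

lemma y1_bound: "\<bar>y1 l z\<bar> \<le> yb l z * sqrt (yv z)"
proof (cases "l < N")
  case True
  have "(2 * (ht (xpart N z))\<^sup>2) * \<bar>z l\<bar> \<le> (2 * (ht (xpart N z))\<^sup>2) * sqrt (rad N z)"
    by (intro mult_left_mono abs_le_sqrt_rad True) auto
  then show ?thesis using True by (simp add: y1_def yb_def sqrt_yv abs_mult power2_eq_square)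
next
  case False
  have "rad N z = sqrt (rad N z) * sqrt (rad N z)" by simp
  then have "\<bar>y1 l z\<bar> = yb l z * sqrt (yv z)"
    using False ht_pos[of "xpart N z"] by (simp add: y1_def yb_def sqrt_yv abs_mult)
  then show ?thesis by simp
qed

lemma y1_y1_bound: "\<bar>y1 l z * y1 k z\<bar> \<le> (yb l z * yb k z) * sqrt (yv z) ^ 2"
proof -
  have "\<bar>y1 l z\<bar> * \<bar>y1 k z\<bar> \<le> (yb l z * sqrt (yv z)) * (yb k z * sqrt (yv z))"
    by (intro mult_mono y1_bound order_trans[OF abs_ge_zero y1_bound]) simp
  then show ?thesis unfolding abs_mult power2_eq_square by (simp only: mult_ac)
qed

lemma continuous_on_yb: "l < N + m \<Longrightarrow> continuous_on S (yb l)"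
  unfolding yb_def by (cases "l < N") (auto intro!: continuous_intros continuous_on_ht_xpart continuous_on_rad)

lemma vv_continuous:
  assumes A: "good m e r A" and S: "\<And>z. z \<in> S \<Longrightarrow> yv z \<le> 1" and P: "continuous_on S P" "continuous_on S b"
    "\<And>z. z \<in> S \<Longrightarrow> \<bar>P z\<bar> \<le> b z * sqrt (yv z) ^ r"
  shows "continuous_on S (\<lambda>z. P z * vv A c z)"
proof -
  \<comment> \<open>Normalising by \<open>b'\<close> turns a bound that varies with z into the
    constant bound 1 that \<open>EvR_continuous\<close> asks for.\<close>
  define b' where "b' z = 1 + \<bar>b z\<bar>" for z
  have b': "b' z > 0" for z by (simp add: b'_def add_pos_nonneg)
  have c: "continuous_on S (\<lambda>z. P z / b' z * vv A c z)"
    unfolding vv_def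
  proof (rule EvR_continuous[OF s _ continuous_on_yv _ _ _ A, where B = 1])
    show "continuous_on S (\<lambda>z. xpart N z i)" for i
      unfolding xpart_def by (rule continuous_on_coord)
    show "continuous_on S (\<lambda>z. P z / b' z)"
      using b' unfolding b'_def by (intro continuous_intros P) (auto simp: less_imp_neq[symmetric])
    fix z assume z: "z \<in> S"
    show "0 \<le> yv z \<and> yv z \<le> 1" using S[OF z] by simp
    have "\<bar>P z\<bar> \<le> b' z * sqrt (yv z) ^ r"
      using P(3)[OF z] by (rule order_trans) (intro mult_right_mono, auto simp: b'_def)
    then show "\<bar>P z / b' z\<bar> \<le> 1 * sqrt (yv z) ^ r"
      using b'[of z] by (simp add: abs_divide divide_le_eq mult.commute)
  qed
  have "continuous_on S (\<lambda>z. b' z * (P z / b' z * vv A c z))"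
    unfolding b'_def by (intro continuous_intros P c[unfolded b'_def])
  moreover have "b' z * (P z / b' z * vv A c z) = P z * vv A c z" for z using b'[of z] by simp
  ultimately show ?thesis by simp
qed

lemma vv_slice:
  assumes l: "l < N + m" and z: "yv z < 1"
    and P: "\<And>z. ((\<lambda>u. P (z(l := u))) has_real_derivative P1 z) (at (z l))"
    and cont: "continuous_on UNIV P" "continuous_on UNIV P1" "continuous_on UNIV b"
    and r: "\<And>z. \<bar>P z * y1 l z\<bar> \<le> b z * sqrt (yv z) ^ r"
    and A: "good m e 0 A" "good m e r (smap Dif A)" "N \<le> l \<Longrightarrow> good m e 0 (smap (Kop (l - N)) A)"
  shows "((\<lambda>u. P (z(l := u)) * vv A c (z(l := u))) has_real_derivative
    P1 z * vv A c z + P z * y1 l z * vv (smap Dif A) c z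
    + (if N \<le> l then P z * vv (smap (Kop (l - N)) A) (c + pi / 2) z else 0)) (at (z l))"
proof -
  have upd: "continuous_on UNIV f \<Longrightarrow> continuous_on S (\<lambda>u. f (z(l := u)))" for f :: "(nat \<Rightarrow> real) \<Rightarrow> real" and S
    using continuous_on_compose2[OF _ continuous_on_upd subset_UNIV] by blast
  \<comment> \<open>\<open>EvR_slice\<close> asks for constant bounds on an open interval with y <=
    1; continuity provides them near the given point.\<close>
  have op: "open {u. yv (z(l := u)) < 1}"
    by (intro open_Collect_less upd continuous_on_yv continuous_intros)
  have "z l \<in> {u. yv (z(l := u)) < 1}" using z by simp
  with op obtain d where d: "d > 0" "ball (z l) d \<subseteq> {u. yv (z(l := u)) < 1}"
    by (rule openE)
  define f where "f z = \<bar>P z\<bar> + \<bar>P1 z\<bar> + \<bar>b z\<bar>" for z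
  have "continuous_on UNIV f" unfolding f_def by (intro continuous_intros cont)
  then have "bounded ((\<lambda>u. f (z(l := u))) ` cball (z l) d)"
    by (intro compact_imp_bounded compact_continuous_image upd) auto
  then obtain B where B: "\<And>u. u \<in> ball (z l) d \<Longrightarrow> f (z(l := u)) \<le> B"
    unfolding bounded_iff ball_simps by (metis abs_le_D1 ball_subset_cball real_norm_def subsetD)
  have fle: "\<bar>P z\<bar> \<le> f z" "\<bar>P1 z\<bar> \<le> f z" "\<bar>b z\<bar> \<le> f z" for z by (auto simp: f_def)
  have slice: "((\<lambda>u. g (z(l := u))) has_real_derivative g' (z(l := v))) (at v)"
    if "\<And>z. ((\<lambda>u. g (z(l := u))) has_real_derivative g' z) (at (z l))" for g g' v
    using that[of "z(l := v)"] by simp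
  have "((\<lambda>u. P (z(l := u)) * EvR m s c A (yv (z(l := u))) (xpart N (z(l := u)))) has_real_derivative
     P1 (z(l := z l)) * EvR m s c A (yv (z(l := z l))) (xpart N (z(l := z l)))
     + P (z(l := z l)) * y1 l (z(l := z l)) * EvR m s c (smap Dif A) (yv (z(l := z l))) (xpart N (z(l := z l)))
     + (if N \<le> l then P (z(l := z l)) * EvR m s (c + pi / 2) (smap (Kop (l - N)) A) (yv (z(l := z l))) (xpart N (z(l := z l))) else 0)) (at (z l))"
  proof (rule EvR_slice[where S = "ball (z l) d" and B = B and ?r1.0 = r and ?r2.0 = 0, OF _ _ _ s _ _ _ _ _ _ _ _ A])
    show "((\<lambda>u. dot m k (xpart N (z(l := u)))) has_real_derivative (if N \<le> l then real_of_int (k (l - N)) else 0)) (at u)" for k u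
      using dot_update[of "l - N" m k "xpart N z" u] l by (auto simp: xpart_upd)
    show "((\<lambda>u. yv (z(l := u))) has_real_derivative y1 l (z(l := u))) (at u)" for u
      by (rule slice) (rule yv_deriv[OF l])
    show "((\<lambda>u. P (z(l := u))) has_real_derivative P1 (z(l := u))) (at u)" for u
      by (rule slice) (rule P)
    fix u assume u: "u \<in> ball (z l) d"
    show "0 \<le> yv (z(l := u)) \<and> yv (z(l := u)) \<le> 1" using d u by auto
    show "\<bar>P (z(l := u))\<bar> \<le> B" "\<bar>P1 (z(l := u))\<bar> \<le> B" using fle B[OF u] order_trans by blast+
    then show "\<bar>P (z(l := u))\<bar> \<le> B * sqrt (yv (z(l := u))) ^ 0" by simp
    have "b (z(l := u)) \<le> B" using fle(3)[of "z(l := u)"] B[OF u] by linarith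
    then show "\<bar>P (z(l := u)) * y1 l (z(l := u))\<bar> \<le> B * sqrt (yv (z(l := u))) ^ r"
      by (rule order_trans[OF r mult_right_mono]) simp
  qed (use d in auto)
  then show ?thesis by (simp add: vv_def cong: if_cong)
qed

definition w :: "(nat \<Rightarrow> real) \<Rightarrow> real"
  where "w z = vv V 0 z"

definition w1 :: "nat \<Rightarrow> (nat \<Rightarrow> real) \<Rightarrow> real"
  where "w1 l z = y1 l z * vv (smap Dif V) 0 z + (if N \<le> l then vv (smap (Kop (l - N)) V) (pi / 2) z else 0)"

definition w2 :: "nat \<Rightarrow> nat \<Rightarrow> (nat \<Rightarrow> real) \<Rightarrow> real"
  where "w2 l k z = y2 l k z * vv (smap Dif V) 0 z + y1 l z * y1 k z * vv (smap Dif (smap Dif V)) 0 z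
    + (if N \<le> k then y1 l z * vv (smap (Kop (k - N)) (smap Dif V)) (pi / 2) z else 0)
    + (if N \<le> l then y1 k z * vv (smap Dif (smap (Kop (l - N)) V)) (pi / 2) z
        + (if N \<le> k then vv (smap (Kop (k - N)) (smap (Kop (l - N)) V)) pi z else 0) else 0)"

lemma w_deriv:
  assumes z: "yv z < 1" and l: "l < N + m"
  shows "((\<lambda>u. w (z(l := u))) has_real_derivative w1 l z) (at (z l))"
proof -
  have A: "N \<le> l \<Longrightarrow> good m e 0 (smap (Kop (l - N)) V)" using l by (intro good_V(4)) auto
  have "((\<lambda>u. 1 * vv V 0 (z(l := u))) has_real_derivative
    0 * vv V 0 z + 1 * y1 l z * vv (smap Dif V) 0 z
    + (if N \<le> l then 1 * vv (smap (Kop (l - N)) V) (0 + pi / 2) z else 0)) (at (z l))"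
    by (rule vv_slice[OF l z, where P = "\<lambda>_. 1" and ?P1.0 = "\<lambda>_. 0" and b = "\<lambda>z. \<bar>y1 l z\<bar>" and r = 0])
      (auto intro!: good_V(1,2) A continuous_intros continuous_on_y1 l)
  then show ?thesis by (cases "N \<le> l") (simp_all add: w_def w1_def)
qed

lemma w1_deriv:
  assumes z: "yv z < 1" and l: "l < N + m" and k: "k < N + m"
  shows "((\<lambda>u. w1 l (z(k := u))) has_real_derivative w2 l k z) (at (z k))"
proof -
  have A: "N \<le> k \<Longrightarrow> good m e 0 (smap (Kop (k - N)) (smap Dif V))" using k by (intro good_V(5)) auto
  have 1: "((\<lambda>u. y1 l (z(k := u)) * vv (smap Dif V) 0 (z(k := u))) has_real_derivative
    y2 l k z * vv (smap Dif V) 0 z + y1 l z * y1 k z * vv (smap Dif (smap Dif V)) 0 z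
    + (if N \<le> k then y1 l z * vv (smap (Kop (k - N)) (smap Dif V)) (0 + pi / 2) z else 0)) (at (z k))"
    by (rule vv_slice[OF k z y1_deriv[OF l k] continuous_on_y1[OF l] continuous_on_y2[OF l k] _ y1_y1_bound])
      (auto intro!: good_V(2,3) A continuous_intros continuous_on_yb l k)
  show ?thesis
  proof (cases "N \<le> l")
    case False
    then show ?thesis using 1 by (simp add: w1_def w2_def cong: if_cong)
  next
    case True
    then have l': "l - N < m" using l by simp
    have A': "N \<le> k \<Longrightarrow> good m e 0 (smap (Kop (k - N)) (smap (Kop (l - N)) V))" using k l' by (intro good_V(7)) auto
    have "((\<lambda>u. 1 * vv (smap (Kop (l - N)) V) (pi / 2) (z(k := u))) has_real_derivative
      0 * vv (smap (Kop (l - N)) V) (pi / 2) z + 1 * y1 k z * vv (smap Dif (smap (Kop (l - N)) V)) (pi / 2) z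
      + (if N \<le> k then 1 * vv (smap (Kop (k - N)) (smap (Kop (l - N)) V)) (pi / 2 + pi / 2) z else 0)) (at (z k))"
      by (rule vv_slice[OF k z, where P = "\<lambda>_. 1" and ?P1.0 = "\<lambda>_. 0" and b = "\<lambda>z. \<bar>y1 k z\<bar>" and r = 0])
        (auto intro!: good_V(4,6) A' l' continuous_intros continuous_on_y1 k)
    from DERIV_add[OF 1 this] show ?thesis using True by (simp add: w1_def w2_def add_ac cong: if_cong)
  qed
qed

lemma w_continuous:
  assumes S: "\<And>z. z \<in> S \<Longrightarrow> yv z \<le> 1"
  shows "continuous_on S w" "l < N + m \<Longrightarrow> continuous_on S (w1 l)"
    "l < N + m \<Longrightarrow> k < N + m \<Longrightarrow> continuous_on S (w2 l k)"
proof -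
  have v: "continuous_on S (vv A c)" if "good m e 0 A" for A c
    using vv_continuous[OF that S, where P = "\<lambda>_. 1" and b = "\<lambda>_. 1" and c = c] by (simp add: continuous_intros)
  show "continuous_on S w" unfolding w_def by (rule v[OF good_V(1)])
  show "continuous_on S (w1 l)" if "l < N + m"
    unfolding w1_def using that
    by (cases "N \<le> l") (auto intro!: continuous_intros continuous_on_y1 v good_V)
  assume l: "l < N + m" and k: "k < N + m"
  have 2: "continuous_on S (\<lambda>z. y1 l z * y1 k z * vv (smap Dif (smap Dif V)) 0 z)"
    by (rule vv_continuous[OF good_V(3) S _ _ y1_y1_bound]) (auto intro!: continuous_intros continuous_on_y1 continuous_on_yb l k)
  have l': "l - N < m \<or> \<not> N \<le> l" "k - N < m \<or> \<not> N \<le> k" using l k by auto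
  show "continuous_on S (w2 l k)"
    unfolding w2_def using l'
    by (cases "N \<le> l"; cases "N \<le> k") (auto intro!: continuous_intros 2 continuous_on_y1 continuous_on_y2 l k v good_V)
qed

end

lemma Euclidean_space_top_of_set: "Euclidean_space d = top_of_set (Rn d)"
  unfolding Euclidean_space_def euclidean_product_topology[symmetric] by simp

lemma closedin_Euclidean_space: "closed T \<Longrightarrow> closedin (Euclidean_space d) (Rn d \<inter> T)"
  using closedin_closed_Int[of T "Rn d"] unfolding Euclidean_space_top_of_set[symmetric] .

lemma openin_Euclidean_space: "open T \<Longrightarrow> openin (Euclidean_space d) (Rn d \<inter> T)"
  using openin_open_Int[of T "Rn d"] unfolding Euclidean_space_top_of_set[symmetric] .

lemma cw_single: "F k 0 = 0 \<Longrightarrow> cw F (single k u) = single k (F k u)"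
proof (rule poly_mapping_eqI)
  fix l
  assume "F k 0 = 0"
  then show "lookup (cw F (single k u)) l = lookup (single k (F k u)) l"
    by (cases "k = l") (auto simp: cw_def lookup_mapp lookup_single when_def in_keys_iff)
qed

lemma pr_Dop: "pr m c (cw (\<lambda>_. eD N) p) y x = 4 * y * pr m c (Dif (Dif p)) y x + 2 * real N * pr m c (Dif p) y x"
proof -
  have "keys (Dif (Dif p)) \<subseteq> keys p" "keys (Dif p) \<subseteq> keys p" using keys_cw unfolding Dif_def by blast+
  then show ?thesis
    by (subst (1 2 3) pr_superset[of "keys p"])
      (auto simp: lookup_cw lookup_Dif ev_eD sum_distrib_left sum.distrib[symmetric] algebra_simps intro: subsetD[OF keys_cw] intro!: sum.cong)
qed

lemma pr_Rop: "pr m c (cw (\<lambda>_ u. eX * ediff u) p) y x = y * pr m c (Dif p) y x"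
proof -
  have "cw (\<lambda>_ u. eX * ediff u) p = cw (\<lambda>_ u. eX * u) (Dif p)"
    by (rule poly_mapping_eqI) (simp add: lookup_cw lookup_Dif)
  then show ?thesis by (simp add: pr_cw_scale)
qed

lemma pr_RRop: "pr m c (cw (\<lambda>_ u. eX * (eX * ediff (ediff u))) p) y x = y\<^sup>2 * pr m c (Dif (Dif p)) y x"
proof -
  have "cw (\<lambda>_ u. eX * (eX * ediff (ediff u))) p = cw (\<lambda>_ u. eX * (eX * u)) (Dif (Dif p))"
    by (rule poly_mapping_eqI) (simp add: lookup_cw lookup_Dif)
  then show ?thesis by (simp add: pr_cw_scale power2_eq_square)
qed

lemma pr_cong_ev: "(\<And>k. ev (lookup p k) y = ev (lookup q k) y) \<Longrightarrow> pr m c p y x = pr m c q y x"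
proof -
  assume *: "\<And>k. ev (lookup p k) y = ev (lookup q k) y"
  have "finite (keys p \<union> keys q)" by simp
  then show ?thesis using * by (simp add: pr_superset[of "keys p \<union> keys q"])
qed

context bif_at
begin

text \<open>The chain rule produces y-derivatives of V, the recursion the operators
  \<open>Rop\<close>, \<open>RRop\<close> and \<open>Dop\<close>. The factors y are kept on the left
  side, so the identities also hold at the axis.\<close>

lemma V_numbers:
  assumes "yv z \<le> 1"
  defines "y \<equiv> yv z" and "x \<equiv> xpart N z"
  shows "vv V 0 z = ev U y + s * EvR m s 0 Y y x"
    "y * vv (smap Dif V) 0 z = ev (eX * ediff U) y + s * EvR m s 0 (smap Rop Y) y x"
    "4 * y * vv (smap Dif (smap Dif V)) 0 z + 2 * real N * vv (smap Dif V) 0 z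
       = ev (eD N U) y + s * EvR m s 0 (smap Dop Y) y x"
    "y\<^sup>2 * vv (smap Dif (smap Dif V)) 0 z = ev (eX * (eX * ediff (ediff U))) y + s * EvR m s 0 (smap RRop Y) y x"
    "i < m \<Longrightarrow> y * vv (smap (Kop i) (smap Dif V)) (pi / 2) z = s * EvR m s (pi / 2) (smap (Kop i) (smap Rop Y)) y x"
    "(\<Sum>i<m. vv (smap (Kop i) (smap (Kop i) V)) pi z) = s * EvR m s 0 (smap (Lap m) Y) y x"
proof -
  obtain K where K: "bd m e 2 Z K" "bdF e Y K" "bd m e 0 (smap Dop Y) K" "bd m e 1 (smap Rop Y) K"
    "bd m e 0 (smap RRop Y) K" "bd m e 1 (smap Nop Y) K" "bd m e 2 Y K" by (rule component_bound)
  obtain KV where KV: "bd m e 0 V KV" by (rule V_bound)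
  have y: "0 \<le> y" "y \<le> 1" using assms(1) by (auto simp: y_def)
  note sy = s y
  have id: "smap (\<lambda>p. p) A = A" for A by (simp add: fps_eq_iff)
  have "good m e 0 Y" using bd_mono[OF K(7), of 0] by (intro good_bd) auto
  then show "vv V 0 z = ev U y + s * EvR m s 0 Y y x"
    using EvR_V[of "\<lambda>p. p" s y 0 x] sy by (simp add: id vv_def y_def[symmetric] x_def[symmetric] dot_def)
  have gR: "good m e 0 (smap Rop Y)" using bd_mono[OF K(4), of 0] by (intro good_bd) auto
  have R: "EvR m s c (smap Rop V) y x = y * EvR m s c (smap Dif V) y x" for c
    using good_summable(3)[OF good_V(2) s y, of y 1 c x] y by (simp add: EvR_def pr_Rop mult_ac)
  show "y * vv (smap Dif V) 0 z = ev (eX * ediff U) y + s * EvR m s 0 (smap Rop Y) y x"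
    using EvR_V[OF gR sy, of 0 x] by (simp add: R vv_def y_def[symmetric] x_def[symmetric] cw_single dot_def)
  have by2: "\<bar>y * b\<bar> \<le> \<bar>b\<bar> * sqrt y ^ 2" for b using y by (simp add: abs_mult)
  have "EvR m s 0 (smap Dop V) y x = suminf (\<lambda>J. y * 4 * (s ^ J * pr m 0 (smap Dif (smap Dif V) $ J) y x)
     + 2 * real N * (s ^ J * pr m 0 (smap Dif V $ J) y x))"
    by (simp add: EvR_def Dop_def pr_Dop algebra_simps)
  also have "\<dots> = y * 4 * EvR m s 0 (smap Dif (smap Dif V)) y x + 2 * real N * EvR m s 0 (smap Dif V) y x"
    using suminf_add[OF good_summable(2)[OF good_V(3) sy by2] good_summable(2)[OF good_V(2) sy, of "2 * real N" "2 * real N"]]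
      good_summable(3)[OF good_V(3) sy by2] good_summable(3)[OF good_V(2) sy, of "2 * real N" "2 * real N"] by simp
  finally show "4 * y * vv (smap Dif (smap Dif V)) 0 z + 2 * real N * vv (smap Dif V) 0 z
       = ev (eD N U) y + s * EvR m s 0 (smap Dop Y) y x"
    using EvR_V[OF good_bd[OF K(3)] sy, of 0 x]
    by (simp add: vv_def y_def[symmetric] x_def[symmetric] Dop_def cw_single dot_def)
  have "EvR m s 0 (smap RRop V) y x = y\<^sup>2 * EvR m s 0 (smap Dif (smap Dif V)) y x"
    using good_summable(3)[OF good_V(3) sy by2, of y 0 x] by (simp add: EvR_def pr_RRop power2_eq_square mult_ac)
  then show "y\<^sup>2 * vv (smap Dif (smap Dif V)) 0 z = ev (eX * (eX * ediff (ediff U))) y + s * EvR m s 0 (smap RRop Y) y x"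
    using EvR_V[OF good_bd[OF K(5)] sy, of 0 x]
    by (simp add: vv_def y_def[symmetric] x_def[symmetric] cw_single dot_def)
  have KR: "Kop i (Rop p) = Rop (Kop i p)" for i p
    by (rule poly_mapping_eqI) (simp add: lookup_cw lookup_Kop mult_ac)
  show "y * vv (smap (Kop i) (smap Dif V)) (pi / 2) z = s * EvR m s (pi / 2) (smap (Kop i) (smap Rop Y)) y x" if i: "i < m"
  proof -
    have c: "smap (\<lambda>p. Kop i (Rop p)) A = smap (Kop i) (smap Rop A)" for A by (simp add: fps_eq_iff)
    have "EvR m s (pi / 2) (smap (\<lambda>p. Kop i (Rop p)) V) y x = s * EvR m s (pi / 2) (smap (\<lambda>p. Kop i (Rop p)) Y) y x"
      using EvR_V[of "\<lambda>p. Kop i (Rop p)" s y "pi / 2" x] good_Kop[OF K(4) i] sy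
      by (simp add: c cw_single econst_simps)
    moreover have "EvR m s (pi / 2) (smap (\<lambda>p. Kop i (Rop p)) V) y x = y * EvR m s (pi / 2) (smap (Kop i) (smap Dif V)) y x"
      using good_summable(3)[OF good_V(5)[OF i] s y, of y 1 "pi / 2" x] y by (simp add: EvR_def KR pr_Rop Dif_Kop mult_ac)
    ultimately show ?thesis by (simp add: c vv_def y_def[symmetric] x_def[symmetric])
  qed
  have gL: "good m e 0 (smap (Lap m) Y)" using bd_smap[OF Wn_Lap _ K(7)] by (intro good_bd) auto
  show "(\<Sum>i<m. vv (smap (Kop i) (smap (Kop i) V)) pi z) = s * EvR m s 0 (smap (Lap m) Y) y x"
    using EvR_Lap[OF KV sy, of x] EvR_V[OF gL sy, of 0 x]
    by (simp add: vv_def y_def[symmetric] x_def[symmetric] econst_simps)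
qed

text \<open>By the chain rule the coordinates of t contribute h^2 D V and those of x the terms with
  derivatives of z; multiplied by (1 + s z)^2 the sum is the left side of
  \<open>PDE_numbers\<close>.\<close>

lemma w_equation:
  assumes z: "yv z \<le> 1"
  shows "(\<Sum>l<N + m. w2 l l z) + j\<^sup>2 * (th s)\<^sup>2 * w z = 0"
proof -
  define y where "y = yv z"
  define x where "x = xpart N z"
  define ze where "ze = 1 + s * zn s x"
  define \<theta> where "\<theta> = th s"
  define r where "r = rad N z"
  define g where "g = (\<Sum>i<m. zi s i x * zi s i x)"
  define zL where "zL = EvR m s 0 (smap (Lap m) Z) 0 x"
  define V1 where "V1 = vv (smap Dif V) 0 z"
  define V2 where "V2 = vv (smap Dif (smap Dif V)) 0 z"
  define E where "E i = vv (smap (Kop i) (smap Dif V)) (pi / 2) z" for i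
  define zE where "zE = (\<Sum>i<m. zi s i x * E i)"
  define L where "L = (\<Sum>i<m. vv (smap (Kop i) (smap (Kop i) V)) pi z)"
  have y: "y \<le> 1" "0 \<le> y" using z by (auto simp: y_def)
  have yr: "y = (\<theta> * ze)\<^sup>2 * r" by (simp add: y_def yv_def ht_def \<theta>_def ze_def x_def r_def)
  have ze: "ze > 0" unfolding ze_def by (rule ze_pos)
  note num = V_numbers[OF z, folded x_def, folded V1_def V2_def y_def, folded L_def E_def]
  have zE: "y * zE = (\<Sum>i<m. s * (zi s i x * EvR m s (pi / 2) (smap (Kop i) (smap Rop Y)) y x))"
    unfolding zE_def sum_distrib_left by (intro sum.cong refl) (use num(5) in \<open>simp add: mult_ac\<close>)
  obtain K where "bd m e 2 Z K" by (rule H_bound)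
  then have "bd m e 0 Z K" using bd_mono by blast
  then have zL: "zL = (\<Sum>i<m. EvR m s pi (smap (Kop i) (smap (Kop i) Z)) 0 x)"
    unfolding zL_def by (rule EvR_Lap) (use s in auto)
  have "(\<Sum>l<N. w2 l l z) = (\<Sum>l<N. 2 * (\<theta> * ze)\<^sup>2 * V1 + 4 * (\<theta> * ze) ^ 4 * V2 * (z l)\<^sup>2)"
    by (intro sum.cong refl)
      (simp add: w2_def y2_def y1_def V1_def V2_def ht_def \<theta>_def ze_def x_def power2_eq_square power4_eq_xxxx algebra_simps)
  also have "\<dots> = 2 * real N * (\<theta> * ze)\<^sup>2 * V1 + 4 * (\<theta> * ze) ^ 4 * V2 * r"
    by (simp add: sum.distrib r_def rad_def sum_distrib_left)
  finally have s1: "(\<Sum>l<N. w2 l l z) = 2 * real N * (\<theta> * ze)\<^sup>2 * V1 + 4 * (\<theta> * ze) ^ 4 * V2 * r" .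
  have "smap Dif (smap (Kop i) V) = smap (Kop i) (smap Dif V)" for i by (simp add: fps_eq_iff Dif_Kop)
  then have "(\<Sum>i<m. w2 (i + N) (i + N) z) = (\<Sum>i<m. (2 * \<theta>\<^sup>2 * s\<^sup>2 * r * V1 + 4 * \<theta> ^ 4 * ze\<^sup>2 * s\<^sup>2 * r\<^sup>2 * V2) * (zi s i x * zi s i x)
      + 2 * \<theta>\<^sup>2 * ze * s * r * V1 * EvR m s pi (smap (Kop i) (smap (Kop i) Z)) 0 x
      + 4 * \<theta>\<^sup>2 * ze * s * r * (zi s i x * E i) + vv (smap (Kop i) (smap (Kop i) V)) pi z)"
    by (intro sum.cong refl)
      (simp add: w2_def y2_def y1_def V1_def V2_def E_def ht_def ht1_def ht2_def \<theta>_def ze_def x_def r_def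
        power2_eq_square power4_eq_xxxx algebra_simps)
  also have "\<dots> = (2 * \<theta>\<^sup>2 * s\<^sup>2 * r * V1 + 4 * \<theta> ^ 4 * ze\<^sup>2 * s\<^sup>2 * r\<^sup>2 * V2) * g
      + 2 * \<theta>\<^sup>2 * ze * s * r * V1 * zL + 4 * \<theta>\<^sup>2 * ze * s * r * zE + L"
    by (simp add: sum.distrib g_def zL zE_def L_def sum_distrib_left)
  finally have s2: "(\<Sum>i<m. w2 (i + N) (i + N) z) = (2 * \<theta>\<^sup>2 * s\<^sup>2 * r * V1 + 4 * \<theta> ^ 4 * ze\<^sup>2 * s\<^sup>2 * r\<^sup>2 * V2) * g
      + 2 * \<theta>\<^sup>2 * ze * s * r * V1 * zL + 4 * \<theta>\<^sup>2 * ze * s * r * zE + L" .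
  have "\<theta>\<^sup>2 * (ze^4 * (4 * y * V2 + 2 * real N * V1) + j\<^sup>2 * ze^2 * w z) + ze^2 * L
      + 4 * ze * (s * (y * zE)) + 4 * (s^2 * g) * (y\<^sup>2 * V2) + 2 * (ze * (s * zL) + s^2 * g) * (y * V1) = 0"
    using PDE_numbers[OF s y(2,1), of x, folded ze_def, folded \<theta>_def g_def zL_def]
    unfolding num w_def zE num(1)[folded w_def] by (simp add: sum_distrib_left mult_ac)
  \<comment> \<open>With y = (theta ze)^2 r substituted, the two expressions agree as
    polynomials.\<close>
  then have "ze\<^sup>2 * ((\<Sum>l<N. w2 l l z) + (\<Sum>i<m. w2 (i + N) (i + N) z) + j\<^sup>2 * \<theta>\<^sup>2 * w z) = 0"
    unfolding s1 s2 yr by algebra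
  then show ?thesis using ze by (simp add: sum_split \<theta>_def)
qed

text \<open>At y = 1 the function V vanishes for all x, and so do its x-derivatives at fixed y. The
  gradient of w is therefore the y-derivative of V times the gradient of y.\<close>

lemma w_boundary:
  assumes z: "yv z = 1"
  shows "w z = 0" "enorm (N + m) (\<lambda>l. w1 l z) = 2 * \<bar>a\<bar> * th s"
proof -
  define x where "x = xpart N z"
  define ze where "ze = 1 + s * zn s x"
  define \<theta> where "\<theta> = th s"
  define r where "r = rad N z"
  define g where "g = (\<Sum>i<m. zi s i x * zi s i x)"
  define V1 where "V1 = vv (smap Dif V) 0 z"
  obtain K where K: "bd m e 2 Y K" by (rule component_bound)
  have ze: "ze > 0" unfolding ze_def by (rule ze_pos)
  have \<theta>: "\<theta> > 0" unfolding \<theta>_def by (rule th_pos)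
  have yr: "(\<theta> * ze)\<^sup>2 * r = 1" using z by (simp add: yv_def ht_def \<theta>_def ze_def x_def r_def)
  have z1: "yv z \<le> 1" using z by simp
  note num = V_numbers[OF z1, folded x_def, unfolded z]
  show "w z = 0" using num(1) boundary_numbers(2)[OF s, of x] by (simp add: w_def U_1)
  have K0: "vv (smap (Kop i) V) (pi / 2) z = 0" if "i < m" for i
  proof -
    have Y: "EvR m s (pi / 2) (smap (Kop i) Y) 1 x = 0"
      unfolding EvR_def pr_def by (simp add: Y_def Ys_def lookup_Kop lookup_cw yc_1 yc_def[of 0] zc_def econst_simps)
    have "bd m e 1 Y K" using bd_mono[OF K] by simp
    from EvR_V[OF good_Kop[OF this that] s, of 1 "pi / 2" x] show ?thesis
      by (simp add: vv_def z x_def[symmetric] Y econst_simps)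
  qed
  have "EvR m s 0 (smap Rop Y) 1 x = EvR m s 0 (smap Nop Y) 1 x"
  proof -
    have "pr m 0 (Rop p) 1 x = pr m 0 (Nop p) 1 x" for p
      by (rule pr_cong_ev) (simp add: lookup_cw econst_simps)
    then show ?thesis by (simp add: EvR_def)
  qed
  then have V1: "V1 = a + s * EvR m s 0 (smap Nop Y) 1 x" using num(2) by (simp add: V1_def a_def)
  have "(\<Sum>l<N. (w1 l z)\<^sup>2) = (\<Sum>l<N. 4 * (\<theta> * ze) ^ 4 * V1\<^sup>2 * (z l)\<^sup>2)"
    by (intro sum.cong refl)
      (simp add: w1_def y1_def V1_def ht_def \<theta>_def ze_def x_def power2_eq_square power4_eq_xxxx algebra_simps)
  also have "\<dots> = 4 * (\<theta> * ze) ^ 4 * V1\<^sup>2 * r" by (simp add: r_def rad_def sum_distrib_left)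
  finally have s1: "(\<Sum>l<N. (w1 l z)\<^sup>2) = 4 * (\<theta> * ze) ^ 4 * V1\<^sup>2 * r" .
  have "(\<Sum>i<m. (w1 (i + N) z)\<^sup>2) = (\<Sum>i<m. 4 * \<theta> ^ 4 * ze\<^sup>2 * s\<^sup>2 * r\<^sup>2 * V1\<^sup>2 * (zi s i x * zi s i x))"
    by (intro sum.cong refl)
      (simp add: w1_def y1_def V1_def ht_def ht1_def \<theta>_def ze_def x_def r_def K0 power2_eq_square power4_eq_xxxx algebra_simps)
  also have "\<dots> = 4 * \<theta> ^ 4 * ze\<^sup>2 * s\<^sup>2 * r\<^sup>2 * V1\<^sup>2 * g" by (simp add: g_def sum_distrib_left)
  finally have s2: "(\<Sum>i<m. (w1 (i + N) z)\<^sup>2) = 4 * \<theta> ^ 4 * ze\<^sup>2 * s\<^sup>2 * r\<^sup>2 * V1\<^sup>2 * g" .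
  have bn: "(\<theta>\<^sup>2 * ze^4 + s^2 * g) * V1^2 = \<theta>\<^sup>2 * a^2 * ze^2"
    using boundary_numbers(1)[OF s, of x, folded ze_def, folded \<theta>_def g_def] by (simp add: V1)
  have r: "r = 1 / (\<theta> * ze)\<^sup>2" using yr ze \<theta> by (simp add: eq_divide_eq mult.commute)
  have "(\<Sum>l<N + m. (w1 l z)\<^sup>2) = 4 * ((\<theta>\<^sup>2 * ze^4 + s^2 * g) * V1^2) / ze\<^sup>2"
    unfolding sum_split s1 s2 r using ze \<theta>
    by (simp add: field_simps power2_eq_square power4_eq_xxxx)
  also have "\<dots> = (2 * \<bar>a\<bar> * \<theta>)\<^sup>2" unfolding bn using ze by (simp add: power_mult_distrib)
  finally show "enorm (N + m) (\<lambda>l. w1 l z) = 2 * \<bar>a\<bar> * th s"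
    unfolding L2_set_def using \<theta> by (simp add: \<theta>_def)
qed

lemma Omega_eq: "Omega N m ht = {z \<in> Rn (N + m). yv z < 1}"
proof (intro equalityI subsetI)
  fix z assume "z \<in> Omega N m ht"
  then obtain t x where z: "z = join N t x" and t: "t \<in> Rn N" "x \<in> Rn m" "enorm N t < 1 / ht x"
    by (auto simp: Omega_def)
  have "ht x * sqrt (rad N t) < 1" using t(3) ht_pos[of x] by (simp add: enorm_rad less_divide_eq mult.commute)
  then have "(ht x * sqrt (rad N t))\<^sup>2 < 1" using ht_pos[of x] by (simp add: abs_square_less_1)
  then have "yv z < 1" by (simp add: z yv_def power_mult_distrib)
  moreover have "z \<in> Rn (N + m)" using t unfolding z by (auto simp: topspace_Euclidean_space join_def)
  ultimately show "z \<in> {z \<in> Rn (N + m). yv z < 1}" by simp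
next
  fix z assume z: "z \<in> {z \<in> Rn (N + m). yv z < 1}"
  define tt where "tt = (\<lambda>i. if i < N then z i else 0)"
  have j: "z = join N tt (xpart N z)" by (auto simp: join_def tt_def xpart_def fun_eq_iff)
  have "rad N tt = rad N z" by (simp add: rad_def tt_def)
  then have "(ht (xpart N z) * sqrt (rad N tt))\<^sup>2 < 1" using z by (simp add: yv_def power_mult_distrib)
  then have "ht (xpart N z) * sqrt (rad N tt) < 1"
    using ht_pos[of "xpart N z"] by (simp add: abs_square_less_1)
  then have "enorm N tt < 1 / ht (xpart N z)"
    using ht_pos[of "xpart N z"] by (simp add: enorm_rad less_divide_eq mult.commute)
  moreover have "tt \<in> Rn N" "xpart N z \<in> Rn m" using z by (auto simp: topspace_Euclidean_space tt_def xpart_def)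
  ultimately show "z \<in> Omega N m ht" unfolding Omega_def using j by blast
qed

text \<open>The set y <= 1 is closed, and the series are controlled on all of it, so properties
  shown there pass to the closure of the domain.\<close>

lemma Omega_closure_sub: "Omega_closure N m ht \<subseteq> {z \<in> Rn (N + m). yv z \<le> 1}"
  unfolding Omega_closure_def Omega_eq
proof (rule closure_of_minimal)
  have "closed {z. yv z \<le> 1}" by (intro closed_Collect_le continuous_on_yv continuous_intros)
  then have "closedin (Euclidean_space (N + m)) (Rn (N + m) \<inter> {z. yv z \<le> 1})"
    by (rule closedin_Euclidean_space)
  moreover have "Rn (N + m) \<inter> {z. yv z \<le> 1} = {z \<in> Rn (N + m). yv z \<le> 1}" by blast
  ultimately show "closedin (Euclidean_space (N + m)) {z \<in> Rn (N + m). yv z \<le> 1}" by metis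
qed auto

lemma Omega_boundary_sub: "Omega_boundary N m ht \<subseteq> {z \<in> Rn (N + m). yv z = 1}"
proof
  fix z assume z: "z \<in> Omega_boundary N m ht"
  have "open {z. yv z < 1}" by (intro open_Collect_less continuous_on_yv continuous_intros)
  then have "openin (Euclidean_space (N + m)) (Rn (N + m) \<inter> {z. yv z < 1})"
    by (rule openin_Euclidean_space)
  moreover have "Rn (N + m) \<inter> {z. yv z < 1} = Omega N m ht" unfolding Omega_eq by blast
  ultimately have "openin (Euclidean_space (N + m)) (Omega N m ht)" by metis
  then have "z \<in> Omega_closure N m ht" "z \<notin> Omega N m ht"
    using z by (auto simp: Omega_boundary_def Omega_closure_def frontier_of_def interior_of_openin)
  then show "z \<in> {z \<in> Rn (N + m). yv z = 1}" using Omega_closure_sub by (auto simp: Omega_eq)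
qed

theorem overdetermined: "overdetermined_solution N m ht (j\<^sup>2 * (th s)\<^sup>2) (2 * \<bar>a\<bar> * th s) w"
proof -
  have yO: "yv z \<le> 1" if "z \<in> Omega N m ht" for z using that by (simp add: Omega_eq)
  have yC: "yv z \<le> 1" if "z \<in> Omega_closure N m ht" for z using that Omega_closure_sub by blast
  have ck: "Ck_on (N + m) (Omega N m ht) 2 w"
    "\<And>z i. z \<in> Omega N m ht \<Longrightarrow> i < N + m \<Longrightarrow> pdiff i w z = w1 i z"
    "\<And>z i l. z \<in> Omega N m ht \<Longrightarrow> i < N + m \<Longrightarrow> l < N + m \<Longrightarrow> pdiff l (pdiff i w) z = w2 i l z"
  proof -
    have S: "eventually (\<lambda>u. z(i := u) \<in> Omega N m ht) (nhds (z i))" if "z \<in> Omega N m ht" "i < N + m" for z i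
    proof -
      have "open {u. yv (z(i := u)) < 1}"
        by (intro open_Collect_less continuous_on_compose2[OF continuous_on_yv continuous_on_upd subset_UNIV] continuous_intros)
      moreover have "z i \<in> {u. yv (z(i := u)) < 1}" using that by (simp add: Omega_eq)
      ultimately have "eventually (\<lambda>u. u \<in> {u. yv (z(i := u)) < 1}) (nhds (z i))" by (rule eventually_nhds_in_open)
      then show ?thesis using that by (auto simp: Omega_eq Rn_slices elim!: eventually_mono)
    qed
    have sub: "Omega N m ht \<subseteq> Rn (N + m)" by (auto simp: Omega_eq)
    have d: "yv z < 1" if "z \<in> Omega N m ht" for z using that by (simp add: Omega_eq)
    note ck = Ck2I[of _ "N + m" w w1 w2, OF sub S w_deriv[OF d] w1_deriv[OF d] w_continuous(1)[OF yO] w_continuous(2)[OF yO] w_continuous(3)[OF yO]]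
    show "Ck_on (N + m) (Omega N m ht) 2 w" by (rule ck(1))
    show "\<And>z i. z \<in> Omega N m ht \<Longrightarrow> i < N + m \<Longrightarrow> pdiff i w z = w1 i z" by (rule ck(2))
    show "\<And>z i l. z \<in> Omega N m ht \<Longrightarrow> i < N + m \<Longrightarrow> l < N + m \<Longrightarrow> pdiff l (pdiff i w) z = w2 i l z" by (rule ck(3))
  qed
  have sub: "Omega_closure N m ht \<subseteq> Rn (N + m)" using Omega_closure_sub by blast
  show ?thesis
    unfolding overdetermined_solution_def cont_on_iff[OF sub]
  \<comment> \<open>\<open>w1\<close> is given by series that converge up to y = 1, and so it
    extends the gradient continuously to the closure.\<close>
  proof (intro conjI exI[of _ w1] allI impI ballI)
    show "laplacian (N + m) w z + j\<^sup>2 * (th s)\<^sup>2 * w z = 0" if "z \<in> Omega N m ht" for z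
      using w_equation[OF yO[OF that]] by (simp add: laplacian_def ck(3)[OF that])
    show "w z = 0" "enorm (N + m) (\<lambda>i. w1 i z) = 2 * \<bar>a\<bar> * th s" if "z \<in> Omega_boundary N m ht" for z
      using w_boundary[of z] that Omega_boundary_sub by auto
  qed (use ck in \<open>auto intro!: w_continuous yC\<close>)
qed

lemma sinv_V: "sinv m V"
  unfolding V_def by (intro sinv_intros invY)

lemma w_join: "w (join N v x) = EvR m s 0 V ((ht x)\<^sup>2 * rad N v) x"
  by (simp add: w_def vv_def yv_def)

lemma ht_symmetric:
  "i < m \<Longrightarrow> ht (x(i := - x i)) = ht x" "i < m \<Longrightarrow> ht (x(i := x i + 2 * pi)) = ht x"
  "p permutes {..<m} \<Longrightarrow> ht (x \<circ> p) = ht x"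
  by (simp_all add: ht_def EvR_flip[OF invZ] EvR_shift EvR_permute[OF invZ])

text \<open>The symmetries hold for each term of the series, hence on every set \<open>A\<close>,
  also where the series does not converge.\<close>

theorem w_symmetric: "radial_in_t N m A w" "symmetric_in_x N m A w"
proof -
  show "radial_in_t N m A w"
    unfolding radial_in_t_def w_join enorm_rad real_sqrt_eq_iff by metis
  show "symmetric_in_x N m A w"
    by (auto simp: symmetric_in_x_def Let_def even_on_def periodic_on_def perm_invariant_on_def w_join
      ht_symmetric EvR_flip[OF sinv_V] EvR_shift EvR_permute[OF sinv_V])
qed

end

section \<open>Expansions and conclusion\<close>

text \<open>A quadratic bound around 0 includes F 0 p = 0, as the convention for the little-o
  demands.\<close>

lemma uniform_little_oI:
  fixes F :: "real \<Rightarrow> 'a \<Rightarrow> real"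
  assumes "\<epsilon> > 0" "\<And>s p. \<bar>s\<bar> < \<epsilon> \<Longrightarrow> p \<in> A \<Longrightarrow> \<bar>F s p\<bar> \<le> K * s\<^sup>2"
  shows "uniform_little_o A F"
  unfolding uniform_little_o_def
proof (intro allI impI)
  fix c :: real assume c: "c > 0"
  define d where "d = min \<epsilon> (c / (\<bar>K\<bar> + 1))"
  have d: "d > 0" using assms(1) c by (simp add: d_def)
  have "eventually (\<lambda>s. s \<in> ball 0 d) (nhds (0::real))" using d by (intro eventually_nhds_in_open) auto
  then show "eventually (\<lambda>s. \<forall>p\<in>A. \<bar>F s p\<bar> \<le> c * \<bar>s\<bar>) (nhds 0)"
  proof (rule eventually_mono, intro ballI)
    fix s :: real and p assume s: "s \<in> ball 0 d" and p: "p \<in> A"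
    have "\<bar>F s p\<bar> \<le> K * s\<^sup>2" using s by (intro assms(2) p) (simp add: d_def)
    also have "\<dots> \<le> (\<bar>K\<bar> + 1) * \<bar>s\<bar> * \<bar>s\<bar>"
      unfolding mult.assoc abs_mult_self_eq power2_eq_square by (intro mult_right_mono) auto
    also have "\<dots> \<le> c * \<bar>s\<bar>"
    proof (rule mult_right_mono)
      have "\<bar>s\<bar> \<le> c / (\<bar>K\<bar> + 1)" using s by (simp add: d_def)
      then show "(\<bar>K\<bar> + 1) * \<bar>s\<bar> \<le> c" by (simp add: le_divide_eq mult.commute add_pos_nonneg split: if_splits)
    qed simp
    finally show "\<bar>F s p\<bar> \<le> c * \<bar>s\<bar>" .
  qed
qed

lemma EvR_at_0: "EvR m 0 c A y x = pr m c (A $ 0) y x"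
proof -
  have "(\<lambda>J. 0 ^ J * pr m c (A $ J) y x) = (\<lambda>J. if J = 0 then pr m c (A $ 0) y x else 0)" by (auto simp: fun_eq_iff)
  then show ?thesis unfolding EvR_def using sums_single[of 0 "\<lambda>_. pr m c (A $ 0) y x"] by (simp add: sums_iff)
qed

text \<open>For J >= 1 the power |s|^J is at most |s| / e times e^J, so the tail is |s| / e times
  the majorant.\<close>

lemma EvR_first_order:
  assumes A: "bd m e 0 A K" and s: "\<bar>s\<bar> \<le> e" "0 \<le> y" "y \<le> 1" and e: "e > 0"
  shows "\<bar>EvR m s c A y x - pr m c (A $ 0) y x\<bar> \<le> K / e * \<bar>s\<bar>"
proof -
  have S: "summable (\<lambda>J. s ^ J * pr m c (A $ J) y x)"
    using good_summable0(2)[OF good_bd[OF A] s] .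
  have le: "\<bar>s ^ Suc J * pr m c (A $ Suc J) y x\<bar> \<le> \<bar>s\<bar> / e * (e ^ Suc J * Wn m 0 (A $ Suc J))" for J
  proof -
    have "\<bar>s\<bar> ^ J * \<bar>pr m c (A $ Suc J) y x\<bar> \<le> e ^ J * Wn m 0 (A $ Suc J)"
      using s pr_bound[OF s(2,3)] by (intro mult_mono power_mono) auto
    then have "\<bar>s\<bar> * (\<bar>s\<bar> ^ J * \<bar>pr m c (A $ Suc J) y x\<bar>) \<le> \<bar>s\<bar> * (e ^ J * Wn m 0 (A $ Suc J))"
      by (intro mult_left_mono) auto
    then show ?thesis using e by (simp add: abs_mult power_abs mult_ac)
  qed
  have sum: "(\<Sum>J\<le>n. e ^ Suc J * Wn m 0 (A $ Suc J)) \<le> K" for n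
  proof -
    have "(\<Sum>J\<le>n. e ^ Suc J * Wn m 0 (A $ Suc J)) \<le> (\<Sum>J\<le>Suc n. e ^ J * Wn m 0 (A $ J))"
      unfolding sum.atMost_Suc_shift by simp
    also have "\<dots> \<le> K" using A unfolding bd_def by blast
    finally show ?thesis .
  qed
  have S1: "summable (\<lambda>J. e ^ Suc J * Wn m 0 (A $ Suc J))"
    by (rule bounded_imp_summable[OF _ sum]) (use e in auto)
  then have S2: "summable (\<lambda>J. \<bar>s\<bar> / e * (e ^ Suc J * Wn m 0 (A $ Suc J)))" by (rule summable_mult)
  have a: "summable (\<lambda>J. \<bar>s ^ Suc J * pr m c (A $ Suc J) y x\<bar>)"
    by (rule summable_comparison_test'[OF S2, of 0]) (use le in auto)
  have "\<bar>EvR m s c A y x - pr m c (A $ 0) y x\<bar> = \<bar>suminf (\<lambda>J. s ^ Suc J * pr m c (A $ Suc J) y x)\<bar>"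
    unfolding EvR_def suminf_split_head[OF S] by simp
  also have "\<dots> \<le> suminf (\<lambda>J. \<bar>s ^ Suc J * pr m c (A $ Suc J) y x\<bar>)" using a by (rule summable_rabs)
  also have "\<dots> \<le> suminf (\<lambda>J. \<bar>s\<bar> / e * (e ^ Suc J * Wn m 0 (A $ Suc J)))" by (intro suminf_le le a S2)
  also have "\<dots> = \<bar>s\<bar> / e * suminf (\<lambda>J. e ^ Suc J * Wn m 0 (A $ Suc J))" using S1 by (rule suminf_mult)
  also have "\<dots> \<le> \<bar>s\<bar> / e * K"
    using e by (intro mult_left_mono LIMSEQ_le_const2[OF summable_LIMSEQ'[OF S1]]) (use sum in auto)
  finally show ?thesis by (simp add: mult.commute)
qed

lemma dot_unit_freq: "i < m \<Longrightarrow> dot m (unit_freq i) x = x i"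
proof -
  assume "i < m"
  moreover have "dot m (unit_freq i) x = (\<Sum>l<m. if l = i then x i else 0)"
    unfolding dot_def by (intro sum.cong) (auto simp: unit_freq_def)
  ultimately show ?thesis by simp
qed

text \<open>The frequencies k and - k of the kernel element give the same cosine, hence the factor
  2.\<close>

lemma (in bif) pr_G0:
  assumes "F 0 = 0"
  shows "pr m 0 (cw (\<lambda>_. F) G0) y x = 2 * ev (F g0) y * (\<Sum>i<m. cos (x i))"
proof -
  have "keys (cw (\<lambda>_. F) G0) \<subseteq> K1" using keys_cw[of "\<lambda>_. F" G0] by (auto simp: in_keys_iff lookup_G0 split: if_splits)
  then have "pr m 0 (cw (\<lambda>_. F) G0) y x = (\<Sum>k\<in>K1. ev (F g0) y * cos (dot m k x))"
    by (subst pr_superset[OF finite_K1]) (auto simp: lookup_cw[of "\<lambda>_. F", OF assms] lookup_G0)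
  also have "\<dots> = (\<Sum>k\<in>unit_freq ` {..<m}. ev (F g0) y * cos (dot m k x))
      + (\<Sum>k\<in>(\<lambda>i. - unit_freq i) ` {..<m}. ev (F g0) y * cos (dot m k x))"
    unfolding K1_eq
  proof (rule sum.union_disjoint)
    have "unit_freq i \<noteq> - unit_freq l" for i l
    proof
      assume "unit_freq i = - unit_freq l"
      then have "unit_freq i i = - unit_freq l i" by (metis uminus_apply)
      then show False by (simp add: unit_freq_def split: if_splits)
    qed
    then show "unit_freq ` {..<m} \<inter> (\<lambda>i. - unit_freq i) ` {..<m} = {}" by auto
  qed auto
  also have "(\<Sum>k\<in>unit_freq ` {..<m}. ev (F g0) y * cos (dot m k x)) = (\<Sum>i<m. ev (F g0) y * cos (x i))"
  proof -
    have "inj_on unit_freq {..<m}"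
      by (rule inj_onI) (metis unit_freq_def zero_neq_one)
    then show ?thesis by (simp add: sum.reindex dot_unit_freq)
  qed
  also have "(\<Sum>k\<in>(\<lambda>i. - unit_freq i) ` {..<m}. ev (F g0) y * cos (dot m k x)) = (\<Sum>i<m. ev (F g0) y * cos (x i))"
  proof -
    have "inj_on (\<lambda>i. - unit_freq i) {..<m}"
      by (rule inj_onI) (metis neg_equal_iff_equal unit_freq_def zero_neq_one)
    then show ?thesis by (simp add: sum.reindex dot_uminus dot_unit_freq)
  qed
  finally show ?thesis by (simp add: sum_distrib_left mult.assoc)
qed

context bif_solution
begin

lemma ev_g0_1: "ev g0 1 = a"
proof -
  have "ev (phi N qs) 1 \<noteq> 0" unfolding qs_def by (rule q_star(5)[OF N])
  then show ?thesis by (simp add: g0_def gam_def)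
qed

lemma pr_Z0: "pr m 0 (Z $ 0) 0 x = (\<Sum>i<m. cos (x i))"
  using pr_G0[of zc 0 x] a_nz by (simp add: Z_def Zs_def G0 zc_def econst_simps ev_g0_1)

lemma pr_Y0: "pr m 0 (Y $ 0) y x = (gam * ev (phi N qs) y - 2 * y * ev (ediff U) y) * (\<Sum>i<m. cos (x i))"
proof -
  have "2 * ev (yc g0) y = gam * ev (phi N qs) y - 2 * y * ev (ediff U) y"
    using a_nz by (simp add: yc_def zc_def ev_g0_1 uu_def) (simp add: g0_def)
  moreover have "yc 0 = 0" by (simp add: yc_def zc_def econst_simps)
  ultimately show ?thesis using pr_G0[of yc y x] by (simp add: Y_def Ys_def G0)
qed

lemma th_at_0: "th 0 = th0"
  by (simp add: EvR_at_0 TT_def tser_def se_def t0 econst_simps dot_def)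

lemma parameter_range:
  obtains \<epsilon> where "0 < \<epsilon>" "\<epsilon> \<le> e" "\<And>s. \<bar>s\<bar> < \<epsilon> \<Longrightarrow> bif_at N m j C e R G t s"
proof -
  obtain K where K: "bd m e 2 Z K" "bd m e 2 TT K" by (rule H_bound)
  then have K0: "bd m e 0 Z K" "bd m e 0 TT K" using bd_mono by blast+
  have Kn: "K \<ge> 0" using bd_nonneg[OF K(1)] .
  have "isCont (\<lambda>s. EvR m s 0 TT 0 (\<lambda>_. 0)) 0"
    using EvR_has_derivative_s[OF conv_ser_bd[OF K0(2)], of 0] e by (intro DERIV_isCont) auto
  then have "((\<lambda>s. EvR m s 0 TT 0 (\<lambda>_. 0)) \<longlongrightarrow> th 0) (nhds 0)"
    unfolding isCont_def
    using tendsto_at_iff_tendsto_nhds[of "\<lambda>s. EvR m s 0 TT 0 (\<lambda>_. 0)" 0] by blast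
  then have "((\<lambda>s. EvR m s 0 TT 0 (\<lambda>_. 0)) \<longlongrightarrow> th0) (nhds 0)" unfolding th_at_0 .
  then have "eventually (\<lambda>s. th s > 0) (nhds 0)" using th0_pos by (rule order_tendstoD)
  then obtain d where d: "d > 0" "\<And>s. \<bar>s\<bar> < d \<Longrightarrow> th s > 0"
    unfolding eventually_nhds_metric by (auto simp: dist_real_def)
  \<comment> \<open>The bound 1 / (K + 1) keeps |s z| below 1.\<close>
  define \<epsilon> where "\<epsilon> = min e (min d (1 / (K + 1)))"
  show ?thesis
  proof
    show "0 < \<epsilon>" "\<epsilon> \<le> e" using e d Kn by (auto simp: \<epsilon>_def)
    fix s assume s: "\<bar>s\<bar> < \<epsilon>"
    then have se: "\<bar>s\<bar> \<le> e" by (simp add: \<epsilon>_def)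
    show "bif_at N m j C e R G t s"
    proof (unfold_locales, rule se)
      show "th s > 0" using s by (intro d) (simp add: \<epsilon>_def)
      fix x
      have "\<bar>s * zn s x\<bar> \<le> \<bar>s\<bar> * K"
        unfolding abs_mult using EvR_le[OF K0(1) se] by (intro mult_left_mono) auto
      also have "\<dots> < 1"
      proof -
        have "\<bar>s\<bar> < 1 / (K + 1)" using s by (simp add: \<epsilon>_def)
        then have "\<bar>s\<bar> * (K + 1) < 1" using Kn by (simp add: less_divide_eq)
        then show ?thesis by (simp add: distrib_left)
      qed
      finally show "1 + s * zn s x > 0" by linarith
    qed
  qed
qed

text \<open>Origin of the constants: 1 / j because sqrt mu = j theta, \<open>th0\<close> because h =
  theta + s theta z, and -1 because the term 2 z y U' subtracted from G is z times r times the
  derivative of the radial profile.\<close>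

theorem conclusion:
  fixes \<alpha> :: real and Uf :: "real \<Rightarrow> real"
  assumes \<alpha>: "0 < \<alpha>" "\<alpha> < 1" and Uf: "\<And>r. r \<ge> 0 \<Longrightarrow> Uf r = ev U (r\<^sup>2)"
  shows "\<exists>\<epsilon>>0. \<exists>(\<psi>\<^sub>1 :: real \<Rightarrow> real) (\<mu> :: real \<Rightarrow> real)
          (h :: real \<Rightarrow> (nat \<Rightarrow> real) \<Rightarrow> real) (w :: real \<Rightarrow> (nat \<Rightarrow> real) \<Rightarrow> real).
        (\<forall>s\<in>{-\<epsilon><..<\<epsilon>}. \<mu> s > 0 \<and> h s \<in> P2a_pe m \<alpha>) \<and>
        smooth_real_curve {-\<epsilon><..<\<epsilon>} \<mu> \<and>
        smooth_curve_C2a m \<alpha> {-\<epsilon><..<\<epsilon>} h \<and>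
        \<mu> 0 = j\<^sup>2 * th0\<^sup>2 \<and>
        uniform_little_o (Rn m)
          (\<lambda>s x. h s x - (1 / j * sqrt (\<mu> s) + s * th0 * (\<Sum>i<m. cos (x i)))) \<and>
        (\<forall>s\<in>{-\<epsilon><..<\<epsilon>}.
          overdetermined_solution N m (h s) (\<mu> s) (2 * \<bar>a\<bar> / j * sqrt (\<mu> s)) (w s) \<and>
          radial_in_t N m (Omega_closure N m (h s)) (w s) \<and>
          symmetric_in_x N m (Omega_closure N m (h s)) (w s)) \<and>
        uniform_little_o ({t \<in> Rn N. enorm N t < 1} \<times> Rn m)
          (\<lambda>s (t, x). w s (join N (\<lambda>i. t i / h s x) x) -
            (Uf (enorm N t) +
             s * (\<psi>\<^sub>1 (enorm N t) + (- 1) * enorm N t * deriv Uf (enorm N t)) *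
               (\<Sum>i<m. cos (x i))))"
proof -
  obtain \<epsilon> where \<epsilon>: "0 < \<epsilon>" "\<epsilon> \<le> e" and at: "\<And>s. \<bar>s\<bar> < \<epsilon> \<Longrightarrow> bif_at N m j C e R G t s"
    by (rule parameter_range) blast
  obtain K where K: "bd m e 2 H K" "bd m e 2 Z K" "bd m e 2 TT K" by (rule H_bound)
  then have K0: "bd m e 0 H K" "bd m e 0 Z K" "bd m e 0 TT K" using bd_mono by blast+
  obtain KY where "bd m e 2 Y KY" by (rule component_bound)
  then have KY: "bd m e 0 Y KY" using bd_mono by blast
  have conv: "conv_ser m \<epsilon> A" if "bd m e 0 A K'" for A K'
    using conv_ser_bd[OF that] \<epsilon>(2) by (auto simp: conv_ser_def)
  \<comment> \<open>mu = j^2 theta^2 as a series in s, so that its smoothness follows from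
    convergence.\<close>
  define M where "M = sc (j\<^sup>2) * TT ^ 2"
  have bM: "bd m e 0 M (\<bar>j\<^sup>2\<bar> * K ^ 2)" unfolding M_def by (intro bd_mult bd_power bd_sc e0 K0)
  define \<mu> where "\<mu> s = EvR m s 0 M 0 (\<lambda>_. 0)" for s
  define h where "h s x = EvR m s 0 H 0 x" for s x
  define w where "w s z = EvR m s 0 V ((h s (xpart N z))\<^sup>2 * rad N z) (xpart N z)" for s z
  \<comment> \<open>Twice the radial profile \<open>g0\<close> of G at order 0.\<close>
  define \<psi> where "\<psi> r = gam * ev (phi N qs) (r\<^sup>2)" for r
  have \<mu>: "\<mu> s = j\<^sup>2 * (th s)\<^sup>2" if "\<bar>s\<bar> < \<epsilon>" for s
  proof -
    have s: "\<bar>s\<bar> \<le> e" "0 \<le> (0::real)" "(0::real) \<le> 1" using that \<epsilon> by auto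
    have "eval_to m e s 0 (\<lambda>_. 0) M (j\<^sup>2 * (th s)\<^sup>2)"
      unfolding M_def by (intro eval_to_mult eval_to_power eval_to_sc[OF s] eval_to_base[OF K(3) invT s])
    then show ?thesis by (simp add: eval_to_def \<mu>_def)
  qed
  have res: "0 < \<mu> s \<and> (\<forall>x. 0 < h s x) \<and> sqrt (\<mu> s) = j * th s \<and>
    (\<forall>x. h s x = th s * (1 + s * zn s x)) \<and>
    overdetermined_solution N m (h s) (\<mu> s) (2 * \<bar>a\<bar> / j * sqrt (\<mu> s)) (w s) \<and>
    radial_in_t N m A (w s) \<and> symmetric_in_x N m A (w s)" if "\<bar>s\<bar> < \<epsilon>" for s A
  proof -
    interpret S: bif_at N m j C e R G t s by (rule at[OF that])
    have hS: "S.ht = h s" by (simp add: fun_eq_iff S.ht_def h_def EvR_H[OF S.s])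
    have wS: "S.w = w s" by (simp add: fun_eq_iff S.w_def S.vv_def S.yv_def w_def hS)
    have "sqrt (\<mu> s) = j * th s" unfolding \<mu>[OF that] using j S.th_pos by (simp add: real_sqrt_mult)
    moreover have "2 * \<bar>a\<bar> / j * (j * th s) = 2 * \<bar>a\<bar> * th s" using j by simp
    moreover have "0 < \<mu> s" unfolding \<mu>[OF that] using j S.th_pos by simp
    ultimately show ?thesis
      using S.ht_pos S.overdetermined S.w_symmetric[of A] EvR_H[OF S.s]
      unfolding hS wS \<mu>[OF that] by (simp add: h_def)
  qed
  have hP: "h s \<in> P2a_pe m \<alpha>" if "\<bar>s\<bar> < \<epsilon>" for s
  proof -
    have "h s \<in> C2a_pe m \<alpha>"
      unfolding h_def by (rule EvR_C2a_pe[OF m \<alpha> conv[OF K0(1)] const_H sinv_H that])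
    moreover have "perm_invariant_on m (Rn m) (h s)"
      by (simp add: perm_invariant_on_def h_def EvR_permute[OF sinv_H])
    ultimately show ?thesis using conjunct1[OF conjunct2[OF res[OF that]]] by (simp add: P2a_pe_def)
  qed
  have smu: "smooth_real_curve {-\<epsilon><..<\<epsilon>} \<mu>"
    unfolding \<mu>_def by (rule smooth_real_curve_series[OF conv[OF bM]])
  have sh: "smooth_curve_C2a m \<alpha> {-\<epsilon><..<\<epsilon>} h"
    unfolding h_def[abs_def] by (rule smooth_curve_series[OF m \<alpha> conv[OF K0(1)] const_H sinv_H])
  have mu0: "\<mu> 0 = j\<^sup>2 * th0\<^sup>2" using \<mu>[of 0] \<epsilon> by (simp add: th_at_0)
  have expand_h: "uniform_little_o (Rn m) (\<lambda>s x. h s x - (1 / j * sqrt (\<mu> s) + s * th0 * (\<Sum>i<m. cos (x i))))"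
  proof (rule uniform_little_oI[OF \<epsilon>(1), where K = "K * K / e"])
    fix s x assume s: "\<bar>s\<bar> < \<epsilon>"
    then have se: "\<bar>s\<bar> \<le> e" "0 \<le> (0::real)" "(0::real) \<le> 1" using \<epsilon> by auto
    have T0: "(TT * Z) $ 0 = single 0 (econst th0) * Z $ 0"
      by (simp add: TT_def tser_def se_def t0 econst_simps)
    have "EvR m s 0 (TT * Z) 0 x = th s * zn s x"
      using EvR_mult[OF good_bd[OF K0(3)] good_bd[OF K0(2)] invT invZ se, of x] unfolding EvR_TT[of s 0 x] .
    moreover have "pr m 0 ((TT * Z) $ 0) 0 x = th0 * (\<Sum>i<m. cos (x i))"
      unfolding T0 pr_single_0_mult pr_Z0 by simp
    ultimately have le: "\<bar>th s * zn s x - th0 * (\<Sum>i<m. cos (x i))\<bar> \<le> K * K / e * \<bar>s\<bar>"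
      using EvR_first_order[OF bd_mult[OF K0(3,2)] se e(1), of 0 x] by simp
    \<comment> \<open>The leading term contains theta at s itself, so the error is s times the
      first-order error of theta z.\<close>
    have "h s x - (1 / j * sqrt (\<mu> s) + s * th0 * (\<Sum>i<m. cos (x i))) = s * (th s * zn s x - th0 * (\<Sum>i<m. cos (x i)))"
      using res[OF s] j by (simp add: algebra_simps)
    also have "\<bar>\<dots>\<bar> \<le> \<bar>s\<bar> * (K * K / e * \<bar>s\<bar>)"
      unfolding abs_mult[of s] by (rule mult_left_mono[OF le]) simp
    also have "\<dots> = K * K / e * s\<^sup>2" by (simp add: power2_eq_square)
    finally show "\<bar>h s x - (1 / j * sqrt (\<mu> s) + s * th0 * (\<Sum>i<m. cos (x i)))\<bar> \<le> K * K / e * s\<^sup>2" .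
  qed
  have dU: "r * deriv Uf r = 2 * r\<^sup>2 * ev (ediff U) (r\<^sup>2)" if "r \<ge> 0" for r
  \<comment> \<open>At r = 0 the factor r makes both sides 0; \<open>deriv Uf\<close> is unknown
    there, because \<open>Uf\<close> is prescribed for r >= 0 only.\<close>
  proof (cases "r = 0")
    case False
    then have r: "r > 0" using that by simp
    have "((\<lambda>r. ev U (r\<^sup>2)) has_real_derivative ev (ediff U) (r\<^sup>2) * (2 * r)) (at r)"
      by (auto intro!: derivative_eq_intros)
    then have "(Uf has_real_derivative ev (ediff U) (r\<^sup>2) * (2 * r)) (at r)"
      by (rule has_field_derivative_transform_within_open[of _ _ _ "{0<..}"]) (use r Uf in auto)
    then show ?thesis by (simp add: DERIV_imp_deriv power2_eq_square)
  qed simp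
  have expand_w: "\<bar>w s (join N (\<lambda>i. v i / h s x) x) - (Uf (enorm N v) + s * (\<psi> (enorm N v)
      + (- 1) * enorm N v * deriv Uf (enorm N v)) * (\<Sum>i<m. cos (x i)))\<bar> \<le> KY / e * s\<^sup>2"
    if s: "\<bar>s\<bar> < \<epsilon>" and v: "enorm N v < 1" for s v x
  proof -
    define r where "r = enorm N v"
    have r: "0 \<le> r" "r\<^sup>2 = rad N v" by (simp_all add: r_def enorm_rad)
    have "r\<^sup>2 \<le> 1" using r(1) v by (simp add: r_def power_le_one)
    then have se: "\<bar>s\<bar> \<le> e" "0 \<le> r\<^sup>2" "r\<^sup>2 \<le> 1" using s \<epsilon> by auto
    have "(h s x)\<^sup>2 * rad N (\<lambda>i. v i / h s x) = rad N v"
      using conjunct1[OF conjunct2[OF res[OF s]]]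
      by (simp add: rad_def power_divide sum_divide_distrib[symmetric] less_imp_neq[symmetric])
    then have "w s (join N (\<lambda>i. v i / h s x) x) = EvR m s 0 V (r\<^sup>2) x" by (simp add: w_def r)
    also have "\<dots> = ev U (r\<^sup>2) + s * EvR m s 0 Y (r\<^sup>2) x"
    proof -
      have id: "smap (\<lambda>p. p) A = A" for A by (simp add: fps_eq_iff)
      show ?thesis using EvR_V[of "\<lambda>p. p" s "r\<^sup>2" 0 x] good_bd[OF KY] se by (simp add: id dot_def)
    qed
    finally have "w s (join N (\<lambda>i. v i / h s x) x) - (Uf r + s * (\<psi> r + (- 1) * r * deriv Uf r) * (\<Sum>i<m. cos (x i)))
       = s * (EvR m s 0 Y (r\<^sup>2) x - pr m 0 (Y $ 0) (r\<^sup>2) x)"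
      using dU[OF r(1)] by (simp add: Uf[OF r(1)] pr_Y0 \<psi>_def algebra_simps)
    also have "\<bar>\<dots>\<bar> \<le> \<bar>s\<bar> * (KY / e * \<bar>s\<bar>)"
      unfolding abs_mult[of s] by (rule mult_left_mono[OF EvR_first_order[OF KY se e(1)]]) simp
    also have "\<dots> = KY / e * s\<^sup>2" by (simp add: power2_eq_square)
    finally show ?thesis unfolding r_def .
  qed
  have abs: "\<bar>s\<bar> < \<epsilon>" if "s \<in> {-\<epsilon><..<\<epsilon>}" for s using that by auto
  show ?thesis
  proof (intro exI conjI)
    show "\<forall>s\<in>{-\<epsilon><..<\<epsilon>}. \<mu> s > 0 \<and> h s \<in> P2a_pe m \<alpha>" using res[OF abs] hP[OF abs] by blast
    show "\<forall>s\<in>{-\<epsilon><..<\<epsilon>}. overdetermined_solution N m (h s) (\<mu> s) (2 * \<bar>a\<bar> / j * sqrt (\<mu> s)) (w s) \<and>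
        radial_in_t N m (Omega_closure N m (h s)) (w s) \<and> symmetric_in_x N m (Omega_closure N m (h s)) (w s)"
      using res[OF abs] by blast
    show "uniform_little_o ({t \<in> Rn N. enorm N t < 1} \<times> Rn m)
          (\<lambda>s (t, x). w s (join N (\<lambda>i. t i / h s x) x) -
            (Uf (enorm N t) + s * (\<psi> (enorm N t) + (- 1) * enorm N t * deriv Uf (enorm N t)) * (\<Sum>i<m. cos (x i))))"
      by (rule uniform_little_oI[OF \<epsilon>(1), where K = "KY / e"]) (use expand_w in auto)
  qed (fact \<epsilon> smu sh mu0 expand_h)+
qed

end

theorem theorem1p1:
  fixes N n :: nat
  assumes "N \<ge> 1" and "n \<ge> 1"
  shows "\<exists>\<mu>\<^sub>n \<kappa>\<^sub>n c\<^sub>n \<beta>\<^sub>n \<delta>\<^sub>n :: real.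
    \<mu>\<^sub>n > 0 \<and> \<kappa>\<^sub>n > 0 \<and> c\<^sub>n > 0 \<and> \<beta>\<^sub>n \<noteq> 0 \<and> \<delta>\<^sub>n \<noteq> 0 \<and>
    (\<forall>(m::nat) (\<alpha>::real). m \<ge> 1 \<longrightarrow> 0 < \<alpha> \<longrightarrow> \<alpha> < 1 \<longrightarrow>
      (\<exists>\<epsilon>>0. \<exists>(\<psi>\<^sub>1 :: real \<Rightarrow> real) (\<mu> :: real \<Rightarrow> real)
          (h :: real \<Rightarrow> (nat \<Rightarrow> real) \<Rightarrow> real) (w :: real \<Rightarrow> (nat \<Rightarrow> real) \<Rightarrow> real).
        (\<forall>s\<in>{-\<epsilon><..<\<epsilon>}. \<mu> s > 0 \<and> h s \<in> P2a_pe m \<alpha>) \<and>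
        smooth_real_curve {-\<epsilon><..<\<epsilon>} \<mu> \<and>
        smooth_curve_C2a m \<alpha> {-\<epsilon><..<\<epsilon>} h \<and>
        \<mu> 0 = \<mu>\<^sub>n \<and>
        uniform_little_o (Rn m)
          (\<lambda>s x. h s x - (\<kappa>\<^sub>n * sqrt (\<mu> s) + s * \<beta>\<^sub>n * (\<Sum>i<m. cos (x i)))) \<and>
        (\<forall>s\<in>{-\<epsilon><..<\<epsilon>}.
          overdetermined_solution N m (h s) (\<mu> s) (c\<^sub>n * sqrt (\<mu> s)) (w s) \<and>
          radial_in_t N m (Omega_closure N m (h s)) (w s) \<and>
          symmetric_in_x N m (Omega_closure N m (h s)) (w s)) \<and>
        uniform_little_o ({t \<in> Rn N. enorm N t < 1} \<times> Rn m)
          (\<lambda>s (t, x). w s (join N (\<lambda>i. t i / h s x) x) -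
            (U_fun N n (enorm N t) +
             s * (\<psi>\<^sub>1 (enorm N t) + \<delta>\<^sub>n * enorm N t * deriv (U_fun N n) (enorm N t)) *
               (\<Sum>i<m. cos (x i))))))"
proof -
  define \<nu> where "\<nu> = real N / 2 - 1"
  define j where "j = bessel_zero \<nu> n"
  define C where "C = 1 / (2 powr \<nu> * Gamma (\<nu> + 1))"
  have j: "j > 0" "ev (Phi N) (j\<^sup>2) = 0"
    using bessel_zero_Phi[OF assms] by (simp_all add: j_def \<nu>_def)
  have "\<nu> + 1 > 0" using assms(1) by (simp add: \<nu>_def)
  then have C: "C > 0" by (simp add: C_def Gamma_real_pos)
  have bif: "bif N m j C" if "m \<ge> 1" for m using assms(1) j C that by unfold_locales auto
  \<comment> \<open>The constants are built from N, j and C alone, so an instance with m = 1 names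
    them before m is quantified.\<close>
  interpret B: bif N 1 j C by (rule bif) simp
  have main: "\<exists>\<epsilon>>0. \<exists>(\<psi>\<^sub>1 :: real \<Rightarrow> real) (\<mu> :: real \<Rightarrow> real)
          (h :: real \<Rightarrow> (nat \<Rightarrow> real) \<Rightarrow> real) (w :: real \<Rightarrow> (nat \<Rightarrow> real) \<Rightarrow> real).
        (\<forall>s\<in>{-\<epsilon><..<\<epsilon>}. \<mu> s > 0 \<and> h s \<in> P2a_pe m \<alpha>) \<and>
        smooth_real_curve {-\<epsilon><..<\<epsilon>} \<mu> \<and>
        smooth_curve_C2a m \<alpha> {-\<epsilon><..<\<epsilon>} h \<and>
        \<mu> 0 = j\<^sup>2 * B.th0\<^sup>2 \<and>
        uniform_little_o (Rn m)
          (\<lambda>s x. h s x - (1 / j * sqrt (\<mu> s) + s * B.th0 * (\<Sum>i<m. cos (x i)))) \<and>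
        (\<forall>s\<in>{-\<epsilon><..<\<epsilon>}.
          overdetermined_solution N m (h s) (\<mu> s) (2 * \<bar>B.a\<bar> / j * sqrt (\<mu> s)) (w s) \<and>
          radial_in_t N m (Omega_closure N m (h s)) (w s) \<and>
          symmetric_in_x N m (Omega_closure N m (h s)) (w s)) \<and>
        uniform_little_o ({t \<in> Rn N. enorm N t < 1} \<times> Rn m)
          (\<lambda>s (t, x). w s (join N (\<lambda>i. t i / h s x) x) -
            (U_fun N n (enorm N t) +
             s * (\<psi>\<^sub>1 (enorm N t) + (- 1) * enorm N t * deriv (U_fun N n) (enorm N t)) *
               (\<Sum>i<m. cos (x i))))"
    if m: "m \<ge> 1" and \<alpha>: "0 < \<alpha>" "\<alpha> < 1" for m :: nat and \<alpha> :: real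
  proof -
    interpret M: bif N m j C by (rule bif[OF m])
    obtain e R G t where sol: "0 < e" "e \<le> 1" "G $ 0 = M.G0" "t 0 = 0" "sinv m G" "M.bdF e G R" "bd m e 2 (M.tser t) R"
      "sc (M.th0\<^sup>2) * smap M.Mop G + smap (Lap m) G + M.T2 (M.tser t) * smap M.Mop G + fps_X * M.Q1 G (M.tser t) = 0"
      "\<And>n k. ev (lookup ((sc M.a * (M.TH (M.tser t) * smap M.Bop G) + fps_X * M.Q2 G (M.tser t)) $ n) k) 1 = 0"
      by (rule M.solution_series) (rule that; assumption)
    interpret S: bif_solution N m j C e R G t by unfold_locales (use sol in auto)
    have "U_fun N n r = ev M.U (r\<^sup>2)" if "r \<ge> 0" for r
      unfolding M.U_def using U_fun_Phi[OF assms that] by (simp add: C_def j_def \<nu>_def)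
    from S.conclusion[OF \<alpha> this] show ?thesis .
  qed
  have pos: "j\<^sup>2 * B.th0\<^sup>2 > 0" "1 / j > 0" "2 * \<bar>B.a\<bar> / j > 0" "B.th0 \<noteq> 0" "(- 1 :: real) \<noteq> 0"
    using j B.th0_pos B.a_nz by auto
  show ?thesis
    by (rule exI[of _ "j\<^sup>2 * B.th0\<^sup>2"], rule exI[of _ "1 / j"], rule exI[of _ "2 * \<bar>B.a\<bar> / j"],
        rule exI[of _ B.th0], rule exI[of _ "- 1"], intro conjI allI impI pos)
      (rule main; assumption)
qed

end
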